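(* Let $\rho_1,\rho_2,\rho_3,k,b,m,\delta,\tilde\beta>0$ be constants and let $g:[0,\infty)\to\mathbb{R}$ be a differentiable kernel, not identically zero, such that: $g\ge 0$; there are constants $k_1,k_2>0$ with $-k_1g(\sigma)\le g'(\sigma)\le -k_2g(\sigma)$ for all $\sigma\ge0$; and $a:=b-b_0>0$, where $b_0:=\int_0^\infty g(\sigma)\,d\sigma$. Put $$\chi_0=\rho_2-\frac{b\rho_1}{k}.$$ Let $s$ be a nonnegative integer and let $V_0=(v_0,u_0,z_0,y_0,\theta_0,\eta_0)\in\mathbb{H}^s\cap\mathbb{L}^1$, where $$\mathbb{H}^s=[H^s(\mathbb{R})]^5\times L^2_g(\mathbb{R}^+;H^{1+s}(\mathbb{R})),\qquad \mathbb{L}^1=[L^1(\mathbb{R})]^5\times L^2_g(\mathbb{R}^+;W^{1,1}(\mathbb{R})).$$ Let $V=(v,u,z,y,\theta,\eta)$ be the solution with $V(0)=V_0$ of the following system for $t>0$, $x\in\mathbb{R}$, $\sigma>0$: $$\begin{cases} v_t-u_x+y=0,\\ \rho_1u_t-kv_x=0,\\ z_t-y_x=0,\\ \rho_2y_t-az_x-m\int_0^\infty g(\sigma)\eta_{xx}(t,\sigma,x)\,d\sigma-kv+\delta\theta_x=0,\\ \rho_3\theta_t-\tilde\beta\theta_{xx}+\delta y_x=0,\\ \eta_t+\eta_\sigma-y=0,\qquad \eta(t,0,x)=0.\end{cases}$$ Then for all nonnegative integers $j,l$ with $j+l\le s$ there are constants $C_1,C_2>0$, independent of $t$ and $V_0$,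 such that: (i) if $\chi_0=0$, then $\|\partial_x^jV(t)\|_2\le C_1(1+t)^{-\frac18-\frac j4}\|V_0\|_1+C_2(1+t)^{-\frac l2}\|\partial_x^{j+l}V_0\|_2$ for all $t\ge0$; (ii) if $\chi_0\ne0$, then $\|\partial_x^jV(t)\|_2\le C_1(1+t)^{-\frac18-\frac j4}\|V_0\|_1+C_2(1+t)^{-\frac l4}\|\partial_x^{j+l}V_0\|_2$ for all $t\ge0$.
   Context: The unknowns $v,u,z,y,\theta$ depend on $(t,x)$ and $\eta=\eta(t,\sigma,x)$, with $\sigma\ge0$ the history variable. For a Banach space $X$ of functions of $x$, $L^2_g(\mathbb{R}^+;X)$ is the space of $X$-valued functions of $\sigma$ that are square integrable with weight $g(\sigma)\,d\sigma$. The history component is measured by $\|\eta\|^2=\int_{\mathbb{R}}\int_0^\infty g(\sigma)|\eta_x(\sigma,x)|^2\,d\sigma\,dx$. Accordingly, $\|\partial_x^jV\|_2^2$ is the sum of the squared $L^2(\mathbb{R})$ norms of $\partial_x^j$ of the first five components plus $\int_{\mathbb{R}}\int_0^\infty g(\sigma)|\partial_x^{j+1}\eta(\sigma,x)|^2\,d\sigma\,dx$. $\|V_0\|_1$ is the norm of $V_0$ in $\mathbb{L}^1$. "Solution" is understood in the usual sense of linear evolution equations, with history component in the weighted space $L^2_g$, $\eta$ vanishing at $\sigma=0$, and transport operator $-\partial_\sigma$. *)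

theory Defs
  imports "HOL-Analysis.Analysis"
begin

text \<open>
  Elements of the function spaces are represented by Borel functions; all notions
  below are invariant under changes on null sets.
\<close>

definition test_function :: "(real \<Rightarrow> real) \<Rightarrow> bool" where
  "test_function \<phi> \<longleftrightarrow>
     (\<forall>n x. (deriv ^^ n) \<phi> field_differentiable at x) \<and> (\<exists>r. \<forall>x. r < \<bar>x\<bar> \<longrightarrow> \<phi> x = 0)"

definition locally_integrable :: "(real \<Rightarrow> real) \<Rightarrow> bool" where
  "locally_integrable f \<longleftrightarrow> (\<forall>r. set_integrable lborel {-r..r} f)"

definition weak_deriv :: "nat \<Rightarrow> (real \<Rightarrow> real) \<Rightarrow> (real \<Rightarrow> real) \<Rightarrow> bool" where
  "weak_deriv n f h \<longleftrightarrow> locally_integrable f \<and> locally_integrable h \<and>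
     (\<forall>\<phi>. test_function \<phi> \<longrightarrow>
        (LBINT x. f x * (deriv ^^ n) \<phi> x) = (-1) ^ n * (LBINT x. h x * \<phi> x))"

text \<open>A representative; unique up to a null set whenever a weak derivative exists.\<close>

definition dx :: "nat \<Rightarrow> (real \<Rightarrow> real) \<Rightarrow> real \<Rightarrow> real" where
  "dx n f = (SOME h. weak_deriv n f h)"

definition in_L2 :: "(real \<Rightarrow> real) \<Rightarrow> bool" where
  "in_L2 f \<longleftrightarrow> f \<in> borel_measurable lborel \<and> integrable lborel (\<lambda>x. (f x)\<^sup>2)"

definition L2_norm :: "(real \<Rightarrow> real) \<Rightarrow> real" where
  "L2_norm f = sqrt (LBINT x. (f x)\<^sup>2)"

definition L1_norm :: "(real \<Rightarrow> real) \<Rightarrow> real" where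
  "L1_norm f = (LBINT x. \<bar>f x\<bar>)"

definition in_Hs :: "nat \<Rightarrow> (real \<Rightarrow> real) \<Rightarrow> bool" where
  "in_Hs s f \<longleftrightarrow> in_L2 f \<and> (\<forall>i\<le>s. \<exists>h. in_L2 h \<and> weak_deriv i f h)"

text \<open>
  A function \<open>\<eta> \<sigma> x\<close> of the history variable \<open>\<sigma> \<ge> 0\<close> and of \<open>x\<close> stands for the map
  \<open>\<sigma> \<mapsto> \<eta> \<sigma>\<close>; its values at \<open>\<sigma> < 0\<close> are irrelevant. The measure below is
  \<open>g \<sigma> d\<sigma>\<close> on the half line. Square integrable maps into \<open>L\<^sup>2\<close> are jointly measurable
  functions that are square integrable for the product measure.
\<close>

definition history_measure :: "(real \<Rightarrow> real) \<Rightarrow> real measure" where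
  "history_measure g = density lborel (\<lambda>\<sigma>. ennreal (indicator {0..} \<sigma> * g \<sigma>))"

definition history_measurable :: "(real \<Rightarrow> real) \<Rightarrow> (real \<Rightarrow> real \<Rightarrow> real) \<Rightarrow> bool" where
  "history_measurable g \<eta> \<longleftrightarrow>
     (\<lambda>(\<sigma>, x). \<eta> \<sigma> x) \<in> borel_measurable (history_measure g \<Otimes>\<^sub>M lborel)"

definition history_weak_deriv ::
    "(real \<Rightarrow> real) \<Rightarrow> nat \<Rightarrow> (real \<Rightarrow> real \<Rightarrow> real) \<Rightarrow> (real \<Rightarrow> real \<Rightarrow> real) \<Rightarrow> bool" where
  "history_weak_deriv g n \<eta> \<zeta> \<longleftrightarrow>
     history_measurable g \<zeta> \<and> (AE \<sigma> in history_measure g. weak_deriv n (\<eta> \<sigma>) (\<zeta> \<sigma>))"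

text \<open>
  The jointly measurable \<open>x\<close>-derivative. Choosing \<open>dx n (\<eta> \<sigma>)\<close> separately for every
  \<open>\<sigma>\<close> might not be measurable in the pair.
\<close>

definition history_dx ::
    "(real \<Rightarrow> real) \<Rightarrow> nat \<Rightarrow> (real \<Rightarrow> real \<Rightarrow> real) \<Rightarrow> real \<Rightarrow> real \<Rightarrow> real" where
  "history_dx g n \<eta> = (SOME \<zeta>. history_weak_deriv g n \<eta> \<zeta>)"

definition history_in_L2 :: "(real \<Rightarrow> real) \<Rightarrow> (real \<Rightarrow> real \<Rightarrow> real) \<Rightarrow> bool" where
  "history_in_L2 g \<eta> \<longleftrightarrow> history_measurable g \<eta> \<and>
     integrable (history_measure g \<Otimes>\<^sub>M lborel) (\<lambda>(\<sigma>, x). (\<eta> \<sigma> x)\<^sup>2)"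

definition history_L2_norm :: "(real \<Rightarrow> real) \<Rightarrow> (real \<Rightarrow> real \<Rightarrow> real) \<Rightarrow> real" where
  "history_L2_norm g \<eta> =
     sqrt (LINT p|(history_measure g \<Otimes>\<^sub>M lborel). (\<eta> (fst p) (snd p))\<^sup>2)"

definition history_in_Hs :: "(real \<Rightarrow> real) \<Rightarrow> nat \<Rightarrow> (real \<Rightarrow> real \<Rightarrow> real) \<Rightarrow> bool" where
  "history_in_Hs g s \<eta> \<longleftrightarrow> history_in_L2 g \<eta> \<and>
     (\<forall>i\<le>s. \<exists>\<zeta>. history_in_L2 g \<zeta> \<and> history_weak_deriv g i \<eta> \<zeta>)"

definition history_in_W11 :: "(real \<Rightarrow> real) \<Rightarrow> (real \<Rightarrow> real \<Rightarrow> real) \<Rightarrow> bool" where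
  "history_in_W11 g \<eta> \<longleftrightarrow> history_measurable g \<eta> \<and>
     (\<exists>\<zeta>. history_weak_deriv g 1 \<eta> \<zeta> \<and>
        (AE \<sigma> in history_measure g. integrable lborel (\<eta> \<sigma>) \<and> integrable lborel (\<zeta> \<sigma>)) \<and>
        integrable (history_measure g) (\<lambda>\<sigma>. (L1_norm (\<eta> \<sigma>) + L1_norm (\<zeta> \<sigma>))\<^sup>2))"

definition history_W11_norm :: "(real \<Rightarrow> real) \<Rightarrow> (real \<Rightarrow> real \<Rightarrow> real) \<Rightarrow> real" where
  "history_W11_norm g \<eta> =
     sqrt (LINT \<sigma>|history_measure g. (L1_norm (\<eta> \<sigma>) + L1_norm (history_dx g 1 \<eta> \<sigma>))\<^sup>2)"

text \<open>
  \<open>history_ds g \<eta> \<zeta>\<close> says that \<open>\<eta>\<close> is absolutely continuous in \<open>\<sigma>\<close> with derivative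
  \<open>\<eta>\<^sub>\<sigma> = \<zeta>\<close> and boundary value \<open>\<eta> = 0\<close> at \<open>\<sigma> = 0\<close>.
\<close>

definition history_ds ::
    "(real \<Rightarrow> real) \<Rightarrow> (real \<Rightarrow> real \<Rightarrow> real) \<Rightarrow> (real \<Rightarrow> real \<Rightarrow> real) \<Rightarrow> bool" where
  "history_ds g \<eta> \<zeta> \<longleftrightarrow>
     (AE (\<sigma>, x) in history_measure g \<Otimes>\<^sub>M lborel. \<eta> \<sigma> x = (LBINT \<tau>:{0..\<sigma>}. \<zeta> \<tau> x))"

datatype state = State
  (cv: "real \<Rightarrow> real") (cu: "real \<Rightarrow> real") (cz: "real \<Rightarrow> real")
  (cy: "real \<Rightarrow> real") (c\<theta>: "real \<Rightarrow> real") (c\<eta>: "real \<Rightarrow> real \<Rightarrow> real")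

definition state_diff :: "state \<Rightarrow> state \<Rightarrow> state" where
  "state_diff V W = State (\<lambda>x. cv V x - cv W x) (\<lambda>x. cu V x - cu W x) (\<lambda>x. cz V x - cz W x)
     (\<lambda>x. cy V x - cy W x) (\<lambda>x. c\<theta> V x - c\<theta> W x) (\<lambda>\<sigma> x. c\<eta> V \<sigma> x - c\<eta> W \<sigma> x)"

definition state_scale :: "real \<Rightarrow> state \<Rightarrow> state" where
  "state_scale r V = State (\<lambda>x. r * cv V x) (\<lambda>x. r * cu V x) (\<lambda>x. r * cz V x)
     (\<lambda>x. r * cy V x) (\<lambda>x. r * c\<theta> V x) (\<lambda>\<sigma> x. r * c\<eta> V \<sigma> x)"

definition in_HHs :: "(real \<Rightarrow> real) \<Rightarrow> nat \<Rightarrow> state \<Rightarrow> bool" where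
  "in_HHs g s V \<longleftrightarrow> in_Hs s (cv V) \<and> in_Hs s (cu V) \<and> in_Hs s (cz V) \<and> in_Hs s (cy V) \<and>
     in_Hs s (c\<theta> V) \<and> history_in_Hs g (1 + s) (c\<eta> V)"

definition in_LL1 :: "(real \<Rightarrow> real) \<Rightarrow> state \<Rightarrow> bool" where
  "in_LL1 g V \<longleftrightarrow> integrable lborel (cv V) \<and> integrable lborel (cu V) \<and>
     integrable lborel (cz V) \<and> integrable lborel (cy V) \<and> integrable lborel (c\<theta> V) \<and>
     history_in_W11 g (c\<eta> V)"

definition LL1_norm :: "(real \<Rightarrow> real) \<Rightarrow> state \<Rightarrow> real" where
  "LL1_norm g V = L1_norm (cv V) + L1_norm (cu V) + L1_norm (cz V) + L1_norm (cy V) +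
     L1_norm (c\<theta> V) + history_W11_norm g (c\<eta> V)"

text \<open>
  The norm of \<open>\<partial>\<^sub>x\<^sup>j V\<close>. The history component carries one more derivative; for \<open>j = 0\<close>
  this is the norm of the phase space.
\<close>

definition dx_norm :: "(real \<Rightarrow> real) \<Rightarrow> nat \<Rightarrow> state \<Rightarrow> real" where
  "dx_norm g j V = sqrt ((L2_norm (dx j (cv V)))\<^sup>2 + (L2_norm (dx j (cu V)))\<^sup>2 +
     (L2_norm (dx j (cz V)))\<^sup>2 + (L2_norm (dx j (cy V)))\<^sup>2 + (L2_norm (dx j (c\<theta> V)))\<^sup>2 +
     (history_L2_norm g (history_dx g (j + 1) (c\<eta> V)))\<^sup>2)"

text \<open>
  \<open>generator \<dots> W F\<close> says that \<open>W\<close> lies in the domain of the operator \<open>A\<close> of the system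
  \<open>V\<^sub>t = A V\<close> and that \<open>A W = F\<close>. As usual, \<open>a z\<^sub>x + m \<integral> g \<eta>\<^sub>x\<^sub>x\<close> is read as the weak
  derivative of \<open>a z + m \<integral> g \<eta>\<^sub>x\<close>: on the domain only this sum, not each summand, need be
  differentiable. The argument \<open>\<beta>\<close> is the coefficient of \<open>\<theta>\<^sub>x\<^sub>x\<close>.
\<close>

definition generator ::
    "real \<Rightarrow> real \<Rightarrow> real \<Rightarrow> real \<Rightarrow> real \<Rightarrow> real \<Rightarrow> real \<Rightarrow> real \<Rightarrow> (real \<Rightarrow> real) \<Rightarrow>
     state \<Rightarrow> state \<Rightarrow> bool" where
  "generator \<rho>1 \<rho>2 \<rho>3 k a m \<delta> \<beta> g W F \<longleftrightarrow>
    (let p = (\<lambda>x. a * cz W x + m * (LINT \<sigma>|history_measure g. history_dx g 1 (c\<eta> W) \<sigma> x)) in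
     in_HHs g 0 W \<and> in_HHs g 0 F \<and>
     in_Hs 1 (cv W) \<and> in_Hs 1 (cu W) \<and> in_Hs 1 (cy W) \<and> in_Hs 1 p \<and> in_Hs 2 (c\<theta> W) \<and>
     (AE x in lborel. cv F x = dx 1 (cu W) x - cy W x) \<and>
     (AE x in lborel. \<rho>1 * cu F x = k * dx 1 (cv W) x) \<and>
     (AE x in lborel. cz F x = dx 1 (cy W) x) \<and>
     (AE x in lborel. \<rho>2 * cy F x = dx 1 p x + k * cv W x - \<delta> * dx 1 (c\<theta> W) x) \<and>
     (AE x in lborel. \<rho>3 * c\<theta> F x = \<beta> * dx 2 (c\<theta> W) x - \<delta> * dx 1 (cy W) x) \<and>
     (\<exists>\<zeta>. history_in_Hs g 1 \<zeta> \<and> history_ds g (c\<eta> W) \<zeta> \<and>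
        (AE (\<sigma>, x) in history_measure g \<Otimes>\<^sub>M lborel. c\<eta> F \<sigma> x = - \<zeta> \<sigma> x + cy W x)))"

text \<open>
  Mild solutions: \<open>V\<close> is continuous in the phase space and \<open>V(t) = V\<^sub>0 + A \<integral>\<^sub>0\<^sup>t V(r) dr\<close>.
  The integral \<open>W\<close> is described as the primitive of \<open>V\<close> in the phase space norm.
  The case \<open>t = 0\<close> contains the initial condition \<open>V(0) = V\<^sub>0\<close>.
\<close>

definition mild_solution ::
    "real \<Rightarrow> real \<Rightarrow> real \<Rightarrow> real \<Rightarrow> real \<Rightarrow> real \<Rightarrow> real \<Rightarrow> real \<Rightarrow> (real \<Rightarrow> real) \<Rightarrow>
     state \<Rightarrow> (real \<Rightarrow> state) \<Rightarrow> bool" where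
  "mild_solution \<rho>1 \<rho>2 \<rho>3 k a m \<delta> \<beta> g V0 V \<longleftrightarrow>
     (\<forall>t\<ge>0. in_HHs g 0 (V t) \<and>
        ((\<lambda>r. dx_norm g 0 (state_diff (V r) (V t))) \<longlongrightarrow> 0) (at t within {0..})) \<and>
     (\<exists>W. dx_norm g 0 (W 0) = 0 \<and>
        (\<forall>t\<ge>0. generator \<rho>1 \<rho>2 \<rho>3 k a m \<delta> \<beta> g (W t) (state_diff (V t) V0) \<and>
           ((\<lambda>r. dx_norm g 0
                (state_diff (state_scale (1 / (r - t)) (state_diff (W r) (W t))) (V t))) \<longlongrightarrow> 0)
             (at t within {0..})))"

end

theory Submission
  imports Defs
begin

text \<open>
  The state is read as a vector of a Hilbert space on which the translations in \<open>x\<close> act as a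
  one-parameter group of isometries, with \<open>\<partial>\<^sub>x\<close> as its generator; the history enters as
  \<open>\<surd>g \<eta>\<^sub>x\<close>. The kernel condition makes the right shift in \<open>\<sigma>\<close> a semigroup decaying at rate
  \<open>k2 / 2\<close>, so the history dissipates its own energy.
  Adding correlations of neighbouring components to the energies of \<open>V, V\<^sub>x, V\<^sub>x\<^sub>x, V\<^sub>x\<^sub>x\<^sub>x\<close> gives a
  functional whose dissipation controls \<open>\<parallel>V\<^sub>x\<^sub>x\<parallel>\<^sup>2\<close>. In frequency terms the decay
  rate is \<open>\<xi>\<^sup>4 / (1 + \<xi>\<^sup>2)\<^sup>3\<close>: heat flow with symbol \<open>\<xi>\<^sup>4\<close> for small \<open>\<xi>\<close> and loss of regularity,
  one derivative for each factor \<open>t\<^sup>-\<^sup>1\<^sup>/\<^sup>2\<close>, for large \<open>\<xi>\<close>, whether or not \<open>\<chi>\<^sub>0 = 0\<close>.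
  No Fourier transform is used. Low frequencies are split off by averaging over translations,
  and the \<open>L\<^sup>1\<close> norm enters since the average of \<open>V\<^sub>0\<close> over an interval of length \<open>r\<close> has norm at
  most \<open>r\<^sup>-\<^sup>1\<^sup>/\<^sup>2 \<parallel>V\<^sub>0\<parallel>\<^sub>1\<close>, the autocorrelation of an integrable function being integrable.
  The weak solution is regularized by difference quotients in time and averages in space.
\<close>

section \<open>Derivatives along isometry groups\<close>

text \<open>The functional involves three derivatives that neither the solution nor the data need
  possess. It is therefore applied to the image of the solution under the cube of a truncated
  resolvent mean, where derivatives up to order 3 are bounded operators; the functional is then
  comparable to the squared norm of the solution, or of its j-fold difference quotient. What remains
  is its gap to the second-order dissipation. One parameter \<rho> closes it at both ends:
  frequencies below \<rho>^(-1/2) are left to the L1 norm of the data, those above \<rho> to l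
  further derivatives, and in between \<rho>^2 times the dissipation suffices, as \<xi>^4 and
  \<xi>^(-2) predict. With \<rho>^2 proportional to 1 + t, the factors \<rho>^(-j/2-1/4) and
  \<rho>^(-l) become the powers -j/4-1/8 and -l/2 of 1 + t. Since solutions are only mild,
  regularity and size at later times come from comparison with the data under every bounded operator
  that respects both the translations and the generator.\<close>

definition tder :: "(real \<Rightarrow> 'h \<Rightarrow> 'h::real_normed_vector) \<Rightarrow> 'h \<Rightarrow> 'h \<Rightarrow> bool" where
  "tder T x y \<longleftrightarrow> ((\<lambda>s. T s x) has_vector_derivative y) (at 0)"

text \<open>A relation instead of a function, because powers of the generator are unbounded: the
  existence of \<open>y\<close> is itself the statement that \<open>x\<close> has \<open>n\<close>
  derivatives.\<close>

primrec dern :: "(real \<Rightarrow> 'h \<Rightarrow> 'h::real_normed_vector) \<Rightarrow> nat \<Rightarrow> 'h \<Rightarrow> 'h \<Rightarrow> bool" where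
  "dern T 0 x y \<longleftrightarrow> x = y"
| "dern T (Suc n) x y \<longleftrightarrow> (\<exists>z. dern T n x z \<and> tder T z y)"

text \<open>One family serves two purposes. With \<open>c = 0\<close> it is an unnormalised average,
  damping frequencies above 1/r; with \<open>c = 1\<close> it is the integral for the resolvent of
  the generator at 1, cut off at time \<open>r\<close>.\<close>

definition damped_mean :: "(real \<Rightarrow> 'h \<Rightarrow> 'h::real_normed_vector) \<Rightarrow> real \<Rightarrow> real \<Rightarrow> 'h \<Rightarrow> 'h" where
  "damped_mean T c r x = integral {0..r} (\<lambda>s. exp (- (c * s)) *\<^sub>R T s x)"

definition avg :: "(real \<Rightarrow> 'h \<Rightarrow> 'h::real_normed_vector) \<Rightarrow> real \<Rightarrow> 'h \<Rightarrow> 'h" where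
  "avg T r x = (1 / r) *\<^sub>R damped_mean T 0 r x"

definition diffq :: "(real \<Rightarrow> 'h \<Rightarrow> 'h::real_normed_vector) \<Rightarrow> real \<Rightarrow> 'h \<Rightarrow> 'h" where
  "diffq T r x = (1 / r) *\<^sub>R (T r x - x)"

definition commutes_with :: "(real \<Rightarrow> 'h \<Rightarrow> 'h::real_normed_vector) \<Rightarrow> ('h \<Rightarrow> 'h) \<Rightarrow> bool" where
  "commutes_with T B \<longleftrightarrow> bounded_linear B \<and> (\<forall>s x. B (T s x) = T s (B x))"

locale isometry_group =
  fixes T :: "real \<Rightarrow> 'h \<Rightarrow> 'h::{real_inner,banach}"
  assumes linear_T: "bounded_linear (T s)"
    and norm_T: "norm (T s x) = norm x"
    and T_zero: "T 0 x = x"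
    and T_add: "T (s + t) x = T s (T t x)"
    and continuous_T: "continuous_on UNIV (\<lambda>s. T s x)"
begin

lemma T_commute: "T s (T t x) = T t (T s x)"
  by (metis T_add add.commute)

lemma T_minus: "T s (T (- s) x) = x" "T (- s) (T s x) = x"
  by (metis T_add T_zero add.right_inverse add.left_inverse)+

lemma T_diff: "T s (x - y) = T s x - T s y"
  by (simp add: linear_diff bounded_linear.linear linear_T)

lemma T_plus: "T s (x + y) = T s x + T s y"
  by (simp add: linear_add bounded_linear.linear linear_T)

lemma T_scaleR: "T s (c *\<^sub>R x) = c *\<^sub>R T s x"
  by (simp add: linear_scale bounded_linear.linear linear_T)

lemma inner_T: "inner (T s x) (T s y) = inner x y"
proof -
  have "inner a b = ((norm (a + b))\<^sup>2 - (norm (a - b))\<^sup>2) / 4" for a b :: 'h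
    by (simp add: power2_norm_eq_inner inner_add_left inner_add_right inner_diff_left inner_diff_right inner_commute)
  then show ?thesis
    by (metis T_diff T_plus norm_T)
qed

lemma inner_T_left: "inner (T s x) y = inner x (T (- s) y)"
  by (metis inner_T T_minus(1))

lemma continuous_T_on: "continuous_on S (\<lambda>s. T s x)"
  by (rule continuous_on_subset[OF continuous_T]) simp

lemma tder_at:
  assumes "tder T x y"
  shows "((\<lambda>s. T s x) has_vector_derivative T t y) (at t within S)"
proof -
  have "((\<lambda>s. T s x) \<circ> (\<lambda>s. s - t) has_vector_derivative (1 *\<^sub>R y)) (at t)"
    using assms unfolding tder_def
    by (intro vector_diff_chain_at) (auto intro!: derivative_eq_intros simp: has_vector_derivative_def)
  then have "((\<lambda>s. T (s - t) x) has_vector_derivative y) (at t)"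
    by (simp add: o_def)
  from bounded_linear.has_vector_derivative[OF linear_T[of t] this]
  have "((\<lambda>s. T s x) has_vector_derivative T t y) (at t)"
    by (simp flip: T_add)
  then show ?thesis
    by (rule has_vector_derivative_at_within)
qed

lemma tder_unique: "tder T x y \<Longrightarrow> tder T x z \<Longrightarrow> y = z"
  unfolding tder_def by (rule vector_derivative_unique_at)

lemma dern_unique: "dern T n x y \<Longrightarrow> dern T n x z \<Longrightarrow> y = z"
  by (induction n arbitrary: y z) (auto dest: tder_unique)

lemma tder_integral:
  assumes "tder T x y" "0 \<le> r"
  shows "((\<lambda>s. T s y) has_integral T r x - x) {0..r}"
  using fundamental_theorem_of_calculus[OF assms(2), of "\<lambda>s. T s x" "\<lambda>s. T s y"] tder_at[OF assms(1)]
  by (simp add: T_zero)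

text \<open>The hypothesis covers only nonnegative \<open>r\<close>, while the derivative at 0 is
  two-sided. Hence the integral is differentiated at the interior time 1 and the result is carried
  back by the isometry \<open>T (- 1)\<close>.\<close>

lemma tder_if_integral:
  assumes "\<And>r. 0 \<le> r \<Longrightarrow> integral {0..r} (\<lambda>s. T s y) = T r x - x"
  shows "tder T x y"
proof -
  have "((\<lambda>r. integral {0..r} (\<lambda>s. T s y)) has_vector_derivative T 1 y) (at 1 within {0..2})"
    by (rule integral_has_vector_derivative) (auto intro: continuous_T_on)
  then have "((\<lambda>r. T r x - x) has_vector_derivative T 1 y) (at 1 within {0..2})"
    by (rule has_vector_derivative_transform[rotated 2]) (auto simp: assms)
  then have "((\<lambda>r. T r x - x) has_vector_derivative T 1 y) (at 1)"
    by (simp add: at_within_interior[of 1 "{0..2}"])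
  then have "((\<lambda>r. (T r x - x) + x) has_vector_derivative T 1 y + 0) (at 1)"
    by (intro has_vector_derivative_add) auto
  then have "((\<lambda>r. T r x) has_vector_derivative T 1 y) (at 1)"
    by simp
  then have "((\<lambda>r. T r x) \<circ> (\<lambda>s. s + 1) has_vector_derivative (1 *\<^sub>R T 1 y)) (at 0)"
    by (intro vector_diff_chain_at) (auto intro!: derivative_eq_intros simp: has_vector_derivative_def)
  then have "((\<lambda>r. T (r + 1) x) has_vector_derivative T 1 y) (at 0)"
    by (simp add: o_def)
  from bounded_linear.has_vector_derivative[OF linear_T[of "-1"] this]
  show ?thesis
    by (simp add: tder_def flip: T_add) (simp add: T_zero)
qed

lemma integral_T_diff:
  "norm (integral {0..r} (\<lambda>s. T s y) - integral {0..r} (\<lambda>s. T s z)) \<le> r * norm (y - z)" if "0 \<le> r"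
proof -
  have "integral {0..r} (\<lambda>s. T s y) - integral {0..r} (\<lambda>s. T s z) = integral {0..r} (\<lambda>s. T s (y - z))"
    by (subst integral_diff[symmetric])
      (auto intro!: integrable_continuous_interval continuous_T_on simp: T_diff)
  also have "norm \<dots> \<le> norm (y - z) * (r - 0)"
    by (rule integral_bound) (auto simp: that norm_T intro: continuous_T_on)
  finally show ?thesis by (simp add: mult.commute)
qed

text \<open>Closedness of the generator: the integrated identity \<open>T r x - x = integral\<close>
  passes to norm limits, which differentiation does not.\<close>

lemma tder_closed:
  fixes a b :: "nat \<Rightarrow> 'h"
  assumes ab: "\<And>n. tder T (a n) (b n)" and a: "a \<longlonglongrightarrow> x" and b: "b \<longlonglongrightarrow> y"
  shows "tder T x y"
proof (rule tder_if_integral)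
  fix r :: real assume r: "0 \<le> r"
  have "(\<lambda>n. integral {0..r} (\<lambda>s. T s (b n))) \<longlonglongrightarrow> integral {0..r} (\<lambda>s. T s y)"
  proof (rule Lim_transform_bound[where g = "\<lambda>n. r * norm (b n - y)", THEN LIM_zero_cancel])
    show "\<forall>\<^sub>F n in sequentially.
        norm (integral {0..r} (\<lambda>s. T s (b n)) - integral {0..r} (\<lambda>s. T s y)) \<le> norm (r * norm (b n - y))"
      using integral_T_diff[OF r] r by (auto intro!: always_eventually)
    show "(\<lambda>n. r * norm (b n - y)) \<longlonglongrightarrow> 0"
      using b by (intro tendsto_mult_right_zero) (simp add: LIM_zero tendsto_norm_zero)
  qed
  moreover have "integral {0..r} (\<lambda>s. T s (b n)) = T r (a n) - a n" for n
    using tder_integral[OF ab r] by (rule integral_unique)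
  moreover have "(\<lambda>n. T r (a n) - a n) \<longlonglongrightarrow> T r x - x"
    by (intro tendsto_diff a bounded_linear.tendsto[OF linear_T])
  ultimately show "integral {0..r} (\<lambda>s. T s y) = T r x - x"
    using LIMSEQ_unique by auto
qed

lemma tder_diff: "tder T x y \<Longrightarrow> tder T x' y' \<Longrightarrow> tder T (x - x') (y - y')"
  unfolding tder_def by (simp add: T_diff has_vector_derivative_diff)

lemma tder_plus: "tder T x y \<Longrightarrow> tder T x' y' \<Longrightarrow> tder T (x + x') (y + y')"
  unfolding tder_def by (simp add: T_plus has_vector_derivative_add)

lemma tder_scaleR: "tder T x y \<Longrightarrow> tder T (c *\<^sub>R x) (c *\<^sub>R y)"
  unfolding tder_def T_scaleR
  by (rule bounded_linear.has_vector_derivative[OF bounded_linear_scaleR_right])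

lemma tder_commutes:
  assumes "commutes_with T B" "tder T x y"
  shows "tder T (B x) (B y)"
  using bounded_linear.has_vector_derivative[of B "\<lambda>s. T s x" y "at 0"] assms
  unfolding tder_def commutes_with_def by auto

lemma dern_commutes:
  assumes "commutes_with T B" "dern T n x y"
  shows "dern T n (B x) (B y)"
  using assms by (induction n arbitrary: y) (auto dest: tder_commutes)

lemma dern_append:
  "dern T (m + n) x y \<longleftrightarrow> (\<exists>z. dern T m x z \<and> dern T n z y)"
  by (induction n arbitrary: y) auto

text \<open>The inner product of \<open>T s x\<close> and \<open>T s x'\<close> is constant in
  \<open>s\<close>; its derivative at 0 vanishes. Every integration by parts in the estimates is an
  instance of this.\<close>

lemma tder_skew:
  assumes "tder T x y" "tder T x' y'"
  shows "inner y x' = - inner x y'"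
proof -
  have "((\<lambda>s. inner (T s x) (T s x')) has_vector_derivative (inner (T 0 x) y' + inner y (T 0 x'))) (at 0)"
    using assms unfolding tder_def
    by (rule bounded_bilinear.has_vector_derivative[OF bounded_bilinear_inner])
  then have "((\<lambda>s. inner x x') has_vector_derivative (inner x y' + inner y x')) (at 0)"
    by (simp add: inner_T T_zero)
  from vector_derivative_unique_at[OF this has_vector_derivative_const]
  show ?thesis by simp
qed

lemma tder_interpolation:
  assumes "tder T x y" "tder T y z"
  shows "(norm y)\<^sup>2 \<le> norm x * norm z"
proof -
  have "(norm y)\<^sup>2 = - inner x z"
    using tder_skew[OF assms] by (simp add: power2_norm_eq_inner)
  also have "\<dots> \<le> norm x * norm z"
    using Cauchy_Schwarz_ineq2[of x z] by linarith
  finally show ?thesis .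
qed

text \<open>Weak derivatives are strong. Invariance of the test set allows testing with
  \<open>T (- t) \<phi>\<close>, which gives the derivative of \<open>inner (T s x) \<phi>\<close>
  at every time \<open>t\<close>; the integrated identity then holds against a total set, without
  mollification.\<close>

lemma tder_weak:
  assumes inv: "\<And>\<phi> s. \<phi> \<in> \<Phi> \<Longrightarrow> T s \<phi> \<in> \<Phi>"
    and weak: "\<And>\<phi>. \<phi> \<in> \<Phi> \<Longrightarrow> \<exists>\<phi>'. tder T \<phi> \<phi>' \<and> inner x \<phi>' = - inner y \<phi>"
    and total: "\<And>z. (\<And>\<phi>. \<phi> \<in> \<Phi> \<Longrightarrow> inner z \<phi> = 0) \<Longrightarrow> z = 0"
  shows "tder T x y"
proof (rule tder_if_integral)
  fix r :: real assume r: "0 \<le> r"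
  have "integral {0..r} (\<lambda>s. T s y) - (T r x - x) = 0"
  proof (rule total)
    fix \<phi> assume \<phi>: "\<phi> \<in> \<Phi>"
    have d: "((\<lambda>s. inner (T s x) \<phi>) has_vector_derivative inner (T t y) \<phi>) (at t within {0..r})" for t
    proof -
      obtain \<phi>' where \<phi>': "tder T (T (- t) \<phi>) \<phi>'" "inner x \<phi>' = - inner y (T (- t) \<phi>)"
        using weak[OF inv[OF \<phi>]] by blast
      have "((\<lambda>s. T s (T (- t) \<phi>)) \<circ> (\<lambda>s. t - s) has_vector_derivative (- 1) *\<^sub>R \<phi>') (at t)"
        using \<phi>'(1) unfolding tder_def
        by (intro vector_diff_chain_at) (auto intro!: derivative_eq_intros simp: has_vector_derivative_def)
      then have "((\<lambda>s. T (- s) \<phi>) has_vector_derivative - \<phi>') (at t)"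
        by (simp add: o_def flip: T_add)
      from bounded_linear.has_vector_derivative[OF bounded_linear_inner_right this, of x]
      have "((\<lambda>s. inner x (T (- s) \<phi>)) has_vector_derivative inner y (T (- t) \<phi>)) (at t)"
        using \<phi>'(2) by simp
      then show ?thesis
        unfolding inner_T_left by (rule has_vector_derivative_at_within)
    qed
    have "((\<lambda>s. inner (T s y) \<phi>) has_integral inner (T r x) \<phi> - inner (T 0 x) \<phi>) {0..r}"
      using d by (intro fundamental_theorem_of_calculus r) auto
    moreover have "((\<lambda>s. inner (T s y) \<phi>) has_integral inner (integral {0..r} (\<lambda>s. T s y)) \<phi>) {0..r}"
      using has_integral_linear[OF integrable_integral bounded_linear_inner_left]
        integrable_continuous_interval[OF continuous_T_on]
      by (force simp: o_def)
    ultimately have "inner (T r x) \<phi> - inner (T 0 x) \<phi> = inner (integral {0..r} (\<lambda>s. T s y)) \<phi>"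
      by (rule has_integral_unique)
    then show "inner (integral {0..r} (\<lambda>s. T s y) - (T r x - x)) \<phi> = 0"
      by (simp add: inner_diff_left T_zero)
  qed
  then show "integral {0..r} (\<lambda>s. T s y) = T r x - x" by simp
qed

lemma integrable_damped: "(\<lambda>s. exp (- (c * s)) *\<^sub>R T s x) integrable_on {a..b}"
  by (intro integrable_continuous_interval continuous_intros continuous_T_on)

lemma damped_mean_commute:
  assumes "commutes_with T B"
  shows "damped_mean T c r (B x) = B (damped_mean T c r x)"
proof -
  have B: "bounded_linear B" and BT: "\<And>s x. B (T s x) = T s (B x)"
    using assms by (auto simp: commutes_with_def)
  have "integral {0..r} (B \<circ> (\<lambda>s. exp (- (c * s)) *\<^sub>R T s x)) = B (damped_mean T c r x)"
    unfolding damped_mean_def by (rule integral_linear[OF integrable_damped B])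
  then show ?thesis
    by (simp add: damped_mean_def o_def BT linear_scale[OF bounded_linear.linear[OF B]])
qed

lemma commutes_T: "commutes_with T (T s)"
  by (auto simp: commutes_with_def linear_T T_commute)

lemma commutes_id: "commutes_with T (\<lambda>x. x)"
  by (simp add: commutes_with_def)

lemma commutes_compose: "commutes_with T B \<Longrightarrow> commutes_with T C \<Longrightarrow> commutes_with T (\<lambda>x. B (C x))"
  by (auto simp: commutes_with_def bounded_linear_compose)

lemma commutes_diff: "commutes_with T B \<Longrightarrow> commutes_with T C \<Longrightarrow> commutes_with T (\<lambda>x. B x - C x)"
  by (auto simp: commutes_with_def bounded_linear_sub T_diff)

lemma commutes_plus: "commutes_with T B \<Longrightarrow> commutes_with T C \<Longrightarrow> commutes_with T (\<lambda>x. B x + C x)"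
  by (auto simp: commutes_with_def bounded_linear_add T_plus)

lemma commutes_scaleR: "commutes_with T B \<Longrightarrow> commutes_with T (\<lambda>x. c *\<^sub>R B x)"
  by (auto simp: commutes_with_def T_scaleR intro: bounded_linear_const_scaleR)

lemma commutes_funpow: "commutes_with T B \<Longrightarrow> commutes_with T (B ^^ n)"
proof (induction n)
  case 0
  then show ?case using commutes_id by (simp add: id_def)
next
  case (Suc n)
  then show ?case using commutes_compose[of B "B ^^ n"] by (simp add: o_def)
qed

lemma norm_damped_mean:
  assumes "0 \<le> c" "0 \<le> r"
  shows "norm (damped_mean T c r x) \<le> r * norm x"
proof -
  have "norm (damped_mean T c r x) \<le> norm x * (r - 0)"
    unfolding damped_mean_def
    by (rule integral_bound)
      (use assms in \<open>auto simp: norm_T mult_left_le_one_le intro!: continuous_intros continuous_T_on\<close>)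
  then show ?thesis by (simp add: mult.commute)
qed

lemma commutes_damped_mean:
  assumes "0 \<le> c" "0 \<le> r"
  shows "commutes_with T (damped_mean T c r)"
  unfolding commutes_with_def
proof safe
  show "bounded_linear (damped_mean T c r)"
  proof (rule bounded_linear_intro)
    show "damped_mean T c r (x + y) = damped_mean T c r x + damped_mean T c r y" for x y
      unfolding damped_mean_def
      by (subst integral_add[symmetric]) (auto intro: integrable_damped simp: T_plus scaleR_add_right)
    show "damped_mean T c r (a *\<^sub>R x) = a *\<^sub>R damped_mean T c r x" for a x
      unfolding damped_mean_def
      by (subst integral_cmul[symmetric]) (simp add: T_scaleR mult.commute)
    show "norm (damped_mean T c r x) \<le> norm x * r" for x
      using norm_damped_mean[OF assms] by (simp add: mult.commute)
  qed
  show "damped_mean T c r (T s x) = T s (damped_mean T c r x)" for s x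
    by (rule damped_mean_commute[OF commutes_T])
qed

text \<open>Moving the mean by \<open>t\<close> shifts the window of integration and multiplies by
  \<open>exp (c * t)\<close>, so only the two end points of the window are differentiated. No
  regularity of \<open>x\<close> is involved: means map everything into the domain of the
  generator.\<close>

lemma tder_damped_mean:
  assumes r: "0 < r"
  shows "tder T (damped_mean T c r x) (c *\<^sub>R damped_mean T c r x - x + exp (- (c * r)) *\<^sub>R T r x)"
proof -
  define \<psi> where "\<psi> = (\<lambda>s. exp (- (c * s)) *\<^sub>R T s x)"
  have c\<psi>: "continuous_on S \<psi>" for S
    unfolding \<psi>_def by (intro continuous_intros continuous_T_on)
  \<comment> \<open>The lower limit -1 lies to the left of all times under consideration, so that
    \<open>F\<close> has a two-sided derivative at 0.\<close>
  define F where "F = (\<lambda>t. integral {-1..t} \<psi>)"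
  have F: "(F has_vector_derivative \<psi> t) (at t)" if "-1 < t" for t
  proof -
    have "(F has_vector_derivative \<psi> t) (at t within {-1..t+1})"
      unfolding F_def by (rule integral_has_vector_derivative) (use that c\<psi> in auto)
    then show ?thesis
      using that by (simp add: at_within_interior[of t "{-1..t+1}"])
  qed
  have eq: "T t (damped_mean T c r x) = exp (c * t) *\<^sub>R (F (t + r) - F t)" if "\<bar>t\<bar> < 1" for t
  proof -
    have "T t (damped_mean T c r x) = damped_mean T c r (T t x)"
      by (simp add: damped_mean_commute[OF commutes_T])
    also have "\<dots> = integral {0..r} (\<lambda>s. exp (c * t) *\<^sub>R \<psi> (t + s))"
      unfolding damped_mean_def \<psi>_def
      by (intro integral_cong) (simp add: T_add[symmetric] add.commute distrib_left flip: exp_add)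
    also have "\<dots> = exp (c * t) *\<^sub>R integral {0..r} (\<lambda>s. \<psi> (s + t))"
      by (simp add: add.commute)
    also have "integral {0..r} (\<lambda>s. \<psi> (s + t)) = integral {t..r + t} \<psi>"
      using integral_shift_real_ivl[of t t "r + t" \<psi>] by simp
    also have "\<dots> = F (t + r) - F t"
      unfolding F_def
      using Henstock_Kurzweil_Integration.integral_combine[of "-1" t "t + r" \<psi>] that r
        integrable_continuous_interval[OF c\<psi>]
      by (auto simp: add.commute algebra_simps)
    finally show ?thesis .
  qed
  have "(F \<circ> (\<lambda>t. t + r) has_vector_derivative 1 *\<^sub>R \<psi> r) (at 0)"
    using F[of r] r by (intro vector_diff_chain_at) (auto intro!: derivative_eq_intros simp: has_vector_derivative_def)
  then have "((\<lambda>t. F (t + r) - F t) has_vector_derivative \<psi> r - \<psi> 0) (at 0)"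
    using F[of 0] by (intro has_vector_derivative_diff) (auto simp: o_def)
  then have "((\<lambda>t. exp (c * t) *\<^sub>R (F (t + r) - F t)) has_vector_derivative
      exp (c * 0) *\<^sub>R (\<psi> r - \<psi> 0) + c *\<^sub>R (F (0 + r) - F 0)) (at 0)"
    by (intro has_vector_derivative_scaleR) (auto intro!: derivative_eq_intros)
  moreover have "c *\<^sub>R (F (0 + r) - F 0) = c *\<^sub>R damped_mean T c r x"
    using eq[of 0] by (simp add: T_zero)
  ultimately have "((\<lambda>t. exp (c * t) *\<^sub>R (F (t + r) - F t)) has_vector_derivative
      (c *\<^sub>R damped_mean T c r x - x + exp (- (c * r)) *\<^sub>R T r x)) (at 0)"
    by (simp add: \<psi>_def T_zero algebra_simps)
  then show ?thesis
    unfolding tder_def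
    by (rule has_vector_derivative_transform_within_open[where S = "{-1<..<1}"]) (auto simp: eq)
qed

lemma commutes_avg: "0 \<le> r \<Longrightarrow> commutes_with T (avg T r)"
  unfolding avg_def using commutes_scaleR[OF commutes_damped_mean[of 0 r]] by simp

lemma commutes_diffq: "commutes_with T (diffq T r)"
  unfolding diffq_def by (intro commutes_scaleR commutes_diff commutes_T commutes_id)

lemma norm_avg: "0 < r \<Longrightarrow> norm (avg T r x) \<le> norm x"
  using norm_damped_mean[of 0 r x] by (simp add: avg_def field_simps)

lemma norm_avg_funpow: "0 < r \<Longrightarrow> norm ((avg T r ^^ n) x) \<le> norm x"
  by (induction n) (auto intro: order_trans[OF norm_avg])

lemma tder_avg: "0 < r \<Longrightarrow> tder T (avg T r x) (diffq T r x)"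
  using tder_scaleR[OF tder_damped_mean[of r 0 x], of "1 / r"]
  by (simp add: avg_def diffq_def algebra_simps)

lemma diffq_eq_avg: "tder T x y \<Longrightarrow> 0 < r \<Longrightarrow> diffq T r x = avg T r y"
  using tder_integral[of x y r] by (simp add: diffq_def avg_def damped_mean_def integral_unique)

lemma norm_avg_diff:
  assumes "0 < r" "\<And>s. 0 \<le> s \<Longrightarrow> s \<le> r \<Longrightarrow> norm (T s x - x) \<le> e"
  shows "norm (avg T r x - x) \<le> e"
proof -
  have "integral {0..r} (\<lambda>s. T s x) - r *\<^sub>R x = integral {0..r} (\<lambda>s. T s x - x)"
    by (subst integral_diff) (use assms(1) in \<open>auto intro!: integrable_continuous_interval continuous_T_on\<close>)
  also have "norm \<dots> \<le> e * (r - 0)"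
    by (rule integral_bound) (use assms in \<open>auto intro!: continuous_intros continuous_T_on\<close>)
  finally have *: "norm (integral {0..r} (\<lambda>s. T s x) - r *\<^sub>R x) \<le> e * r" by simp
  have "avg T r x - x = (1 / r) *\<^sub>R (integral {0..r} (\<lambda>s. T s x) - r *\<^sub>R x)"
    using assms(1) by (simp add: avg_def damped_mean_def scaleR_diff_right)
  then have "norm (avg T r x - x) = norm (integral {0..r} (\<lambda>s. T s x) - r *\<^sub>R x) / r"
    using assms(1) by simp
  then show ?thesis
    using * assms(1) by (simp add: pos_divide_le_eq)
qed

lemma norm_T_diff:
  assumes "tder T x y" "0 \<le> s"
  shows "norm (T s x - x) \<le> s * norm y"
  using norm_damped_mean[of 0 s y] tder_integral[OF assms] assms(2)
  by (simp add: damped_mean_def integral_unique)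

lemma norm_avg_diff_tder: "tder T x y \<Longrightarrow> 0 < r \<Longrightarrow> norm (avg T r x - x) \<le> r * norm y"
  by (rule norm_avg_diff) (auto intro!: order_trans[OF norm_T_diff] mult_right_mono)

lemma avg_tendsto: "((\<lambda>r. avg T r x) \<longlongrightarrow> x) (at_right 0)"
proof (rule tendstoI)
  fix e :: real assume e: "0 < e"
  have "((\<lambda>s. T s x) \<longlongrightarrow> T 0 x) (at 0)"
    using continuous_T[of x] by (simp add: continuous_on_eq_continuous_at isCont_def)
  then have "\<forall>\<^sub>F s in at 0. dist (T s x) (T 0 x) < e / 2"
    using e by (intro tendstoD) auto
  then obtain d where d: "d > 0" "\<And>s. s \<noteq> 0 \<Longrightarrow> \<bar>s\<bar> < d \<Longrightarrow> norm (T s x - x) < e / 2"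
    by (auto simp: eventually_at dist_norm T_zero)
  have "norm (avg T r x - x) \<le> e / 2" if "0 < r" "r < d" for r
  proof (rule norm_avg_diff[OF that(1)])
    show "norm (T s x - x) \<le> e / 2" if "0 \<le> s" "s \<le> r" for s
      using d(2)[of s] \<open>r < d\<close> that e by (cases "s = 0") (auto simp: T_zero less_imp_le)
  qed
  then show "\<forall>\<^sub>F r in at_right 0. dist (avg T r x) x < e"
    unfolding eventually_at_right_field dist_norm
    using d(1) e by (intro exI[of _ d]) force
qed

lemma avg_funpow_tendsto: "((\<lambda>r. (avg T r ^^ n) x) \<longlongrightarrow> x) (at_right 0)"
proof (induction n)
  case (Suc n)
  have "((\<lambda>r. norm ((avg T r ^^ n) x - x) + norm (avg T r x - x)) \<longlongrightarrow> 0) (at_right 0)"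
    using tendsto_add[OF tendsto_norm_zero[OF LIM_zero[OF Suc]] tendsto_norm_zero[OF LIM_zero[OF avg_tendsto]]]
    by simp
  then have "((\<lambda>r. (avg T r ^^ Suc n) x - x) \<longlongrightarrow> 0) (at_right 0)"
  proof (rule Lim_null_comparison[rotated])
    have "norm ((avg T r ^^ Suc n) x - x) \<le> norm ((avg T r ^^ n) x - x) + norm (avg T r x - x)" if "0 < r" for r
    proof -
      have "(avg T r ^^ Suc n) x - x = avg T r ((avg T r ^^ n) x - x) + (avg T r x - x)"
        using linear_diff[OF bounded_linear.linear, of "avg T r"] commutes_avg[of r] that by (simp add: commutes_with_def)
      then show ?thesis
        using norm_avg[OF that, of "(avg T r ^^ n) x - x"] by (metis add.commute add_left_mono norm_triangle_le)
    qed
    then show "\<forall>\<^sub>F r in at_right 0. norm ((avg T r ^^ Suc n) x - x) \<le> norm ((avg T r ^^ n) x - x) + norm (avg T r x - x)"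
      by (auto simp: eventually_at_right_field intro!: exI[of _ 1])
  qed
  then show ?case by (rule LIM_zero_cancel)
qed auto

lemma funpow_commutes:
  assumes "commutes_with T B" "commutes_with T C" "\<And>x. B (C x) = C (B x)"
  shows "B ((C ^^ n) x) = (C ^^ n) (B x)"
  using assms(3) by (induction n) auto

lemma diffq_avg_commute: "0 \<le> r \<Longrightarrow> diffq T s (avg T r x) = avg T r (diffq T s x)"
  using commutes_avg[of r] linear_diff[OF bounded_linear.linear, of "avg T r"]
    linear_scale[OF bounded_linear.linear, of "avg T r"]
  by (auto simp: diffq_def commutes_with_def)

lemma diffq_funpow_eq_avg: "dern T n x y \<Longrightarrow> 0 < r \<Longrightarrow> (diffq T r ^^ n) x = (avg T r ^^ n) y"
proof (induction n arbitrary: y)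
  case (Suc n)
  then obtain z where z: "dern T n x z" "tder T z y" by auto
  have "(diffq T r ^^ Suc n) x = diffq T r ((avg T r ^^ n) z)"
    using Suc z by simp
  also have "\<dots> = (avg T r ^^ n) (diffq T r z)"
    using Suc.prems by (intro funpow_commutes commutes_avg commutes_diffq diffq_avg_commute) auto
  also have "\<dots> = (avg T r ^^ Suc n) y"
    using z Suc.prems by (simp add: diffq_eq_avg funpow_swap1)
  finally show ?case .
qed auto

lemma diffq_funpow_tendsto:
  assumes "dern T n x y"
  shows "((\<lambda>r. (diffq T r ^^ n) x) \<longlongrightarrow> y) (at_right 0)"
proof (rule Lim_transform_eventually[OF avg_funpow_tendsto[of n y]])
  show "\<forall>\<^sub>F r in at_right 0. (avg T r ^^ n) y = (diffq T r ^^ n) x"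
    using diffq_funpow_eq_avg[OF assms] by (auto simp: eventually_at_right_field intro!: exI[of _ 1])
qed

lemma inverse_at_right: "filterlim (\<lambda>m. 1 / real (Suc m)) (at_right 0) sequentially"
  using LIMSEQ_Suc[OF lim_1_over_n] by (auto simp: filterlim_at intro!: always_eventually)

text \<open>Transfer of regularity. The difference quotients of \<open>x0\<close> are Cauchy as the
  step tends to 0, hence so are those of \<open>x\<close>, and closedness identifies their limits as
  derivatives. Domination is required at all orders up to \<open>n\<close> because the induction
  builds the lower derivatives on the way.\<close>

lemma dern_dominated:
  assumes x0: "dern T n x0 y0"
    and dom: "\<And>i r r'. i \<le> n \<Longrightarrow> 0 < r \<Longrightarrow> 0 < r' \<Longrightarrow>
      norm ((diffq T r ^^ i) x - (diffq T r' ^^ i) x) \<le> C * norm ((diffq T r ^^ i) x0 - (diffq T r' ^^ i) x0)"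
  shows "\<exists>y. dern T n x y"
  using assms
proof (induction n arbitrary: y0)
  case (Suc n)
  obtain z where z: "dern T n x z"
    using Suc.IH Suc.prems by fastforce
  define r where "r m = 1 / real (Suc m)" for m
  have r: "filterlim r (at_right 0) sequentially"
    unfolding r_def by (rule inverse_at_right)
  have "(\<lambda>m. (diffq T (r m) ^^ Suc n) x0) \<longlonglongrightarrow> y0"
    using diffq_funpow_tendsto[OF Suc.prems(1)] r by (rule filterlim_compose)
  then have C0: "Cauchy (\<lambda>m. (diffq T (r m) ^^ Suc n) x0)"
    by (rule LIMSEQ_imp_Cauchy)
  have "Cauchy (\<lambda>m. (diffq T (r m) ^^ Suc n) x)"
  proof (rule metric_CauchyI)
    fix e :: real assume e: "0 < e"
    have "0 < e / (\<bar>C\<bar> + 1)" using e by (intro divide_pos_pos) auto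
    then obtain M where M: "\<And>m k. m \<ge> M \<Longrightarrow> k \<ge> M \<Longrightarrow>
        dist ((diffq T (r m) ^^ Suc n) x0) ((diffq T (r k) ^^ Suc n) x0) < e / (\<bar>C\<bar> + 1)"
      using metric_CauchyD[OF C0] by blast
    have "dist ((diffq T (r m) ^^ Suc n) x) ((diffq T (r k) ^^ Suc n) x) < e" if "m \<ge> M" "k \<ge> M" for m k
    proof -
      let ?d = "norm ((diffq T (r m) ^^ Suc n) x0 - (diffq T (r k) ^^ Suc n) x0)"
      have "norm ((diffq T (r m) ^^ Suc n) x - (diffq T (r k) ^^ Suc n) x) \<le> C * ?d"
        using Suc.prems(2)[of "Suc n" "r m" "r k"] by (simp add: r_def)
      also have "\<dots> \<le> (\<bar>C\<bar> + 1) * ?d" by (intro mult_right_mono) auto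
      also have "\<dots> < e"
        using M[OF that] by (simp add: dist_norm field_simps pos_less_divide_eq add_pos_nonneg)
      finally show ?thesis by (simp add: dist_norm)
    qed
    then show "\<exists>M. \<forall>m\<ge>M. \<forall>k\<ge>M. dist ((diffq T (r m) ^^ Suc n) x) ((diffq T (r k) ^^ Suc n) x) < e"
      by blast
  qed
  then obtain y where y: "(\<lambda>m. (diffq T (r m) ^^ Suc n) x) \<longlonglongrightarrow> y"
    using convergent_eq_Cauchy by blast
  have w: "(\<lambda>m. (diffq T (r m) ^^ n) x) \<longlonglongrightarrow> z"
    using diffq_funpow_tendsto[OF z] r by (rule filterlim_compose)
  \<comment> \<open>A difference quotient is the exact derivative of an average. Once the averages
    of the n-th quotients are known to tend to \<open>z\<close>, \<open>tder_closed\<close> applies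
    to this sequence.\<close>
  have "(\<lambda>m. avg T (r m) ((diffq T (r m) ^^ n) x - z)) \<longlonglongrightarrow> 0"
    by (rule Lim_null_comparison[OF _ tendsto_norm_zero[OF LIM_zero[OF w]]])
      (auto simp: r_def intro!: always_eventually norm_avg)
  moreover have "(\<lambda>m. avg T (r m) z) \<longlonglongrightarrow> z"
    using avg_tendsto r by (rule filterlim_compose)
  ultimately have "(\<lambda>m. avg T (r m) ((diffq T (r m) ^^ n) x - z) + avg T (r m) z) \<longlonglongrightarrow> 0 + z"
    by (rule tendsto_add)
  moreover have "avg T (r m) ((diffq T (r m) ^^ n) x - z) + avg T (r m) z = avg T (r m) ((diffq T (r m) ^^ n) x)" for m
    using linear_diff[OF bounded_linear.linear, of "avg T (r m)"] commutes_avg[of "r m"]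
    by (simp add: commutes_with_def r_def)
  ultimately have av: "(\<lambda>m. avg T (r m) ((diffq T (r m) ^^ n) x)) \<longlonglongrightarrow> z"
    by simp
  have td: "tder T (avg T (r m) ((diffq T (r m) ^^ n) x)) ((diffq T (r m) ^^ Suc n) x)" for m
    using tder_avg[of "r m"] by (simp add: r_def)
  have "tder T z y"
    by (rule tder_closed[OF td av y])
  then show ?case using z by auto
qed auto

lemma dern_norm_le:
  assumes "dern T n x y" "dern T n x0 y0"
    and "\<And>r. 0 < r \<Longrightarrow> norm ((diffq T r ^^ n) x) \<le> C * norm ((diffq T r ^^ n) x0)"
  shows "norm y \<le> C * norm y0"
proof (rule tendsto_le[OF _ tendsto_mult[OF tendsto_const] tendsto_norm])
  show "((\<lambda>r. (diffq T r ^^ n) x) \<longlongrightarrow> y) (at_right 0)" "((\<lambda>r. norm ((diffq T r ^^ n) x0)) \<longlongrightarrow> norm y0) (at_right 0)"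
    using assms by (auto intro!: tendsto_norm diffq_funpow_tendsto)
  show "\<forall>\<^sub>F r in at_right 0. norm ((diffq T r ^^ n) x) \<le> C * norm ((diffq T r ^^ n) x0)"
    using assms(3) by (auto simp: eventually_at_right_field intro!: exI[of _ 1])
qed simp

end

section \<open>Products of isometry groups\<close>

definition prod_group ::
    "(real \<Rightarrow> 'a \<Rightarrow> 'a) \<Rightarrow> (real \<Rightarrow> 'b \<Rightarrow> 'b) \<Rightarrow> real \<Rightarrow> 'a \<times> 'b \<Rightarrow> 'a \<times> 'b" where
  "prod_group T T' s p = (T s (fst p), T' s (snd p))"

lemma isometry_group_prod:
  assumes "isometry_group T" "isometry_group T'"
  shows "isometry_group (prod_group T T')"
proof -
  interpret T: isometry_group T by fact
  interpret T': isometry_group T' by fact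
  have "bounded_linear (\<lambda>p. (T s (fst p), T' s (snd p)))" for s
    by (intro bounded_linear_Pair bounded_linear_compose[OF T.linear_T] bounded_linear_compose[OF T'.linear_T]
        bounded_linear_fst bounded_linear_snd)
  then show ?thesis
    by (intro isometry_group.intro)
      (auto simp: prod_group_def[abs_def] norm_prod_def T.norm_T T'.norm_T T.T_zero T'.T_zero T.T_add T'.T_add
        intro!: continuous_on_Pair T.continuous_T T'.continuous_T)
qed

lemma tder_prod:
  "tder (prod_group T T') p q \<longleftrightarrow> tder T (fst p) (fst q) \<and> tder T' (snd p) (snd q)"
  unfolding tder_def prod_group_def
  using bounded_linear.has_vector_derivative[OF bounded_linear_fst, of "\<lambda>s. (T s (fst p), T' s (snd p))" q]
    bounded_linear.has_vector_derivative[OF bounded_linear_snd, of "\<lambda>s. (T s (fst p), T' s (snd p))" q]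
    has_vector_derivative_Pair[of "\<lambda>s. T s (fst p)" "fst q" 0 UNIV "\<lambda>s. T' s (snd p)" "snd q"]
  by auto

lemma dern_prod:
  "dern (prod_group T T') n p q \<longleftrightarrow> dern T n (fst p) (fst q) \<and> dern T' n (snd p) (snd q)"
proof (induction n arbitrary: q)
  case (Suc n)
  show ?case
    unfolding dern.simps Suc tder_prod by (metis fst_conv snd_conv)
qed (auto simp: prod_eq_iff)

section \<open>Averaging and Fourier splitting\<close>

text \<open>Fourier splitting as a differential inequality. At time \<open>t\<close> the bound is
  used with \<rho>^2 = (1 + t) / k; multiplied by the right constant, its last term is cancelled by
  the decrease of \<open>f\<close>, and what is left bounds the derivative of
  \<open>(1 + t) powr p * f t\<close> by powers of \<open>1 + t\<close>. The constant
  \<open>K\<close> depends on \<open>c\<close>, \<open>C\<close> and the two rates only.\<close>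

lemma splitting_decay:
  fixes c C \<alpha> \<gamma> :: real
  assumes c: "0 < c" and C: "0 < C" and \<alpha>: "0 \<le> \<alpha>" and \<gamma>: "0 \<le> \<gamma>"
  shows "\<exists>K>0. \<forall>f f' X N M t.
    (\<forall>t\<ge>0. (f has_real_derivative f' t) (at t within {0..})) \<and> (\<forall>t\<ge>0. f' t \<le> - c * X t) \<and>
    (\<forall>t\<ge>0. X t \<le> f t) \<and> 0 \<le> N \<and> 0 \<le> M \<and>
    (\<forall>t\<ge>0. \<forall>\<rho>>0. f t \<le> C * (\<rho> powr (- 2 * \<alpha>) * N + \<rho> powr (- 2 * \<gamma>) * M + \<rho>\<^sup>2 * X t)) \<and> 0 \<le> t
    \<longrightarrow> f t \<le> K * ((1 + t) powr (- \<alpha>) * N + (1 + t) powr (- \<gamma>) * M)"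
proof -
  \<comment> \<open>Any weight exceeding both rates would do; exceeding them by at least 1 makes the
    divisors \<open>p - \<alpha>\<close> and \<open>p - \<gamma>\<close> in the primitive at least
    1.\<close>
  define p where "p = \<alpha> + \<gamma> + 1"
  \<comment> \<open>Balances the two effects: \<open>c * k / C = p\<close>, so the multiple of
    \<open>f t\<close> produced by the weight is exactly what the bound with this \<rho>
    controls.\<close>
  define k where "k = p * C / c"
  \<comment> \<open>The value of \<rho> at time 0: as \<open>C * r^2 = 1/2\<close> and
    \<open>X 0\<close> is at most \<open>f 0\<close>, half of \<open>f 0\<close> is absorbed and
    \<open>f 0\<close> is bounded by \<open>N\<close> and \<open>M\<close>.\<close>
  define r where "r = sqrt (1 / (2 * C))"
  define A where "A = 2 * C * (r powr (- 2 * \<alpha>) + r powr (- 2 * \<gamma>))"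
  define B where "B = c * k * (k powr \<alpha> + k powr \<gamma>)"
  have p: "1 \<le> p - \<alpha>" "1 \<le> p - \<gamma>" "0 < p" using \<alpha> \<gamma> by (auto simp: p_def)
  have k: "0 < k" using p c C by (simp add: k_def)
  have r: "0 < r" using C by (simp add: r_def)
  have A: "0 < A" using C r by (auto simp: A_def intro!: mult_pos_pos add_pos_pos)
  have B: "0 < B" using c k by (auto simp: B_def intro!: mult_pos_pos add_pos_pos)
  have "f t \<le> (A + B) * ((1 + t) powr (- \<alpha>) * N + (1 + t) powr (- \<gamma>) * M)"
    if f: "\<forall>t\<ge>0. (f has_real_derivative f' t) (at t within {0..})"
      and f': "\<forall>t\<ge>0. f' t \<le> - c * X t" and X: "\<forall>t\<ge>0. X t \<le> f t" and N: "0 \<le> N" and M: "0 \<le> M"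
      and bd: "\<forall>t\<ge>0. \<forall>\<rho>>0. f t \<le> C * (\<rho> powr (- 2 * \<alpha>) * N + \<rho> powr (- 2 * \<gamma>) * M + \<rho>\<^sup>2 * X t)"
      and t: "0 \<le> t" for f f' X N M t
  proof -
    define N' where "N' = k powr \<alpha> * N"
    define M' where "M' = k powr \<gamma> * M"
    have NM: "0 \<le> N'" "0 \<le> M'" using N M by (auto simp: N'_def M'_def)
    have f0: "f 0 \<le> A * (N + M)"
    proof -
      have "f 0 \<le> C * (r powr (- 2 * \<alpha>) * N + r powr (- 2 * \<gamma>) * M + r\<^sup>2 * X 0)"
        using bd r by simp
      also have "\<dots> = C * (r powr (- 2 * \<alpha>) * N + r powr (- 2 * \<gamma>) * M) + X 0 / 2"
        using C by (simp add: r_def field_simps)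
      finally have "f 0 \<le> 2 * C * (r powr (- 2 * \<alpha>) * N + r powr (- 2 * \<gamma>) * M)"
        using X[rule_format, of 0] by simp
      also have "\<dots> \<le> 2 * C * ((r powr (- 2 * \<alpha>) + r powr (- 2 * \<gamma>)) * (N + M))"
        using C N M by (intro mult_left_mono) (auto simp: algebra_simps)
      finally show ?thesis by (simp add: A_def)
    qed
    \<comment> \<open>A primitive of the source terms; the weighted \<open>f\<close> minus
      \<open>\<psi>\<close> is nonincreasing.\<close>
    define \<psi> where "\<psi> = (\<lambda>t. c * k * (N' * (1 + t) powr (p - \<alpha>) / (p - \<alpha>) + M' * (1 + t) powr (p - \<gamma>) / (p - \<gamma>)))"
    define h where "h = (\<lambda>t. (1 + t) powr p * f t - \<psi> t)"
    define h' where "h' = (\<lambda>t. p * (1 + t) powr (p - 1) * f t + (1 + t) powr p * f' t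
      - c * k * (N' * (1 + t) powr (p - \<alpha> - 1) + M' * (1 + t) powr (p - \<gamma> - 1)))"
    have h: "(h has_real_derivative h' t) (at t within {0..})" if "0 \<le> t" for t
    proof -
      have d: "((\<lambda>t. (1 + t) powr e) has_real_derivative e * (1 + t) powr (e - 1)) (at t within {0..})" for e
        using that by (auto intro!: derivative_eq_intros)
      have dc: "((\<lambda>t. n * (1 + t) powr e / e) has_real_derivative n * (1 + t) powr (e - 1)) (at t within {0..})"
        if "1 \<le> e" for n e
        using DERIV_cmult[OF d, of "n / e" e] that by simp
      have "((\<lambda>t. (1 + t) powr p * f t) has_real_derivative p * (1 + t) powr (p - 1) * f t + f' t * (1 + t) powr p)
          (at t within {0..})"
        using DERIV_mult[OF d] f that by blast
      from DERIV_diff[OF this DERIV_cmult[OF DERIV_add[OF dc[OF p(1), of N'] dc[OF p(2), of M']], of "c * k"]]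
      show ?thesis
        by (simp add: h_def h'_def \<psi>_def mult.commute)
    qed
    have h'le: "h' t \<le> 0" if t: "0 \<le> t" for t
    proof -
      let ?\<rho> = "sqrt ((1 + t) / k)"
      have sq: "?\<rho> powr (- 2 * e) = (1 + t) powr (- e) * k powr e" for e
      proof -
        have "?\<rho> powr (- 2 * e) = ((1 + t) / k) powr (- e)"
          using t k by (simp add: powr_half_sqrt[symmetric] powr_powr)
        also have "\<dots> = (1 + t) powr (- e) * k powr e"
          using t k by (simp add: powr_divide powr_minus field_simps)
        finally show ?thesis .
      qed
      have rho: "?\<rho>\<^sup>2 = (1 + t) / k" "0 < ?\<rho>" using t k by simp_all
      have "f t \<le> C * (?\<rho> powr (- 2 * \<alpha>) * N + ?\<rho> powr (- 2 * \<gamma>) * M + ?\<rho>\<^sup>2 * X t)"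
        using bd t rho(2) by blast
      then have "f t \<le> C * (N' * (1 + t) powr (- \<alpha>) + M' * (1 + t) powr (- \<gamma>) + (1 + t) / k * X t)"
        unfolding sq rho(1) by (simp add: N'_def M'_def mult_ac)
      then have "f t / C \<le> N' * (1 + t) powr (- \<alpha>) + M' * (1 + t) powr (- \<gamma>) + (1 + t) / k * X t"
        using C by (simp add: pos_divide_le_eq mult.commute)
      then have "c * k * (f t / C) \<le> c * k * (N' * (1 + t) powr (- \<alpha>) + M' * (1 + t) powr (- \<gamma>) + (1 + t) / k * X t)"
        using c k by (intro mult_left_mono) auto
      moreover have "c * k * ((1 + t) / k * X t) = c * (1 + t) * X t" using k by simp
      ultimately have "c * k * (f t / C) \<le> c * k * (N' * (1 + t) powr (- \<alpha>) + M' * (1 + t) powr (- \<gamma>)) + c * (1 + t) * X t"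
        unfolding distrib_left[of "c * k"] by linarith
      moreover have "c * k * (f t / C) = p * f t" using C c by (simp add: k_def)
      moreover have "(1 + t) * f' t \<le> (1 + t) * (- c * X t)"
        using f' t by (intro mult_left_mono) auto
      ultimately have "p * f t + (1 + t) * f' t - c * k * (N' * (1 + t) powr (- \<alpha>) + M' * (1 + t) powr (- \<gamma>)) \<le> 0"
        by (simp add: algebra_simps)
      then have "(1 + t) powr (p - 1) * (p * f t + (1 + t) * f' t - c * k * (N' * (1 + t) powr (- \<alpha>) + M' * (1 + t) powr (- \<gamma>))) \<le> 0"
        by (simp add: mult_nonneg_nonpos)
      moreover have "(1 + t) powr p = (1 + t) powr (p - 1) * (1 + t)"
        using t by (simp add: powr_diff)
      moreover have e: "(1 + t) powr (p - e - 1) = (1 + t) powr (p - 1) * (1 + t) powr (- e)" for e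
        using t by (simp add: powr_add[symmetric] algebra_simps)
      ultimately show ?thesis
        unfolding h'_def e by (simp add: algebra_simps)
    qed
    have "h t \<le> h 0"
    proof (cases "t = 0")
      case False
      show ?thesis
      proof (rule DERIV_nonpos_imp_decreasing_open[of 0 t h])
        show "0 \<le> t" by fact
        show "\<exists>y. (h has_real_derivative y) (at x) \<and> y \<le> 0" if "0 < x" "x < t" for x
          using h[of x] h'le[of x] that by (auto simp: at_within_interior[of x "{0..}"])
        show "continuous_on {0..t} h"
          by (rule DERIV_continuous_on[of "{0..t}" h h'], rule DERIV_subset[OF h]) auto
      qed
    qed auto
    then have "(1 + t) powr p * f t \<le> f 0 - \<psi> 0 + \<psi> t"
      by (simp add: h_def)
    also have "\<dots> \<le> A * (N + M) + \<psi> t"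
    proof -
      have "0 \<le> \<psi> 0"
        unfolding \<psi>_def using NM p c k
        by (intro mult_nonneg_nonneg add_nonneg_nonneg divide_nonneg_nonneg) auto
      then show ?thesis using f0 by linarith
    qed
    also have "\<psi> t \<le> c * k * (N' * (1 + t) powr (p - \<alpha>) + M' * (1 + t) powr (p - \<gamma>))"
    proof -
      have "a / b \<le> a" if "0 \<le> a" "1 \<le> b" for a b :: real
        using that by (simp add: field_simps mult_left_mono mult_le_cancel_left1)
      then show ?thesis
        unfolding \<psi>_def using c k NM p by (intro mult_left_mono add_mono) auto
    qed
    finally have *: "(1 + t) powr p * f t \<le>
      A * (N + M) + c * k * (N' * (1 + t) powr (p - \<alpha>) + M' * (1 + t) powr (p - \<gamma>))" by simp
    have "f t = (1 + t) powr (- p) * ((1 + t) powr p * f t)"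
      using t by (simp add: powr_minus)
    also have "\<dots> \<le> (1 + t) powr (- p) * (A * (N + M) + c * k * (N' * (1 + t) powr (p - \<alpha>) + M' * (1 + t) powr (p - \<gamma>)))"
      using * by (intro mult_left_mono) auto
    also have "\<dots> = A * ((1 + t) powr (- p) * N + (1 + t) powr (- p) * M)
        + c * k * (N' * (1 + t) powr (- \<alpha>) + M' * (1 + t) powr (- \<gamma>))"
    proof -
      have "(1 + t) powr (- p) * (1 + t) powr (p - e) = (1 + t) powr (- e)" for e
        using t by (simp add: powr_add[symmetric])
      then show ?thesis by (simp add: algebra_simps)
    qed
    also have "\<dots> \<le> A * ((1 + t) powr (- \<alpha>) * N + (1 + t) powr (- \<gamma>) * M)
        + c * k * ((k powr \<alpha> + k powr \<gamma>) * ((1 + t) powr (- \<alpha>) * N + (1 + t) powr (- \<gamma>) * M))"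
    proof (intro add_mono)
      have le: "(1 + t) powr (- p) \<le> (1 + t) powr (- \<alpha>)" "(1 + t) powr (- p) \<le> (1 + t) powr (- \<gamma>)"
        using t p by (auto intro!: powr_mono)
      show "A * ((1 + t) powr (- p) * N + (1 + t) powr (- p) * M) \<le> A * ((1 + t) powr (- \<alpha>) * N + (1 + t) powr (- \<gamma>) * M)"
        using le A N M by (intro mult_left_mono add_mono mult_right_mono) auto
      have "0 \<le> k powr \<gamma> * ((1 + t) powr (- \<alpha>) * N) + k powr \<alpha> * ((1 + t) powr (- \<gamma>) * M)"
        using N M by simp
      then have "N' * (1 + t) powr (- \<alpha>) + M' * (1 + t) powr (- \<gamma>)
        \<le> (k powr \<alpha> + k powr \<gamma>) * ((1 + t) powr (- \<alpha>) * N + (1 + t) powr (- \<gamma>) * M)"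
        by (simp add: N'_def M'_def algebra_simps)
      then show "c * k * (N' * (1 + t) powr (- \<alpha>) + M' * (1 + t) powr (- \<gamma>))
        \<le> c * k * ((k powr \<alpha> + k powr \<gamma>) * ((1 + t) powr (- \<alpha>) * N + (1 + t) powr (- \<gamma>) * M))"
        using c k by (intro mult_left_mono) auto
    qed
    also have "\<dots> = (A + B) * ((1 + t) powr (- \<alpha>) * N + (1 + t) powr (- \<gamma>) * M)"
      by (simp add: B_def algebra_simps)
    finally show ?thesis .
  qed
  then show ?thesis
    using A B by (intro exI[of _ "A + B"] conjI allI impI) auto
qed

section \<open>Young and interpolation inequalities\<close>

lemma inner_young:
  fixes x y :: "'a::real_inner"
  assumes "0 < e"
  shows "c * inner x y \<le> e * (norm x)\<^sup>2 + c\<^sup>2 / (4 * e) * (norm y)\<^sup>2"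
proof -
  have "0 \<le> (norm ((2 * e) *\<^sub>R x - c *\<^sub>R y))\<^sup>2" by simp
  also have "\<dots> = 4 * e * (e * (norm x)\<^sup>2 - c * inner x y) + c\<^sup>2 * (norm y)\<^sup>2"
    unfolding power2_norm_eq_inner
    by (simp add: inner_diff_left inner_diff_right inner_commute power2_eq_square algebra_simps)
  finally show ?thesis
    using assms by (simp add: field_simps)
qed

lemma inner_young':
  fixes x y :: "'a::real_inner"
  assumes "0 < e" "(norm y)\<^sup>2 \<le> B * R"
  shows "c * inner x y \<le> e * (norm x)\<^sup>2 + (c\<^sup>2 * B / (4 * e)) * R"
proof -
  have "c\<^sup>2 / (4 * e) * (norm y)\<^sup>2 \<le> c\<^sup>2 / (4 * e) * (B * R)"
    using assms by (intro mult_left_mono) auto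
  then show ?thesis
    using inner_young[OF assms(1), of c x y] by simp
qed

text \<open>If the first term does not suffice, the norm grows by at least the factor
  \<open>w\<close> from \<open>x0\<close> to \<open>x1\<close>. By \<open>tder_interpolation\<close>
  such growth persists along the whole chain of derivatives, so each of the \<open>l\<close> further
  derivatives gains a factor \<open>w\<close>.\<close>

lemma (in isometry_group) interpolation_high:
  assumes "tder T x0 x1" "dern T l x1 y" "0 < w"
  shows "norm x1 \<le> w * norm x0 + norm y / w ^ l"
proof (cases "norm x1 \<le> w * norm x0")
  case True
  then show ?thesis using assms(3) by (simp add: add_increasing2)
next
  case False
  have "w ^ l * norm x1 \<le> norm y" if "tder T x0 x1" "dern T l x1 y" "w * norm x0 \<le> norm x1" for x0 x1
    using that
  proof (induction l arbitrary: x0 x1)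
    case (Suc l)
    obtain x2 where x2: "tder T x1 x2" "dern T l x2 y"
      using Suc.prems(2) dern_append[of 1 l x1 y] by auto
    have "norm x1 * (w * norm x1) \<le> norm x1 * norm x2"
    proof -
      have "w * (norm x1)\<^sup>2 \<le> w * (norm x0 * norm x2)"
        using tder_interpolation[OF Suc.prems(1) x2(1)] assms(3) by simp
      also have "\<dots> \<le> norm x1 * norm x2"
        using mult_right_mono[OF Suc.prems(3), of "norm x2"] by (simp add: mult_ac)
      finally show ?thesis by (simp add: power2_eq_square mult_ac)
    qed
    then have le: "w * norm x1 \<le> norm x2"
      by (cases "norm x1 = 0") auto
    have "w ^ Suc l * norm x1 = w ^ l * (w * norm x1)" by simp
    also have "\<dots> \<le> w ^ l * norm x2" using le assms(3) by (intro mult_left_mono) auto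
    also have "\<dots> \<le> norm y" by (rule Suc.IH[OF x2 le])
    finally show ?case .
  qed auto
  from this[OF assms(1,2)] False have "norm x1 \<le> norm y / w ^ l"
    using assms(3) by (simp add: field_simps)
  moreover have "0 \<le> w * norm x0" using assms(3) by simp
  ultimately show ?thesis by linarith
qed

text \<open>Averaging \<open>n\<close> times moves \<open>x\<close> by at most \<open>n * r\<close>
  times the norm of \<open>x'\<close>. Interpolating \<open>x'\<close> between \<open>x\<close> and
  \<open>x''\<close> produces half of \<open>norm x\<close>, which is absorbed on the left and
  causes the factor 2.\<close>

lemma (in isometry_group) interpolation_low:
  assumes "tder T x x'" "tder T x' x''" "0 < r"
  shows "norm x \<le> 2 * norm ((avg T r ^^ n) x) + (real n * r)\<^sup>2 * norm x''"
proof -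
  have step: "norm ((avg T r ^^ n) x - x) \<le> real n * (r * norm x')" for n
  proof (induction n)
    case (Suc n)
    have eq: "(avg T r ^^ Suc n) x - x = avg T r ((avg T r ^^ n) x - x) + (avg T r x - x)"
      using linear_diff[OF bounded_linear.linear, of "avg T r"] commutes_avg[of r] assms(3)
      by (simp add: commutes_with_def)
    have "norm ((avg T r ^^ Suc n) x - x) \<le> norm (avg T r ((avg T r ^^ n) x - x)) + norm (avg T r x - x)"
      unfolding eq by (rule norm_triangle_ineq)
    also have "\<dots> \<le> real n * (r * norm x') + r * norm x'"
      using norm_avg[OF assms(3)] Suc norm_avg_diff_tder[OF assms(1,3)] by (meson add_mono order_trans)
    finally show ?case by (simp add: algebra_simps)
  qed auto
  define b where "b = real n * r"
  have "norm x \<le> norm ((avg T r ^^ n) x) + b * norm x'"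
    using step[of n] norm_triangle_ineq2[of x "(avg T r ^^ n) x"] by (simp add: b_def norm_minus_commute)
  moreover have "2 * (b * norm x') \<le> norm x + b\<^sup>2 * norm x''"
  proof -
    have "(2 * (b * norm x'))\<^sup>2 \<le> 4 * (norm x * (b\<^sup>2 * norm x''))"
      using mult_left_mono[OF tder_interpolation[OF assms(1,2)], of "4 * b\<^sup>2"]
      by (simp add: power_mult_distrib algebra_simps)
    also have "\<dots> \<le> (norm x + b\<^sup>2 * norm x'')\<^sup>2"
      using sum_squares_bound[of "norm x" "b\<^sup>2 * norm x''"] by (simp add: power2_sum mult_ac)
    finally show ?thesis
      by (rule power2_le_imp_le) simp
  qed
  ultimately show ?thesis by (simp add: b_def)
qed

text \<open>Logarithmic convexity of the norms of successive derivatives: the two inner terms of a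
  chain of four are controlled by its ends, so that later only the orders 0 and 3 need an estimate
  of their own.\<close>

lemma (in isometry_group) interpolation_two_thirds:
  assumes "tder T x0 x1" "tder T x1 x2" "tder T x2 x3"
  shows "norm x2 \<le> norm x0 + norm x3" "norm x1 \<le> 2 * norm x0 + norm x3"
proof -
  have i1: "(norm x1)\<^sup>2 \<le> norm x0 * norm x2" and i2: "(norm x2)\<^sup>2 \<le> norm x1 * norm x3"
    using tder_interpolation assms by blast+
  show le: "norm x2 \<le> norm x0 + norm x3"
  proof (rule ccontr)
    assume "\<not> norm x2 \<le> norm x0 + norm x3"
    then have lt: "norm x0 + norm x3 < norm x2" by simp
    then have p: "0 < norm x2" by (smt (verit) norm_ge_zero)
    have "(norm x1)\<^sup>2 \<le> norm x2 * norm x2"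
      using i1 mult_right_mono[of "norm x0" "norm x2" "norm x2"] lt by (smt (verit) norm_ge_zero)
    then have "norm x1 \<le> norm x2"
      using power2_le_imp_le[of "norm x1" "norm x2"] by (simp add: power2_eq_square)
    then have "(norm x2)\<^sup>2 \<le> norm x2 * norm x3"
      using i2 mult_right_mono[of "norm x1" "norm x2" "norm x3"] by simp
    then have "norm x2 \<le> norm x3"
      using p by (simp add: power2_eq_square)
    then show False using lt by (smt (verit) norm_ge_zero)
  qed
  have "(norm x1)\<^sup>2 \<le> (norm x0 + norm x2)\<^sup>2"
    using i1 zero_le_power2[of "norm x0"] zero_le_power2[of "norm x2"] mult_nonneg_nonneg[OF norm_ge_zero norm_ge_zero, of x0 x2]
    unfolding power2_sum by linarith
  then have "norm x1 \<le> norm x0 + norm x2"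
    by (rule power2_le_imp_le) simp
  then show "norm x1 \<le> 2 * norm x0 + norm x3" using le by simp
qed

text \<open>Inverting \<open>1 - \<partial>\<close> on the truncated exponential mean costs only the factor \<open>1 / (1 - e\<^sup>-\<^sup>1)\<close>.\<close>

definition mean_der :: "(real \<Rightarrow> 'h \<Rightarrow> 'h::real_normed_vector) \<Rightarrow> 'h \<Rightarrow> 'h" where
  "mean_der T x = damped_mean T 1 1 x - x + exp (- 1) *\<^sub>R T 1 x"

context isometry_group
begin

abbreviation "P \<equiv> damped_mean T 1 1"
abbreviation "Q \<equiv> mean_der T"

lemma tder_P: "tder T (P x) (Q x)"
  using tder_damped_mean[of 1 1 x] by (simp add: mean_der_def)

lemma commutes_P: "commutes_with T P"
  by (rule commutes_damped_mean) auto

lemma commutes_Q: "commutes_with T Q"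
  unfolding mean_der_def
  by (intro commutes_plus commutes_diff commutes_P commutes_id commutes_scaleR commutes_T)

lemma P_Q_commute: "P (Q x) = Q (P x)"
  by (rule damped_mean_commute[OF commutes_Q])

lemma norm_Q: "norm (Q x) \<le> 3 * norm x"
proof -
  have "norm (exp (- 1) *\<^sub>R T 1 x) \<le> norm x"
    by (simp add: norm_T mult_left_le_one_le)
  then show ?thesis
    using norm_damped_mean[of 1 1 x] norm_triangle_ineq4[of "P x" x]
      norm_triangle_ineq[of "P x - x" "exp (- 1) *\<^sub>R T 1 x"]
    unfolding mean_der_def by linarith
qed

text \<open>The vector equals \<open>P x - Q x\<close> up to a term of norm at most half of its own,
  which is absorbed.\<close>

lemma norm_le_P_Q: "norm x \<le> 2 * (norm (P x) + norm (Q x))"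
proof -
  have "norm (exp (- 1) *\<^sub>R T 1 x) \<le> (1 / 2) * norm x"
  proof -
    have "2 \<le> exp (1 :: real)" using exp_ge_add_one_self[of 1] by simp
    then have "exp (- 1 :: real) \<le> 1 / 2" by (simp add: exp_minus field_simps)
    from mult_right_mono[OF this, of "norm x"] show ?thesis by (simp add: norm_T)
  qed
  moreover have "x = P x - Q x + exp (- 1) *\<^sub>R T 1 x" by (simp add: mean_der_def)
  from arg_cong[OF this, of norm] have "norm x \<le> norm (P x) + norm (Q x) + norm (exp (- 1) *\<^sub>R T 1 x)"
    using norm_triangle_ineq[of "P x - Q x" "exp (- 1) *\<^sub>R T 1 x"] norm_triangle_ineq4[of "P x" "Q x"] by linarith
  ultimately show ?thesis by argo
qed

text \<open>The i-th derivative of \<open>P (P (P x))\<close>, with every derivative merged into one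
  \<open>P\<close> to give the bounded operator \<open>Q\<close>. In frequency terms this is the
  weight \<xi>^i / (1 - i\<xi>)^3 up to truncation, the origin of the denominator in the decay rate;
  the four values together are equivalent to \<open>norm x\<close>.\<close>

definition smoothing :: "nat \<Rightarrow> 'h \<Rightarrow> 'h" where
  "smoothing i x = (Q ^^ i) ((P ^^ (3 - i)) x)"

lemma commutes_smoothing: "commutes_with T (smoothing i)"
  using commutes_compose[OF commutes_funpow[OF commutes_Q] commutes_funpow[OF commutes_P]]
  by (simp add: smoothing_def[abs_def])

lemma tder_smoothing:
  assumes "i < 3"
  shows "tder T (smoothing i x) (smoothing (Suc i) x)"
proof -
  have "3 - i = Suc (3 - Suc i)" using assms by simp
  then have "smoothing i x = (Q ^^ i) (P ((P ^^ (3 - Suc i)) x))"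
    by (simp add: smoothing_def)
  moreover have "smoothing (Suc i) x = (Q ^^ i) (Q ((P ^^ (3 - Suc i)) x))"
    by (simp add: smoothing_def funpow_swap1)
  ultimately show ?thesis
    using tder_commutes[OF commutes_funpow[OF commutes_Q] tder_P] by simp
qed

lemma norm_le_smoothing: 
  "norm x \<le> 24 * (norm (smoothing 0 x) + norm (smoothing 1 x) + norm (smoothing 2 x) + norm (smoothing 3 x))"
proof -
  have s: "smoothing 0 x = P (P (P x))" "smoothing 1 x = Q (P (P x))" "smoothing 2 x = Q (Q (P x))"
    "smoothing 3 x = Q (Q (Q x))"
    by (simp_all add: smoothing_def eval_nat_numeral)
  have "norm (P x) \<le> 2 * (norm (P (P x)) + norm (Q (P x)))"
    "norm (P (P x)) \<le> 2 * (norm (P (P (P x))) + norm (Q (P (P x))))"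
    "norm (Q (P x)) \<le> 2 * (norm (Q (P (P x))) + norm (Q (Q (P x))))"
    "norm (Q x) \<le> 2 * (norm (Q (P x)) + norm (Q (Q x)))"
    "norm (Q (Q x)) \<le> 2 * (norm (Q (Q (P x))) + norm (Q (Q (Q x))))"
    using norm_le_P_Q[of "P x"] norm_le_P_Q[of "P (P x)"] norm_le_P_Q[of "Q (P x)"] norm_le_P_Q[of "Q x"]
      norm_le_P_Q[of "Q (Q x)"] by (simp_all add: P_Q_commute)
  \<comment> \<open>Three applications of the two-term bound give 8 times the binomial coefficients
    1, 3, 3, 1; the largest product is 24.\<close>
  moreover have "n \<le> 24 * (a + b + c + d)"
    if "n \<le> 2 * (p + q)" "p \<le> 2 * (p' + q')" "p' \<le> 2 * (a + b)" "q' \<le> 2 * (b + c)" "q \<le> 2 * (q' + q'')"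
      "q'' \<le> 2 * (c + d)" "0 \<le> a" "0 \<le> d" for n p q p' q' q'' a b c d :: real
    using that by argo
  ultimately show ?thesis
    unfolding s using norm_le_P_Q[of x] norm_ge_zero[of "P (P (P x))"] norm_ge_zero[of "Q (Q (Q x))"] by blast
qed

lemma norm_P_pow3: "norm (smoothing 0 x) \<le> norm x"
  using norm_damped_mean[of 1 1 x] norm_damped_mean[of 1 1 "P x"] norm_damped_mean[of 1 1 "P (P x)"]
  by (simp add: smoothing_def eval_nat_numeral)

lemma norm_smoothing_3: "norm (smoothing 3 x) \<le> 27 * norm x"
  using norm_Q[of x] norm_Q[of "Q x"] norm_Q[of "Q (Q x)"]
  by (simp add: smoothing_def eval_nat_numeral)

end

section \<open>Dissipation estimates for the correlations\<close>

text \<open>Bare vectors in place of solutions: the index counts x-derivatives, a prime marks the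
  time derivative, \<open>\<zeta>\<close> is the history, \<open>q\<close> its integral against the
  kernel and \<open>ds\<close> its transport term. At order 3 the stress \<open>a z + m q\<close> is
  differentiable only as a sum, and \<open>px\<close> is its derivative; \<open>y\<close> and
  \<open>\<theta>\<close> have one order more.\<close>

locale dissipation_chain = X: isometry_group TX
  for TX :: "real \<Rightarrow> 'x \<Rightarrow> 'x::{real_inner,banach}" +
  fixes J :: "'x \<Rightarrow> 'y::real_inner"
    and \<rho>1 \<rho>2 k a m \<delta> b0 \<kappa> :: real
    and v u z y \<theta> q v' u' z' y' :: "nat \<Rightarrow> 'x" and \<zeta> ds \<zeta>' :: "nat \<Rightarrow> 'y" and px :: 'x
  assumes pos: "0 < \<rho>1" "0 < \<rho>2" "0 < k" "0 < a" "0 < m" "0 < b0" "0 \<le> \<kappa>"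
    and inner_J: "inner (J x) (J w) = b0 * inner x w"
    and der: "i < 3 \<Longrightarrow> tder TX (v i) (v (Suc i))" "i < 3 \<Longrightarrow> tder TX (u i) (u (Suc i))"
      "i < 3 \<Longrightarrow> tder TX (z i) (z (Suc i))" "i \<le> 3 \<Longrightarrow> tder TX (y i) (y (Suc i))"
      "i \<le> 3 \<Longrightarrow> tder TX (\<theta> i) (\<theta> (Suc i))" "i < 3 \<Longrightarrow> tder TX (q i) (q (Suc i))"
      "tder TX (a *\<^sub>R z 3 + m *\<^sub>R q 3) px"
    and q: "i \<le> 3 \<Longrightarrow> inner (q i) w = inner (\<zeta> i) (J w)"
    and ds: "i \<le> 3 \<Longrightarrow> \<bar>inner (J w) (ds i)\<bar> \<le> \<kappa> * norm w * norm (\<zeta> i)"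
    and v': "i \<le> 2 \<Longrightarrow> v' i = u (Suc i) - y i" and u': "i \<le> 2 \<Longrightarrow> \<rho>1 *\<^sub>R u' i = k *\<^sub>R v (Suc i)"
    and z': "i \<le> 3 \<Longrightarrow> z' i = y (Suc i)"
    and y': "i \<le> 2 \<Longrightarrow> \<rho>2 *\<^sub>R y' i = a *\<^sub>R z (Suc i) + m *\<^sub>R q (Suc i) + k *\<^sub>R v i - \<delta> *\<^sub>R \<theta> (Suc i)"
      "\<rho>2 *\<^sub>R y' 3 = px + k *\<^sub>R v 3 - \<delta> *\<^sub>R \<theta> 4"
    and \<zeta>': "i \<le> 2 \<Longrightarrow> \<zeta>' i = J (y (Suc i)) - ds i"
begin

text \<open>\<open>R\<close> collects what the energies dissipate directly, the history and the
  derivatives of the temperature. The next four sums are recovered one from another, in the order y,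
  z, v, u. The range of orders shrinks along the way, since cross terms shift derivatives; only
  order 2 is left for all components.\<close>

definition "R = (norm (\<zeta> 0))\<^sup>2 + (norm (\<zeta> 1))\<^sup>2 + (norm (\<zeta> 2))\<^sup>2 + (norm (\<zeta> 3))\<^sup>2
  + (norm (\<theta> 1))\<^sup>2 + (norm (\<theta> 2))\<^sup>2 + (norm (\<theta> 3))\<^sup>2 + (norm (\<theta> 4))\<^sup>2"
definition "Ys = (norm (y 1))\<^sup>2 + (norm (y 2))\<^sup>2 + (norm (y 3))\<^sup>2"
definition "Zs = (norm (z 2))\<^sup>2 + (norm (z 3))\<^sup>2"
definition "Vs = (norm (v 1))\<^sup>2 + (norm (v 2))\<^sup>2"
definition "Us = (norm (u 2))\<^sup>2"

lemma le_3_cases: "i \<le> 3 \<Longrightarrow> i = 0 \<or> i = 1 \<or> i = 2 \<or> i = (3::nat)"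
  by auto

lemma \<zeta>_le_R: "i \<le> 3 \<Longrightarrow> (norm (\<zeta> i))\<^sup>2 \<le> R"
  by (drule le_3_cases) (auto simp: R_def)

lemma \<theta>_le_R: "i \<le> 3 \<Longrightarrow> (norm (\<theta> (Suc i)))\<^sup>2 \<le> 1 * R"
  by (drule le_3_cases) (auto simp: R_def eval_nat_numeral)

text \<open>\<open>q\<close> is the adjoint of \<open>J\<close> applied to \<open>\<zeta>\<close>,
  and \<open>J\<close> is an isometry up to the factor \<open>sqrt b0\<close>.\<close>

lemma q_le_R: "i \<le> 3 \<Longrightarrow> (norm (q i))\<^sup>2 \<le> b0 * R"
proof -
  assume i: "i \<le> 3"
  have "(norm (q i))\<^sup>2 = inner (\<zeta> i) (J (q i))"
    using q[OF i] by (simp add: power2_norm_eq_inner)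
  also have "\<dots> \<le> (b0 / 2) * (norm (\<zeta> i))\<^sup>2 + (norm (J (q i)))\<^sup>2 / (2 * b0)"
    using inner_young[of "b0 / 2" 1 "\<zeta> i" "J (q i)"] pos by simp
  also have "(norm (J (q i)))\<^sup>2 = b0 * (norm (q i))\<^sup>2"
    by (simp add: power2_norm_eq_inner inner_J)
  finally have "(norm (q i))\<^sup>2 \<le> b0 * (norm (\<zeta> i))\<^sup>2"
    using pos by simp
  also have "\<dots> \<le> b0 * R"
    using \<zeta>_le_R[OF i] pos by (intro mult_left_mono) auto
  finally show ?thesis .
qed

lemma q_young: "i \<le> 3 \<Longrightarrow> 0 < e \<Longrightarrow> c * inner x (q i) \<le> e * (norm x)\<^sup>2 + (c\<^sup>2 * b0 / (4 * e)) * R"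
  by (rule inner_young'[OF _ q_le_R])

lemma \<theta>_young: "i \<le> 3 \<Longrightarrow> 0 < e \<Longrightarrow> c * inner x (\<theta> (Suc i)) \<le> e * (norm x)\<^sup>2 + (c\<^sup>2 * 1 / (4 * e)) * R"
  by (rule inner_young'[OF _ \<theta>_le_R])

lemma ds_young:
  assumes "i \<le> 3" "0 < e" "0 \<le> c"
  shows "c * inner (J x) (ds i) \<le> e * (norm x)\<^sup>2 + ((c * \<kappa>)\<^sup>2 / (4 * e)) * R"
proof -
  have "c * inner (J x) (ds i) \<le> c * (\<kappa> * norm x * norm (\<zeta> i))"
    using ds[OF assms(1), of x] assms(3) by (intro mult_left_mono) auto
  also have "\<dots> = (c * \<kappa>) * inner (norm x) (norm (\<zeta> i))" by simp
  also have "\<dots> \<le> e * (norm (norm x))\<^sup>2 + ((c * \<kappa>)\<^sup>2 * 1 / (4 * e)) * R"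
    using \<zeta>_le_R[OF assms(1)] by (intro inner_young'[OF assms(2)]) simp
  finally show ?thesis by simp
qed

text \<open>Time derivatives, by the product rule, of the correlations of history with velocity
  \<open>y\<close>, of \<open>y\<close> with \<open>z\<close> (and \<open>u\<close> with
  \<open>z\<close>), of \<open>y\<close> with \<open>v\<close>, and of \<open>v\<close> with
  \<open>u\<close>. Signs are chosen so that each produces a negative square of the component to be
  recovered.\<close>

definition "dF1 i = - \<rho>2 * (inner (\<zeta>' i) (J (y (Suc i))) + inner (\<zeta> i) (J (y' (Suc i))))"
definition "dFz i = - \<rho>2 * (inner (y' i) (z (Suc i)) + inner (y i) (z' (Suc i)))
  - \<rho>1 * (inner (u' i) (z i) + inner (u i) (z' i))"
definition "dFv i = - \<rho>2 * (inner (y' i) (v i) + inner (y i) (v' i))"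
definition "dFu = - (inner (v' 1) (u 2) + inner (v 1) (u' 2))"

text \<open>The damping of \<open>y\<close> arises because the history is driven by \<open>J\<close>
  of the derivative of \<open>y\<close>, which pairs with itself to \<open>b0\<close> times a
  square. The vector \<open>p'\<close> stands for the derivative of the stress, so that the two
  lower orders and the top order, where it cannot be split, are treated at once.\<close>

lemma dF1_eq:
  assumes "i \<le> 2" "inner (q i) p' = - inner (q (Suc i)) (a *\<^sub>R z (Suc i) + m *\<^sub>R q (Suc i))"
    "\<rho>2 *\<^sub>R y' (Suc i) = p' + k *\<^sub>R v (Suc i) - \<delta> *\<^sub>R \<theta> (Suc (Suc i))"
  shows "dF1 i = - (\<rho>2 * b0) * (norm (y (Suc i)))\<^sup>2 + \<rho>2 * inner (J (y (Suc i))) (ds i)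
    + a * inner (z (Suc i)) (q (Suc i)) + m * (norm (q (Suc i)))\<^sup>2
    - k * inner (v (Suc i)) (q i) + \<delta> * inner (\<theta> (Suc (Suc i))) (q i)"
proof -
  have f1: "inner (\<zeta>' i) (J (y (Suc i))) = b0 * (norm (y (Suc i)))\<^sup>2 - inner (J (y (Suc i))) (ds i)"
    using assms(1) by (simp add: \<zeta>' inner_diff_left inner_diff_right inner_J power2_norm_eq_inner inner_commute)
  have f2: "\<rho>2 * inner (\<zeta> i) (J (y' (Suc i))) = inner (q i) (\<rho>2 *\<^sub>R y' (Suc i))"
    using assms(1) q[of i "y' (Suc i)"] by simp
  have f3: "inner (q i) (\<rho>2 *\<^sub>R y' (Suc i)) = - inner (q (Suc i)) (a *\<^sub>R z (Suc i) + m *\<^sub>R q (Suc i))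
      + k * inner (v (Suc i)) (q i) - \<delta> * inner (\<theta> (Suc (Suc i))) (q i)"
    unfolding assms(3) inner_diff_right inner_add_right assms(2)[unfolded inner_add_right]
    by (simp add: inner_commute)
  have "dF1 i = - \<rho>2 * inner (\<zeta>' i) (J (y (Suc i))) - \<rho>2 * inner (\<zeta> i) (J (y' (Suc i)))"
    by (simp add: dF1_def algebra_simps)
  then show ?thesis
    unfolding f1 f2 f3
    by (simp add: inner_add_right power2_norm_eq_inner inner_commute[of "q (Suc i)" "z (Suc i)"] algebra_simps)
qed

lemma skew_p:
  assumes "i \<le> 1"
  shows "inner (q i) (a *\<^sub>R z (Suc (Suc i)) + m *\<^sub>R q (Suc (Suc i))) = - inner (q (Suc i)) (a *\<^sub>R z (Suc i) + m *\<^sub>R q (Suc i))"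
proof -
  have "tder TX (a *\<^sub>R z (Suc i) + m *\<^sub>R q (Suc i)) (a *\<^sub>R z (Suc (Suc i)) + m *\<^sub>R q (Suc (Suc i)))"
    using assms by (intro X.tder_plus X.tder_scaleR der) auto
  then show ?thesis
    using X.tder_skew[OF der(6)[of i]] assms by fastforce
qed

lemma dF1_bound:
  assumes e: "0 < e"
  shows "dF1 0 + dF1 1 + dF1 2 \<le> - (\<rho>2 * b0 / 2) * Ys + e * Zs + e * Vs
    + 3 * ((\<rho>2 * \<kappa>)\<^sup>2 / (2 * (\<rho>2 * b0)) + a\<^sup>2 * b0 / (2 * e) + m * b0 + k\<^sup>2 * b0 / (2 * e) + 1 + \<delta>\<^sup>2 * b0 / 4) * R"
proof -
  define c1 where "c1 = (\<rho>2 * \<kappa>)\<^sup>2 / (2 * (\<rho>2 * b0))"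
  define c2 where "c2 = a\<^sup>2 * b0 / (2 * e)"
  define c3 where "c3 = m * b0"
  define c4 where "c4 = k\<^sup>2 * b0 / (2 * e)"
  define c5 where "c5 = \<delta>\<^sup>2 * b0 / 4"
  have y_ds: "\<rho>2 * inner (J (y (Suc i))) (ds i) \<le> (\<rho>2 * b0 / 2) * (norm (y (Suc i)))\<^sup>2 + c1 * R" if "i \<le> 3" for i
    using ds_young[OF that, of "\<rho>2 * b0 / 2" \<rho>2 "y (Suc i)"] pos by (simp add: c1_def)
  have zq: "a * inner x (q i) \<le> (e / 2) * (norm x)\<^sup>2 + c2 * R" "- a * inner x (q i) \<le> (e / 2) * (norm x)\<^sup>2 + c2 * R"
    if "i \<le> 3" for i x
    using q_young[OF that, of "e / 2" a x] q_young[OF that, of "e / 2" "- a" x] e by (simp_all add: c2_def)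
  have vq: "k * inner x (q i) \<le> (e / 2) * (norm x)\<^sup>2 + c4 * R" "- k * inner x (q i) \<le> (e / 2) * (norm x)\<^sup>2 + c4 * R"
    if "i \<le> 3" for i x
    using q_young[OF that, of "e / 2" k x] q_young[OF that, of "e / 2" "- k" x] e by (simp_all add: c4_def)
  have qq: "m * (norm (q i))\<^sup>2 \<le> c3 * R" if "i \<le> 3" for i
    using mult_left_mono[OF q_le_R[OF that], of m] pos by (simp add: c3_def mult.assoc)
  have tq: "\<delta> * inner (\<theta> (Suc (Suc i))) (q i) \<le> R + c5 * R" if "i \<le> 2" for i
    using q_young[of i 1 \<delta> "\<theta> (Suc (Suc i))"] \<theta>_le_R[of "Suc i"] that by (simp add: c5_def)
  \<comment> \<open>One derivative is moved across, because \<open>z 1\<close> does not occur in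
    \<open>Zs\<close> and \<open>v 3\<close> does not occur in \<open>Vs\<close>.\<close>
  have s: "inner (z 1) (q 1) = - inner (z 2) (q 0)" "inner (v 3) (q 2) = - inner (v 2) (q 3)"
    using X.tder_skew[OF der(3)[of 1] der(6)[of 0]] X.tder_skew[OF der(1)[of 2] der(6)[of 2]]
    by (simp_all add: eval_nat_numeral)
  have n: "Suc 0 = 1" "Suc 1 = 2" "Suc 2 = 3" "Suc 3 = 4" by simp_all
  have e0: "dF1 0 = - (\<rho>2 * b0) * (norm (y 1))\<^sup>2 + \<rho>2 * inner (J (y 1)) (ds 0)
    + a * inner (z 1) (q 1) + m * (norm (q 1))\<^sup>2 - k * inner (v 1) (q 0) + \<delta> * inner (\<theta> 2) (q 0)"
    using dF1_eq[of 0, OF _ skew_p[of 0]] y'(1)[of 1] unfolding n by simp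
  have e1: "dF1 1 = - (\<rho>2 * b0) * (norm (y 2))\<^sup>2 + \<rho>2 * inner (J (y 2)) (ds 1)
    + a * inner (z 2) (q 2) + m * (norm (q 2))\<^sup>2 - k * inner (v 2) (q 1) + \<delta> * inner (\<theta> 3) (q 1)"
    using dF1_eq[of 1, OF _ skew_p[of 1]] y'(1)[of 2] unfolding n by simp
  have "inner (q 2) px = - inner (q 3) (a *\<^sub>R z 3 + m *\<^sub>R q 3)"
    using X.tder_skew[OF der(6)[of 2] der(7)] by (simp add: eval_nat_numeral)
  then have e2: "dF1 2 = - (\<rho>2 * b0) * (norm (y 3))\<^sup>2 + \<rho>2 * inner (J (y 3)) (ds 2)
    + a * inner (z 3) (q 3) + m * (norm (q 3))\<^sup>2 - k * inner (v 3) (q 2) + \<delta> * inner (\<theta> 4) (q 2)"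
    using dF1_eq[of 2 px] y'(2) unfolding n by simp
  have b0: "dF1 0 \<le> - (\<rho>2 * b0 / 2) * (norm (y 1))\<^sup>2 + (e / 2) * (norm (z 2))\<^sup>2 + (e / 2) * (norm (v 1))\<^sup>2
      + (c1 + c2 + c3 + c4 + 1 + c5) * R"
    unfolding e0 s using y_ds[of 0] zq(2)[of 0 "z 2"] vq(2)[of 0 "v 1"] qq[of 1] tq[of 0] unfolding n
    by (simp add: algebra_simps)
  have b1: "dF1 1 \<le> - (\<rho>2 * b0 / 2) * (norm (y 2))\<^sup>2 + (e / 2) * (norm (z 2))\<^sup>2 + (e / 2) * (norm (v 2))\<^sup>2
      + (c1 + c2 + c3 + c4 + 1 + c5) * R"
    unfolding e1 using y_ds[of 1] zq(1)[of 2 "z 2"] vq(2)[of 1 "v 2"] qq[of 2] tq[of 1] unfolding n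
    by (simp add: algebra_simps)
  have b2: "dF1 2 \<le> - (\<rho>2 * b0 / 2) * (norm (y 3))\<^sup>2 + (e / 2) * (norm (z 3))\<^sup>2 + (e / 2) * (norm (v 2))\<^sup>2
      + (c1 + c2 + c3 + c4 + 1 + c5) * R"
    unfolding e2 s using y_ds[of 2] zq(1)[of 3 "z 3"] vq(1)[of 3 "v 2"] qq[of 3] tq[of 2] unfolding n
    by (simp add: algebra_simps)
  have "dF1 0 + dF1 1 + dF1 2 \<le> - (\<rho>2 * b0 / 2) * Ys + e * Zs + e * Vs + 3 * (c1 + c2 + c3 + c4 + 1 + c5) * R
      - (e / 2) * (norm (z 3))\<^sup>2 - (e / 2) * (norm (v 1))\<^sup>2"
    using add_mono[OF add_mono[OF b0 b1] b2]
    unfolding Ys_def Zs_def Vs_def by (simp add: algebra_simps)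
  moreover have "0 \<le> (e / 2) * (norm (z 3))\<^sup>2" "0 \<le> (e / 2) * (norm (v 1))\<^sup>2" using e by simp_all
  ultimately have "dF1 0 + dF1 1 + dF1 2 \<le> - (\<rho>2 * b0 / 2) * Ys + e * Zs + e * Vs + 3 * (c1 + c2 + c3 + c4 + 1 + c5) * R"
    by linarith
  then show ?thesis
    unfolding c1_def c2_def c3_def c4_def c5_def .
qed

text \<open>The correlation of \<open>u\<close> with \<open>z\<close> is included for one purpose:
  it cancels \<open>k * inner (v i) (z (Suc i))\<close>, which would make the estimate for
  \<open>z\<close> depend on \<open>v\<close>, a component recovered only after
  \<open>z\<close>.\<close>

lemma dFz_eq:
  assumes "1 \<le> i" "i \<le> 2"
  shows "dFz i = - a * (norm (z (Suc i)))\<^sup>2 - m * inner (z (Suc i)) (q (Suc i)) + \<delta> * inner (z (Suc i)) (\<theta> (Suc i))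
    + \<rho>2 * (norm (y (Suc i)))\<^sup>2 - \<rho>1 * inner (u i) (y (Suc i))"
proof -
  have "\<rho>2 * inner (y' i) (z (Suc i)) = inner (\<rho>2 *\<^sub>R y' i) (z (Suc i))" by simp
  then have 1: "\<rho>2 * inner (y' i) (z (Suc i)) = a * (norm (z (Suc i)))\<^sup>2 + m * inner (z (Suc i)) (q (Suc i))
      + k * inner (v i) (z (Suc i)) - \<delta> * inner (z (Suc i)) (\<theta> (Suc i))"
    unfolding y'(1)[OF assms(2)]
    by (simp add: inner_diff_left inner_add_left power2_norm_eq_inner inner_commute[of "q (Suc i)"] inner_commute[of "\<theta> (Suc i)"])
  have "\<rho>1 * inner (u' i) (z i) = inner (\<rho>1 *\<^sub>R u' i) (z i)" by simp
  then have 2: "\<rho>1 * inner (u' i) (z i) = - k * inner (v i) (z (Suc i))"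
    unfolding u'[OF assms(2)] using X.tder_skew[OF der(1)[of i] der(3)[of i]] assms by simp
  have 3: "inner (y i) (z' (Suc i)) = - (norm (y (Suc i)))\<^sup>2"
    using X.tder_skew[OF der(4)[of i] der(4)[of "Suc i"]] assms
    by (simp add: z' power2_norm_eq_inner)
  have "dFz i = - (\<rho>2 * inner (y' i) (z (Suc i))) - \<rho>2 * inner (y i) (z' (Suc i))
      - \<rho>1 * inner (u' i) (z i) - \<rho>1 * inner (u i) (z' i)"
    by (simp add: dFz_def algebra_simps)
  then show ?thesis
    unfolding 1 2 3 using assms by (simp add: z' algebra_simps)
qed

lemma dFz_bound:
  assumes e: "0 < e"
  shows "dFz 1 + dFz 2 \<le> - (a / 2) * Zs + e * Us + (\<rho>2 + \<rho>1\<^sup>2 / (2 * e)) * Ys + 2 * (m\<^sup>2 * b0 + \<delta>\<^sup>2) / a * R"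
proof -
  define c1 where "c1 = m\<^sup>2 * b0 / a"
  define c2 where "c2 = \<delta>\<^sup>2 / a"
  define c3 where "c3 = \<rho>1\<^sup>2 / (2 * e)"
  have zq: "- m * inner x (q i) \<le> (a / 4) * (norm x)\<^sup>2 + c1 * R" if "i \<le> 3" for i x
    using q_young[OF that, of "a / 4" "- m" x] pos by (simp add: c1_def)
  have zt: "\<delta> * inner x (\<theta> (Suc i)) \<le> (a / 4) * (norm x)\<^sup>2 + c2 * R" if "i \<le> 3" for i x
    using \<theta>_young[OF that, of "a / 4" \<delta> x] pos by (simp add: c2_def)
  have uy: "\<rho>1 * inner x w \<le> (e / 2) * (norm x)\<^sup>2 + c3 * (norm w)\<^sup>2" "- \<rho>1 * inner x w \<le> (e / 2) * (norm x)\<^sup>2 + c3 * (norm w)\<^sup>2" for x w :: 'x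
    using inner_young[of "e / 2" \<rho>1 x w] inner_young[of "e / 2" "- \<rho>1" x w] e by (simp_all add: c3_def)
  \<comment> \<open>Among the orders of \<open>u\<close>, only \<open>u 2\<close> is in
    \<open>Us\<close>; the derivative therefore goes to \<open>u\<close>.\<close>
  have s: "inner (u 1) (y 2) = - inner (u 2) (y 1)"
    using X.tder_skew[OF der(2)[of 1] der(4)[of 1]] by (simp add: eval_nat_numeral)
  have n: "Suc 0 = 1" "Suc 1 = 2" "Suc 2 = 3" "Suc 3 = 4" by simp_all
  have e1: "dFz 1 = - a * (norm (z 2))\<^sup>2 - m * inner (z 2) (q 2) + \<delta> * inner (z 2) (\<theta> 2)
    + \<rho>2 * (norm (y 2))\<^sup>2 + \<rho>1 * inner (u 2) (y 1)"
    using dFz_eq[of 1] s unfolding n by simp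
  have e2: "dFz 2 = - a * (norm (z 3))\<^sup>2 - m * inner (z 3) (q 3) + \<delta> * inner (z 3) (\<theta> 3)
    + \<rho>2 * (norm (y 3))\<^sup>2 - \<rho>1 * inner (u 2) (y 3)"
    using dFz_eq[of 2] unfolding n by simp
  have b1: "dFz 1 \<le> - (a / 2) * (norm (z 2))\<^sup>2 + \<rho>2 * (norm (y 2))\<^sup>2 + (e / 2) * (norm (u 2))\<^sup>2 + c3 * (norm (y 1))\<^sup>2 + (c1 + c2) * R"
    unfolding e1 using zq[of 2 "z 2"] zt[of 1 "z 2"] uy(1)[of "u 2" "y 1"] unfolding n
    by (simp add: algebra_simps)
  have b2: "dFz 2 \<le> - (a / 2) * (norm (z 3))\<^sup>2 + \<rho>2 * (norm (y 3))\<^sup>2 + (e / 2) * (norm (u 2))\<^sup>2 + c3 * (norm (y 3))\<^sup>2 + (c1 + c2) * R"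
    unfolding e2 using zq[of 3 "z 3"] zt[of 2 "z 3"] uy(2)[of "u 2" "y 3"] unfolding n
    by (simp add: algebra_simps)
  have c3: "0 \<le> c3 * (norm (y 2))\<^sup>2" "0 \<le> \<rho>2 * (norm (y 1))\<^sup>2"
    using e pos by (auto simp: c3_def)
  have "dFz 1 + dFz 2 \<le> - (a / 2) * Zs + e * Us + (\<rho>2 + c3) * Ys + 2 * (c1 + c2) * R"
    using add_mono[OF b1 b2] c3
    unfolding Ys_def Zs_def Us_def by (simp add: algebra_simps)
  moreover have "2 * (c1 + c2) = 2 * (m\<^sup>2 * b0 + \<delta>\<^sup>2) / a"
    by (simp add: c1_def c2_def add_divide_distrib)
  ultimately show ?thesis
    unfolding c3_def by simp
qed

lemma dFv_eq:
  assumes "1 \<le> i" "i \<le> 2"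
  shows "dFv i = - k * (norm (v i))\<^sup>2 - a * inner (v i) (z (Suc i)) - m * inner (v i) (q (Suc i))
    + \<delta> * inner (v i) (\<theta> (Suc i)) - \<rho>2 * inner (u (Suc i)) (y i) + \<rho>2 * (norm (y i))\<^sup>2"
proof -
  have "\<rho>2 * inner (y' i) (v i) = inner (\<rho>2 *\<^sub>R y' i) (v i)" by simp
  then have 1: "\<rho>2 * inner (y' i) (v i) = a * inner (v i) (z (Suc i)) + m * inner (v i) (q (Suc i))
      + k * (norm (v i))\<^sup>2 - \<delta> * inner (v i) (\<theta> (Suc i))"
    unfolding y'(1)[OF assms(2)]
    by (simp add: inner_diff_left inner_add_left power2_norm_eq_inner inner_commute[of "q (Suc i)"]
        inner_commute[of "\<theta> (Suc i)"] inner_commute[of "z (Suc i)"])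
  have "dFv i = - (\<rho>2 * inner (y' i) (v i)) - \<rho>2 * inner (y i) (v' i)"
    by (simp add: dFv_def algebra_simps)
  then show ?thesis
    unfolding 1 using assms
    by (simp add: v' inner_diff_right power2_norm_eq_inner inner_commute[of "u (Suc i)"] algebra_simps)
qed

lemma dFv_bound:
  assumes e: "0 < e"
  shows "dFv 1 + dFv 2 \<le> - (k / 2) * Vs + e * Us + 3 * a\<^sup>2 / (2 * k) * Zs + (\<rho>2 + \<rho>2\<^sup>2 / (2 * e)) * Ys
    + 3 * (m\<^sup>2 * b0 + \<delta>\<^sup>2) / k * R"
proof -
  define c0 where "c0 = 3 * a\<^sup>2 / (2 * k)"
  define c1 where "c1 = 3 * (m\<^sup>2 * b0) / (2 * k)"
  define c2 where "c2 = 3 * \<delta>\<^sup>2 / (2 * k)"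
  define c3 where "c3 = \<rho>2\<^sup>2 / (2 * e)"
  have vz: "- a * inner x w \<le> (k / 6) * (norm x)\<^sup>2 + c0 * (norm w)\<^sup>2" for x w :: 'x
    using inner_young[of "k / 6" "- a" x w] pos by (simp add: c0_def field_simps)
  have vq: "- m * inner x (q i) \<le> (k / 6) * (norm x)\<^sup>2 + c1 * R" if "i \<le> 3" for i x
    using q_young[OF that, of "k / 6" "- m" x] pos by (simp add: c1_def field_simps)
  have vt: "\<delta> * inner x (\<theta> (Suc i)) \<le> (k / 6) * (norm x)\<^sup>2 + c2 * R" if "i \<le> 3" for i x
    using \<theta>_young[OF that, of "k / 6" \<delta> x] pos by (simp add: c2_def field_simps)
  have uy: "\<rho>2 * inner x w \<le> (e / 2) * (norm x)\<^sup>2 + c3 * (norm w)\<^sup>2" "- \<rho>2 * inner x w \<le> (e / 2) * (norm x)\<^sup>2 + c3 * (norm w)\<^sup>2" for x w :: 'x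
    using inner_young[of "e / 2" \<rho>2 x w] inner_young[of "e / 2" "- \<rho>2" x w] e by (simp_all add: c3_def)
  have s: "inner (u 3) (y 2) = - inner (u 2) (y 3)"
    using X.tder_skew[OF der(2)[of 2] der(4)[of 2]] by (simp add: eval_nat_numeral)
  have n: "Suc 0 = 1" "Suc 1 = 2" "Suc 2 = 3" "Suc 3 = 4" by simp_all
  have e1: "dFv 1 = - k * (norm (v 1))\<^sup>2 - a * inner (v 1) (z 2) - m * inner (v 1) (q 2)
    + \<delta> * inner (v 1) (\<theta> 2) - \<rho>2 * inner (u 2) (y 1) + \<rho>2 * (norm (y 1))\<^sup>2"
    using dFv_eq[of 1] unfolding n by simp
  have e2: "dFv 2 = - k * (norm (v 2))\<^sup>2 - a * inner (v 2) (z 3) - m * inner (v 2) (q 3)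
    + \<delta> * inner (v 2) (\<theta> 3) + \<rho>2 * inner (u 2) (y 3) + \<rho>2 * (norm (y 2))\<^sup>2"
    using dFv_eq[of 2] s unfolding n by simp
  have b1: "dFv 1 \<le> - (k / 2) * (norm (v 1))\<^sup>2 + c0 * (norm (z 2))\<^sup>2 + (e / 2) * (norm (u 2))\<^sup>2 + (\<rho>2 + c3) * (norm (y 1))\<^sup>2 + (c1 + c2) * R"
    unfolding e1 using vz[of "v 1" "z 2"] vq[of 2 "v 1"] vt[of 1 "v 1"] uy(2)[of "u 2" "y 1"] unfolding n
    by (simp add: algebra_simps)
  have b2: "dFv 2 \<le> - (k / 2) * (norm (v 2))\<^sup>2 + c0 * (norm (z 3))\<^sup>2 + (e / 2) * (norm (u 2))\<^sup>2 + c3 * (norm (y 3))\<^sup>2 + \<rho>2 * (norm (y 2))\<^sup>2 + (c1 + c2) * R"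
    unfolding e2 using vz[of "v 2" "z 3"] vq[of 3 "v 2"] vt[of 2 "v 2"] uy(1)[of "u 2" "y 3"] unfolding n
    by (simp add: algebra_simps)
  have c3: "0 \<le> c3 * (norm (y 2))\<^sup>2" "0 \<le> \<rho>2 * (norm (y 3))\<^sup>2"
    using e pos by (auto simp: c3_def)
  have "dFv 1 + dFv 2 \<le> - (k / 2) * Vs + e * Us + c0 * Zs + (\<rho>2 + c3) * Ys + 2 * (c1 + c2) * R"
    using add_mono[OF b1 b2] c3
    unfolding Ys_def Zs_def Us_def Vs_def by (simp add: algebra_simps)
  moreover have "2 * (c1 + c2) = 3 * (m\<^sup>2 * b0 + \<delta>\<^sup>2) / k"
    using pos by (simp add: c1_def c2_def field_simps)
  ultimately show ?thesis
    unfolding c3_def c0_def by simp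
qed

text \<open>\<open>v' 1\<close> contains \<open>u 2\<close>, which supplies the square;
  \<open>v 1\<close> against \<open>v 3\<close> becomes minus the square of \<open>v 2\<close> by
  skewness and is paid for by \<open>Vs\<close>.\<close>

lemma dFu_bound: "dFu \<le> - (1 / 2) * Us + (1 / 2) * Ys + k / \<rho>1 * Vs"
proof -
  have n: "Suc 0 = 1" "Suc 1 = 2" "Suc 2 = 3" by simp_all
  have u2: "u' 2 = (k / \<rho>1) *\<^sub>R v 3"
  proof -
    have "(1 / \<rho>1) *\<^sub>R (\<rho>1 *\<^sub>R u' 2) = (1 / \<rho>1) *\<^sub>R (k *\<^sub>R v 3)"
      using u'[of 2] unfolding n by simp
    then show ?thesis using pos by simp
  qed
  define c where "c = k / \<rho>1"
  have "0 \<le> c" using pos by (simp add: c_def)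
  have "inner (v 1) (u' 2) = - c * (norm (v 2))\<^sup>2"
    using X.tder_skew[OF der(1)[of 1] der(1)[of 2]] unfolding u2 n c_def by (simp add: power2_norm_eq_inner)
  moreover have "inner (v' 1) (u 2) = (norm (u 2))\<^sup>2 - inner (u 2) (y 1)"
    using v'[of 1] unfolding n by (simp add: inner_diff_left power2_norm_eq_inner inner_commute[of "y (Suc 0)" "u 2"])
  ultimately have "dFu = - (norm (u 2))\<^sup>2 + inner (u 2) (y 1) + c * (norm (v 2))\<^sup>2"
    by (simp add: dFu_def)
  moreover have "inner (u 2) (y 1) \<le> (1 / 2) * (norm (u 2))\<^sup>2 + (1 / 2) * (norm (y 1))\<^sup>2"
    using inner_young[of "1 / 2" 1 "u 2" "y 1"] by simp
  moreover have "c * Vs = c * (norm (v 1))\<^sup>2 + c * (norm (v 2))\<^sup>2"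
    by (simp add: Vs_def distrib_left)
  moreover have "0 \<le> c * (norm (v 1))\<^sup>2" using \<open>0 \<le> c\<close> by simp
  ultimately show ?thesis
    unfolding Us_def Ys_def c_def[symmetric] using zero_le_power2[of "norm (y 2)"] zero_le_power2[of "norm (y 3)"] by argo
qed

end

section \<open>The system in an abstract Hilbert space\<close>

text \<open>The weights are fixed against the order of recovery: \<open>nv\<close> outweighs the
  \<open>V\<close> left by \<open>du\<close>, then \<open>nz\<close> the \<open>Z\<close> left by
  \<open>dv\<close>, then \<open>n1\<close> the \<open>Y\<close> left by all three, and finally
  \<open>n0\<close> every multiple of \<open>R\<close>. Each small parameter is chosen after its
  weight, so the harm done to components settled before is a fixed fraction. This is why the
  coefficients of \<open>Y\<close> and \<open>R\<close> may depend on \<open>e\<close>.\<close>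

lemma lyapunov_weights:
  fixes A k a \<kappa> d zv rz rv :: real and c1 yz yv :: "real \<Rightarrow> real"
  assumes pos: "0 < A" "0 < k" "0 < a" "0 \<le> \<kappa>" "0 < d" "0 \<le> zv"
    and y: "\<And>e. 0 < e \<Longrightarrow> 0 \<le> yz e" "\<And>e. 0 < e \<Longrightarrow> 0 \<le> yv e"
  shows "\<exists>n1>0. \<exists>nz>0. \<exists>nv>0. \<exists>c>0. \<exists>N>0. \<forall>n0\<ge>N. \<forall>U V Z Y R dE d1 dz dv du.
    0 \<le> U \<and> 0 \<le> V \<and> 0 \<le> Z \<and> 0 \<le> Y \<and> 0 \<le> R \<and>
    (\<forall>e>0. d1 \<le> - A * Y + e * Z + e * V + c1 e * R) \<and>
    (\<forall>e>0. dz \<le> - (a / 2) * Z + e * U + yz e * Y + rz * R) \<and>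
    (\<forall>e>0. dv \<le> - (k / 2) * V + e * U + zv * Z + yv e * Y + rv * R) \<and>
    du \<le> - (1 / 2) * U + (1 / 2) * Y + \<kappa> * V \<and> dE \<le> - d * R
    \<longrightarrow> n0 * dE + n1 * d1 + nz * dz + nv * dv + du \<le> - c * (U + V + Z + Y + R)"
proof -
  define nv where "nv = (\<kappa> + 1) * 2 / k"
  define ev where "ev = 1 / (8 * nv)"
  define nz where "nz = (nv * zv + 1) * 2 / a"
  define ez where "ez = 1 / (8 * nz)"
  define n1 where "n1 = (nv * yv ev + nz * yz ez + 3 / 2) / A"
  define e1 where "e1 = 1 / (2 * n1)"
  define N where "N = (\<bar>n1 * c1 e1 + nz * rz + nv * rv\<bar> + 1) / d"
  have nv: "0 < nv" "0 < ev" using pos by (auto simp: nv_def ev_def)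
  have nz: "0 < nz" "0 < ez" using pos nv by (auto simp: nz_def ez_def intro!: divide_pos_pos mult_pos_pos add_nonneg_pos)
  have "0 < nv * yv ev + nz * yz ez + 3 / 2"
    using nv nz y by (intro add_nonneg_pos add_nonneg_nonneg mult_nonneg_nonneg) auto
  then have n1: "0 < n1" "0 < e1" using pos by (auto simp: n1_def e1_def)
  have N: "0 < N" using pos by (auto simp: N_def)
  \<comment> \<open>The remaining coefficients are 1/2 - 1/8 - 1/8 for \<open>U\<close>, 1 - 1/2 for
    \<open>V\<close> and \<open>Z\<close>, 3/2 - 1/2 for \<open>Y\<close> and 1 for
    \<open>R\<close>; the least of them is 1/4.\<close>
  have "n0 * dE + n1 * d1 + nz * dz + nv * dv + du \<le> - (1 / 4) * (U + V + Z + Y + R)"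
    if n0: "N \<le> n0" and nn: "0 \<le> U" "0 \<le> V" "0 \<le> Z" "0 \<le> Y" "0 \<le> R"
      and h1: "\<forall>e>0. d1 \<le> - A * Y + e * Z + e * V + c1 e * R"
      and hz: "\<forall>e>0. dz \<le> - (a / 2) * Z + e * U + yz e * Y + rz * R"
      and hv: "\<forall>e>0. dv \<le> - (k / 2) * V + e * U + zv * Z + yv e * Y + rv * R"
      and hu: "du \<le> - (1 / 2) * U + (1 / 2) * Y + \<kappa> * V" and hE: "dE \<le> - d * R"
    for n0 U V Z Y R dE d1 dz dv du
  proof -
    have "n1 * d1 \<le> n1 * (- A * Y + e1 * Z + e1 * V + c1 e1 * R)"
      using h1 n1 by (intro mult_left_mono) auto
    also have "\<dots> = - (nv * yv ev) * Y - (nz * yz ez) * Y - (3 / 2) * Y + (1 / 2) * Z + (1 / 2) * V + n1 * c1 e1 * R"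
    proof -
      have eqs: "n1 * A = nv * yv ev + nz * yz ez + 3 / 2" "n1 * e1 = 1 / 2"
        using pos n1 by (auto simp: n1_def e1_def)
      have eq: "n1 * (- A * Y + e1 * Z + e1 * V + c1 e1 * R)
        = - (n1 * A) * Y + (n1 * e1) * Z + (n1 * e1) * V + n1 * c1 e1 * R" by (simp add: algebra_simps)
      show ?thesis unfolding eq eqs by (simp add: algebra_simps)
    qed
    finally have b1: "n1 * d1 \<le> \<dots>" .
    have "nz * dz \<le> nz * (- (a / 2) * Z + ez * U + yz ez * Y + rz * R)"
      using hz nz by (intro mult_left_mono) auto
    also have "\<dots> = - (nv * zv) * Z - Z + (1 / 8) * U + (nz * yz ez) * Y + nz * rz * R"
    proof -
      have eqs: "nz * (a / 2) = nv * zv + 1" "nz * ez = 1 / 8"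
        using pos nz by (auto simp: nz_def ez_def)
      have eq: "nz * (- (a / 2) * Z + ez * U + yz ez * Y + rz * R)
        = - (nz * (a / 2)) * Z + (nz * ez) * U + (nz * yz ez) * Y + nz * rz * R" by (simp add: algebra_simps)
      show ?thesis unfolding eq eqs by (simp add: algebra_simps)
    qed
    finally have bz: "nz * dz \<le> - (nv * zv) * Z - Z + (1 / 8) * U + (nz * yz ez) * Y + nz * rz * R" .
    have "nv * dv \<le> nv * (- (k / 2) * V + ev * U + zv * Z + yv ev * Y + rv * R)"
      using hv nv by (intro mult_left_mono) auto
    also have "\<dots> = - \<kappa> * V - V + (1 / 8) * U + (nv * zv) * Z + (nv * yv ev) * Y + nv * rv * R"
    proof -
      have eqs: "nv * (k / 2) = \<kappa> + 1" "nv * ev = 1 / 8"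
        using pos nv by (auto simp: nv_def ev_def)
      have eq: "nv * (- (k / 2) * V + ev * U + zv * Z + yv ev * Y + rv * R)
        = - (nv * (k / 2)) * V + (nv * ev) * U + (nv * zv) * Z + (nv * yv ev) * Y + nv * rv * R" by (simp add: algebra_simps)
      show ?thesis unfolding eq eqs by (simp add: algebra_simps)
    qed
    finally have bv: "nv * dv \<le> - \<kappa> * V - V + (1 / 8) * U + (nv * zv) * Z + (nv * yv ev) * Y + nv * rv * R" .
    have "n0 * dE \<le> n0 * (- d * R)" using hE n0 N by (intro mult_left_mono) auto
    also have "\<dots> \<le> N * (- d * R)" using n0 nn pos by (intro mult_right_mono_neg) auto
    also have "\<dots> = - \<bar>n1 * c1 e1 + nz * rz + nv * rv\<bar> * R - R"
      using pos by (simp add: N_def field_simps)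
    also have "\<dots> \<le> - (n1 * c1 e1 + nz * rz + nv * rv) * R - R"
      using mult_right_mono[OF abs_ge_self nn(5), of "n1 * c1 e1 + nz * rz + nv * rv"]
      by (simp only: mult_minus_left)
    finally have bE: "n0 * dE \<le> - (n1 * c1 e1) * R - (nz * rz) * R - (nv * rv) * R - R"
      by (simp add: algebra_simps)
    have b1': "n1 * d1 \<le> - (nv * yv ev) * Y - (nz * yz ez) * Y - (3 / 2) * Y + (1 / 2) * Z + (1 / 2) * V + n1 * c1 e1 * R"
      using b1 by simp
    show ?thesis
      using b1' bz bv bE hu nn by argo
  qed
  note main = this
  have "0 < (1 / 4 :: real)" by simp
  show ?thesis
    by (rule exI[of _ n1], rule conjI[OF n1(1)], rule exI[of _ nz], rule conjI[OF nz(1)],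
        rule exI[of _ nv], rule conjI[OF nv(1)], rule exI[of _ "1 / 4"], rule conjI[OF \<open>0 < 1 / 4\<close>],
        rule exI[of _ N], rule conjI[OF N], intro allI impI, elim conjE, rule main; assumption)
qed

lemma nonincreasing_if_derivative:
  fixes f :: "real \<Rightarrow> real"
  assumes d: "\<And>t. 0 \<le> t \<Longrightarrow> (f has_real_derivative f' t) (at t within {0..})"
    and le: "\<And>t. 0 \<le> t \<Longrightarrow> f' t \<le> 0" and t: "0 \<le> t"
  shows "f t \<le> f 0"
proof (rule DERIV_nonpos_imp_decreasing_open[of 0 t f])
  show "\<exists>y. (f has_real_derivative y) (at x) \<and> y \<le> 0" if "0 < x" "x < t" for x
    using d[of x] le[of x] that by (auto simp: at_within_interior[of x "{0..}"])
  show "continuous_on {0..t} f"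
    by (rule DERIV_continuous_on[of "{0..t}" f f'], rule DERIV_subset[OF d]) auto
qed (rule t)

lemma inner_has_derivative:
  assumes "(f has_vector_derivative f') (at t within S)" "(g has_vector_derivative g') (at t within S)"
  shows "((\<lambda>t. inner (f t) (g t)) has_real_derivative inner f' (g t) + inner (f t) g') (at t within S)"
  using bounded_bilinear.has_vector_derivative[OF bounded_bilinear_inner assms]
  by (simp add: has_real_derivative_iff_has_vector_derivative add.commute)

lemma damped_mean_prod:
  assumes "isometry_group T" "isometry_group T'"
  shows "damped_mean (prod_group T T') c r p = (damped_mean T c r (fst p), damped_mean T' c r (snd p))"
proof -
  interpret T: isometry_group "prod_group T T'" using assms by (rule isometry_group_prod)
  have "integral {0..r} (fst \<circ> (\<lambda>s. exp (- (c * s)) *\<^sub>R prod_group T T' s p)) = fst (damped_mean (prod_group T T') c r p)"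
    "integral {0..r} (snd \<circ> (\<lambda>s. exp (- (c * s)) *\<^sub>R prod_group T T' s p)) = snd (damped_mean (prod_group T T') c r p)"
    unfolding damped_mean_def
    by (rule integral_linear[OF T.integrable_damped bounded_linear_fst], rule integral_linear[OF T.integrable_damped bounded_linear_snd])
  then show ?thesis
    by (simp add: damped_mean_def o_def prod_group_def prod_eq_iff)
qed

section \<open>The evolution equation on the product space\<close>

abbreviation "pv w \<equiv> fst w"
abbreviation "pu w \<equiv> fst (snd w)"
abbreviation "pz w \<equiv> fst (snd (snd w))"
abbreviation "py w \<equiv> fst (snd (snd (snd w)))"
abbreviation "p\<theta> w \<equiv> fst (snd (snd (snd (snd w))))"
abbreviation "p\<zeta> w \<equiv> snd (snd (snd (snd (snd w))))"

text \<open>Two Hilbert spaces with translations: functions of x, and weighted histories.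
  \<open>J\<close> multiplies a function of x by the square root of the kernel, and
  \<open>b0\<close> is the integral of the kernel. All that the equations need to know about the
  kernel sits in the conditions on the test pairs \<Psi>: coercivity gives the damping,
  \<open>\<Psi>_J\<close> lets the transport term enter a correlation, and
  \<open>\<Psi>_zero\<close> gives uniqueness.\<close>

locale history_system = X: isometry_group TX + Y: isometry_group TY
  for TX :: "real \<Rightarrow> 'x \<Rightarrow> 'x::{real_inner,banach}"
    and TY :: "real \<Rightarrow> 'y \<Rightarrow> 'y::{real_inner,banach}" +
  fixes J :: "'x \<Rightarrow> 'y" and \<Psi> :: "('y \<times> 'y) set"
    and \<rho>1 \<rho>2 \<rho>3 k a m \<delta> \<beta> b0 k2 \<kappa> :: real
  assumes pos: "0 < \<rho>1" "0 < \<rho>2" "0 < \<rho>3" "0 < k" "0 < a" "0 < m" "0 < \<beta>" "0 < b0" "0 < k2" "0 \<le> \<kappa>"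
    and linear_J: "bounded_linear J" and inner_J: "inner (J x) (J y) = b0 * inner x y"
    and J_T: "J (TX s x) = TY s (J x)"
    and \<Psi>_T: "(\<psi>1, \<psi>2) \<in> \<Psi> \<Longrightarrow> (TY s \<psi>1, TY s \<psi>2) \<in> \<Psi>"
    and \<Psi>_coercive: "(\<And>\<psi>1 \<psi>2. (\<psi>1, \<psi>2) \<in> \<Psi> \<Longrightarrow> inner \<zeta> \<psi>1 = inner \<zeta>' \<psi>2) \<Longrightarrow> k2 / 2 * (norm \<zeta>)\<^sup>2 \<le> inner \<zeta> \<zeta>'"
    and \<Psi>_J: "(\<And>\<psi>1 \<psi>2. (\<psi>1, \<psi>2) \<in> \<Psi> \<Longrightarrow> inner \<zeta> \<psi>1 = inner \<zeta>' \<psi>2) \<Longrightarrow> \<bar>inner (J x) \<zeta>'\<bar> \<le> \<kappa> * norm x * norm \<zeta>"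
    and \<Psi>_zero: "(\<And>\<psi>1 \<psi>2. (\<psi>1, \<psi>2) \<in> \<Psi> \<Longrightarrow> inner \<zeta>' \<psi>2 = 0) \<Longrightarrow> \<zeta>' = 0"
begin

text \<open>\<open>transport \<zeta> \<zeta>'\<close> is a weak form of \<open>\<zeta>' = \<surd>g \<partial>\<^sub>\<sigma>(\<zeta> / \<surd>g)\<close>; as an intersection of kernels it is visibly stable under averaging.\<close>

definition transport :: "'y \<Rightarrow> 'y \<Rightarrow> bool" where
  "transport \<zeta> \<zeta>' \<longleftrightarrow> (\<forall>\<psi>1 \<psi>2. (\<psi>1, \<psi>2) \<in> \<Psi> \<longrightarrow> inner \<zeta> \<psi>1 = inner \<zeta>' \<psi>2)"

definition TH :: "real \<Rightarrow> 'x \<times> 'x \<times> 'x \<times> 'x \<times> 'x \<times> 'y \<Rightarrow> 'x \<times> 'x \<times> 'x \<times> 'x \<times> 'x \<times> 'y" where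
  "TH = prod_group TX (prod_group TX (prod_group TX (prod_group TX (prod_group TX TY))))"

sublocale H: isometry_group TH
  unfolding TH_def by (intro isometry_group_prod X.isometry_group_axioms Y.isometry_group_axioms)

text \<open>\<open>gen w f\<close> is the equation \<open>A w = f\<close> for the generator \<open>A\<close> of the system, solved for the
  derivatives of the components of \<open>w\<close>; \<open>q\<close> stands for \<open>\<integral> g \<eta>\<^sub>x\<close>.\<close>

definition gen :: "'x \<times> 'x \<times> 'x \<times> 'x \<times> 'x \<times> 'y \<Rightarrow> 'x \<times> 'x \<times> 'x \<times> 'x \<times> 'x \<times> 'y \<Rightarrow> bool" where
  "gen w f \<longleftrightarrow> (\<exists>q \<theta>x. (\<forall>x. inner q x = inner (p\<zeta> w) (J x)) \<and>
     tder TX (pu w) (pv f + py w) \<and> tder TX (k *\<^sub>R pv w) (\<rho>1 *\<^sub>R pu f) \<and> tder TX (py w) (pz f) \<and>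
     tder TX (p\<theta> w) \<theta>x \<and>
     tder TX (a *\<^sub>R pz w + m *\<^sub>R q) (\<rho>2 *\<^sub>R py f - k *\<^sub>R pv w + \<delta> *\<^sub>R \<theta>x) \<and>
     tder TX (\<beta> *\<^sub>R \<theta>x) (\<rho>3 *\<^sub>R p\<theta> f + \<delta> *\<^sub>R pz f) \<and>
     transport (p\<zeta> w) (J (pz f) - p\<zeta> f))"

lemma J_linear: "J (x + y) = J x + J y" "J (x - y) = J x - J y" "J (c *\<^sub>R x) = c *\<^sub>R J x"
  using linear_J by (simp_all add: linear_add linear_diff linear_scale bounded_linear.linear)

lemma transport_diff: "transport \<zeta> \<zeta>' \<Longrightarrow> transport \<xi> \<xi>' \<Longrightarrow> transport (\<zeta> - \<xi>) (\<zeta>' - \<xi>')"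
  by (simp add: transport_def inner_diff_left)

lemma transport_scaleR: "transport \<zeta> \<zeta>' \<Longrightarrow> transport (c *\<^sub>R \<zeta>) (c *\<^sub>R \<zeta>')"
  by (simp add: transport_def)

lemma gen_diff:
  assumes "gen w f" "gen w' f'"
  shows "gen (w - w') (f - f')"
proof -
  obtain q \<theta>x where 1: "\<forall>x. inner q x = inner (p\<zeta> w) (J x)"
    "tder TX (pu w) (pv f + py w)" "tder TX (k *\<^sub>R pv w) (\<rho>1 *\<^sub>R pu f)" "tder TX (py w) (pz f)"
    "tder TX (p\<theta> w) \<theta>x" "tder TX (a *\<^sub>R pz w + m *\<^sub>R q) (\<rho>2 *\<^sub>R py f - k *\<^sub>R pv w + \<delta> *\<^sub>R \<theta>x)"
    "tder TX (\<beta> *\<^sub>R \<theta>x) (\<rho>3 *\<^sub>R p\<theta> f + \<delta> *\<^sub>R pz f)" "transport (p\<zeta> w) (J (pz f) - p\<zeta> f)"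
    using assms(1) unfolding gen_def by blast
  obtain q' \<theta>x' where 2: "\<forall>x. inner q' x = inner (p\<zeta> w') (J x)"
    "tder TX (pu w') (pv f' + py w')" "tder TX (k *\<^sub>R pv w') (\<rho>1 *\<^sub>R pu f')" "tder TX (py w') (pz f')"
    "tder TX (p\<theta> w') \<theta>x'" "tder TX (a *\<^sub>R pz w' + m *\<^sub>R q') (\<rho>2 *\<^sub>R py f' - k *\<^sub>R pv w' + \<delta> *\<^sub>R \<theta>x')"
    "tder TX (\<beta> *\<^sub>R \<theta>x') (\<rho>3 *\<^sub>R p\<theta> f' + \<delta> *\<^sub>R pz f')" "transport (p\<zeta> w') (J (pz f') - p\<zeta> f')"
    using assms(2) unfolding gen_def by blast
  show ?thesis
    unfolding gen_def
    using 1(1) 2(1) X.tder_diff[OF 1(2) 2(2)] X.tder_diff[OF 1(3) 2(3)] X.tder_diff[OF 1(4) 2(4)]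
      X.tder_diff[OF 1(5) 2(5)] X.tder_diff[OF 1(6) 2(6)] X.tder_diff[OF 1(7) 2(7)] transport_diff[OF 1(8) 2(8)]
    by (intro exI[of _ "q - q'"] exI[of _ "\<theta>x - \<theta>x'"])
      (simp add: inner_diff_left J_linear scaleR_diff_right algebra_simps)
qed

lemma gen_scaleR:
  assumes "gen w f"
  shows "gen (c *\<^sub>R w) (c *\<^sub>R f)"
proof -
  obtain q \<theta>x where 1: "\<forall>x. inner q x = inner (p\<zeta> w) (J x)"
    "tder TX (pu w) (pv f + py w)" "tder TX (k *\<^sub>R pv w) (\<rho>1 *\<^sub>R pu f)" "tder TX (py w) (pz f)"
    "tder TX (p\<theta> w) \<theta>x" "tder TX (a *\<^sub>R pz w + m *\<^sub>R q) (\<rho>2 *\<^sub>R py f - k *\<^sub>R pv w + \<delta> *\<^sub>R \<theta>x)"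
    "tder TX (\<beta> *\<^sub>R \<theta>x) (\<rho>3 *\<^sub>R p\<theta> f + \<delta> *\<^sub>R pz f)" "transport (p\<zeta> w) (J (pz f) - p\<zeta> f)"
    using assms(1) unfolding gen_def by blast
  show ?thesis
    unfolding gen_def
    using 1(1) X.tder_scaleR[OF 1(2), of c] X.tder_scaleR[OF 1(3), of c] X.tder_scaleR[OF 1(4), of c]
      X.tder_scaleR[OF 1(5), of c] X.tder_scaleR[OF 1(6), of c] X.tder_scaleR[OF 1(7), of c] transport_scaleR[OF 1(8), of c]
    by (intro exI[of _ "c *\<^sub>R q"] exI[of _ "c *\<^sub>R \<theta>x"])
      (simp add: J_linear scaleR_diff_right scaleR_add_right mult.commute)
qed

section \<open>Operators compatible with the generator\<close>

definition map_state :: "('x \<Rightarrow> 'x) \<Rightarrow> ('y \<Rightarrow> 'y) \<Rightarrow> 'x \<times> 'x \<times> 'x \<times> 'x \<times> 'x \<times> 'y \<Rightarrow> 'x \<times> 'x \<times> 'x \<times> 'x \<times> 'x \<times> 'y" where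
  "map_state B C w = (B (pv w), B (pu w), B (pz w), B (py w), B (p\<theta> w), C (p\<zeta> w))"

lemma gen_map_state:
  assumes B: "commutes_with TX B" and C: "linear C"
    and BJ: "\<And>x. C (J x) = J (B x)"
    and q: "\<And>q \<zeta> x. (\<forall>x. inner q x = inner \<zeta> (J x)) \<Longrightarrow> inner (B q) x = inner (C \<zeta>) (J x)"
    and tr: "\<And>\<zeta> \<zeta>'. transport \<zeta> \<zeta>' \<Longrightarrow> transport (C \<zeta>) (C \<zeta>')"
    and gen: "gen w f"
  shows "gen (map_state B C w) (map_state B C f)"
proof -
  obtain q' \<theta>x where 1: "\<forall>x. inner q' x = inner (p\<zeta> w) (J x)"
    "tder TX (pu w) (pv f + py w)" "tder TX (k *\<^sub>R pv w) (\<rho>1 *\<^sub>R pu f)" "tder TX (py w) (pz f)"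
    "tder TX (p\<theta> w) \<theta>x" "tder TX (a *\<^sub>R pz w + m *\<^sub>R q') (\<rho>2 *\<^sub>R py f - k *\<^sub>R pv w + \<delta> *\<^sub>R \<theta>x)"
    "tder TX (\<beta> *\<^sub>R \<theta>x) (\<rho>3 *\<^sub>R p\<theta> f + \<delta> *\<^sub>R pz f)" "transport (p\<zeta> w) (J (pz f) - p\<zeta> f)"
    using gen unfolding gen_def by blast
  have lin: "linear B" using B by (simp add: commutes_with_def bounded_linear.linear)
  show ?thesis
    unfolding gen_def map_state_def
    using q[OF 1(1)] X.tder_commutes[OF B 1(2)] X.tder_commutes[OF B 1(3)] X.tder_commutes[OF B 1(4)]
      X.tder_commutes[OF B 1(5)] X.tder_commutes[OF B 1(6)] X.tder_commutes[OF B 1(7)] tr[OF 1(8)]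
    by (intro exI[of _ "B q'"] exI[of _ "B \<theta>x"])
      (simp add: linear_add[OF lin] linear_diff[OF lin] linear_scale[OF lin] linear_diff[OF C] BJ)
qed

lemma inner_q_T:
  assumes "\<forall>x. inner q x = inner \<zeta> (J x)"
  shows "inner (TX s q) x = inner (TY s \<zeta>) (J x)"
  using assms by (simp add: X.inner_T_left Y.inner_T_left J_T)

lemma transport_T:
  assumes "transport \<zeta> \<zeta>'"
  shows "transport (TY s \<zeta>) (TY s \<zeta>')"
  using assms \<Psi>_T unfolding transport_def by (auto simp: Y.inner_T_left)

text \<open>These operators act as Fourier multipliers without a Fourier transform: whatever energy
  argument applies to a solution applies to its image. Translations, means, difference quotients and
  the smoothing operators all belong to the class, which is closed under sums, multiples and
  composition.\<close>

definition admissible :: "('x \<times> 'x \<times> 'x \<times> 'x \<times> 'x \<times> 'y \<Rightarrow> 'x \<times> 'x \<times> 'x \<times> 'x \<times> 'x \<times> 'y) \<Rightarrow> bool" where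
  "admissible B \<longleftrightarrow> commutes_with TH B \<and> (\<forall>w f. gen w f \<longrightarrow> gen (B w) (B f))"

lemma admissible_T: "admissible (TH s)"
proof -
  have "TH s = map_state (TX s) (TY s)"
    by (simp add: TH_def prod_group_def map_state_def fun_eq_iff)
  then show ?thesis
    unfolding admissible_def using H.commutes_T[of s]
    by (auto intro!: gen_map_state X.commutes_T bounded_linear.linear[OF Y.linear_T] inner_q_T transport_T simp: J_T)
qed

lemma inner_damped:
  "inner (damped_mean TY c r \<zeta>) \<psi> = integral {0..r} (\<lambda>s. exp (- (c * s)) * inner (TY s \<zeta>) \<psi>)"
  using integral_linear[OF Y.integrable_damped[of c \<zeta> 0 r] bounded_linear_inner_left[of \<psi>]]
  by (simp add: damped_mean_def o_def)

lemma inner_damped_X: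
  "inner (damped_mean TX c r x) \<psi> = integral {0..r} (\<lambda>s. exp (- (c * s)) * inner (TX s x) \<psi>)"
  using integral_linear[OF X.integrable_damped[of c x 0 r] bounded_linear_inner_left[of \<psi>]]
  by (simp add: damped_mean_def o_def)

lemma admissible_damped_mean:
  assumes "0 \<le> c" "0 \<le> r"
  shows "admissible (damped_mean TH c r)"
proof -
  note ig = isometry_group_prod X.isometry_group_axioms Y.isometry_group_axioms
  have eq: "damped_mean TH c r = map_state (damped_mean TX c r) (damped_mean TY c r)"
    unfolding TH_def fun_eq_iff map_state_def by (simp add: damped_mean_prod ig)
  have "gen (damped_mean TH c r w) (damped_mean TH c r f)" if "gen w f" for w f
    unfolding eq
  proof (rule gen_map_state[OF _ _ _ _ _ that])
    show "commutes_with TX (damped_mean TX c r)" by (rule X.commutes_damped_mean[OF assms])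
    show "linear (damped_mean TY c r)"
      using Y.commutes_damped_mean[OF assms] by (simp add: commutes_with_def bounded_linear.linear)
    show "damped_mean TY c r (J x) = J (damped_mean TX c r x)" for x
      using integral_linear[OF X.integrable_damped[of c x 0 r] linear_J]
      by (simp add: damped_mean_def o_def J_linear J_T)
    show "inner (damped_mean TX c r q) x = inner (damped_mean TY c r \<zeta>) (J x)"
      if "\<forall>x. inner q x = inner \<zeta> (J x)" for q \<zeta> x
      unfolding inner_damped inner_damped_X by (simp add: inner_q_T[OF that])
    show "transport (damped_mean TY c r \<zeta>) (damped_mean TY c r \<zeta>')" if "transport \<zeta> \<zeta>'" for \<zeta> \<zeta>'
      using transport_T[OF that] unfolding transport_def inner_damped by simp
  qed
  then show ?thesis
    unfolding admissible_def using H.commutes_damped_mean[OF assms] by blast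
qed

lemma admissible_compose: "admissible B \<Longrightarrow> admissible C \<Longrightarrow> admissible (\<lambda>x. B (C x))"
  unfolding admissible_def using H.commutes_compose by blast

lemma admissible_diff: "admissible B \<Longrightarrow> admissible C \<Longrightarrow> admissible (\<lambda>x. B x - C x)"
  unfolding admissible_def using H.commutes_diff gen_diff by blast

lemma admissible_scaleR: "admissible B \<Longrightarrow> admissible (\<lambda>x. c *\<^sub>R B x)"
  unfolding admissible_def using H.commutes_scaleR gen_scaleR by blast

lemma admissible_plus:
  assumes "admissible B" "admissible C"
  shows "admissible (\<lambda>x. B x + C x)"
  using admissible_diff[OF assms(1) admissible_scaleR[OF assms(2), of "-1"]] by simp

lemma admissible_id: "admissible (\<lambda>x. x)"
  unfolding admissible_def using H.commutes_id by blast

lemma admissible_funpow: "admissible B \<Longrightarrow> admissible (B ^^ n)"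
proof (induction n)
  case 0
  then show ?case using admissible_id by (simp add: id_def)
next
  case (Suc n)
  then show ?case using admissible_compose[of B "B ^^ n"] by (simp add: o_def)
qed

lemma admissible_avg: "0 < r \<Longrightarrow> admissible (avg TH r)"
  unfolding avg_def[abs_def] by (rule admissible_scaleR[OF admissible_damped_mean]) auto

lemma admissible_diffq: "admissible (diffq TH r)"
  unfolding diffq_def[abs_def] by (rule admissible_scaleR[OF admissible_diff[OF admissible_T admissible_id]])

lemma admissible_mean_der: "admissible (mean_der TH)"
  unfolding mean_der_def[abs_def]
  by (rule admissible_plus[OF admissible_diff[OF admissible_damped_mean admissible_id] admissible_scaleR[OF admissible_T]]) auto

lemma admissible_smoothing: "admissible (H.smoothing i)"
  unfolding H.smoothing_def[abs_def]
  by (rule admissible_compose[OF admissible_funpow[OF admissible_mean_der] admissible_funpow[OF admissible_damped_mean]]) auto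

section \<open>The energy\<close>

text \<open>The polarised energy; \<open>2 * en w f\<close> is the time derivative of
  \<open>en w w\<close> when \<open>w\<close> moves with velocity \<open>f\<close>. The weights are
  the coefficients of the system, which makes the couplings cancel.\<close>

definition en :: "'x \<times> 'x \<times> 'x \<times> 'x \<times> 'x \<times> 'y \<Rightarrow> 'x \<times> 'x \<times> 'x \<times> 'x \<times> 'x \<times> 'y \<Rightarrow> real" where
  "en w f = k * inner (pv w) (pv f) + \<rho>1 * inner (pu w) (pu f) + a * inner (pz w) (pz f)
    + \<rho>2 * inner (py w) (py f) + \<rho>3 * inner (p\<theta> w) (p\<theta> f) + m * inner (p\<zeta> w) (p\<zeta> f)"

text \<open>All couplings cancel in pairs by skewness. Two terms survive: heat conduction, and the
  pairing of the history with its own transport, for which \<Psi> provides the lower bound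
  \<open>k2 / 2\<close>.\<close>

lemma gen_energy:
  assumes "gen w f" "tder TX (p\<theta> w) \<theta>x"
  shows "en w f \<le> - \<beta> * (norm \<theta>x)\<^sup>2 - m * (k2 / 2) * (norm (p\<zeta> w))\<^sup>2"
proof -
  obtain q \<theta>1 where 1: "\<forall>x. inner q x = inner (p\<zeta> w) (J x)"
    "tder TX (pu w) (pv f + py w)" "tder TX (k *\<^sub>R pv w) (\<rho>1 *\<^sub>R pu f)" "tder TX (py w) (pz f)"
    "tder TX (p\<theta> w) \<theta>1" "tder TX (a *\<^sub>R pz w + m *\<^sub>R q) (\<rho>2 *\<^sub>R py f - k *\<^sub>R pv w + \<delta> *\<^sub>R \<theta>1)"
    "tder TX (\<beta> *\<^sub>R \<theta>1) (\<rho>3 *\<^sub>R p\<theta> f + \<delta> *\<^sub>R pz f)" "transport (p\<zeta> w) (J (pz f) - p\<zeta> f)"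
    using assms(1) unfolding gen_def by blast
  have \<theta>: "\<theta>1 = \<theta>x" using X.tder_unique[OF 1(5) assms(2)] .
  have vu: "k * inner (pv w) (pv f) + \<rho>1 * inner (pu w) (pu f) = - k * inner (pv w) (py w)"
    using X.tder_skew[OF 1(3) 1(2)] by (simp add: inner_add_right inner_commute algebra_simps)
  have p: "a * inner (pz w) (pz f) + m * inner q (pz f)
      = - (\<rho>2 * inner (py w) (py f)) + k * inner (pv w) (py w) - \<delta> * inner \<theta>x (py w)"
    using X.tder_skew[OF 1(6) 1(4)] unfolding \<theta>
    by (simp add: inner_add_left inner_diff_left inner_commute[of "py w"] algebra_simps)
  have t1: "\<rho>3 * inner (p\<theta> w) (p\<theta> f) + \<delta> * inner (p\<theta> w) (pz f) = - \<beta> * (norm \<theta>x)\<^sup>2"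
    using X.tder_skew[OF 1(5) 1(7)] unfolding \<theta> by (simp add: inner_add_right power2_norm_eq_inner)
  have t2: "inner (p\<theta> w) (pz f) = - inner \<theta>x (py w)"
    using X.tder_skew[OF 1(5) 1(4)] unfolding \<theta> by simp
  have tr: "k2 / 2 * (norm (p\<zeta> w))\<^sup>2 \<le> inner q (pz f) - inner (p\<zeta> w) (p\<zeta> f)"
    using \<Psi>_coercive[of "p\<zeta> w" "J (pz f) - p\<zeta> f"] 1(1,8) unfolding transport_def by (simp add: inner_diff_right)
  have tr': "m * (k2 / 2 * (norm (p\<zeta> w))\<^sup>2) \<le> m * inner q (pz f) - m * inner (p\<zeta> w) (p\<zeta> f)"
    using mult_left_mono[OF tr, of m] pos by (simp add: right_diff_distrib)
  show ?thesis
    unfolding en_def using vu p t1[unfolded t2] tr' by (simp add: algebra_simps)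
qed

lemma gen_dissipative: "gen w f \<Longrightarrow> en w f \<le> 0"
proof -
  assume g: "gen w f"
  then obtain \<theta>x where "tder TX (p\<theta> w) \<theta>x" unfolding gen_def by blast
  from gen_energy[OF g this] show ?thesis
    using pos zero_le_power2[of "norm \<theta>x"] zero_le_power2[of "norm (p\<zeta> w)"]
    by (smt (verit) divide_pos_pos mult_nonneg_nonneg mult_minus_left)
qed

text \<open>The mild formulation states the initial condition only through the generator at the zero
  vector; single-valuedness there turns it into \<open>V 0 = V0\<close>.\<close>

lemma gen_zero: "gen 0 f \<Longrightarrow> f = 0"
proof -
  assume "gen 0 f"
  then obtain q \<theta>x where 1: "\<forall>x. inner q x = 0"
    "tder TX 0 (pv f)" "tder TX 0 (\<rho>1 *\<^sub>R pu f)" "tder TX 0 (pz f)"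
    "tder TX 0 \<theta>x" "tder TX (m *\<^sub>R q) (\<rho>2 *\<^sub>R py f + \<delta> *\<^sub>R \<theta>x)"
    "tder TX (\<beta> *\<^sub>R \<theta>x) (\<rho>3 *\<^sub>R p\<theta> f + \<delta> *\<^sub>R pz f)" "transport 0 (J (pz f) - p\<zeta> f)"
    unfolding gen_def by auto
  have z: "tder TX 0 x \<Longrightarrow> x = 0" for x
    using X.tder_unique[of 0 x 0] X.tder_scaleR[of 0 x 0] by simp
  have "q = 0" using 1(1) by (metis inner_eq_zero_iff)
  have "pv f = 0" "pz f = 0" "\<theta>x = 0" using z 1(2,4,5) by auto
  moreover have "pu f = 0" using z[OF 1(3)] pos by simp
  moreover have "py f = 0" using z[of "\<rho>2 *\<^sub>R py f"] 1(6) \<open>q = 0\<close> \<open>\<theta>x = 0\<close> pos by simp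
  moreover have "p\<theta> f = 0" using z[of "\<rho>3 *\<^sub>R p\<theta> f"] 1(7) \<open>\<theta>x = 0\<close> \<open>pz f = 0\<close> pos by simp
  moreover have "J 0 = 0" by (rule linear_0[OF bounded_linear.linear[OF linear_J]])
  then have "transport 0 (- p\<zeta> f)" using 1(8) \<open>pz f = 0\<close> by simp
  then have "- p\<zeta> f = 0" by (intro \<Psi>_zero) (simp add: transport_def)
  ultimately show ?thesis
    by (simp add: prod_eq_iff)
qed

definition "cmin = Min {k, \<rho>1, a, \<rho>2, \<rho>3, m}"
definition "cmax = Max {k, \<rho>1, a, \<rho>2, \<rho>3, m}"

lemma cmin_pos: "0 < cmin" and cmax_pos: "0 < cmax"
  using pos by (auto simp: cmin_def cmax_def)

lemma norm_state: "(norm w)\<^sup>2 = inner (pv w) (pv w) + inner (pu w) (pu w) + inner (pz w) (pz w)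
    + inner (py w) (py w) + inner (p\<theta> w) (p\<theta> w) + inner (p\<zeta> w) (p\<zeta> w)"
  for w :: "'x \<times> 'x \<times> 'x \<times> 'x \<times> 'x \<times> 'y"
  by (simp add: power2_norm_eq_inner inner_prod_def)

lemma en_bounds: "cmin * (norm w)\<^sup>2 \<le> en w w" "en w w \<le> cmax * (norm w)\<^sup>2"
proof -
  have le: "cmin \<le> c" "c \<le> cmax" if "c \<in> {k, \<rho>1, a, \<rho>2, \<rho>3, m}" for c
    unfolding cmin_def cmax_def by (rule Min_le[OF _ that], simp, rule Max_ge[OF _ that], simp)
  have lo: "cmin * inner x x \<le> c * inner x x" and hi: "c * inner x x \<le> cmax * inner x x"
    if "c \<in> {k, \<rho>1, a, \<rho>2, \<rho>3, m}" for c and x :: "'z::real_inner"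
    using le[OF that] by (auto intro: mult_right_mono)
  show "cmin * (norm w)\<^sup>2 \<le> en w w"
    unfolding norm_state en_def distrib_left
    by (rule add_mono[OF add_mono[OF add_mono[OF add_mono[OF add_mono[OF lo lo] lo] lo] lo] lo]) simp_all
  show "en w w \<le> cmax * (norm w)\<^sup>2"
    unfolding norm_state en_def distrib_left
    by (rule add_mono[OF add_mono[OF add_mono[OF add_mono[OF add_mono[OF hi hi] hi] hi] hi] hi]) simp_all
qed

lemma en_has_derivative:
  assumes "(y has_vector_derivative y') (at t within S)"
  shows "((\<lambda>t. en (y t) (y t)) has_real_derivative 2 * en (y t) y') (at t within S)"
proof -
  note f = bounded_linear.has_vector_derivative[OF bounded_linear_fst]
  note s = bounded_linear.has_vector_derivative[OF bounded_linear_snd]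
  note c = f[OF assms] f[OF s[OF assms]] f[OF s[OF s[OF assms]]] f[OF s[OF s[OF s[OF assms]]]]
    f[OF s[OF s[OF s[OF s[OF assms]]]]] s[OF s[OF s[OF s[OF s[OF assms]]]]]
  show ?thesis
    unfolding en_def
    by (rule DERIV_cong, ((rule DERIV_add DERIV_cmult inner_has_derivative c)+)[1]) (simp add: inner_commute algebra_simps)
qed

end

section \<open>The Lyapunov functional\<close>

context history_system
begin

text \<open>The correlations as bilinear forms in two families of vectors, one per derivative order.
  On the diagonal they enter the functional; with one argument replaced by its velocity they give
  the time derivative \<open>pol F G + pol G F\<close>.\<close>

definition pol1 where
  "pol1 G F = - \<rho>2 * (inner (p\<zeta> (G 0)) (J (py (F 1))) + inner (p\<zeta> (G 1)) (J (py (F 2))) + inner (p\<zeta> (G 2)) (J (py (F 3))))"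
  for G F :: "nat \<Rightarrow> 'x \<times> 'x \<times> 'x \<times> 'x \<times> 'x \<times> 'y"
definition polz where
  "polz G F = - \<rho>2 * (inner (py (G 1)) (pz (F 2)) + inner (py (G 2)) (pz (F 3)))
    - \<rho>1 * (inner (pu (G 1)) (pz (F 1)) + inner (pu (G 2)) (pz (F 2)))"
  for G F :: "nat \<Rightarrow> 'x \<times> 'x \<times> 'x \<times> 'x \<times> 'x \<times> 'y"
definition polv where
  "polv G F = - \<rho>2 * (inner (py (G 1)) (pv (F 1)) + inner (py (G 2)) (pv (F 2)))"
  for G F :: "nat \<Rightarrow> 'x \<times> 'x \<times> 'x \<times> 'x \<times> 'x \<times> 'y"
definition polu where
  "polu G F = - inner (pv (G 1)) (pu (F 2))"
  for G F :: "nat \<Rightarrow> 'x \<times> 'x \<times> 'x \<times> 'x \<times> 'x \<times> 'y"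

lemma tder_TH:
  assumes "tder TH w w'"
  shows "tder TX (pv w) (pv w')" "tder TX (pu w) (pu w')" "tder TX (pz w) (pz w')" "tder TX (py w) (py w')"
    "tder TX (p\<theta> w) (p\<theta> w')" "tder TY (p\<zeta> w) (p\<zeta> w')"
  using assms by (simp_all add: TH_def tder_prod)

lemma inner_q_tder:
  assumes q: "\<forall>x. inner q x = inner \<zeta> (J x)" and d: "tder TX q q'" "tder TY \<zeta> \<zeta>'"
  shows "inner q' x = inner \<zeta>' (J x)"
proof -
  have "((\<lambda>s. inner (TX s q) x) has_vector_derivative inner q' x) (at 0)"
    using d(1) unfolding tder_def by (rule bounded_linear.has_vector_derivative[OF bounded_linear_inner_left])
  moreover have "((\<lambda>s. inner (TX s q) x) has_vector_derivative inner \<zeta>' (J x)) (at 0)"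
    using d(2) unfolding tder_def inner_q_T[OF q]
    by (rule bounded_linear.has_vector_derivative[OF bounded_linear_inner_left])
  ultimately show ?thesis by (rule vector_derivative_unique_at)
qed

text \<open>The weights depend on the coefficients only, not on the family \<open>G\<close>; this
  uniformity is what later allows limits in the regularisation parameters. Each family of four
  successive derivatives is an instance of \<open>dissipation_chain\<close>.\<close>

lemma dissipation:
  obtains n1 nz nv c N where "0 < n1" "0 < nz" "0 < nv" "0 < c" "0 < N"
    "\<And>n0 G F. N \<le> n0 \<Longrightarrow> (\<And>i. i < 3 \<Longrightarrow> tder TH (G i) (G (Suc i))) \<Longrightarrow> (\<And>i. i \<le> 3 \<Longrightarrow> gen (G i) (F i)) \<Longrightarrow>
      n0 * (en (G 0) (F 0) + en (G 1) (F 1) + en (G 2) (F 2) + en (G 3) (F 3))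
      + n1 * (pol1 F G + pol1 G F) + nz * (polz F G + polz G F) + nv * (polv F G + polv G F) + (polu F G + polu G F)
      \<le> - c * (norm (G 2))\<^sup>2"
proof -
  define d where "d = min \<beta> (m * (k2 / 2))"
  have d: "0 < d" "d \<le> \<beta>" "d \<le> m * (k2 / 2)" using pos by (auto simp: d_def)
  define c1 where "c1 e = 3 * ((\<rho>2 * \<kappa>)\<^sup>2 / (2 * (\<rho>2 * b0)) + a\<^sup>2 * b0 / (2 * e) + m * b0 + k\<^sup>2 * b0 / (2 * e) + 1 + \<delta>\<^sup>2 * b0 / 4)" for e
  have "\<exists>n1>0. \<exists>nz>0. \<exists>nv>0. \<exists>c>0. \<exists>N>0. \<forall>n0\<ge>N. \<forall>U V Z Y R dE d1 dz dv du.
    0 \<le> U \<and> 0 \<le> V \<and> 0 \<le> Z \<and> 0 \<le> Y \<and> 0 \<le> R \<and>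
    (\<forall>e>0. d1 \<le> - (\<rho>2 * b0 / 2) * Y + e * Z + e * V + c1 e * R) \<and>
    (\<forall>e>0. dz \<le> - (a / 2) * Z + e * U + (\<rho>2 + \<rho>1\<^sup>2 / (2 * e)) * Y + (2 * (m\<^sup>2 * b0 + \<delta>\<^sup>2) / a) * R) \<and>
    (\<forall>e>0. dv \<le> - (k / 2) * V + e * U + (3 * a\<^sup>2 / (2 * k)) * Z + (\<rho>2 + \<rho>2\<^sup>2 / (2 * e)) * Y + (3 * (m\<^sup>2 * b0 + \<delta>\<^sup>2) / k) * R) \<and>
    du \<le> - (1 / 2) * U + (1 / 2) * Y + (k / \<rho>1) * V \<and> dE \<le> - d * R
    \<longrightarrow> n0 * dE + n1 * d1 + nz * dz + nv * dv + du \<le> - c * (U + V + Z + Y + R)"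
    by (rule lyapunov_weights[where yz = "\<lambda>e. \<rho>2 + \<rho>1\<^sup>2 / (2 * e)" and yv = "\<lambda>e. \<rho>2 + \<rho>2\<^sup>2 / (2 * e)"])
      (use pos d in auto)
  then obtain n1 nz nv c N where n: "0 < n1" "0 < nz" "0 < nv" "0 < c" "0 < N"
    and W: "\<And>n0 U V Z Y R dE d1 dz dv du. N \<le> n0 \<Longrightarrow> 0 \<le> U \<Longrightarrow> 0 \<le> V \<Longrightarrow> 0 \<le> Z \<Longrightarrow> 0 \<le> Y \<Longrightarrow> 0 \<le> R \<Longrightarrow>
    (\<And>e. e > 0 \<Longrightarrow> d1 \<le> - (\<rho>2 * b0 / 2) * Y + e * Z + e * V + c1 e * R) \<Longrightarrow>
    (\<And>e. e > 0 \<Longrightarrow> dz \<le> - (a / 2) * Z + e * U + (\<rho>2 + \<rho>1\<^sup>2 / (2 * e)) * Y + (2 * (m\<^sup>2 * b0 + \<delta>\<^sup>2) / a) * R) \<Longrightarrow>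
    (\<And>e. e > 0 \<Longrightarrow> dv \<le> - (k / 2) * V + e * U + (3 * a\<^sup>2 / (2 * k)) * Z + (\<rho>2 + \<rho>2\<^sup>2 / (2 * e)) * Y + (3 * (m\<^sup>2 * b0 + \<delta>\<^sup>2) / k) * R) \<Longrightarrow>
    du \<le> - (1 / 2) * U + (1 / 2) * Y + (k / \<rho>1) * V \<Longrightarrow> dE \<le> - d * R \<Longrightarrow>
    n0 * dE + n1 * d1 + nz * dz + nv * dv + du \<le> - c * (U + V + Z + Y + R)"
    by metis
  show thesis
  proof (rule that[OF n])
    fix n0 and G F :: "nat \<Rightarrow> 'x \<times> 'x \<times> 'x \<times> 'x \<times> 'x \<times> 'y"
    assume n0: "N \<le> n0" and G: "\<And>i. i < 3 \<Longrightarrow> tder TH (G i) (G (Suc i))" and F: "\<And>i. i \<le> 3 \<Longrightarrow> gen (G i) (F i)"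
    have "\<forall>i\<in>{..3}. \<exists>q\<theta>. (\<forall>x. inner (fst q\<theta>) x = inner (p\<zeta> (G i)) (J x)) \<and>
     tder TX (pu (G i)) (pv (F i) + py (G i)) \<and> tder TX (k *\<^sub>R pv (G i)) (\<rho>1 *\<^sub>R pu (F i)) \<and> tder TX (py (G i)) (pz (F i)) \<and>
     tder TX (p\<theta> (G i)) (snd q\<theta>) \<and>
     tder TX (a *\<^sub>R pz (G i) + m *\<^sub>R fst q\<theta>) (\<rho>2 *\<^sub>R py (F i) - k *\<^sub>R pv (G i) + \<delta> *\<^sub>R snd q\<theta>) \<and>
     tder TX (\<beta> *\<^sub>R snd q\<theta>) (\<rho>3 *\<^sub>R p\<theta> (F i) + \<delta> *\<^sub>R pz (F i)) \<and>
     transport (p\<zeta> (G i)) (J (pz (F i)) - p\<zeta> (F i))"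
      using F unfolding gen_def by auto
    from bchoice[OF this] obtain q\<theta> where q0: "\<forall>i\<in>{..3}. (\<forall>x. inner (fst (q\<theta> i)) x = inner (p\<zeta> (G i)) (J x)) \<and>
     tder TX (pu (G i)) (pv (F i) + py (G i)) \<and> tder TX (k *\<^sub>R pv (G i)) (\<rho>1 *\<^sub>R pu (F i)) \<and> tder TX (py (G i)) (pz (F i)) \<and>
     tder TX (p\<theta> (G i)) (snd (q\<theta> i)) \<and>
     tder TX (a *\<^sub>R pz (G i) + m *\<^sub>R fst (q\<theta> i)) (\<rho>2 *\<^sub>R py (F i) - k *\<^sub>R pv (G i) + \<delta> *\<^sub>R snd (q\<theta> i)) \<and>
     tder TX (\<beta> *\<^sub>R snd (q\<theta> i)) (\<rho>3 *\<^sub>R p\<theta> (F i) + \<delta> *\<^sub>R pz (F i)) \<and>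
     transport (p\<zeta> (G i)) (J (pz (F i)) - p\<zeta> (F i))"
      by (rule exE)
    have q\<theta>: "(\<forall>x. inner (fst (q\<theta> i)) x = inner (p\<zeta> (G i)) (J x)) \<and>
     tder TX (pu (G i)) (pv (F i) + py (G i)) \<and> tder TX (k *\<^sub>R pv (G i)) (\<rho>1 *\<^sub>R pu (F i)) \<and> tder TX (py (G i)) (pz (F i)) \<and>
     tder TX (p\<theta> (G i)) (snd (q\<theta> i)) \<and>
     tder TX (a *\<^sub>R pz (G i) + m *\<^sub>R fst (q\<theta> i)) (\<rho>2 *\<^sub>R py (F i) - k *\<^sub>R pv (G i) + \<delta> *\<^sub>R snd (q\<theta> i)) \<and>
     tder TX (\<beta> *\<^sub>R snd (q\<theta> i)) (\<rho>3 *\<^sub>R p\<theta> (F i) + \<delta> *\<^sub>R pz (F i)) \<and>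
     transport (p\<zeta> (G i)) (J (pz (F i)) - p\<zeta> (F i))" if "i \<le> 3" for i
      by (rule bspec[OF q0]) (use that in simp)
    define q where "q i = fst (q\<theta> i)" for i
    \<comment> \<open>The family \<open>G\<close> stops at order 3. The fourth derivatives of
      \<open>y\<close> and \<open>\<theta>\<close> are supplied by the generator equation at order
      3.\<close>
    define y where "y i = (if i \<le> 3 then py (G i) else pz (F 3))" for i
    define \<theta> where "\<theta> i = (if i \<le> 3 then p\<theta> (G i) else snd (q\<theta> 3))" for i
    define px where "px = \<rho>2 *\<^sub>R py (F 3) - k *\<^sub>R pv (G 3) + \<delta> *\<^sub>R \<theta> 4"
    note g = q\<theta>[THEN conjunct1] q\<theta>[THEN conjunct2, THEN conjunct1] q\<theta>[THEN conjunct2, THEN conjunct2, THEN conjunct1]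
      q\<theta>[THEN conjunct2, THEN conjunct2, THEN conjunct2, THEN conjunct1]
      q\<theta>[THEN conjunct2, THEN conjunct2, THEN conjunct2, THEN conjunct2, THEN conjunct1]
      q\<theta>[THEN conjunct2, THEN conjunct2, THEN conjunct2, THEN conjunct2, THEN conjunct2, THEN conjunct1]
      q\<theta>[THEN conjunct2, THEN conjunct2, THEN conjunct2, THEN conjunct2, THEN conjunct2, THEN conjunct2, THEN conjunct1]
      q\<theta>[THEN conjunct2, THEN conjunct2, THEN conjunct2, THEN conjunct2, THEN conjunct2, THEN conjunct2, THEN conjunct2]
    have dy: "pz (F i) = y (Suc i)" if "i \<le> 3" for i
    proof (cases "i = 3")
      case True then show ?thesis by (simp add: y_def)
    next
      case False
      then show ?thesis using X.tder_unique[OF g(4) tder_TH(4)[OF G]] that by (simp add: y_def)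
    qed
    have d\<theta>: "snd (q\<theta> i) = \<theta> (Suc i)" if "i \<le> 3" for i
    proof (cases "i = 3")
      case True then show ?thesis by (simp add: \<theta>_def)
    next
      case False
      then show ?thesis using X.tder_unique[OF g(5) tder_TH(5)[OF G]] that by (simp add: \<theta>_def)
    qed
    \<comment> \<open>The equation differentiates only the stress. Below order 3 the derivative of
      \<open>z\<close> exists as well, so \<open>q\<close> is differentiable as a difference, and
      its derivative is identified by pairing with \<open>J\<close>.\<close>
    have dq: "tder TX (q i) (q (Suc i))" and
      eqy: "\<rho>2 *\<^sub>R py (F i) - k *\<^sub>R pv (G i) + \<delta> *\<^sub>R \<theta> (Suc i) = a *\<^sub>R pz (G (Suc i)) + m *\<^sub>R q (Suc i)" if i: "i < 3" for i
    proof -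
      let ?p = "\<rho>2 *\<^sub>R py (F i) - k *\<^sub>R pv (G i) + \<delta> *\<^sub>R \<theta> (Suc i)"
      have p: "tder TX (a *\<^sub>R pz (G i) + m *\<^sub>R q i) ?p"
        using g(6)[of i] d\<theta>[of i] i by (simp add: q_def)
      have "tder TX ((1 / m) *\<^sub>R ((a *\<^sub>R pz (G i) + m *\<^sub>R q i) - a *\<^sub>R pz (G i)))
        ((1 / m) *\<^sub>R (?p - a *\<^sub>R pz (G (Suc i))))"
        by (intro X.tder_scaleR X.tder_diff p tder_TH(3) G i)
      then have 1: "tder TX (q i) ((1 / m) *\<^sub>R (?p - a *\<^sub>R pz (G (Suc i))))"
        using pos by simp
      have "inner ((1 / m) *\<^sub>R (?p - a *\<^sub>R pz (G (Suc i)))) x = inner (q (Suc i)) x" for x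
        using inner_q_tder[OF _ 1 tder_TH(6)[OF G[OF i]]] g(1)[of i] g(1)[of "Suc i"] i by (simp add: q_def)
      then have 2: "(1 / m) *\<^sub>R (?p - a *\<^sub>R pz (G (Suc i))) = q (Suc i)"
        by (rule vector_eq_rdot[THEN iffD1, OF allI])
      show "tder TX (q i) (q (Suc i))" using 1 unfolding 2 .
      have "m *\<^sub>R ((1 / m) *\<^sub>R (?p - a *\<^sub>R pz (G (Suc i)))) = m *\<^sub>R q (Suc i)" unfolding 2 ..
      then have "?p - a *\<^sub>R pz (G (Suc i)) = m *\<^sub>R q (Suc i)" using pos by simp
      then show "?p = a *\<^sub>R pz (G (Suc i)) + m *\<^sub>R q (Suc i)" by (simp add: algebra_simps)
    qed
    interpret dissipation_chain TX J \<rho>1 \<rho>2 k a m \<delta> b0 \<kappa>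
      "\<lambda>i. pv (G i)" "\<lambda>i. pu (G i)" "\<lambda>i. pz (G i)" y \<theta> q
      "\<lambda>i. pv (F i)" "\<lambda>i. pu (F i)" "\<lambda>i. pz (F i)" "\<lambda>i. py (F i)"
      "\<lambda>i. p\<zeta> (G i)" "\<lambda>i. J (pz (F i)) - p\<zeta> (F i)" "\<lambda>i. p\<zeta> (F i)" px
    proof
      show "tder TX (pv (G i)) (pv (G (Suc i)))" "tder TX (pu (G i)) (pu (G (Suc i)))"
        "tder TX (pz (G i)) (pz (G (Suc i)))" "tder TX (q i) (q (Suc i))" if "i < 3" for i
        using tder_TH[OF G[OF that]] dq[OF that] by auto
      show "tder TX (y i) (y (Suc i))" "tder TX (\<theta> i) (\<theta> (Suc i))" if "i \<le> 3" for i
        using g(4)[OF that] g(5)[OF that] that unfolding dy[OF that] d\<theta>[OF that] by (simp_all add: y_def \<theta>_def)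
      show "tder TX (a *\<^sub>R pz (G 3) + m *\<^sub>R q 3) px"
        using g(6)[of 3] d\<theta>[of 3] by (simp add: q_def px_def)
      show "inner (q i) w = inner (p\<zeta> (G i)) (J w)" if "i \<le> 3" for i w
        using g(1)[OF that] by (simp add: q_def)
      show "\<bar>inner (J w) (J (pz (F i)) - p\<zeta> (F i))\<bar> \<le> \<kappa> * norm w * norm (p\<zeta> (G i))" if "i \<le> 3" for i w
        using g(8)[OF that] by (intro \<Psi>_J) (auto simp: transport_def)
      show "pv (F i) = pu (G (Suc i)) - y i" if "i \<le> 2" for i
        using X.tder_unique[OF tder_TH(2)[OF G] g(2), of i] that by (simp add: y_def)
      show "\<rho>1 *\<^sub>R pu (F i) = k *\<^sub>R pv (G (Suc i))" if "i \<le> 2" for i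
        using X.tder_unique[OF X.tder_scaleR[OF tder_TH(1)[OF G[of i]], of k] g(3)[of i]] that by simp
      show "pz (F i) = y (Suc i)" if "i \<le> 3" for i using dy[OF that] .
      show "\<rho>2 *\<^sub>R py (F i) = a *\<^sub>R pz (G (Suc i)) + m *\<^sub>R q (Suc i) + k *\<^sub>R pv (G i) - \<delta> *\<^sub>R \<theta> (Suc i)" if "i \<le> 2" for i
        using eqy[of i] that by (simp add: algebra_simps)
      show "\<rho>2 *\<^sub>R py (F 3) = px + k *\<^sub>R pv (G 3) - \<delta> *\<^sub>R \<theta> 4" by (simp add: px_def)
      show "p\<zeta> (F i) = J (y (Suc i)) - (J (pz (F i)) - p\<zeta> (F i))" if "i \<le> 2" for i
        using dy[of i] that by simp
    qed (use pos inner_J in auto)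
    have y: "y 0 = py (G 0)" "y 1 = py (G 1)" "y 2 = py (G 2)" "y 3 = py (G 3)" by (auto simp: y_def)
    have n': "Suc 0 = 1" "Suc 1 = 2" "Suc 2 = 3" "Suc 3 = 4" by simp_all
    have p1: "pol1 F G + pol1 G F = dF1 0 + dF1 1 + dF1 2"
      unfolding pol1_def dF1_def n' y by (simp add: algebra_simps)
    have pz: "polz F G + polz G F = dFz 1 + dFz 2"
      unfolding polz_def dFz_def n' y by (simp add: algebra_simps)
    have pv: "polv F G + polv G F = dFv 1 + dFv 2"
      unfolding polv_def dFv_def n' y by (simp add: algebra_simps)
    have pu: "polu F G + polu G F = dFu"
      unfolding polu_def dFu_def by simp
    have E: "en (G i) (F i) \<le> - d * ((norm (\<theta> (Suc i)))\<^sup>2 + (norm (p\<zeta> (G i)))\<^sup>2)" if "i \<le> 3" for i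
    proof -
      have "en (G i) (F i) \<le> - \<beta> * (norm (\<theta> (Suc i)))\<^sup>2 - m * (k2 / 2) * (norm (p\<zeta> (G i)))\<^sup>2"
        using gen_energy[OF F[OF that] g(5)[OF that]] unfolding d\<theta>[OF that] .
      moreover have "d * (norm (\<theta> (Suc i)))\<^sup>2 \<le> \<beta> * (norm (\<theta> (Suc i)))\<^sup>2"
        "d * (norm (p\<zeta> (G i)))\<^sup>2 \<le> m * (k2 / 2) * (norm (p\<zeta> (G i)))\<^sup>2"
        using mult_right_mono[OF d(2) zero_le_power2] mult_right_mono[OF d(3) zero_le_power2] by blast+
      ultimately show ?thesis by (simp add: algebra_simps)
    qed
    have "en (G 0) (F 0) + en (G 1) (F 1) + en (G 2) (F 2) + en (G 3) (F 3) \<le> - d * R"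
      using E[of 0] E[of 1] E[of 2] E[of 3] unfolding R_def n' by (simp add: algebra_simps)
    then have "n0 * (en (G 0) (F 0) + en (G 1) (F 1) + en (G 2) (F 2) + en (G 3) (F 3))
      + n1 * (dF1 0 + dF1 1 + dF1 2) + nz * (dFz 1 + dFz 2) + nv * (dFv 1 + dFv 2) + dFu
      \<le> - c * (Us + Vs + Zs + Ys + R)"
      by (intro W n0 dF1_bound[folded c1_def] dFz_bound dFv_bound dFu_bound)
        (auto simp: Us_def Vs_def Zs_def Ys_def R_def)
    also have "\<dots> \<le> - c * (norm (G 2))\<^sup>2"
    proof -
      have "(norm (G 2))\<^sup>2 \<le> Us + Vs + Zs + Ys + R"
        unfolding norm_state Us_def Vs_def Zs_def Ys_def R_def y power2_norm_eq_inner[symmetric] by (simp add: \<theta>_def)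
      then show ?thesis using n(4) by simp
    qed
    finally show "n0 * (en (G 0) (F 0) + en (G 1) (F 1) + en (G 2) (F 2) + en (G 3) (F 3))
      + n1 * (pol1 F G + pol1 G F) + nz * (polz F G + polz G F) + nv * (polv F G + polv G F) + (polu F G + polu G F)
      \<le> - c * (norm (G 2))\<^sup>2"
      unfolding p1 pz pv pu .
  qed
qed

lemma pol_has_derivative:
  assumes "\<And>i. i \<le> 3 \<Longrightarrow> ((\<lambda>t. G t i) has_vector_derivative F i) (at t within S)"
  shows "((\<lambda>t. pol1 (G t) (G t)) has_real_derivative pol1 F (G t) + pol1 (G t) F) (at t within S)"
    "((\<lambda>t. polz (G t) (G t)) has_real_derivative polz F (G t) + polz (G t) F) (at t within S)"
    "((\<lambda>t. polv (G t) (G t)) has_real_derivative polv F (G t) + polv (G t) F) (at t within S)"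
    "((\<lambda>t. polu (G t) (G t)) has_real_derivative polu F (G t) + polu (G t) F) (at t within S)"
proof -
  note f = bounded_linear.has_vector_derivative[OF bounded_linear_fst]
  note s = bounded_linear.has_vector_derivative[OF bounded_linear_snd]
  note j = bounded_linear.has_vector_derivative[OF linear_J]
  have c: "((\<lambda>t. pv (G t i)) has_vector_derivative pv (F i)) (at t within S)"
    "((\<lambda>t. pu (G t i)) has_vector_derivative pu (F i)) (at t within S)"
    "((\<lambda>t. pz (G t i)) has_vector_derivative pz (F i)) (at t within S)"
    "((\<lambda>t. py (G t i)) has_vector_derivative py (F i)) (at t within S)"
    "((\<lambda>t. J (py (G t i))) has_vector_derivative J (py (F i))) (at t within S)"
    "((\<lambda>t. p\<zeta> (G t i)) has_vector_derivative p\<zeta> (F i)) (at t within S)" if "i \<le> 3" for i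
    using f[OF assms[OF that]] f[OF s[OF assms[OF that]]] f[OF s[OF s[OF assms[OF that]]]]
      f[OF s[OF s[OF s[OF assms[OF that]]]]] j[OF f[OF s[OF s[OF s[OF assms[OF that]]]]]]
      s[OF s[OF s[OF s[OF s[OF assms[OF that]]]]]] by auto
  have n: "(0::nat) \<le> 3" "(1::nat) \<le> 3" "(2::nat) \<le> 3" "(3::nat) \<le> 3" by auto
  note cs = c[OF n(1)] c[OF n(2)] c[OF n(3)] c[OF n(4)]
  show "((\<lambda>t. pol1 (G t) (G t)) has_real_derivative pol1 F (G t) + pol1 (G t) F) (at t within S)"
    unfolding pol1_def
    by (rule DERIV_cong, ((rule DERIV_add DERIV_diff DERIV_cmult inner_has_derivative cs)+)[1]) (simp add: algebra_simps)
  show "((\<lambda>t. polz (G t) (G t)) has_real_derivative polz F (G t) + polz (G t) F) (at t within S)"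
    unfolding polz_def
    by (rule DERIV_cong, ((rule DERIV_add DERIV_diff DERIV_cmult inner_has_derivative cs)+)[1]) (simp add: algebra_simps)
  show "((\<lambda>t. polv (G t) (G t)) has_real_derivative polv F (G t) + polv (G t) F) (at t within S)"
    unfolding polv_def
    by (rule DERIV_cong, ((rule DERIV_add DERIV_diff DERIV_cmult inner_has_derivative cs)+)[1]) (simp add: algebra_simps)
  show "((\<lambda>t. polu (G t) (G t)) has_real_derivative polu F (G t) + polu (G t) F) (at t within S)"
    unfolding polu_def
    by (rule DERIV_cong, ((rule DERIV_minus inner_has_derivative cs)+)[1]) simp
qed

definition sq4 where "sq4 G = (norm (G 0))\<^sup>2 + (norm (G 1))\<^sup>2 + (norm (G 2))\<^sup>2 + (norm (G 3))\<^sup>2"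
  for G :: "nat \<Rightarrow> 'x \<times> 'x \<times> 'x \<times> 'x \<times> 'x \<times> 'y"

lemma norm_fst_snd_le: "norm (fst p) \<le> norm p" "norm (snd p) \<le> norm p"
  by (metis norm_fst_le norm_snd_le prod.collapse)+

lemma components_le:
  "norm (pv w) \<le> norm w" "norm (pu w) \<le> norm w" "norm (pz w) \<le> norm w" "norm (py w) \<le> norm w"
  "norm (p\<theta> w) \<le> norm w" "norm (p\<zeta> w) \<le> norm w"
  for w :: "'x \<times> 'x \<times> 'x \<times> 'x \<times> 'x \<times> 'y"
  by (meson norm_fst_snd_le order_trans)+

text \<open>The correlations involve no order above 3, so a large multiple of the four energies
  dominates them; this makes the functional comparable to \<open>sq4\<close>.\<close>

lemma pol_bound:
  "\<exists>K>0. \<forall>G. \<bar>n1 * pol1 G G + nz * polz G G + nv * polv G G + polu G G\<bar> \<le> K * sq4 G"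
proof -
  have prod: "norm (G i) * norm (G j) \<le> sq4 G" if "i \<le> 3" "j \<le> 3" for G i j
  proof -
    have "norm (G i) * norm (G j) \<le> ((norm (G i))\<^sup>2 + (norm (G j))\<^sup>2) / 2"
      using sum_squares_bound[of "norm (G i)" "norm (G j)"] by simp
    moreover have "(norm (G i))\<^sup>2 \<le> sq4 G" if "i \<le> 3" for i
    proof -
      have "i = 0 \<or> i = 1 \<or> i = 2 \<or> i = 3" using that by auto
      then show ?thesis by (auto simp: sq4_def)
    qed
    then have "(norm (G i))\<^sup>2 \<le> sq4 G" "(norm (G j))\<^sup>2 \<le> sq4 G" using that by auto
    ultimately show ?thesis by simp
  qed
  have ip: "\<bar>inner x y\<bar> \<le> sq4 G" if "norm x \<le> norm (G i)" "norm y \<le> norm (G j)" "i \<le> 3" "j \<le> 3" for G i j and x y :: 'x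
    using Cauchy_Schwarz_ineq2[of x y] mult_mono[OF that(1,2)] prod[OF that(3,4), of G] by fastforce
  have ij: "\<bar>inner x (J y)\<bar> \<le> (b0 + 1) * sq4 G" if "norm x \<le> norm (G i)" "norm y \<le> norm (G j)" "i \<le> 3" "j \<le> 3"
    for G i j and x :: 'y and y :: 'x
  proof -
    have "norm (J y) \<le> (b0 + 1) * norm y"
    proof (rule power2_le_imp_le)
      have "(norm (J y))\<^sup>2 = b0 * (norm y)\<^sup>2" by (simp add: power2_norm_eq_inner inner_J)
      also have "\<dots> \<le> (b0 + 1)\<^sup>2 * (norm y)\<^sup>2"
        using pos by (intro mult_right_mono) (auto simp: power2_eq_square algebra_simps)
      finally show "(norm (J y))\<^sup>2 \<le> ((b0 + 1) * norm y)\<^sup>2" by (simp add: power_mult_distrib)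
    qed (use pos in auto)
    then have "\<bar>inner x (J y)\<bar> \<le> norm x * ((b0 + 1) * norm y)"
      by (intro order_trans[OF Cauchy_Schwarz_ineq2] mult_left_mono) auto
    also have "\<dots> = (b0 + 1) * (norm x * norm y)" by simp
    also have "\<dots> \<le> (b0 + 1) * sq4 G"
      using pos mult_mono[OF that(1,2)] prod[OF that(3,4), of G] by (intro mult_left_mono) auto
    finally show ?thesis .
  qed
  define K where "K = \<bar>n1\<bar> * (\<rho>2 * (3 * (b0 + 1))) + \<bar>nz\<bar> * (2 * \<rho>2 + 2 * \<rho>1) + \<bar>nv\<bar> * (2 * \<rho>2) + 1"
  have "\<bar>n1 * pol1 G G + nz * polz G G + nv * polv G G + polu G G\<bar> \<le> K * sq4 G" for G
  proof -
    note c = components_le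
    have t: "\<bar>x + y\<bar> \<le> a + b" "\<bar>x - y\<bar> \<le> a + b" if "\<bar>x\<bar> \<le> a" "\<bar>y\<bar> \<le> b" for x y a b :: real
      using that by auto
    have sc: "\<bar>e * x\<bar> \<le> \<bar>e\<bar> * b" if "\<bar>x\<bar> \<le> b" for e x b :: real
      using that by (auto simp: abs_mult intro: mult_left_mono)
    have "\<bar>n1 * pol1 G G\<bar> \<le> \<bar>n1\<bar> * (\<bar>- \<rho>2\<bar> * ((b0 + 1) * sq4 G + (b0 + 1) * sq4 G + (b0 + 1) * sq4 G))"
      unfolding pol1_def
      by (intro sc t ij[of _ G 0 _ 1] ij[of _ G 1 _ 2] ij[of _ G 2 _ 3] c) auto
    moreover have "\<bar>nz * polz G G\<bar> \<le> \<bar>nz\<bar> * (\<bar>- \<rho>2\<bar> * (sq4 G + sq4 G) + \<bar>\<rho>1\<bar> * (sq4 G + sq4 G))"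
      unfolding polz_def
      by (intro sc t ip[of _ G 1 _ 2] ip[of _ G 2 _ 3] ip[of _ G 1 _ 1] ip[of _ G 2 _ 2] c) auto
    moreover have "\<bar>nv * polv G G\<bar> \<le> \<bar>nv\<bar> * (\<bar>- \<rho>2\<bar> * (sq4 G + sq4 G))"
      unfolding polv_def
      by (intro sc t ip[of _ G 1 _ 1] ip[of _ G 2 _ 2] c) auto
    moreover have "\<bar>polu G G\<bar> \<le> sq4 G"
      unfolding polu_def abs_minus_cancel by (intro ip[of _ G 1 _ 2] c) auto
    ultimately have "\<bar>n1 * pol1 G G + nz * polz G G + nv * polv G G + polu G G\<bar>
      \<le> \<bar>n1\<bar> * (\<bar>- \<rho>2\<bar> * ((b0 + 1) * sq4 G + (b0 + 1) * sq4 G + (b0 + 1) * sq4 G))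
        + \<bar>nz\<bar> * (\<bar>- \<rho>2\<bar> * (sq4 G + sq4 G) + \<bar>\<rho>1\<bar> * (sq4 G + sq4 G))
        + \<bar>nv\<bar> * (\<bar>- \<rho>2\<bar> * (sq4 G + sq4 G)) + sq4 G"
      by (intro t)
    also have "\<dots> = K * sq4 G"
      using pos by (simp add: K_def algebra_simps)
    finally show ?thesis .
  qed
  moreover have "0 < K"
    using pos by (auto simp: K_def intro!: add_nonneg_pos add_nonneg_nonneg mult_nonneg_nonneg)
  ultimately show ?thesis by blast
qed

end

context isometry_group
begin

lemma avg_commute: "commutes_with T B \<Longrightarrow> avg T r (B x) = B (avg T r x)"
  using linear_scale[OF bounded_linear.linear, of B]
  by (simp add: avg_def damped_mean_commute) (simp add: commutes_with_def)

lemma avg_funpow_commute: "commutes_with T B \<Longrightarrow> (avg T r ^^ n) (B x) = B ((avg T r ^^ n) x)"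
  by (induction n) (simp_all add: avg_commute)

text \<open>A difference quotient with step \<open>s\<close> is the derivative of an average over
  length \<open>s\<close>, and averages commute; hence the two steps can be interchanged. A quotient
  with tiny step \<open>s\<close> is traded for one with step \<open>r\<close>, of norm at most
  \<open>2 / r\<close>.\<close>

lemma avg_diffq_exchange:
  assumes "0 < r" "0 < s"
  shows "(avg T r ^^ n) ((diffq T s ^^ n) x) = (avg T s ^^ n) ((diffq T r ^^ n) x)"
proof (induction n arbitrary: x)
  case (Suc n)
  note c = commutes_funpow[OF commutes_diffq] commutes_avg[of r] commutes_avg[of s] commutes_funpow[OF commutes_avg, of s]
  have base: "avg T r (diffq T s x) = avg T s (diffq T r x)"
    using diffq_eq_avg[OF tder_avg[OF assms(1)] assms(2), of x] avg_commute[OF commutes_diffq, of r s x] by simp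
  have "(avg T r ^^ Suc n) ((diffq T s ^^ Suc n) x) = avg T r ((avg T r ^^ n) ((diffq T s ^^ n) (diffq T s x)))"
    by (simp add: funpow_swap1)
  also have "\<dots> = avg T r ((avg T s ^^ n) ((diffq T r ^^ n) (diffq T s x)))"
    by (simp only: Suc)
  also have "\<dots> = (avg T s ^^ n) ((diffq T r ^^ n) (avg T r (diffq T s x)))"
    using assms c by (simp add: avg_commute)
  also have "\<dots> = (avg T s ^^ n) (avg T s ((diffq T r ^^ n) (diffq T r x)))"
    using assms c unfolding base by (simp add: avg_commute)
  finally show ?case by (simp add: funpow_swap1)
qed auto

lemma norm_diffq: "0 < r \<Longrightarrow> norm (diffq T r x) \<le> 2 / r * norm x"
  using norm_triangle_ineq4[of "T r x" x] by (simp add: diffq_def norm_T divide_right_mono)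

lemma norm_diffq_funpow: "0 < r \<Longrightarrow> norm ((diffq T r ^^ n) x) \<le> (2 / r) ^ n * norm x"
proof (induction n)
  case (Suc n)
  then have "norm ((diffq T r ^^ Suc n) x) \<le> 2 / r * ((2 / r) ^ n * norm x)"
    by (auto intro!: order_trans[OF norm_diffq] divide_right_mono mult_left_mono simp: mult.assoc)
  then show ?case by (simp add: mult_ac)
qed auto

end

lemma has_vector_derivative_sequence:
  assumes "(f has_vector_derivative f') (at t within {t0..})" "t0 \<le> t"
  shows "(\<lambda>n. (1 / (1 / real (Suc n))) *\<^sub>R (f (t + 1 / real (Suc n)) - f t)) \<longlonglongrightarrow> f'"
proof -
  define h where "h n = 1 / real (Suc n)" for n
  have "((\<lambda>y. (1 / norm (y - t)) *\<^sub>R (f y - (f t + (y - t) *\<^sub>R f'))) \<longlongrightarrow> 0) (at t within {t0..})"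
    using assms(1) unfolding has_vector_derivative_def has_derivative_within by simp
  moreover have "filterlim (\<lambda>n. t + h n) (at t within {t0..}) sequentially"
    using tendsto_add[OF tendsto_const LIMSEQ_Suc[OF lim_1_over_n], of t] assms(2)
    unfolding filterlim_at h_def by (auto intro!: always_eventually add_increasing2)
  ultimately have "(\<lambda>n. (1 / norm (t + h n - t)) *\<^sub>R (f (t + h n) - (f t + (t + h n - t) *\<^sub>R f'))) \<longlonglongrightarrow> 0"
    by (rule filterlim_compose)
  moreover have "(1 / norm (t + h n - t)) *\<^sub>R (f (t + h n) - (f t + (t + h n - t) *\<^sub>R f'))
      = (1 / h n) *\<^sub>R (f (t + h n) - f t) - f'" for n
  proof -
    have "0 < h n" by (simp add: h_def)
    then show ?thesis by (simp add: scaleR_diff_right scaleR_add_right)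
  qed
  ultimately show ?thesis
    unfolding h_def by (simp add: LIM_zero_cancel)
qed

section \<open>Mild solutions and propagation of regularity\<close>

context history_system
begin

definition mild where
  "mild V0 W V \<longleftrightarrow> W 0 = 0 \<and> (\<forall>t\<ge>0. (W has_vector_derivative V t) (at t within {0..})) \<and>
    (\<forall>t\<ge>0. gen (W t) (V t - V0))"
  for V0 :: "'x \<times> 'x \<times> 'x \<times> 'x \<times> 'x \<times> 'y" and W V :: "real \<Rightarrow> 'x \<times> 'x \<times> 'x \<times> 'x \<times> 'x \<times> 'y"

lemma mild_initial: "mild V0 W V \<Longrightarrow> V 0 = V0"
  using gen_zero[of "V 0 - V0"] unfolding mild_def by force

definition CE where "CE = sqrt (cmax / cmin)"

lemma CE_pos: "0 < CE"
  using cmin_pos cmax_pos by (simp add: CE_def)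

lemma norm_le_if_en_le:
  assumes "en x x \<le> en y y"
  shows "norm x \<le> CE * norm y"
proof (rule power2_le_imp_le)
  have "cmin * (norm x)\<^sup>2 \<le> cmax * (norm y)\<^sup>2"
    using en_bounds(1)[of x] en_bounds(2)[of y] assms by linarith
  then show "(norm x)\<^sup>2 \<le> (CE * norm y)\<^sup>2"
    using cmin_pos cmax_pos by (simp add: CE_def power_mult_distrib field_simps)
qed (use CE_pos in simp)

definition quot :: "(real \<Rightarrow> 'x \<times> 'x \<times> 'x \<times> 'x \<times> 'x \<times> 'y) \<Rightarrow> real \<Rightarrow> real \<Rightarrow> 'x \<times> 'x \<times> 'x \<times> 'x \<times> 'x \<times> 'y" where
  "quot W h t = (1 / h) *\<^sub>R (W (t + h) - W t)"

text \<open>Difference quotients of the time integral of a mild solution are classical solutions.\<close>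

lemma quot_classical:
  assumes m: "mild V0 W V" and h: "0 < h" and t: "0 \<le> t"
  shows "(quot W h has_vector_derivative quot V h t) (at t within {0..})" "gen (quot W h t) (quot V h t)"
proof -
  have W: "(W has_vector_derivative V t) (at t within {0..})" if "0 \<le> t" for t
    using m that by (auto simp: mild_def)
  have "(W \<circ> (\<lambda>t. t + h) has_vector_derivative 1 *\<^sub>R V (t + h)) (at t within {0..})"
  proof (rule vector_diff_chain_within)
    show "((\<lambda>t. t + h) has_vector_derivative 1) (at t within {0..})"
      by (auto intro!: derivative_eq_intros simp: has_vector_derivative_def)
    show "(W has_vector_derivative V (t + h)) (at (t + h) within (\<lambda>t. t + h) ` {0..})"
      by (rule has_vector_derivative_within_subset[OF W]) (use h t in auto)
  qed
  then have "((\<lambda>t. W (t + h) - W t) has_vector_derivative V (t + h) - V t) (at t within {0..})"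
    by (intro has_vector_derivative_diff W t) (simp add: o_def)
  then show "(quot W h has_vector_derivative quot V h t) (at t within {0..})"
    unfolding quot_def[abs_def] by (rule bounded_linear.has_vector_derivative[OF bounded_linear_scaleR_right])
  have "gen (W (t + h) - W t) ((V (t + h) - V0) - (V t - V0))"
    using m h t by (intro gen_diff) (auto simp: mild_def)
  then show "gen (quot W h t) (quot V h t)"
    unfolding quot_def by (intro gen_scaleR) simp
qed

lemma admissible_bounded_linear: "admissible B \<Longrightarrow> bounded_linear B"
  by (simp add: admissible_def commutes_with_def)

lemma quot_contraction:
  assumes m: "mild V0 W V" and h: "0 < h" and t: "0 \<le> t" and B: "admissible B"
  shows "norm (B (quot W h t)) \<le> CE * norm (B (quot W h 0))"
proof -
  have "en (B (quot W h t)) (B (quot W h t)) \<le> en (B (quot W h 0)) (B (quot W h 0))"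
  proof (rule nonincreasing_if_derivative[where f' = "\<lambda>t. 2 * en (B (quot W h t)) (B (quot V h t))"])
    fix t :: real assume t: "0 \<le> t"
    note c = quot_classical[OF m h t]
    show "((\<lambda>t. en (B (quot W h t)) (B (quot W h t))) has_real_derivative 2 * en (B (quot W h t)) (B (quot V h t)))
        (at t within {0..})"
      by (rule en_has_derivative bounded_linear.has_vector_derivative[OF admissible_bounded_linear[OF B]] c)+
    show "2 * en (B (quot W h t)) (B (quot V h t)) \<le> 0"
      using gen_dissipative[of "B (quot W h t)" "B (quot V h t)"] B c(2) unfolding admissible_def by auto
  qed (rule t)
  then show ?thesis by (rule norm_le_if_en_le)
qed

lemma quot_tendsto:
  assumes m: "mild V0 W V" and t: "0 \<le> t"
  shows "(\<lambda>n. quot W (1 / real (Suc n)) t) \<longlonglongrightarrow> V t"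
  using has_vector_derivative_sequence[of W "V t" t 0] m t by (simp add: quot_def mild_def)

text \<open>The energy of \<open>B\<close> applied to a difference quotient of \<open>W\<close> is
  nonincreasing, as these quotients are classical solutions; the inequality is closed in the limit
  \<open>h\<close> to 0. \<open>CE\<close> converts energy into norm.\<close>

lemma mild_contraction:
  assumes m: "mild V0 W V" and t: "0 \<le> t" and B: "admissible B"
  shows "norm (B (V t)) \<le> CE * norm (B V0)"
proof (rule LIMSEQ_le)
  note l = bounded_linear.tendsto[OF admissible_bounded_linear[OF B]]
  show "(\<lambda>n. norm (B (quot W (1 / real (Suc n)) t))) \<longlonglongrightarrow> norm (B (V t))"
    by (intro tendsto_norm l quot_tendsto[OF m t])
  show "(\<lambda>n. CE * norm (B (quot W (1 / real (Suc n)) 0))) \<longlonglongrightarrow> CE * norm (B V0)"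
    using quot_tendsto[OF m, of 0] mild_initial[OF m] by (intro tendsto_mult tendsto_const tendsto_norm l) auto
  show "\<exists>N. \<forall>n\<ge>N. norm (B (quot W (1 / real (Suc n)) t)) \<le> CE * norm (B (quot W (1 / real (Suc n)) 0))"
    using quot_contraction[OF m _ t B] by auto
qed

text \<open>Everything the evolution guarantees about a later state relative to the data, for all
  multipliers at once. It covers differences of difference quotients, hence regularity, and
  averages, hence the low frequencies.\<close>

definition dominated where
  "dominated V0 x \<longleftrightarrow> (\<forall>B. admissible B \<longrightarrow> norm (B x) \<le> CE * norm (B V0))"

lemma dominated_mild: "mild V0 W V \<Longrightarrow> 0 \<le> t \<Longrightarrow> dominated V0 (V t)"
  using mild_contraction unfolding dominated_def by blast

text \<open>The difference quotient of \<open>W\<close> is the mean of \<open>V\<close> over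
  \<open>{t..t + h}\<close>, so the mean value inequality carries the bound for \<open>V\<close>
  over to it.\<close>

lemma dominated_quot:
  assumes m: "mild V0 W V" and h: "0 < h" and t: "0 \<le> t"
  shows "dominated V0 (quot W h t)"
  unfolding dominated_def
proof (intro allI impI)
  fix B assume B: "admissible B"
  note bl = admissible_bounded_linear[OF B]
  have "norm (B (W (t + h)) - B (W t)) \<le> (CE * norm (B V0)) * norm ((t + h) - t)"
  proof (rule differentiable_bound[where f' = "\<lambda>s u. u *\<^sub>R B (V s)" and S = "{t..t + h}"])
    fix s assume s: "s \<in> {t..t + h}"
    have "(W has_vector_derivative V s) (at s within {t..t + h})"
      by (rule has_vector_derivative_within_subset[of _ _ _ "{0..}"]) (use m s t in \<open>auto simp: mild_def\<close>)
    from bounded_linear.has_vector_derivative[OF bl this]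
    show "((\<lambda>s. B (W s)) has_derivative (\<lambda>u. u *\<^sub>R B (V s))) (at s within {t..t + h})"
      by (simp add: has_vector_derivative_def)
    show "onorm (\<lambda>u. u *\<^sub>R B (V s)) \<le> CE * norm (B V0)"
      using mild_contraction[OF m _ B, of s] s t CE_pos
      by (intro onorm_le) (auto simp: mult.commute mult_left_mono)
  qed (use h in auto)
  then show "norm (B (quot W h t)) \<le> CE * norm (B V0)"
  proof -
    have "B (quot W h t) = (1 / h) *\<^sub>R (B (W (t + h)) - B (W t))"
      by (simp add: quot_def linear_scale linear_diff bounded_linear.linear[OF bl])
    then have "norm (B (quot W h t)) = norm (B (W (t + h)) - B (W t)) / h"
      using h by simp
    then show ?thesis
      using \<open>norm (B (W (t + h)) - B (W t)) \<le> _\<close> h by (simp add: pos_divide_le_eq)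
  qed
qed

text \<open>The difference of two difference quotients is again an admissible operator, so
  \<open>dern_dominated\<close> applies with the data as comparison vector.\<close>

lemma dominated_dern:
  assumes x: "dominated V0 x" and d: "dern TH n V0 y0"
  obtains y where "dern TH n x y" "norm y \<le> CE * norm y0"
proof -
  note a = admissible_funpow[OF admissible_diffq]
  have "norm ((diffq TH r ^^ i) x - (diffq TH r' ^^ i) x) \<le> CE * norm ((diffq TH r ^^ i) V0 - (diffq TH r' ^^ i) V0)" for i r r'
    using x admissible_diff[OF a[of i r] a[of i r']] unfolding dominated_def by blast
  then obtain y where y: "dern TH n x y"
    using H.dern_dominated[OF d] by blast
  have "norm y \<le> CE * norm y0"
    by (rule H.dern_norm_le[OF y d]) (use x a in \<open>auto simp: dominated_def\<close>)
  then show ?thesis using that y by blast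
qed

section \<open>Splitting of frequencies and decay\<close>

text \<open>The three terms are low, high and intermediate frequencies. By interpolation only the
  orders 0 and 3 matter. Order 0 is compared with order 2 by averaging and uses the smallness of
  averages of the data; order 3 is compared with order 2 by \<open>l\<close> more derivatives. The
  constant is uniform in the step \<tau>, which is to tend to 0.\<close>

lemma sq4_smoothing:
  fixes j l :: nat
  shows "\<exists>C>0. \<forall>V0 x M0 N \<tau> \<rho>. dominated V0 x \<and> dern TH (j + l) V0 M0 \<and> 0 \<le> N \<and> (\<forall>r>0. norm (avg TH r V0) \<le> N / sqrt r) \<and>
      0 < \<tau> \<and> 0 < \<rho> \<longrightarrow>
      sq4 (\<lambda>i. H.smoothing i ((diffq TH \<tau> ^^ j) x)) \<le> C * (\<rho> powr (- 2 * (real j / 2 + 1 / 4)) * N\<^sup>2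
        + \<rho> powr (- 2 * real l) * (norm M0)\<^sup>2 + \<rho>\<^sup>2 * (norm (H.smoothing 2 ((diffq TH \<tau> ^^ j) x)))\<^sup>2)"
proof -
  define A where "A = 2 * 2 ^ j * CE"
  define B where "B = 27 * CE"
  define n where "n = (real (Suc j))\<^sup>2"
  define C where "C = 11 * (2 * A\<^sup>2 + 2 * B\<^sup>2 + 2 * n\<^sup>2 + 2)"
  have pos: "0 < A" "0 < B" "0 < n" using CE_pos by (auto simp: A_def B_def n_def)
  have "0 < C" by (auto simp: C_def intro!: add_nonneg_pos)
  moreover have "sq4 (\<lambda>i. H.smoothing i ((diffq TH \<tau> ^^ j) x)) \<le> C * (\<rho> powr (- 2 * (real j / 2 + 1 / 4)) * N\<^sup>2
        + \<rho> powr (- 2 * real l) * (norm M0)\<^sup>2 + \<rho>\<^sup>2 * (norm (H.smoothing 2 ((diffq TH \<tau> ^^ j) x)))\<^sup>2)"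
    if dom: "dominated V0 x" and M0: "dern TH (j + l) V0 M0" and N: "0 \<le> N"
      and low: "\<forall>r>0. norm (avg TH r V0) \<le> N / sqrt r" and \<tau>: "0 < \<tau>" and \<rho>: "0 < \<rho>"
    for V0 x M0 N \<tau> \<rho>
  proof -
    define g where "g = (diffq TH \<tau> ^^ j) x"
    define G where "G = (\<lambda>i. H.smoothing i g)"
    \<comment> \<open>Order 0 is two derivatives away from order 2, so an averaging length
      \<open>sqrt \<rho>\<close> costs the factor \<rho>; at order 3, one derivative away, the
      cutoff is \<rho> itself.\<close>
    define r where "r = sqrt \<rho>"
    have r: "0 < r" "r\<^sup>2 = \<rho>" using \<rho> by (auto simp: r_def)
    have d: "tder TH (G 0) (G 1)" "tder TH (G 1) (G 2)" "tder TH (G 2) (G 3)"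
      using H.tder_smoothing[of 0 g] H.tder_smoothing[of 1 g] H.tder_smoothing[of 2 g] by (auto simp: G_def eval_nat_numeral)
    have G0: "norm (G 0) \<le> A * \<rho> powr (- (real j / 2 + 1 / 4)) * N + n * \<rho> * norm (G 2)"
    proof -
      \<comment> \<open>Of the \<open>j + 1\<close> averages, \<open>j\<close> are exchanged against
        the difference quotients, replacing the step \<tau> by \<open>r\<close>; the last one acts
        on the state and meets the bound on averages of the data.\<close>
      have "(avg TH r ^^ Suc j) (G 0) = H.smoothing 0 ((avg TH r ^^ Suc j) g)"
        unfolding G_def by (rule H.avg_funpow_commute[OF H.commutes_smoothing])
      also have "(avg TH r ^^ Suc j) g = avg TH r ((avg TH \<tau> ^^ j) ((diffq TH r ^^ j) x))"
        using H.avg_diffq_exchange[OF r(1) \<tau>, of j x] by (simp add: g_def)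
      also have "\<dots> = (avg TH \<tau> ^^ j) ((diffq TH r ^^ j) (avg TH r x))"
        using H.commutes_funpow[OF H.commutes_avg, of \<tau> j] \<tau> H.commutes_funpow[OF H.commutes_diffq, of j r]
        by (simp add: H.avg_commute)
      finally have eq: "(avg TH r ^^ Suc j) (G 0) = H.smoothing 0 ((avg TH \<tau> ^^ j) ((diffq TH r ^^ j) (avg TH r x)))" .
      have "norm ((avg TH r ^^ Suc j) (G 0)) \<le> norm ((diffq TH r ^^ j) (avg TH r x))"
        unfolding eq by (rule order_trans[OF H.norm_P_pow3 H.norm_avg_funpow[OF \<tau>]])
      also have "\<dots> \<le> (2 / r) ^ j * norm (avg TH r x)"
        by (rule H.norm_diffq_funpow[OF r(1)])
      also have "\<dots> \<le> (2 / r) ^ j * (CE * (N / sqrt r))"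
      proof (intro mult_left_mono)
        have "norm (avg TH r x) \<le> CE * norm (avg TH r V0)"
          using dom admissible_avg[OF r(1)] by (simp add: dominated_def)
        also have "\<dots> \<le> CE * (N / sqrt r)"
          using low r(1) CE_pos by (intro mult_left_mono) auto
        finally show "norm (avg TH r x) \<le> CE * (N / sqrt r)" .
      qed (use r in auto)
      also have "\<dots> = 2 ^ j * CE * N * \<rho> powr (- (real j / 2 + 1 / 4))"
      proof -
        have "r ^ j = \<rho> powr (real j / 2)" "sqrt r = \<rho> powr (1 / 4)"
          using \<rho> by (simp_all add: r_def powr_half_sqrt[symmetric] powr_powr powr_realpow[symmetric])
        then have "(2 / r) ^ j * (CE * (N / sqrt r)) = 2 ^ j * CE * N / (\<rho> powr (real j / 2) * \<rho> powr (1 / 4))"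
          by (simp add: power_divide)
        also have "\<rho> powr (real j / 2) * \<rho> powr (1 / 4) = \<rho> powr (real j / 2 + 1 / 4)"
          by (simp add: powr_add)
        finally show ?thesis by (simp add: powr_minus field_simps)
      qed
      finally have "norm ((avg TH r ^^ Suc j) (G 0)) \<le> 2 ^ j * CE * N * \<rho> powr (- (real j / 2 + 1 / 4))" .
      moreover have "norm (G 0) \<le> 2 * norm ((avg TH r ^^ Suc j) (G 0)) + (real (Suc j) * r)\<^sup>2 * norm (G 2)"
        by (rule H.interpolation_low[OF d(1,2) r(1)])
      moreover have "(real (Suc j) * r)\<^sup>2 = n * \<rho>" using r by (simp add: n_def power_mult_distrib)
      ultimately show ?thesis by (simp add: A_def mult_ac)
    qed
    have G3: "norm (G 3) \<le> \<rho> * norm (G 2) + B * (norm M0) * \<rho> powr (- real l)"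
    proof -
      \<comment> \<open>The later state inherits \<open>j + l\<close> derivatives from the data. The
        quotient of step \<tau> consumes \<open>j\<close> of them and turns into an average, leaving
        \<open>l\<close> for \<open>interpolation_high\<close>.\<close>
      obtain y where y: "dern TH (j + l) x y" "norm y \<le> CE * norm M0"
        using dominated_dern[OF dom M0] by blast
      then obtain xj where xj: "dern TH j x xj" "dern TH l xj y"
        by (auto simp: H.dern_append)
      have "g = (avg TH \<tau> ^^ j) xj"
        unfolding g_def by (rule H.diffq_funpow_eq_avg[OF xj(1) \<tau>])
      then have "dern TH l (G 3) (H.smoothing 3 ((avg TH \<tau> ^^ j) y))"
        unfolding G_def
        using H.dern_commutes[OF H.commutes_smoothing H.dern_commutes[OF H.commutes_funpow[OF H.commutes_avg] xj(2)]] \<tau>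
        by simp
      from H.interpolation_high[OF d(3) this \<rho>]
      have "norm (G 3) \<le> \<rho> * norm (G 2) + norm (H.smoothing 3 ((avg TH \<tau> ^^ j) y)) / \<rho> ^ l" .
      moreover have "norm (H.smoothing 3 ((avg TH \<tau> ^^ j) y)) \<le> B * norm M0"
        using H.norm_smoothing_3[of "(avg TH \<tau> ^^ j) y"] H.norm_avg_funpow[OF \<tau>, of j y] y(2) by (simp add: B_def)
      then have "norm (H.smoothing 3 ((avg TH \<tau> ^^ j) y)) / \<rho> ^ l \<le> B * norm M0 / \<rho> ^ l"
        using \<rho> by (intro divide_right_mono) auto
      ultimately show ?thesis using \<rho> by (simp add: powr_minus powr_realpow field_simps)
    qed
    have sq: "(x + y)\<^sup>2 \<le> 2 * x\<^sup>2 + 2 * y\<^sup>2" for x y :: real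
      using sum_squares_bound[of x y] by (simp add: power2_sum)
    have pw: "(\<rho> powr (- e))\<^sup>2 = \<rho> powr (- 2 * e)" for e
      by (simp add: power2_eq_square powr_add[symmetric])
    have G0sq: "(norm (G 0))\<^sup>2 \<le> 2 * A\<^sup>2 * (\<rho> powr (- 2 * (real j / 2 + 1 / 4)) * N\<^sup>2) + 2 * n\<^sup>2 * (\<rho>\<^sup>2 * (norm (G 2))\<^sup>2)"
    proof -
      have "(norm (G 0))\<^sup>2 \<le> (A * \<rho> powr (- (real j / 2 + 1 / 4)) * N + n * \<rho> * norm (G 2))\<^sup>2"
        by (rule power_mono[OF G0]) simp
      also have "\<dots> \<le> 2 * (A * \<rho> powr (- (real j / 2 + 1 / 4)) * N)\<^sup>2 + 2 * (n * \<rho> * norm (G 2))\<^sup>2" by (rule sq)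
      finally show ?thesis unfolding power_mult_distrib pw by (simp add: mult_ac)
    qed
    have G3sq: "(norm (G 3))\<^sup>2 \<le> 2 * (\<rho>\<^sup>2 * (norm (G 2))\<^sup>2) + 2 * B\<^sup>2 * (\<rho> powr (- 2 * real l) * (norm M0)\<^sup>2)"
    proof -
      have "(norm (G 3))\<^sup>2 \<le> (\<rho> * norm (G 2) + B * (norm M0) * \<rho> powr (- real l))\<^sup>2"
        by (rule power_mono[OF G3]) simp
      also have "\<dots> \<le> 2 * (\<rho> * norm (G 2))\<^sup>2 + 2 * (B * (norm M0) * \<rho> powr (- real l))\<^sup>2" by (rule sq)
      finally show ?thesis unfolding power_mult_distrib pw by (simp add: mult_ac)
    qed
    have G2sq: "(norm (G 2))\<^sup>2 \<le> 2 * (norm (G 0))\<^sup>2 + 2 * (norm (G 3))\<^sup>2"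
      by (rule order_trans[OF power_mono[OF H.interpolation_two_thirds(1)[OF d] norm_ge_zero] sq])
    have G1sq: "(norm (G 1))\<^sup>2 \<le> 8 * (norm (G 0))\<^sup>2 + 2 * (norm (G 3))\<^sup>2"
    proof -
      have "(norm (G 1))\<^sup>2 \<le> 2 * (2 * norm (G 0))\<^sup>2 + 2 * (norm (G 3))\<^sup>2"
        by (rule order_trans[OF power_mono[OF H.interpolation_two_thirds(2)[OF d] norm_ge_zero] sq])
      then show ?thesis by (simp add: power_mult_distrib)
    qed
    define a1 where "a1 = \<rho> powr (- 2 * (real j / 2 + 1 / 4)) * N\<^sup>2"
    define a2 where "a2 = \<rho> powr (- 2 * real l) * (norm M0)\<^sup>2"
    define a3 where "a3 = \<rho>\<^sup>2 * (norm (G 2))\<^sup>2"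
    have a: "0 \<le> a1" "0 \<le> a2" "0 \<le> a3" by (auto simp: a1_def a2_def a3_def)
    \<comment> \<open>The coefficient of the square of order 0 is 1 + 8 + 2; that of order 3 is 1 +
      2 + 2.\<close>
    have "sq4 G \<le> 11 * ((norm (G 0))\<^sup>2 + (norm (G 3))\<^sup>2)"
      using G1sq G2sq zero_le_power2[of "norm (G 3)"] unfolding sq4_def by argo
    also have "\<dots> \<le> 11 * ((2 * A\<^sup>2 * a1 + 2 * n\<^sup>2 * a3) + (2 * a3 + 2 * B\<^sup>2 * a2))"
      using G0sq G3sq unfolding a1_def[symmetric] a2_def[symmetric] a3_def[symmetric] by simp
    also have "\<dots> \<le> C * (a1 + a2 + a3)"
    proof -
      have "2 * A\<^sup>2 * a1 \<le> (2 * A\<^sup>2 + 2 * B\<^sup>2 + 2 * n\<^sup>2 + 2) * a1" "2 * B\<^sup>2 * a2 \<le> (2 * A\<^sup>2 + 2 * B\<^sup>2 + 2 * n\<^sup>2 + 2) * a2"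
        "(2 * n\<^sup>2 + 2) * a3 \<le> (2 * A\<^sup>2 + 2 * B\<^sup>2 + 2 * n\<^sup>2 + 2) * a3"
        using a by (intro mult_right_mono; simp)+
      then show ?thesis by (simp add: C_def algebra_simps)
    qed
    finally show ?thesis by (simp add: G_def g_def a1_def a2_def a3_def)
  qed
  ultimately show ?thesis by blast
qed

text \<open>The functional is evaluated on smoothed difference quotients, of order \<open>j\<close>
  in x with step \<tau> and of order one in time with step \<open>h\<close>. These satisfy the
  equation classically without assumptions on the solution, and the bound contains neither step;
  \<open>h\<close> tends to 0 before \<tau>.\<close>

theorem mild_decay:
  fixes j l :: nat
  shows "\<exists>C>0. \<forall>V0 W V N M0 t y. mild V0 W V \<and> dern TH (j + l) V0 M0 \<and> 0 \<le> N \<and>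
      (\<forall>r>0. norm (avg TH r V0) \<le> N / sqrt r) \<and> 0 \<le> t \<and> dern TH j (V t) y \<longrightarrow>
      norm y \<le> C * (1 + t) powr (- 1 / 8 - real j / 4) * N + C * (1 + t) powr (- real l / 2) * norm M0"
proof (rule dissipation)
  fix n1 nz nv c N1 :: real
  assume n: "0 < n1" "0 < nz" "0 < nv" "0 < c" "0 < N1" and
    diss: "\<And>n0 G F. N1 \<le> n0 \<Longrightarrow> (\<And>i. i < 3 \<Longrightarrow> tder TH (G i) (G (Suc i))) \<Longrightarrow> (\<And>i. i \<le> 3 \<Longrightarrow> gen (G i) (F i)) \<Longrightarrow>
      n0 * (en (G 0) (F 0) + en (G 1) (F 1) + en (G 2) (F 2) + en (G 3) (F 3))
      + n1 * (pol1 F G + pol1 G F) + nz * (polz F G + polz G F) + nv * (polv F G + polv G F) + (polu F G + polu G F)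
      \<le> - c * (norm (G 2))\<^sup>2"
  obtain K where K: "0 < K" "\<And>G. \<bar>n1 * pol1 G G + nz * polz G G + nv * polv G G + polu G G\<bar> \<le> K * sq4 G"
    using pol_bound[of n1 nz nv] by blast
  \<comment> \<open>Large enough for \<open>dissipation\<close>, and such that half of the energies
    exceeds the correlations by a full \<open>sq4\<close>.\<close>
  define n0 where "n0 = max N1 (2 * (K + 1) / cmin)"
  have "2 * (K + 1) / cmin \<le> n0" "N1 \<le> n0" by (simp_all add: n0_def)
  then have n0: "N1 \<le> n0" "K + 1 \<le> n0 / 2 * cmin" "0 < n0"
    using cmin_pos n by (simp_all add: pos_divide_le_eq)
  \<comment> \<open>The factor 1/2 offsets the 2 in the derivative of \<open>en w w\<close>, so the
    derivative of \<open>L\<close> is the expression in \<open>dissipation\<close>.\<close>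
  define L where "L G = n0 / 2 * (en (G 0) (G 0) + en (G 1) (G 1) + en (G 2) (G 2) + en (G 3) (G 3))
    + (n1 * pol1 G G + nz * polz G G + nv * polv G G + polu G G)" for G
  define KL where "KL = n0 / 2 * cmax + K"
  have KL: "0 < KL" using n0 cmax_pos K by (simp add: KL_def add_pos_pos)
  have L: "sq4 G \<le> L G" "L G \<le> KL * sq4 G" for G
  proof -
    have nn: "0 \<le> sq4 G" by (simp add: sq4_def)
    let ?E = "en (G 0) (G 0) + en (G 1) (G 1) + en (G 2) (G 2) + en (G 3) (G 3)"
    have "cmin * sq4 G \<le> ?E" "?E \<le> cmax * sq4 G"
      using en_bounds(1)[of "G 0"] en_bounds(1)[of "G 1"] en_bounds(1)[of "G 2"] en_bounds(1)[of "G 3"]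
        en_bounds(2)[of "G 0"] en_bounds(2)[of "G 1"] en_bounds(2)[of "G 2"] en_bounds(2)[of "G 3"]
      unfolding sq4_def distrib_left by linarith+
    then have "n0 / 2 * (cmin * sq4 G) \<le> n0 / 2 * ?E" "n0 / 2 * ?E \<le> n0 / 2 * (cmax * sq4 G)"
      using n0 by (auto intro: mult_left_mono)
    moreover have "(K + 1) * sq4 G \<le> n0 / 2 * cmin * sq4 G"
      by (rule mult_right_mono[OF n0(2) nn])
    ultimately show "sq4 G \<le> L G" "L G \<le> KL * sq4 G"
      using K(2)[of G] unfolding L_def KL_def distrib_right by (auto simp: abs_le_iff)
  qed
  obtain C0 where C0: "0 < C0" and sq4: "\<And>V0 x M0 N \<tau> \<rho>. dominated V0 x \<Longrightarrow> dern TH (j + l) V0 M0 \<Longrightarrow> 0 \<le> N \<Longrightarrow>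
      (\<forall>r>0. norm (avg TH r V0) \<le> N / sqrt r) \<Longrightarrow> 0 < \<tau> \<Longrightarrow> 0 < \<rho> \<Longrightarrow>
      sq4 (\<lambda>i. H.smoothing i ((diffq TH \<tau> ^^ j) x)) \<le> C0 * (\<rho> powr (- 2 * (real j / 2 + 1 / 4)) * N\<^sup>2
        + \<rho> powr (- 2 * real l) * (norm M0)\<^sup>2 + \<rho>\<^sup>2 * (norm (H.smoothing 2 ((diffq TH \<tau> ^^ j) x)))\<^sup>2)"
    using sq4_smoothing[of j l] by blast
  \<comment> \<open>The functional is quadratic: the exponents here are twice the final ones, and
    the squares of the two norms take the places of \<open>N\<close> and \<open>M\<close>.\<close>
  obtain K1 where K1: "0 < K1" and split: "\<And>f f' X N M t.
    \<forall>t\<ge>0. (f has_real_derivative f' t) (at t within {0..}) \<Longrightarrow> \<forall>t\<ge>0. f' t \<le> - c * X t \<Longrightarrow>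
    \<forall>t\<ge>0. X t \<le> f t \<Longrightarrow> 0 \<le> N \<Longrightarrow> 0 \<le> M \<Longrightarrow>
    \<forall>t\<ge>0. \<forall>\<rho>>0. f t \<le> (KL * C0) * (\<rho> powr (- 2 * (real j / 2 + 1 / 4)) * N + \<rho> powr (- 2 * real l) * M + \<rho>\<^sup>2 * X t) \<Longrightarrow>
    0 \<le> t \<Longrightarrow> f t \<le> K1 * ((1 + t) powr (- (real j / 2 + 1 / 4)) * N + (1 + t) powr (- real l) * M)"
    using splitting_decay[of c "KL * C0" "real j / 2 + 1 / 4" "real l"] n(4) KL C0 by auto
  \<comment> \<open>24 from \<open>norm_le_smoothing\<close>, and 2 from squaring a sum of four
    terms.\<close>
  define C where "C = 48 * sqrt K1"
  have C: "0 < C" using K1 by (simp add: C_def)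
  have q: "norm ((diffq TH \<tau> ^^ j) (quot W h t))
      \<le> C * (1 + t) powr (- 1 / 8 - real j / 4) * N + C * (1 + t) powr (- real l / 2) * norm M0"
    if m: "mild V0 W V" and M0: "dern TH (j + l) V0 M0" and N: "0 \<le> N"
      and low: "\<forall>r>0. norm (avg TH r V0) \<le> N / sqrt r" and t: "0 \<le> t" and h: "0 < h" and \<tau>: "0 < \<tau>"
    for V0 W V N M0 t h \<tau>
  proof -
    define S where "S i x = H.smoothing i ((diffq TH \<tau> ^^ j) x)" for i x
    have adm: "admissible (S i)" for i
      unfolding S_def by (rule admissible_compose[OF admissible_smoothing admissible_funpow[OF admissible_diffq]])
    define G where "G t i = S i (quot W h t)" for t i
    define F where "F t i = S i (quot V h t)" for t i
    define X where "X t = (norm (G t 2))\<^sup>2" for t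
    have Gt: "tder TH (G t i) (G t (Suc i))" if "i < 3" for i t
      unfolding G_def S_def by (rule H.tder_smoothing[OF that])
    have GF: "gen (G t i) (F t i)" if "0 \<le> t" for i t
      using adm[of i] quot_classical(2)[OF m h that] unfolding G_def F_def admissible_def by blast
    have dG: "((\<lambda>t. G t i) has_vector_derivative F t i) (at t within {0..})" if "0 \<le> t" for i t
      unfolding G_def F_def
      by (rule bounded_linear.has_vector_derivative[OF admissible_bounded_linear[OF adm] quot_classical(1)[OF m h that]])
    define L' where "L' t = n0 * (en (G t 0) (F t 0) + en (G t 1) (F t 1) + en (G t 2) (F t 2) + en (G t 3) (F t 3))
      + n1 * (pol1 (F t) (G t) + pol1 (G t) (F t)) + nz * (polz (F t) (G t) + polz (G t) (F t))
      + nv * (polv (F t) (G t) + polv (G t) (F t)) + (polu (F t) (G t) + polu (G t) (F t))" for t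
    have "L (G t) \<le> K1 * ((1 + t) powr (- (real j / 2 + 1 / 4)) * N\<^sup>2 + (1 + t) powr (- real l) * (norm M0)\<^sup>2)"
    proof (rule split[where f' = L' and X = X])
      show "\<forall>t\<ge>0. ((\<lambda>t. L (G t)) has_real_derivative L' t) (at t within {0..})"
      proof (intro allI impI)
        fix t :: real assume t: "0 \<le> t"
        note e = en_has_derivative[OF dG[OF t]] and p = pol_has_derivative[of G, OF dG[OF t]]
        show "((\<lambda>t. L (G t)) has_real_derivative L' t) (at t within {0..})"
          unfolding L_def L'_def
          by (rule DERIV_cong, ((rule DERIV_add DERIV_cmult e p)+)[1]) (simp add: algebra_simps)
      qed
      show "\<forall>t\<ge>0. L' t \<le> - c * X t"
        unfolding L'_def X_def by (intro allI impI diss[OF n0(1)] Gt GF)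
      show "\<forall>t\<ge>0. X t \<le> L (G t)"
      proof (intro allI impI)
        fix t :: real
        have "X t \<le> sq4 (G t)" by (simp add: X_def sq4_def)
        then show "X t \<le> L (G t)" using L(1) by (rule order_trans)
      qed
      show "\<forall>t\<ge>0. \<forall>\<rho>>0. L (G t) \<le> (KL * C0) * (\<rho> powr (- 2 * (real j / 2 + 1 / 4)) * N\<^sup>2 + \<rho> powr (- 2 * real l) * (norm M0)\<^sup>2 + \<rho>\<^sup>2 * X t)"
      proof (intro allI impI)
        fix t \<rho> :: real assume t: "0 \<le> t" and \<rho>: "0 < \<rho>"
        have "L (G t) \<le> KL * sq4 (G t)" by (rule L(2))
        also have "sq4 (G t) \<le> C0 * (\<rho> powr (- 2 * (real j / 2 + 1 / 4)) * N\<^sup>2 + \<rho> powr (- 2 * real l) * (norm M0)\<^sup>2 + \<rho>\<^sup>2 * X t)"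
          using sq4[OF dominated_quot[OF m h t] M0 N low \<tau> \<rho>] by (simp add: G_def[abs_def] X_def S_def)
        finally show "L (G t) \<le> (KL * C0) * (\<rho> powr (- 2 * (real j / 2 + 1 / 4)) * N\<^sup>2 + \<rho> powr (- 2 * real l) * (norm M0)\<^sup>2 + \<rho>\<^sup>2 * X t)"
          using KL by (simp add: mult.assoc)
      qed
    qed (use t in auto)
    then have sqG: "sq4 (G t) \<le> K1 * ((1 + t) powr (- (real j / 2 + 1 / 4)) * N\<^sup>2 + (1 + t) powr (- real l) * (norm M0)\<^sup>2)"
      using L(1) by (rule order_trans[rotated])
    define a1 where "a1 = (1 + t) powr (- 1 / 8 - real j / 4) * N"
    define a2 where "a2 = (1 + t) powr (- real l / 2) * norm M0"
    have a: "0 \<le> a1" "0 \<le> a2" using N by (auto simp: a1_def a2_def)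
    have pw: "((1 + t) powr e)\<^sup>2 = (1 + t) powr (2 * e)" for e
      by (simp add: power2_eq_square powr_add[symmetric])
    have "(1 + t) powr (- (real j / 2 + 1 / 4)) * N\<^sup>2 + (1 + t) powr (- real l) * (norm M0)\<^sup>2 = a1\<^sup>2 + a2\<^sup>2"
      unfolding a1_def a2_def power_mult_distrib pw by (simp add: algebra_simps)
    also have "\<dots> \<le> (a1 + a2)\<^sup>2" using a by (simp add: power2_sum)
    finally have "sq4 (G t) \<le> K1 * (a1 + a2)\<^sup>2" using sqG K1 by (meson mult_left_mono less_imp_le order_trans)
    moreover have "(norm ((diffq TH \<tau> ^^ j) (quot W h t)))\<^sup>2 \<le> 24\<^sup>2 * (4 * sq4 (G t))"
    proof -
      have s4: "(x + y + z + w)\<^sup>2 \<le> 4 * (x\<^sup>2 + y\<^sup>2 + z\<^sup>2 + w\<^sup>2)" for x y z w :: real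
        using sum_squares_bound[of x y] sum_squares_bound[of x z] sum_squares_bound[of x w]
          sum_squares_bound[of y z] sum_squares_bound[of y w] sum_squares_bound[of z w]
        by (simp add: power2_eq_square algebra_simps)
      have "(norm ((diffq TH \<tau> ^^ j) (quot W h t)))\<^sup>2 \<le> (24 * (norm (G t 0) + norm (G t 1) + norm (G t 2) + norm (G t 3)))\<^sup>2"
        unfolding G_def S_def by (rule power_mono[OF H.norm_le_smoothing]) simp
      also have "\<dots> \<le> 24\<^sup>2 * (4 * sq4 (G t))"
        unfolding power_mult_distrib sq4_def by (intro mult_left_mono s4) simp
      finally show ?thesis .
    qed
    ultimately have "(norm ((diffq TH \<tau> ^^ j) (quot W h t)))\<^sup>2 \<le> (C * (a1 + a2))\<^sup>2"
      using K1 by (simp add: C_def power_mult_distrib)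
    then have "norm ((diffq TH \<tau> ^^ j) (quot W h t)) \<le> C * (a1 + a2)"
      by (rule power2_le_imp_le) (use C a in auto)
    then show ?thesis by (simp add: a1_def a2_def algebra_simps)
  qed
  have "norm y \<le> C * (1 + t) powr (- 1 / 8 - real j / 4) * N + C * (1 + t) powr (- real l / 2) * norm M0"
    if m: "mild V0 W V" and M0: "dern TH (j + l) V0 M0" and N: "0 \<le> N"
      and low: "\<forall>r>0. norm (avg TH r V0) \<le> N / sqrt r" and t: "0 \<le> t" and y: "dern TH j (V t) y"
    for V0 W V N M0 t y
  proof (rule tendsto_upperbound)
    show "((\<lambda>\<tau>. norm ((diffq TH \<tau> ^^ j) (V t))) \<longlongrightarrow> norm y) (at_right 0)"
      by (intro tendsto_norm H.diffq_funpow_tendsto y)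
    have "norm ((diffq TH \<tau> ^^ j) (V t)) \<le> C * (1 + t) powr (- 1 / 8 - real j / 4) * N + C * (1 + t) powr (- real l / 2) * norm M0"
      if \<tau>: "0 < \<tau>" for \<tau>
    proof (rule LIMSEQ_le_const2)
      show "(\<lambda>k. norm ((diffq TH \<tau> ^^ j) (quot W (1 / real (Suc k)) t))) \<longlonglongrightarrow> norm ((diffq TH \<tau> ^^ j) (V t))"
        by (intro tendsto_norm bounded_linear.tendsto[OF admissible_bounded_linear[OF admissible_funpow[OF admissible_diffq]]]
            quot_tendsto[OF m t])
      show "\<exists>K. \<forall>k\<ge>K. norm ((diffq TH \<tau> ^^ j) (quot W (1 / real (Suc k)) t))
          \<le> C * (1 + t) powr (- 1 / 8 - real j / 4) * N + C * (1 + t) powr (- real l / 2) * norm M0"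
        using q[OF m M0 N low t _ \<tau>] by auto
    qed
    then show "\<forall>\<^sub>F \<tau> in at_right 0. norm ((diffq TH \<tau> ^^ j) (V t)) \<le> C * (1 + t) powr (- 1 / 8 - real j / 4) * N + C * (1 + t) powr (- real l / 2) * norm M0"
      by (auto simp: eventually_at_right_field intro!: exI[of _ 1])
  qed simp
  then show ?thesis using C by blast
qed

lemma mild_dern:
  assumes "mild V0 W V" "dern TH n V0 M0" "0 \<le> t"
  shows "\<exists>y. dern TH n (V t) y"
  using dominated_dern[OF dominated_mild[OF assms(1,3)] assms(2)] by blast

end

section \<open>Square integrable functions\<close>

text \<open>Boxes generate the Borel sets and are stable under intersection, so Dynkin induction
  applies.\<close>

lemma set_integral_zero_if_box:
  fixes h :: "'a::euclidean_space \<Rightarrow> real"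
  assumes h: "integrable lborel h" and box: "\<And>a b. (LINT x:box a b|lborel. h x) = 0"
    and A: "A \<in> sets borel"
  shows "(LINT x:A|lborel. h x) = 0"
proof -
  have si: "set_integrable lborel A h" if "A \<in> sets borel" for A
    unfolding set_integrable_def using integrable_mult_indicator[OF _ h, of A] that by simp
  \<comment> \<open>The complement step of the induction needs the integral over the whole space,
    which is no box; it is obtained by exhaustion with cubes.\<close>
  have total: "(\<integral>x. h x \<partial>lborel) = 0"
  proof -
    have "(\<lambda>n::nat. LINT x:box (- (real n *\<^sub>R One)) (real n *\<^sub>R One)|lborel. h x) \<longlonglongrightarrow> (LINT x:(\<Union>n::nat. box (- (real n *\<^sub>R One)) (real n *\<^sub>R One))|lborel. h x)"
    proof (rule set_integral_cont_up)
      show "incseq (\<lambda>n::nat. box (- (real n *\<^sub>R One)) (real n *\<^sub>R (One::'a)))"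
        unfolding incseq_def
      proof (intro allI impI subsetI)
        fix k n :: nat and x :: 'a
        assume "k \<le> n" and x: "x \<in> box (- (real k *\<^sub>R One)) (real k *\<^sub>R One)"
        then have "real k \<le> real n" by simp
        then show "x \<in> box (- (real n *\<^sub>R One)) (real n *\<^sub>R One)"
          using x by (fastforce simp: mem_box)
      qed
    qed (use si in auto)
    then have "(\<lambda>n::nat. 0) \<longlonglongrightarrow> (LINT x:(UNIV::'a set)|lborel. h x)"
      unfolding box UN_box_eq_UNIV .
    then have "(LINT x:(UNIV::'a set)|lborel. h x) = 0"
      using LIMSEQ_unique tendsto_const by blast
    then show ?thesis by (simp add: set_lebesgue_integral_def)
  qed
  have "Int_stable (range (\<lambda>(a, b). box a b :: 'a set))"
    by (auto simp: Int_stable_def box_Int_box)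
  moreover have "range (\<lambda>(a, b). box a b :: 'a set) \<subseteq> Pow UNIV" by auto
  moreover have "A \<in> sigma_sets UNIV (range (\<lambda>(a, b). box a b))"
    using A by (simp add: borel_eq_box)
  ultimately show ?thesis
  proof (induction rule: sigma_sets_induct_disjoint)
    case (basic A)
    then show ?case using box by auto
  next
    case empty
    then show ?case by (simp add: set_lebesgue_integral_def)
  next
    case (compl A)
    then have A: "A \<in> sets borel" by (simp add: borel_eq_box)
    have "(LINT x:UNIV - A|lborel. h x) = (\<integral>x. h x - indicator A x *\<^sub>R h x \<partial>lborel)"
      unfolding set_lebesgue_integral_def by (intro Bochner_Integration.integral_cong) (auto simp: indicator_def)
    also have "\<dots> = 0"
      using h si[OF A] total compl by (subst Bochner_Integration.integral_diff) (auto simp: set_integrable_def set_lebesgue_integral_def)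
    finally show ?case .
  next
    case (union F)
    then have "\<And>i. F i \<in> sets lborel" by (auto simp: borel_eq_box)
    then have "(LINT x:(\<Union>i. F i)|lborel. h x) = (\<Sum>i. LINT x:F i|lborel. h x)"
      using union(1) by (intro lebesgue_integral_countable_add si) (auto simp: disjoint_family_on_def)
    then show ?case using union by simp
  qed
qed

lemma AE_zero_if_integrable_box:
  fixes h :: "'a::euclidean_space \<Rightarrow> real"
  assumes h: "integrable lborel h" and box: "\<And>a b. (LINT x:box a b|lborel. h x) = 0"
  shows "AE x in lborel. h x = 0"
proof -
  note [measurable] = borel_measurable_integrable[OF h]
  have "AE x in lborel. \<not> 0 < s * h x" if "s = 1 \<or> s = - 1" for s
  proof -
    let ?A = "{x. 0 < s * h x}"
    have A: "?A \<in> sets borel" by measurable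
    have int: "integrable lborel (\<lambda>x. indicator ?A x *\<^sub>R (s * h x))"
      using integrable_mult_indicator[of ?A lborel "\<lambda>x. s * h x"] h A by simp
    have "(\<integral>x. indicator ?A x *\<^sub>R (s * h x) \<partial>lborel) = s * (LINT x:?A|lborel. h x)"
      unfolding set_lebesgue_integral_def by (subst integral_mult_right_zero[symmetric]) (simp add: mult_ac)
    also have "\<dots> = 0" using set_integral_zero_if_box[OF h box A] by simp
    finally have "AE x in lborel. indicator ?A x *\<^sub>R (s * h x) = 0"
      using integral_nonneg_eq_0_iff_AE[OF int] by (auto simp: indicator_def)
    then show ?thesis by (auto simp: indicator_def)
  qed
  from this[of 1] this[of "-1"] show ?thesis by auto
qed

lemma AE_zero_if_box:
  fixes f :: "'a::euclidean_space \<Rightarrow> real"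
  assumes si: "\<And>a b. set_integrable lborel (box a b) f" and box: "\<And>a b. (LINT x:box a b|lborel. f x) = 0"
  shows "AE x in lborel. f x = 0"
proof -
  have "AE x in lborel. x \<in> box (- (real n *\<^sub>R One)) (real n *\<^sub>R One) \<longrightarrow> f x = 0" for n :: nat
  proof -
    let ?B = "box (- (real n *\<^sub>R One)) (real n *\<^sub>R One) :: 'a set"
    have "AE x in lborel. indicator ?B x *\<^sub>R f x = 0"
    proof (rule AE_zero_if_integrable_box)
      show "integrable lborel (\<lambda>x. indicator ?B x *\<^sub>R f x)"
        using si unfolding set_integrable_def .
      show "(LINT x:box a b|lborel. indicator ?B x *\<^sub>R f x) = 0" for a b
      proof -
        obtain c d where cd: "box a b \<inter> ?B = box c d" using box_Int_box by blast
        have "(LINT x:box a b|lborel. indicator ?B x *\<^sub>R f x) = (LINT x:box c d|lborel. f x)"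
          unfolding set_lebesgue_integral_def cd[symmetric]
          by (intro Bochner_Integration.integral_cong) (auto simp: indicator_def)
        then show ?thesis using box by simp
      qed
    qed
    then show ?thesis by (auto simp: indicator_def)
  qed
  then have "AE x in lborel. \<forall>n::nat. x \<in> box (- (real n *\<^sub>R One)) (real n *\<^sub>R One) \<longrightarrow> f x = 0"
    unfolding AE_all_countable by blast
  moreover have "\<exists>n::nat. x \<in> box (- (real n *\<^sub>R One)) (real n *\<^sub>R One)" for x :: 'a
    using UN_box_eq_UNIV by blast
  ultimately show ?thesis by auto
qed

section \<open>The Hilbert space of square integrable functions modulo null sets\<close>

definition sq_integrable :: "('a::euclidean_space \<Rightarrow> real) \<Rightarrow> bool" where
  "sq_integrable f \<longleftrightarrow> f \<in> borel_measurable lborel \<and> integrable lborel (\<lambda>x. (f x)\<^sup>2)"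

lemma sq_integrable_measurable: "sq_integrable f \<Longrightarrow> f \<in> borel_measurable borel"
  by (simp add: sq_integrable_def)

lemma sq_integrable_mult:
  assumes "sq_integrable f" "sq_integrable g"
  shows "integrable lborel (\<lambda>x. f x * g x)"
proof (rule Bochner_Integration.integrable_bound)
  show "integrable lborel (\<lambda>x. (f x)\<^sup>2 + (g x)\<^sup>2)"
    using assms by (simp add: sq_integrable_def)
  show "(\<lambda>x. f x * g x) \<in> borel_measurable lborel"
    using assms by (intro borel_measurable_times) (simp_all add: sq_integrable_def)
  have "\<bar>a * b\<bar> \<le> a\<^sup>2 + b\<^sup>2" for a b :: real
  proof -
    have "2 * \<bar>a * b\<bar> \<le> a\<^sup>2 + b\<^sup>2"
      using sum_squares_bound[of "\<bar>a\<bar>" "\<bar>b\<bar>"] by (simp add: abs_mult mult.assoc)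
    then show ?thesis using abs_ge_zero[of "a * b"] by linarith
  qed
  then show "AE x in lborel. norm (f x * g x) \<le> norm ((f x)\<^sup>2 + (g x)\<^sup>2)"
    by simp
qed

lemma sq_integrable_add: "sq_integrable f \<Longrightarrow> sq_integrable g \<Longrightarrow> sq_integrable (\<lambda>x. f x + g x)"
  using sq_integrable_mult[of f g] by (auto simp: sq_integrable_def power2_sum mult.assoc)

lemma sq_integrable_scale: "sq_integrable f \<Longrightarrow> sq_integrable (\<lambda>x. c * f x)"
  unfolding sq_integrable_def power_mult_distrib by (auto intro: borel_measurable_times)

lemma sq_integrable_minus: "sq_integrable f \<Longrightarrow> sq_integrable (\<lambda>x. - f x)"
  using sq_integrable_scale[of f "- 1"] by simp

lemma sq_integrable_diff: "sq_integrable f \<Longrightarrow> sq_integrable g \<Longrightarrow> sq_integrable (\<lambda>x. f x - g x)"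
  using sq_integrable_add[OF _ sq_integrable_minus, of f g] by simp

lemma sq_integrable_zero: "sq_integrable (\<lambda>x. 0)"
  by (simp add: sq_integrable_def)

lemma sq_integrable_abs: "sq_integrable f \<Longrightarrow> sq_integrable (\<lambda>x. \<bar>f x\<bar>)"
  unfolding sq_integrable_def power2_abs by (auto intro: borel_measurable_abs)

lemma sq_integrable_cong_AE:
  assumes "sq_integrable f" "g \<in> borel_measurable lborel" "AE x in lborel. f x = g x"
  shows "sq_integrable g"
  unfolding sq_integrable_def
proof (intro conjI assms(2))
  have "integrable lborel (\<lambda>x. (f x)\<^sup>2)" using assms(1) by (simp add: sq_integrable_def)
  moreover have "(\<lambda>x. (g x)\<^sup>2) \<in> borel_measurable lborel" using assms(2) by measurable
  moreover have "AE x in lborel. (f x)\<^sup>2 = (g x)\<^sup>2" using assms(3) by eventually_elim simp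
  ultimately show "integrable lborel (\<lambda>x. (g x)\<^sup>2)" by (rule integrable_cong_AE_imp)
qed

\<comment> \<open>A type of its own, so that the results on abstract complete inner product spaces
  apply to function spaces. The domain is left general to cover both the line and the plane.\<close>
quotient_type (overloaded) 'a l2 = "'a::euclidean_space \<Rightarrow> real" /
  partial: "\<lambda>f g. sq_integrable f \<and> sq_integrable g \<and> (AE x in lborel. f x = g x)"
proof (rule part_equivpI)
  show "\<exists>f :: 'a \<Rightarrow> real. sq_integrable f \<and> sq_integrable f \<and> (AE x in lborel. f x = f x)"
    using sq_integrable_zero by (intro exI[of _ "\<lambda>x. 0"]) simp
  show "symp (\<lambda>f g :: 'a \<Rightarrow> real. sq_integrable f \<and> sq_integrable g \<and> (AE x in lborel. f x = g x))"
    by (auto intro!: sympI elim: AE_mp)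
  show "transp (\<lambda>f g :: 'a \<Rightarrow> real. sq_integrable f \<and> sq_integrable g \<and> (AE x in lborel. f x = g x))"
  proof (rule transpI, elim conjE, intro conjI)
    fix f g h :: "'a \<Rightarrow> real"
    assume "AE x in lborel. f x = g x" "AE x in lborel. g x = h x"
    then show "AE x in lborel. f x = h x" by eventually_elim simp
  qed
qed

lemma sq_integrable_rep: "sq_integrable (rep_l2 x)"
  using Quotient_rep_reflp[OF Quotient_l2, of x] by simp

lemma abs_rep: "abs_l2 (rep_l2 x) = x"
  by (rule Quotient_abs_rep[OF Quotient_l2])

lemma abs_eq_iff: "sq_integrable f \<Longrightarrow> sq_integrable g \<Longrightarrow> abs_l2 f = abs_l2 g \<longleftrightarrow> (AE x in lborel. f x = g x)"
  using Quotient_rel[OF Quotient_l2, of f g] by simp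

lemma rep_abs_AE: "sq_integrable f \<Longrightarrow> AE x in lborel. rep_l2 (abs_l2 f) x = f x"
  using abs_eq_iff[OF sq_integrable_rep, of f "abs_l2 f"] by (simp add: abs_rep)

lemma l2_cases: obtains f where "x = abs_l2 f" "sq_integrable f"
  using abs_rep sq_integrable_rep by metis

lemma integral_mult_cong_AE:
  fixes f f' g g' :: "'a::euclidean_space \<Rightarrow> real"
  assumes "f \<in> borel_measurable lborel" "f' \<in> borel_measurable lborel" "g \<in> borel_measurable lborel" "g' \<in> borel_measurable lborel"
   "AE x in lborel. f x = f' x" "AE x in lborel. g x = g' x"
  shows "(\<integral>x. f x * g x \<partial>lborel) = (\<integral>x. f' x * g' x \<partial>lborel)"
  by (rule integral_cong_AE) (use assms in auto)

instantiation l2 :: (euclidean_space) real_vector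
begin

lift_definition zero_l2 :: "'a l2" is "\<lambda>x. 0" by (simp add: sq_integrable_zero)
lift_definition plus_l2 :: "'a l2 \<Rightarrow> 'a l2 \<Rightarrow> 'a l2" is "\<lambda>f g x. f x + g x"
  by (auto simp: sq_integrable_add)
lift_definition minus_l2 :: "'a l2 \<Rightarrow> 'a l2 \<Rightarrow> 'a l2" is "\<lambda>f g x. f x - g x"
  by (auto simp: sq_integrable_diff)
lift_definition uminus_l2 :: "'a l2 \<Rightarrow> 'a l2" is "\<lambda>f x. - f x"
  by (auto simp: sq_integrable_minus)
lift_definition scaleR_l2 :: "real \<Rightarrow> 'a l2 \<Rightarrow> 'a l2" is "\<lambda>c f x. c * f x"
  by (auto simp: sq_integrable_scale)

instance
proof
  fix x y z :: "'a l2" and a b :: real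
  show "x + y + z = x + (y + z)" by transfer (auto simp: sq_integrable_add add.assoc)
  show "x + y = y + x" by transfer (auto simp: sq_integrable_add add.commute)
  show "0 + x = x" by transfer auto
  show "- x + x = 0" by transfer (auto simp: sq_integrable_zero)
  show "x - y = x + - y" by transfer (auto simp: sq_integrable_diff sq_integrable_add)
  show "a *\<^sub>R (x + y) = a *\<^sub>R x + a *\<^sub>R y"
    by transfer (auto simp: sq_integrable_scale sq_integrable_add distrib_left)
  show "(a + b) *\<^sub>R x = a *\<^sub>R x + b *\<^sub>R x"
    by transfer (auto simp: sq_integrable_scale sq_integrable_add distrib_right)
  show "a *\<^sub>R b *\<^sub>R x = (a * b) *\<^sub>R x" by transfer (auto simp: sq_integrable_scale mult.assoc)
  show "1 *\<^sub>R x = x" by transfer auto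
qed

end

instantiation l2 :: (euclidean_space) real_inner
begin

lift_definition inner_l2 :: "'a l2 \<Rightarrow> 'a l2 \<Rightarrow> real" is "\<lambda>f g. \<integral>x. f x * g x \<partial>lborel"
  by (intro integral_mult_cong_AE) (auto simp: sq_integrable_def)
definition norm_l2 :: "'a l2 \<Rightarrow> real" where "norm_l2 x = sqrt (inner x x)"
definition dist_l2 :: "'a l2 \<Rightarrow> 'a l2 \<Rightarrow> real" where "dist_l2 x y = norm (x - y)"
definition sgn_l2 :: "'a l2 \<Rightarrow> 'a l2" where "sgn_l2 x = x /\<^sub>R norm x"
definition uniformity_l2 :: "('a l2 \<times> 'a l2) filter" where
  "uniformity_l2 = (INF e\<in>{0<..}. principal {(x, y). dist x y < e})"
definition open_l2 :: "'a l2 set \<Rightarrow> bool" where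
  "open_l2 U = (\<forall>x\<in>U. eventually (\<lambda>(x', y). x' = x \<longrightarrow> y \<in> U) uniformity)"

instance
proof
  fix x y z :: "'a l2" and a b :: real
  show "dist x y = norm (x - y)" by (rule dist_l2_def)
  show "sgn x = x /\<^sub>R norm x" by (rule sgn_l2_def)
  show "uniformity = (INF e\<in>{0<..}. principal {(x, y :: 'a l2). dist x y < e})" by (rule uniformity_l2_def)
  show "open U = (\<forall>x\<in>U. eventually (\<lambda>(x', y). x' = x \<longrightarrow> y \<in> U) uniformity)" for U :: "'a l2 set"
    by (rule open_l2_def)
  show "inner x y = inner y x" by transfer (simp add: mult.commute)
  show "inner (x + y) z = inner x z + inner y z"
    by transfer (simp add: distrib_right sq_integrable_mult)
  show "inner (a *\<^sub>R x) y = a * inner x y" by transfer (simp add: mult.assoc)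
  show "0 \<le> inner x x" by transfer simp
  show "inner x x = 0 \<longleftrightarrow> x = 0"
    by transfer (auto simp: sq_integrable_zero sq_integrable_def power2_eq_square integral_nonneg_eq_0_iff_AE)
  show "norm x = sqrt (inner x x)" by (rule norm_l2_def)
qed

end

lemma abs_add: "sq_integrable f \<Longrightarrow> sq_integrable g \<Longrightarrow> abs_l2 f + abs_l2 g = abs_l2 (\<lambda>x. f x + g x)"
  by (rule plus_l2.abs_eq) auto

lemma abs_diff: "sq_integrable f \<Longrightarrow> sq_integrable g \<Longrightarrow> abs_l2 f - abs_l2 g = abs_l2 (\<lambda>x. f x - g x)"
  by (rule minus_l2.abs_eq) auto

lemma abs_scaleR: "sq_integrable f \<Longrightarrow> c *\<^sub>R abs_l2 f = abs_l2 (\<lambda>x. c * f x)"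
  by (rule scaleR_l2.abs_eq) auto

lemma inner_abs: "sq_integrable f \<Longrightarrow> sq_integrable g \<Longrightarrow> inner (abs_l2 f) (abs_l2 g) = (\<integral>x. f x * g x \<partial>lborel)"
  by (rule inner_l2.abs_eq) auto

lemma norm_abs: "sq_integrable f \<Longrightarrow> (norm (abs_l2 f))\<^sup>2 = (\<integral>x. (f x)\<^sup>2 \<partial>lborel)"
  unfolding power2_norm_eq_inner by (simp add: inner_abs power2_eq_square)

lemma nn_integral_sq: "sq_integrable f \<Longrightarrow> (\<integral>\<^sup>+x. ennreal ((f x)\<^sup>2) \<partial>lborel) = ennreal ((norm (abs_l2 f))\<^sup>2)"
  unfolding norm_abs by (rule nn_integral_eq_integral) (auto simp: sq_integrable_def)

lemma norm_abs_abs: "sq_integrable f \<Longrightarrow> norm (abs_l2 (\<lambda>x. \<bar>f x\<bar>)) = norm (abs_l2 f)"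
  by (simp add: norm_eq_sqrt_inner inner_abs sq_integrable_abs)

lemma l2_sum:
  fixes n :: nat
  assumes "\<And>i. i < n \<Longrightarrow> sq_integrable (f i)"
  shows "sq_integrable (\<lambda>x. \<Sum>i<n. f i x) \<and> abs_l2 (\<lambda>x. \<Sum>i<n. f i x) = (\<Sum>i<n. abs_l2 (f i))"
  using assms
proof (induction n)
  case 0
  then show ?case by (simp add: sq_integrable_zero zero_l2.abs_eq)
next
  case (Suc n)
  then show ?case by (simp add: sq_integrable_add flip: abs_add)
qed

text \<open>Riesz-Fischer. Monotone convergence applied to the partial sums of the absolute
  increments, whose norms are at most 2, makes the sequence converge almost everywhere; Fatou's
  lemma shows that the pointwise limit is also the limit in norm.\<close>

lemma fast_Cauchy_l2:
  fixes X :: "nat \<Rightarrow> 'a::euclidean_space l2"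
  assumes X: "\<And>k. norm (X (Suc k) - X k) \<le> (1/2) ^ k" and C: "Cauchy X"
  shows "\<exists>l. X \<longlonglongrightarrow> l"
proof -
  define u where "u k = rep_l2 (X k)" for k
  have u: "sq_integrable (u k)" "abs_l2 (u k) = X k" for k by (auto simp: u_def sq_integrable_rep abs_rep)
  note [measurable] = sq_integrable_measurable[OF u(1)]
  define d where "d k x = \<bar>u (Suc k) x - u k x\<bar>" for k x
  have d: "sq_integrable (d k)" "norm (abs_l2 (d k)) \<le> (1/2) ^ k" for k
    using X[of k] norm_abs_abs[OF sq_integrable_diff[OF u(1) u(1)], of "Suc k" k]
    by (auto simp: d_def[abs_def] u abs_diff[symmetric] intro!: sq_integrable_abs sq_integrable_diff)
  note [measurable] = sq_integrable_measurable[OF d(1)]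
  define S where "S n x = (\<Sum>i<n. d i x)" for n x
  have S: "sq_integrable (S n)" "norm (abs_l2 (S n)) \<le> 2" for n
  proof -
    have s: "sq_integrable (S n) \<and> abs_l2 (S n) = (\<Sum>i<n. abs_l2 (d i))"
      unfolding S_def[abs_def] by (rule l2_sum) (rule d)
    then show "sq_integrable (S n)" by simp
    have "norm (abs_l2 (S n)) \<le> (\<Sum>i<n. (1/2) ^ i)"
      using s d(2) by (auto intro!: sum_norm_le)
    also have "\<dots> \<le> 2" by (simp add: geometric_sum)
    finally show "norm (abs_l2 (S n)) \<le> 2" .
  qed
  have d0: "0 \<le> d k x" for k x by (simp add: d_def)
  have mono: "incseq (\<lambda>n x. ennreal ((S n x)\<^sup>2))"
    unfolding incseq_def le_fun_def S_def
    by (intro allI impI ennreal_leI power_mono sum_mono2 sum_nonneg d0) auto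
  have [measurable]: "S n \<in> borel_measurable borel" for n by (rule sq_integrable_measurable[OF S(1)])
  have "(\<integral>\<^sup>+x. (SUP n. ennreal ((S n x)\<^sup>2)) \<partial>lborel) = (SUP n. \<integral>\<^sup>+x. ennreal ((S n x)\<^sup>2) \<partial>lborel)"
    by (rule nn_integral_monotone_convergence_SUP) (use mono in auto)
  also have "\<dots> \<le> ennreal 4"
  proof (rule SUP_least)
    fix n
    have "(norm (abs_l2 (S n)))\<^sup>2 \<le> 2\<^sup>2" by (rule power_mono[OF S(2)]) simp
    then show "(\<integral>\<^sup>+x. ennreal ((S n x)\<^sup>2) \<partial>lborel) \<le> ennreal 4"
      unfolding nn_integral_sq[OF S(1)] by (intro ennreal_leI) simp
  qed
  finally have "(\<integral>\<^sup>+x. (SUP n. ennreal ((S n x)\<^sup>2)) \<partial>lborel) < top"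
    by (rule le_less_trans) (rule ennreal_less_top)
  then have "(\<integral>\<^sup>+x. (SUP n. ennreal ((S n x)\<^sup>2)) \<partial>lborel) \<noteq> \<infinity>"
    by (simp add: less_top)
  then have "AE x in lborel. (SUP n. ennreal ((S n x)\<^sup>2)) \<noteq> \<infinity>"
    by (intro nn_integral_PInf_AE) auto
  then have conv: "AE x in lborel. convergent (\<lambda>k. u k x)"
  proof eventually_elim
    fix x assume "(SUP n. ennreal ((S n x)\<^sup>2)) \<noteq> \<infinity>"
    then obtain B where B: "(SUP n. ennreal ((S n x)\<^sup>2)) = ennreal B" "0 \<le> B"
      by (cases "SUP n. ennreal ((S n x)\<^sup>2)") auto
    have "S n x \<le> sqrt B" for n
    proof -
      have "ennreal ((S n x)\<^sup>2) \<le> ennreal B" unfolding B(1)[symmetric] by (rule SUP_upper) simp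
      then have "(S n x)\<^sup>2 \<le> B" using B(2) by (simp add: ennreal_le_iff)
      then show ?thesis by (rule real_le_rsqrt)
    qed
    then have "summable (\<lambda>k. d k x)"
      unfolding S_def by (intro summableI_nonneg_bounded d0) auto
    then have "summable (\<lambda>k. u (Suc k) x - u k x)"
      unfolding d_def by (rule summable_rabs_cancel)
    then have "convergent (\<lambda>n. \<Sum>k<n. u (Suc k) x - u k x)" by (simp add: summable_iff_convergent)
    then have "convergent (\<lambda>n. u n x - u 0 x)" by (simp only: sum_lessThan_telescope[of "\<lambda>k. u k x"])
    then show "convergent (\<lambda>k. u k x)"
      using convergent_add[OF _ convergent_const[of "u 0 x"]] by fastforce
  qed
  define f where "f x = lim (\<lambda>k. u k x)" for x
  have [measurable]: "f \<in> borel_measurable borel" unfolding f_def by measurable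
  have lim: "AE x in lborel. (\<lambda>k. u k x) \<longlonglongrightarrow> f x"
    using conv by eventually_elim (simp add: f_def convergent_LIMSEQ_iff)
  have fatou: "(\<integral>\<^sup>+x. ennreal ((f x - u m x)\<^sup>2) \<partial>lborel) \<le> ennreal (e\<^sup>2)"
    if e: "\<And>k. k \<ge> m \<Longrightarrow> norm (X k - X m) \<le> e" for m e
  proof -
    have "(\<integral>\<^sup>+x. ennreal ((f x - u m x)\<^sup>2) \<partial>lborel) = (\<integral>\<^sup>+x. liminf (\<lambda>k. ennreal ((u k x - u m x)\<^sup>2)) \<partial>lborel)"
    proof (rule nn_integral_cong_AE)
      show "AE x in lborel. ennreal ((f x - u m x)\<^sup>2) = liminf (\<lambda>k. ennreal ((u k x - u m x)\<^sup>2))"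
        using lim
      proof eventually_elim
        fix x assume "(\<lambda>k. u k x) \<longlonglongrightarrow> f x"
        then have "(\<lambda>k. ennreal ((u k x - u m x)\<^sup>2)) \<longlonglongrightarrow> ennreal ((f x - u m x)\<^sup>2)"
          by (intro tendsto_intros tendsto_ennrealI)
        then show "ennreal ((f x - u m x)\<^sup>2) = liminf (\<lambda>k. ennreal ((u k x - u m x)\<^sup>2))"
          by (rule lim_imp_Liminf[OF sequentially_bot, symmetric])
      qed
    qed
    also have "\<dots> \<le> liminf (\<lambda>k. \<integral>\<^sup>+x. ennreal ((u k x - u m x)\<^sup>2) \<partial>lborel)"
      by (rule nn_integral_liminf) auto
    also have "\<dots> \<le> ennreal (e\<^sup>2)"
    proof (rule Liminf_le)
      show "\<forall>\<^sub>F k in sequentially. (\<integral>\<^sup>+x. ennreal ((u k x - u m x)\<^sup>2) \<partial>lborel) \<le> ennreal (e\<^sup>2)"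
        unfolding eventually_sequentially
      proof (intro exI[of _ m] allI impI)
        fix k assume "m \<le> k"
        then have "(norm (X k - X m))\<^sup>2 \<le> e\<^sup>2" by (intro power_mono e) auto
        then show "(\<integral>\<^sup>+x. ennreal ((u k x - u m x)\<^sup>2) \<partial>lborel) \<le> ennreal (e\<^sup>2)"
          using nn_integral_sq[OF sq_integrable_diff[OF u(1) u(1)], of k m]
          by (simp add: abs_diff[symmetric] u ennreal_leI)
      qed
    qed simp
    finally show ?thesis .
  qed
  have sqd: "sq_integrable (\<lambda>x. f x - u m x)" if "\<And>k. k \<ge> m \<Longrightarrow> norm (X k - X m) \<le> e" for m e
  proof -
    have "(\<integral>\<^sup>+x. ennreal ((f x - u m x)\<^sup>2) \<partial>lborel) < \<infinity>"
      unfolding infinity_ennreal_def by (rule le_less_trans[OF fatou[OF that] ennreal_less_top])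
    then show ?thesis
      unfolding sq_integrable_def by (auto intro!: integrableI_nonneg)
  qed
  have ex: "\<exists>M. \<forall>m\<ge>M. \<forall>k\<ge>m. norm (X k - X m) \<le> e" if "0 < e" for e
  proof -
    obtain M where M: "\<forall>m\<ge>M. \<forall>n\<ge>M. dist (X m) (X n) < e"
      using metric_CauchyD[OF C \<open>0 < e\<close>] by blast
    have "norm (X k - X m) \<le> e" if "m \<ge> M" "k \<ge> m" for m k
      using M[rule_format, of k m] that by (simp add: dist_norm)
    then show ?thesis by blast
  qed
  obtain m0 where "\<forall>k\<ge>m0. norm (X k - X m0) \<le> 1" using ex[of 1] by auto
  then have "sq_integrable (\<lambda>x. f x - u m0 x)" by (intro sqd[of m0 1]) auto
  from sq_integrable_add[OF this u(1)[of m0]] have f: "sq_integrable f" by simp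
  have "X \<longlonglongrightarrow> abs_l2 f"
  proof (rule metric_LIMSEQ_I)
    fix r :: real assume r: "0 < r"
    obtain M where M: "\<forall>m\<ge>M. \<forall>k\<ge>m. norm (X k - X m) \<le> r / 2" using ex[of "r / 2"] r by auto
    have "dist (X m) (abs_l2 f) < r" if "M \<le> m" for m
    proof -
      have "ennreal ((norm (abs_l2 f - X m))\<^sup>2) \<le> ennreal ((r / 2)\<^sup>2)"
        using fatou[of m "r / 2"] M that nn_integral_sq[OF sq_integrable_diff[OF f u(1)], of m]
        by (simp add: abs_diff[symmetric] f u)
      then have "(norm (abs_l2 f - X m))\<^sup>2 \<le> (r / 2)\<^sup>2"
        by (subst (asm) ennreal_le_iff) (rule zero_le_power2)
      then have "norm (abs_l2 f - X m) \<le> r / 2"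
        by (rule power2_le_imp_le) (use r in simp)
      then show ?thesis using r by (simp add: dist_norm norm_minus_commute)
    qed
    then show "\<exists>no. \<forall>n\<ge>no. dist (X n) (abs_l2 f) < r" by blast
  qed
  then show ?thesis by blast
qed

instance l2 :: (euclidean_space) banach
proof
  fix X :: "nat \<Rightarrow> 'a l2" assume X: "Cauchy X"
  have "\<exists>M. \<forall>m\<ge>M. \<forall>n\<ge>M. norm (X m - X n) < (1/2) ^ k" for k :: nat
    using metric_CauchyD[OF X, of "(1/2) ^ k"] by (simp add: dist_norm)
  then obtain M where M: "\<And>k m n. m \<ge> M k \<Longrightarrow> n \<ge> M k \<Longrightarrow> norm (X m - X n) < (1/2) ^ k" by metis
  \<comment> \<open>The summand \<open>k\<close> makes the sequence strictly increasing, and the sum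
    puts it beyond every threshold \<open>M i\<close> with \<open>i\<close> at most
    \<open>k\<close>.\<close>
  define r where "r k = (\<Sum>i\<le>k. M i) + k" for k
  have r: "strict_mono r" "M k \<le> r k" for k
    by (auto simp: r_def strict_mono_Suc_iff trans_le_add1 member_le_sum)
  have "\<exists>l. (X \<circ> r) \<longlonglongrightarrow> l"
  proof (rule fast_Cauchy_l2)
    show "norm ((X \<circ> r) (Suc k) - (X \<circ> r) k) \<le> (1/2) ^ k" for k
    proof -
      have "r k < r (Suc k)" using r(1) by (simp add: strict_mono_Suc_iff)
      then show ?thesis using M[of k "r (Suc k)" "r k"] r(2)[of k] by simp
    qed
    show "Cauchy (X \<circ> r)" by (rule Cauchy_subseq_Cauchy[OF X r(1)])
  qed
  then show "convergent X"
    using Cauchy_converges_subseq[OF X r(1)] by (auto simp: convergent_def)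
qed

text \<open>Projection theorem as a density criterion: a minimising sequence is Cauchy by the
  parallelogram law, and the vector from its limit to \<open>y\<close> is orthogonal to
  \<open>C\<close>, hence zero.\<close>

lemma closed_subspace_eq_UNIV:
  fixes C :: "'h::{real_inner,banach} set"
  assumes sub: "subspace C" and cl: "closed C" and perp: "\<And>z. (\<And>x. x \<in> C \<Longrightarrow> inner z x = 0) \<Longrightarrow> z = 0"
  shows "y \<in> C"
proof -
  have ne: "C \<noteq> {}" using subspace_0[OF sub] by auto
  define d where "d = infdist y C"
  have d: "d \<le> dist y x" if "x \<in> C" for x unfolding d_def by (rule infdist_le[OF that])
  have "\<exists>x\<in>C. dist y x < d + 1 / real (Suc n)" for n
  proof (rule ccontr)
    assume "\<not> ?thesis"
    then have "d + 1 / real (Suc n) \<le> infdist y C"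
      unfolding infdist_notempty[OF ne] using ne by (intro cINF_greatest) (auto simp: not_less)
    then show False by (simp add: d_def)
  qed
  then obtain x where x: "\<And>n. x n \<in> C" "\<And>n. dist y (x n) < d + 1 / real (Suc n)" by metis
  have d0: "0 \<le> d" by (simp add: d_def infdist_nonneg)
  have par: "(norm (x m - x n))\<^sup>2 \<le> 2 * (dist y (x m))\<^sup>2 + 2 * (dist y (x n))\<^sup>2 - 4 * d\<^sup>2" for m n
  proof -
    have "(1/2) *\<^sub>R (x m + x n) \<in> C" using x sub by (intro subspace_scale subspace_add) auto
    from power_mono[OF d[OF this] d0, of 2]
    have "d\<^sup>2 \<le> (norm (y - (1/2) *\<^sub>R (x m + x n)))\<^sup>2" by (simp add: dist_norm)
    also have "4 * (norm (y - (1/2) *\<^sub>R (x m + x n)))\<^sup>2 = 2 * (norm (y - x m))\<^sup>2 + 2 * (norm (y - x n))\<^sup>2 - (norm (x m - x n))\<^sup>2"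
      unfolding power2_norm_eq_inner by (simp add: inner_diff_left inner_diff_right inner_add_left inner_add_right inner_commute algebra_simps)
    finally show ?thesis by (simp add: dist_norm)
  qed
  have "(\<lambda>n. dist y (x n)) \<longlonglongrightarrow> d"
  proof (rule tendsto_sandwich[OF _ _ tendsto_const])
    show "(\<lambda>n. d + 1 / real (Suc n)) \<longlonglongrightarrow> d"
      using tendsto_add[OF tendsto_const LIMSEQ_Suc[OF lim_1_over_n], of d] by simp
    show "\<forall>\<^sub>F n in sequentially. d \<le> dist y (x n)" using d x(1) by simp
    show "\<forall>\<^sub>F n in sequentially. dist y (x n) \<le> d + 1 / real (Suc n)"
      by (intro always_eventually allI less_imp_le x(2))
  qed
  note lim = this
  have "Cauchy x"
  proof (rule metric_CauchyI)
    fix e :: real assume e: "0 < e"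
    have "(\<lambda>n. (dist y (x n))\<^sup>2) \<longlonglongrightarrow> d\<^sup>2" by (intro tendsto_power lim)
    then have "\<forall>\<^sub>F n in sequentially. dist ((dist y (x n))\<^sup>2) (d\<^sup>2) < e\<^sup>2 / 4"
      using e by (intro tendstoD) auto
    then obtain M where M0: "\<And>n. n \<ge> M \<Longrightarrow> dist ((dist y (x n))\<^sup>2) (d\<^sup>2) < e\<^sup>2 / 4"
      unfolding eventually_sequentially by blast
    have M: "(dist y (x n))\<^sup>2 - d\<^sup>2 < e\<^sup>2 / 4" if "n \<ge> M" for n
      using M0[OF that] abs_ge_self[of "(dist y (x n))\<^sup>2 - d\<^sup>2"] unfolding dist_real_def by linarith
    have "dist (x m) (x n) < e" if "m \<ge> M" "n \<ge> M" for m n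
    proof -
      have "(norm (x m - x n))\<^sup>2 < e\<^sup>2" using par[of m n] M[OF that(1)] M[OF that(2)] by linarith
      then show ?thesis using e by (simp add: dist_norm power_less_imp_less_base)
    qed
    then show "\<exists>M. \<forall>m\<ge>M. \<forall>n\<ge>M. dist (x m) (x n) < e" by blast
  qed
  then obtain p where p: "x \<longlonglongrightarrow> p" using convergent_eq_Cauchy by blast
  have pC: "p \<in> C" using closed_sequentially[OF cl] x p by blast
  have dp: "dist y p = d"
    using LIMSEQ_unique[OF tendsto_dist[OF tendsto_const p] lim] .
  have "y - p = 0"
  proof (rule perp)
    fix w assume w: "w \<in> C"
    \<comment> \<open>Minimality against the competitor \<open>p + t *\<^sub>R w\<close>. The value
      of \<open>t\<close> used below minimises the resulting quadratic.\<close>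
    have *: "2 * t * inner (y - p) w \<le> t\<^sup>2 * (norm w)\<^sup>2" for t
    proof -
      have "p + t *\<^sub>R w \<in> C" using pC w sub by (intro subspace_add subspace_scale) auto
      from power_mono[OF d[OF this] d0, of 2]
      have "(norm (y - p))\<^sup>2 \<le> (norm ((y - p) - t *\<^sub>R w))\<^sup>2" by (simp add: dist_norm dp[symmetric] algebra_simps)
      then show ?thesis
        unfolding power2_norm_eq_inner
        by (simp add: inner_diff_left inner_diff_right inner_commute power2_eq_square algebra_simps)
    qed
    show "inner (y - p) w = 0"
    proof (cases "w = 0")
      case False
      define c where "c = inner (y - p) w"
      have "2 * (c / (norm w)\<^sup>2) * c \<le> (c / (norm w)\<^sup>2)\<^sup>2 * (norm w)\<^sup>2"
        using *[of "c / (norm w)\<^sup>2"] by (simp add: c_def)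
      then have "2 * c\<^sup>2 \<le> c\<^sup>2" using False by (simp add: power2_eq_square field_simps)
      then show ?thesis by (simp add: c_def)
    qed simp
  qed
  then show ?thesis using pC by simp
qed

section \<open>Translations\<close>

lemma distr_shift: "distr lborel borel (\<lambda>x. x + c) = (lborel :: 'a::euclidean_space measure)"
proof -
  have "(\<lambda>x. x + c) = (+) c" by (simp add: fun_eq_iff add.commute)
  then show ?thesis by (simp add: lborel_distr_plus)
qed

lemma integral_shift_lborel:
  fixes f :: "'a::euclidean_space \<Rightarrow> real"
  assumes "f \<in> borel_measurable borel"
  shows "(\<integral>x. f (x + c) \<partial>lborel) = (\<integral>x. f x \<partial>lborel)"
  using integral_distr[of "\<lambda>x. x + c" lborel borel f] assms by (simp add: distr_shift)

lemma integrable_shift_lborel: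
  fixes f :: "'a::euclidean_space \<Rightarrow> real"
  assumes "integrable lborel f"
  shows "integrable lborel (\<lambda>x. f (x + c))"
  using integrable_distr[of "\<lambda>x. x + c" lborel borel f] assms by (simp add: distr_shift)

lemma AE_shift_lborel:
  assumes "AE x in (lborel :: 'a::euclidean_space measure). P x"
  shows "AE x in lborel. P (x + c)"
proof -
  have "(\<lambda>x. x + c) \<in> measurable lborel borel" by simp
  moreover have "AE x in distr lborel borel (\<lambda>x. x + c). P x" unfolding distr_shift by (rule assms)
  ultimately show ?thesis by (rule AE_distrD)
qed

lemma sq_integrable_shift: "sq_integrable f \<Longrightarrow> sq_integrable (\<lambda>x. f (x + c))"
  using integrable_shift_lborel[of "\<lambda>x. (f x)\<^sup>2" c] by (auto simp: sq_integrable_def)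

lift_definition shift_l2 :: "'a::euclidean_space \<Rightarrow> 'a l2 \<Rightarrow> 'a l2" is "\<lambda>c f x. f (x + c)"
  using AE_shift_lborel[of "\<lambda>x. f x = g x" for f g :: "'a \<Rightarrow> real"] by (simp add: sq_integrable_shift)

lemma shift_abs: "sq_integrable f \<Longrightarrow> shift_l2 c (abs_l2 f) = abs_l2 (\<lambda>x. f (x + c))"
  by (rule shift_l2.abs_eq) auto

lemma inner_shift: "inner (shift_l2 c x) (shift_l2 c y) = inner x y"
proof -
  obtain f g where fg: "x = abs_l2 f" "sq_integrable f" "y = abs_l2 g" "sq_integrable g"
    by (metis l2_cases)
  note [measurable] = sq_integrable_measurable[OF fg(2)] sq_integrable_measurable[OF fg(4)]
  show ?thesis
    using integral_shift_lborel[of "\<lambda>x. f x * g x" c]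
    by (simp add: fg shift_abs inner_abs sq_integrable_shift)
qed

lemma norm_shift: "norm (shift_l2 c x) = norm x"
  by (simp add: norm_eq_sqrt_inner inner_shift)

lemma linear_shift: "linear (shift_l2 c)"
proof
  fix x y :: "'a l2" and r :: real
  obtain f g where fg: "x = abs_l2 f" "sq_integrable f" "y = abs_l2 g" "sq_integrable g"
    by (metis l2_cases)
  show "shift_l2 c (x + y) = shift_l2 c x + shift_l2 c y"
    by (simp add: fg shift_abs abs_add sq_integrable_shift sq_integrable_add)
  show "shift_l2 c (r *\<^sub>R x) = r *\<^sub>R shift_l2 c x"
    by (simp add: fg shift_abs abs_scaleR sq_integrable_shift sq_integrable_scale)
qed

lemma shift_add: "shift_l2 (c + d) x = shift_l2 c (shift_l2 d x)"
proof -
  obtain f where f: "x = abs_l2 f" "sq_integrable f" by (metis l2_cases)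
  show ?thesis by (simp add: f shift_abs sq_integrable_shift add.assoc)
qed

lemma shift_zero: "shift_l2 0 x = x"
proof -
  obtain f where f: "x = abs_l2 f" "sq_integrable f" by (metis l2_cases)
  show ?thesis by (simp add: f shift_abs)
qed

lemma sq_integrable_indicator_box: "sq_integrable (indicator (box a b) :: 'a::euclidean_space \<Rightarrow> real)"
proof -
  have "(\<lambda>x. (indicator (box a b) x :: real)\<^sup>2) = indicator (box a b)"
    by (auto simp: indicator_def)
  then show ?thesis
    unfolding sq_integrable_def by (simp add: emeasure_lborel_box_eq)
qed

lemma l2_eq_zero_if_box:
  fixes z :: "'a::euclidean_space l2"
  assumes "\<And>a b. inner z (abs_l2 (indicator (box a b))) = 0"
  shows "z = 0"
proof -
  obtain f where f: "z = abs_l2 f" "sq_integrable f" by (metis l2_cases)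
  have "AE x in lborel. f x = 0"
  proof (rule AE_zero_if_box)
    fix a b :: 'a
    have "integrable lborel (\<lambda>x. f x * indicator (box a b) x)"
      by (rule sq_integrable_mult[OF f(2) sq_integrable_indicator_box])
    then show "set_integrable lborel (box a b) f" by (simp add: set_integrable_def mult.commute)
    show "(LINT x:box a b|lborel. f x) = 0"
      using assms[of a b] by (simp add: f inner_abs sq_integrable_indicator_box set_lebesgue_integral_def mult.commute)
  qed
  then show ?thesis
    using abs_eq_iff[OF f(2) sq_integrable_zero] by (simp add: f zero_l2.abs_eq)
qed

lemma AE_not_frontier_box: "AE x in lborel. x \<notin> cbox a b - box a (b :: 'a::euclidean_space)"
proof (rule AE_not_in)
  show "cbox a b - box a b \<in> null_sets lborel"
  proof (rule null_setsI)
    have "emeasure lborel (cbox a b - box a b) = emeasure lborel (cbox a b) - emeasure lborel (box a b)"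
      by (rule emeasure_Diff) (auto simp: emeasure_lborel_box_eq box_subset_cbox)
    also have "\<dots> = 0"
      by (auto simp: emeasure_lborel_box_eq emeasure_lborel_cbox_eq)
    finally show "emeasure lborel (cbox a b - box a b) = 0" .
  qed simp
qed

text \<open>Off the boundary of the box, a null set, the translated indicators are eventually
  constant; a fixed ball dominates them.\<close>

lemma shift_indicator_tendsto:
  fixes X :: "nat \<Rightarrow> 'a::euclidean_space"
  assumes X: "X \<longlonglongrightarrow> 0"
  shows "(\<lambda>n. norm (shift_l2 (X n) (abs_l2 (indicator (box a b))) - abs_l2 (indicator (box a b)))) \<longlonglongrightarrow> 0"
proof -
  let ?i = "indicator (box a b) :: 'a \<Rightarrow> real"
  note sq = sq_integrable_indicator_box[of a b]
  obtain K where K: "\<And>n. norm (X n) \<le> K" using convergent_imp_Bseq[of X] X by (auto simp: convergent_def Bseq_def)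
  obtain L where L: "\<And>x. x \<in> box a b \<Longrightarrow> norm x \<le> L" using bounded_box[of a b] by (auto simp: bounded_iff)
  have "(\<lambda>n. \<integral>x. (?i (x + X n) - ?i x)\<^sup>2 \<partial>lborel) \<longlonglongrightarrow> integral\<^sup>L (lborel :: 'a measure) (\<lambda>x. 0)"
  proof (rule integral_dominated_convergence[of "\<lambda>x. 0" lborel "\<lambda>n x. (?i (x + X n) - ?i x)\<^sup>2" "indicator (cball 0 (L + K))"])
    show "integrable lborel (indicator (cball (0::'a) (L + K)) :: 'a \<Rightarrow> real)"
      using emeasure_bounded_finite[OF bounded_cball, of "0 :: 'a" "L + K"] by (simp add: less_top)
    show "AE x in lborel. (\<lambda>n. (?i (x + X n) - ?i x)\<^sup>2) \<longlonglongrightarrow> 0"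
      using AE_not_frontier_box[of a b]
    proof eventually_elim
      fix x assume x: "x \<notin> cbox a b - box a b"
      have lim: "(\<lambda>n. x + X n) \<longlonglongrightarrow> x" using tendsto_add[OF tendsto_const X, of x] by simp
      have "\<forall>\<^sub>F n in sequentially. ?i (x + X n) = ?i x"
      proof (cases "x \<in> box a b")
        case True
        then have "\<forall>\<^sub>F n in sequentially. x + X n \<in> box a b"
          using lim by (intro topological_tendstoD) (auto simp: open_box)
        then show ?thesis by eventually_elim (simp add: True)
      next
        case False
        then have "\<forall>\<^sub>F n in sequentially. x + X n \<in> - cbox a b"
          using lim x by (intro topological_tendstoD) auto
        then show ?thesis
        proof eventually_elim
          case (elim n)
          then show ?case using False box_subset_cbox[of a b] by (auto simp: indicator_def)
        qed
      qed
      then have "\<forall>\<^sub>F n in sequentially. (?i (x + X n) - ?i x)\<^sup>2 = 0"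
        by eventually_elim simp
      then show "(\<lambda>n. (?i (x + X n) - ?i x)\<^sup>2) \<longlonglongrightarrow> 0"
        by (rule tendsto_eventually)
    qed
    show "AE x in lborel. norm ((?i (x + X n) - ?i x)\<^sup>2) \<le> indicator (cball 0 (L + K)) x" for n
    proof (rule AE_I2)
      fix x :: 'a
      have "norm x \<le> L + K" if "x + X n \<in> box a b \<or> x \<in> box a b"
        using that
      proof
        assume "x + X n \<in> box a b"
        from L[OF this] show ?thesis using K[of n] norm_triangle_ineq4[of "x + X n" "X n"] by simp
      next
        assume "x \<in> box a b"
        from L[OF this] show ?thesis using K[of n] norm_ge_zero[of "X n"] by linarith
      qed
      then show "norm ((?i (x + X n) - ?i x)\<^sup>2) \<le> indicator (cball 0 (L + K)) x"
        by (auto simp: indicator_def)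
    qed
  qed auto
  then have "(\<lambda>n. (norm (shift_l2 (X n) (abs_l2 ?i) - abs_l2 ?i))\<^sup>2) \<longlonglongrightarrow> 0"
    by (simp add: shift_abs[OF sq] abs_diff[OF sq_integrable_shift[OF sq] sq] norm_abs[OF sq_integrable_diff[OF sq_integrable_shift[OF sq] sq]])
  from tendsto_real_sqrt[OF this] show ?thesis by simp
qed

text \<open>The vectors on which the translations are continuous form a closed subspace, because the
  translations are uniformly bounded; it contains the indicators of boxes, and these are
  total.\<close>

lemma shift_tendsto:
  fixes X :: "nat \<Rightarrow> 'a::euclidean_space"
  assumes X: "X \<longlonglongrightarrow> 0"
  shows "(\<lambda>n. norm (shift_l2 (X n) x - x)) \<longlonglongrightarrow> 0"
proof -
  define C where "C = {x. (\<lambda>n. norm (shift_l2 (X n) x - x)) \<longlonglongrightarrow> 0}"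
  have "subspace C"
    unfolding subspace_def
  proof (intro conjI ballI allI)
    show "0 \<in> C" by (simp add: C_def linear_0[OF linear_shift])
    fix x assume x: "x \<in> C"
    show "x + y \<in> C" if "y \<in> C" for y
    proof -
      have lim: "(\<lambda>n. norm (shift_l2 (X n) x - x) + norm (shift_l2 (X n) y - y)) \<longlonglongrightarrow> 0"
        using tendsto_add_zero x that by (auto simp: C_def)
      have le: "norm (shift_l2 (X n) (x + y) - (x + y)) \<le> norm (shift_l2 (X n) x - x) + norm (shift_l2 (X n) y - y)" for n
        using norm_triangle_ineq[of "shift_l2 (X n) x - x" "shift_l2 (X n) y - y"]
        by (simp add: linear_add[OF linear_shift] algebra_simps)
      have "(\<lambda>n. shift_l2 (X n) (x + y) - (x + y)) \<longlonglongrightarrow> 0"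
        by (rule Lim_null_comparison[OF always_eventually lim]) (use le in blast)
      then show ?thesis
        unfolding C_def mem_Collect_eq by (rule tendsto_norm_zero)
    qed
    show "c *\<^sub>R x \<in> C" for c
    proof -
      have "shift_l2 (X n) (c *\<^sub>R x) - c *\<^sub>R x = c *\<^sub>R (shift_l2 (X n) x - x)" for n
        by (simp add: linear_scale[OF linear_shift] scaleR_diff_right)
      then show ?thesis
        using tendsto_mult_right_zero[of _ _ "\<bar>c\<bar>"] x by (simp add: C_def)
    qed
  qed
  moreover have "closed C"
    unfolding closed_sequential_limits
  proof (intro allI impI, elim conjE)
    fix f l assume f: "\<forall>n. f n \<in> C" and l: "f \<longlonglongrightarrow> l"
    show "l \<in> C"
      unfolding C_def mem_Collect_eq
    proof (rule metric_LIMSEQ_I)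
      fix e :: real assume e: "0 < e"
      obtain k where k: "norm (f k - l) < e / 4" using metric_LIMSEQ_D[OF l, of "e / 4"] e by (auto simp: dist_norm)
      have "(\<lambda>n. norm (shift_l2 (X n) (f k) - f k)) \<longlonglongrightarrow> 0" using f by (simp add: C_def)
      from metric_LIMSEQ_D[OF this, of "e / 2"] e
      obtain N where N: "\<And>n. n \<ge> N \<Longrightarrow> norm (shift_l2 (X n) (f k) - f k) < e / 2" by auto
      have "norm (shift_l2 (X n) l - l) < e" if "n \<ge> N" for n
      proof -
        have "shift_l2 (X n) l - l = (shift_l2 (X n) (f k) - f k) + ((f k - l) - shift_l2 (X n) (f k - l))"
          by (simp add: linear_diff[OF linear_shift])
        also have "norm \<dots> \<le> norm (shift_l2 (X n) (f k) - f k) + (norm (f k - l) + norm (shift_l2 (X n) (f k - l)))"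
          by (meson norm_triangle_ineq norm_triangle_ineq4 add_left_mono order_trans)
        finally show ?thesis using k N[OF that] by (simp add: norm_shift)
      qed
      then show "\<exists>N. \<forall>n\<ge>N. dist (norm (shift_l2 (X n) l - l)) 0 < e" by auto
    qed
  qed
  ultimately have "x \<in> C"
  proof (rule closed_subspace_eq_UNIV)
    fix z :: "'a l2" assume z: "\<And>x. x \<in> C \<Longrightarrow> inner z x = 0"
    show "z = 0"
      by (rule l2_eq_zero_if_box, rule z) (use shift_indicator_tendsto[OF X] in \<open>simp add: C_def\<close>)
  qed
  then show ?thesis by (simp add: C_def)
qed

text \<open>The direction \<open>c\<close> is arbitrary, so the same fact yields translation on the
  line, translation of the plane in x alone, and translation in the history variable.\<close>

lemma isometry_group_shift: "isometry_group (\<lambda>s. shift_l2 (s *\<^sub>R c) :: 'a::euclidean_space l2 \<Rightarrow> 'a l2)"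
proof (rule isometry_group.intro)
  fix s t :: real and x :: "'a l2"
  show "bounded_linear (shift_l2 (s *\<^sub>R c) :: 'a l2 \<Rightarrow> 'a l2)"
    using linear_shift[of "s *\<^sub>R c"]
    by (intro bounded_linear.intro bounded_linear_axioms.intro exI[of _ 1]) (auto simp: norm_shift)
  show "norm (shift_l2 (s *\<^sub>R c) x) = norm x" by (rule norm_shift)
  show "shift_l2 (0 *\<^sub>R c) x = x" by (simp add: shift_zero)
  show "shift_l2 ((s + t) *\<^sub>R c) x = shift_l2 (s *\<^sub>R c) (shift_l2 (t *\<^sub>R c) x)"
    by (simp add: scaleR_add_left shift_add)
  show "continuous_on UNIV (\<lambda>s. shift_l2 (s *\<^sub>R c) x)"
    unfolding continuous_on_sequentially
  proof (intro allI ballI impI, elim conjE)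
    fix a :: real and S :: "nat \<Rightarrow> real" assume S: "S \<longlonglongrightarrow> a"
    have "(\<lambda>n. (S n - a) *\<^sub>R c) \<longlonglongrightarrow> 0"
      using tendsto_scaleR[OF LIM_zero[OF S] tendsto_const, of c] by simp
    from shift_tendsto[OF this, of x]
    have "(\<lambda>n. norm (shift_l2 ((S n - a) *\<^sub>R c) x - x)) \<longlonglongrightarrow> 0" .
    moreover have "norm (shift_l2 ((S n - a) *\<^sub>R c) x - x) = norm (shift_l2 (S n *\<^sub>R c) x - shift_l2 (a *\<^sub>R c) x)" for n
    proof -
      have "shift_l2 (S n *\<^sub>R c) x = shift_l2 (a *\<^sub>R c) (shift_l2 ((S n - a) *\<^sub>R c) x)"
        by (simp add: scaleR_diff_left flip: shift_add)
      then show ?thesis by (simp add: norm_shift flip: linear_diff[OF linear_shift])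
    qed
    ultimately have "(\<lambda>n. shift_l2 (S n *\<^sub>R c) x - shift_l2 (a *\<^sub>R c) x) \<longlonglongrightarrow> 0"
      by (simp add: tendsto_norm_zero_iff)
    then show "((\<lambda>s. shift_l2 (s *\<^sub>R c) x) \<circ> S) \<longlonglongrightarrow> shift_l2 (a *\<^sub>R c) x"
      by (simp add: o_def LIM_zero_cancel)
  qed
qed

section \<open>Test functions and weak derivatives\<close>

definition smooth :: "(real \<Rightarrow> real) \<Rightarrow> bool" where
  "smooth f \<longleftrightarrow> (\<forall>n x. (deriv ^^ n) f field_differentiable at x)"

text \<open>A class of functions closed under differentiation consists of smooth functions. Each use
  below exhibits such a class, so that no iterated derivative has to be computed.\<close>

lemma smooth_derivI:
  assumes f: "f \<in> S" and S: "\<And>f. f \<in> S \<Longrightarrow> (\<exists>f'\<in>S. \<forall>x. (f has_real_derivative f' x) (at x))"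
  shows "smooth f"
proof -
  have "(deriv ^^ n) f \<in> S" for n
  proof (induction n)
    case (Suc n)
    obtain f' where f': "f' \<in> S" "\<And>x. ((deriv ^^ n) f has_real_derivative f' x) (at x)"
      using S[OF Suc] by blast
    have "deriv ((deriv ^^ n) f) = f'" by (intro ext DERIV_imp_deriv f')
    then show ?case using f'(1) by simp
  qed (use f in simp)
  then show ?thesis
    using S unfolding smooth_def field_differentiable_def by blast
qed

lemma smooth_deriv: "smooth f \<Longrightarrow> smooth (deriv f)"
  unfolding smooth_def by (metis funpow_Suc_right o_apply)

lemma smooth_has_derivative: "smooth f \<Longrightarrow> (f has_real_derivative deriv f x) (at x)"
  unfolding smooth_def using field_differentiable_derivI[of f x] by (metis funpow_0)

lemma smooth_continuous: "smooth f \<Longrightarrow> continuous_on S f"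
  using smooth_has_derivative by (meson DERIV_isCont continuous_at_imp_continuous_on)

lemma smooth_affine: "smooth f \<Longrightarrow> smooth (\<lambda>x. f (a * x + b))"
proof (rule smooth_derivI[where S = "{\<lambda>x. c * h (a * x + b) | c h. smooth h}"])
  assume "smooth f"
  then show "(\<lambda>x. f (a * x + b)) \<in> {\<lambda>x. c * h (a * x + b) | c h. smooth h}"
    by (auto intro!: exI[of _ 1] exI[of _ f])
next
  fix F assume "F \<in> {\<lambda>x. c * h (a * x + b) | c h. smooth h}"
  then obtain c h where F: "F = (\<lambda>x. c * h (a * x + b))" "smooth h" by auto
  have "(F has_real_derivative (c * a) * deriv h (a * x + b)) (at x)" for x
    unfolding F(1)
    by (rule DERIV_cong[OF DERIV_cmult[OF DERIV_chain2[OF smooth_has_derivative[OF F(2)]]]])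
      (auto intro!: derivative_eq_intros)
  then show "\<exists>F'\<in>{\<lambda>x. c * h (a * x + b) | c h. smooth h}. \<forall>x. (F has_real_derivative F' x) (at x)"
    using smooth_deriv[OF F(2)] by (intro bexI[of _ "\<lambda>x. (c * a) * deriv h (a * x + b)"]) auto
qed

lemma smooth_mult:
  assumes "smooth f" "smooth h"
  shows "smooth (\<lambda>x. f x * h x)"
proof -
  \<comment> \<open>Finite sums of products of smooth functions; the Leibniz rule replaces every
    product by two.\<close>
  define S where "S = {\<lambda>x. \<Sum>p\<leftarrow>ps. fst p x * snd p x | ps. \<forall>p\<in>set ps. smooth (fst p) \<and> smooth (snd p)}"
  define D :: "((real \<Rightarrow> real) \<times> (real \<Rightarrow> real)) list \<Rightarrow> _" where
    "D ps = concat (map (\<lambda>p. [(deriv (fst p), snd p), (fst p, deriv (snd p))]) ps)" for ps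
  show ?thesis
  proof (rule smooth_derivI[of _ S])
    show "(\<lambda>x. f x * h x) \<in> S"
      unfolding S_def using assms by (auto intro!: exI[of _ "[(f, h)]"])
  next
    fix F assume "F \<in> S"
    then obtain ps where ps: "F = (\<lambda>x. \<Sum>p\<leftarrow>ps. fst p x * snd p x)" "\<forall>p\<in>set ps. smooth (fst p) \<and> smooth (snd p)"
      unfolding S_def by auto
    have "((\<lambda>x. \<Sum>p\<leftarrow>ps. fst p x * snd p x) has_real_derivative (\<Sum>p\<leftarrow>D ps. fst p x * snd p x)) (at x)" for x
      using ps(2)
    proof (induction ps)
      case (Cons p ps)
      have "((\<lambda>x. fst p x * snd p x) has_real_derivative (deriv (fst p) x * snd p x + fst p x * deriv (snd p) x)) (at x)"
        using Cons.prems DERIV_mult[OF smooth_has_derivative smooth_has_derivative, of "fst p" "snd p" x]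
        by (simp add: mult.commute)
      from DERIV_add[OF this Cons.IH] Cons.prems show ?case
        by (simp add: D_def add.assoc)
    qed (simp add: D_def)
    moreover have "\<forall>p\<in>set (D ps). smooth (fst p) \<and> smooth (snd p)"
      using ps(2) by (auto simp: D_def smooth_deriv)
    then have "(\<lambda>x. \<Sum>p\<leftarrow>D ps. fst p x * snd p x) \<in> S" unfolding S_def by blast
    ultimately show "\<exists>F'\<in>S. \<forall>x. (F has_real_derivative F' x) (at x)"
      unfolding ps(1) by (intro bexI[of _ "\<lambda>x. \<Sum>p\<leftarrow>D ps. fst p x * snd p x"]) auto
  qed
qed

section \<open>Bump functions\<close>

text \<open>The polynomial is carried along because derivatives of exp(-1/x) are of this shape: with
  y = 1/x, differentiation replaces \<open>p\<close> by y^2 (p - p'). The family is thus closed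
  under differentiation, at 0 included.\<close>

definition flat :: "real poly \<Rightarrow> real \<Rightarrow> real" where
  "flat p x = (if 0 < x then poly p (1 / x) * exp (- (1 / x)) else 0)"

lemma poly_exp_tendsto: "((\<lambda>y. poly p y * exp (- y)) \<longlongrightarrow> 0) at_top" for p :: "real poly"
proof -
  have "((\<lambda>y. \<Sum>i\<le>degree p. coeff p i * (y ^ i / exp y)) \<longlongrightarrow> (\<Sum>i\<le>degree p. coeff p i * 0)) at_top"
    by (intro tendsto_sum tendsto_mult tendsto_const tendsto_power_div_exp_0)
  then show ?thesis
    by (simp add: poly_altdef sum_distrib_right sum_divide_distrib exp_minus field_simps)
qed

lemma flat_has_derivative:
  "(flat p has_real_derivative flat ([:0, 0, 1:] * (p - pderiv p)) x) (at x)"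
proof -
  consider "0 < x" | "x < 0" | "x = 0" by linarith
  then show ?thesis
  proof cases
    case 1
    have "((\<lambda>x. poly p (1 / x) * exp (- (1 / x))) has_real_derivative
        (poly (pderiv p) (1 / x) * (- 1 / x\<^sup>2)) * exp (- (1 / x)) + poly p (1 / x) * (exp (- (1 / x)) * (1 / x\<^sup>2))) (at x)"
      using 1 by (auto intro!: derivative_eq_intros DERIV_chain2[OF poly_DERIV] simp: power2_eq_square field_simps)
    also have "(poly (pderiv p) (1 / x) * (- 1 / x\<^sup>2)) * exp (- (1 / x)) + poly p (1 / x) * (exp (- (1 / x)) * (1 / x\<^sup>2))
        = flat ([:0, 0, 1:] * (p - pderiv p)) x"
      using 1 by (simp add: flat_def power2_eq_square field_simps)
    finally show ?thesis
      by (rule has_field_derivative_transform_within_open[where S = "{0<..}"]) (use 1 in \<open>auto simp: flat_def\<close>)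
  next
    case 2
    have "((\<lambda>x. 0) has_real_derivative flat ([:0, 0, 1:] * (p - pderiv p)) x) (at x)"
      using 2 by (simp add: flat_def)
    then show ?thesis
      by (rule has_field_derivative_transform_within_open[where S = "{..<0}"]) (use 2 in \<open>auto simp: flat_def\<close>)
  next
    case 3
    have "((\<lambda>h. (flat p (0 + h) - flat p 0) / h) \<longlongrightarrow> 0) (at 0)"
      unfolding filterlim_at_split
    proof
      have "((\<lambda>h. (flat p (0 + h) - flat p 0) / h) \<longlongrightarrow> 0) (at_left 0) \<longleftrightarrow> ((\<lambda>h::real. 0::real) \<longlongrightarrow> 0) (at_left 0)"
        by (intro tendsto_cong) (auto simp: eventually_at_left_field flat_def intro!: exI[of _ "- 1"])
      then show "((\<lambda>h. (flat p (0 + h) - flat p 0) / h) \<longlongrightarrow> 0) (at_left 0)" by simp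
      have "((\<lambda>h. poly ([:0, 1:] * p) (inverse h) * exp (- inverse h)) \<longlongrightarrow> 0) (at_right 0)"
        by (rule filterlim_compose[OF poly_exp_tendsto filterlim_inverse_at_top_right])
      moreover have "((\<lambda>h. (flat p (0 + h) - flat p 0) / h) \<longlongrightarrow> 0) (at_right 0) \<longleftrightarrow>
          ((\<lambda>h. poly ([:0, 1:] * p) (inverse h) * exp (- inverse h)) \<longlongrightarrow> 0) (at_right 0)"
        by (intro tendsto_cong) (auto simp: eventually_at_right_field flat_def field_simps intro!: exI[of _ 1])
      ultimately show "((\<lambda>h. (flat p (0 + h) - flat p 0) / h) \<longlongrightarrow> 0) (at_right 0)" by simp
    qed
    then show ?thesis using 3 by (simp add: DERIV_def flat_def)
  qed
qed

lemma smooth_flat: "smooth (flat p)"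
  by (rule smooth_derivI[where S = "range flat"]) (use flat_has_derivative in blast)+

lemma test_function_iff: "test_function \<phi> \<longleftrightarrow> smooth \<phi> \<and> (\<exists>r. \<forall>x. r < \<bar>x\<bar> \<longrightarrow> \<phi> x = 0)"
  by (simp add: test_function_def smooth_def)

lemma test_function_support:
  assumes "test_function \<phi>"
  shows "\<exists>r>0. (\<forall>x. r < \<bar>x\<bar> \<longrightarrow> \<phi> x = 0) \<and> (\<forall>x. r < \<bar>x\<bar> \<longrightarrow> deriv \<phi> x = 0)"
proof -
  obtain r where r: "\<And>x. r < \<bar>x\<bar> \<Longrightarrow> \<phi> x = 0" using assms unfolding test_function_def by blast
  have d: "deriv \<phi> x = 0" if "r < \<bar>x\<bar>" for x
  proof (rule DERIV_imp_deriv, rule has_field_derivative_transform_within_open)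
    show "((\<lambda>x. 0) has_real_derivative 0) (at x)" by simp
    show "open {x. r < \<bar>x\<bar>}" by (intro open_Collect_less continuous_intros)
  qed (use r that in auto)
  show ?thesis by (rule exI[of _ "max r 1"]) (use r d in auto)
qed

lemma test_function_deriv: "test_function \<phi> \<Longrightarrow> test_function (deriv \<phi>)"
  using test_function_support[of \<phi>] smooth_deriv[of \<phi>] by (auto simp: test_function_iff)

lemma test_function_shift:
  assumes "test_function \<phi>"
  shows "test_function (\<lambda>x. \<phi> (x + s))"
proof -
  obtain r where "0 < r" and r: "\<And>x. r < \<bar>x\<bar> \<Longrightarrow> \<phi> x = 0" "\<And>x. r < \<bar>x\<bar> \<Longrightarrow> deriv \<phi> x = 0"
    using test_function_support[OF assms] by blast
  have "\<forall>x. r + \<bar>s\<bar> < \<bar>x\<bar> \<longrightarrow> \<phi> (x + s) = 0" using r by auto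
  then show ?thesis
    using smooth_affine[of \<phi> 1 s] assms unfolding test_function_iff by auto
qed

lemma test_function_continuous: "test_function \<phi> \<Longrightarrow> continuous_on S \<phi>"
  using smooth_continuous by (auto simp: test_function_iff)

lemma test_function_measurable: "test_function \<phi> \<Longrightarrow> \<phi> \<in> borel_measurable borel"
  by (rule borel_measurable_continuous_onI[OF test_function_continuous])

lemma test_function_bounded:
  assumes "test_function \<phi>"
  shows "\<exists>M>0. \<forall>x. \<bar>\<phi> x\<bar> \<le> M"
proof -
  obtain r where r: "0 < r" "\<And>x. r < \<bar>x\<bar> \<Longrightarrow> \<phi> x = 0" "\<And>x. r < \<bar>x\<bar> \<Longrightarrow> deriv \<phi> x = 0"
    using test_function_support[OF assms] by blast
  have "bounded (\<phi> ` {- r..r})"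
    by (intro compact_imp_bounded compact_continuous_image test_function_continuous[OF assms]) auto
  then obtain B where "\<forall>y\<in>\<phi> ` {- r..r}. norm y \<le> B" unfolding bounded_iff by blast
  then have B: "\<And>x. x \<in> {- r..r} \<Longrightarrow> \<bar>\<phi> x\<bar> \<le> B" by auto
  have "\<bar>\<phi> x\<bar> \<le> max B 1" for x
  proof (cases "r < \<bar>x\<bar>")
    case False
    then have "x \<in> {- r..r}" by auto
    from B[OF this] show ?thesis by simp
  qed (simp add: r)
  then show ?thesis by (intro exI[of _ "max B 1"]) auto
qed

text \<open>With f(x) = exp(-1/x) for positive x, the product of f(n(x - c)) and f(n(d - x)), n at
  least 1, vanishes outside the interval and tends to 1 inside, as f tends to 1 at infinity. Staying
  below the indicator provides the dominating function for limits.\<close>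

lemma bump_exists:
  fixes c d :: real
  shows "\<exists>\<phi> :: nat \<Rightarrow> real \<Rightarrow> real. (\<forall>n. test_function (\<phi> n)) \<and> (\<forall>n x. 0 \<le> \<phi> n x) \<and>
    (\<forall>n x. \<phi> n x \<le> indicator {c<..<d} x) \<and> (\<forall>x. (\<lambda>n. \<phi> n x) \<longlonglongrightarrow> indicator {c<..<d} x)"
proof -
  define f where "f = flat 1"
  define \<phi> where "\<phi> n x = f (real (Suc n) * (x - c)) * f (real (Suc n) * (d - x))" for n x
  have f: "0 \<le> f x" "f x \<le> 1" "x \<le> 0 \<Longrightarrow> f x = 0" for x by (auto simp: f_def flat_def)
  have nn: "0 \<le> \<phi> n x" for n x by (simp add: \<phi>_def f)
  have zero: "\<phi> n x = 0" if "x \<notin> {c<..<d}" for n x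
  proof -
    have "x \<le> c \<or> d \<le> x" using that by auto
    then have "real (Suc n) * (x - c) \<le> 0 \<or> real (Suc n) * (d - x) \<le> 0" by (auto intro: mult_nonneg_nonpos)
    then show ?thesis unfolding \<phi>_def using f(3) by auto
  qed
  have le: "\<phi> n x \<le> indicator {c<..<d} x" for n x
    using zero[of x n] f by (cases "x \<in> {c<..<d}") (auto simp: \<phi>_def intro!: mult_le_one)
  have test: "test_function (\<phi> n)" for n
    unfolding test_function_iff
  proof
    have "smooth (\<lambda>x. f (real (Suc n) * x + - real (Suc n) * c) * f (- real (Suc n) * x + real (Suc n) * d))"
      unfolding f_def by (intro smooth_mult smooth_affine smooth_flat)
    then show "smooth (\<phi> n)" by (simp add: \<phi>_def[abs_def] algebra_simps)
    show "\<exists>r. \<forall>x. r < \<bar>x\<bar> \<longrightarrow> \<phi> n x = 0"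
      by (rule exI[of _ "max \<bar>c\<bar> \<bar>d\<bar>"]) (auto intro!: zero)
  qed
  have "(\<lambda>n. \<phi> n x) \<longlonglongrightarrow> indicator {c<..<d} x" for x
  proof (cases "x \<in> {c<..<d}")
    case True
    have "(\<lambda>n. f (real (Suc n) * y)) \<longlonglongrightarrow> 1" if y: "0 < y" for y
    proof -
      have "(\<lambda>n. exp (- ((1 / y) * (1 / real (Suc n))))) \<longlonglongrightarrow> exp (- ((1 / y) * 0))"
        by (intro tendsto_intros LIMSEQ_Suc[OF lim_1_over_n])
      moreover have "exp (- ((1 / y) * (1 / real (Suc n)))) = f (real (Suc n) * y)" for n
        using y by (simp add: f_def flat_def)
      ultimately show ?thesis by simp
    qed
    from tendsto_mult[OF this[of "x - c"] this[of "d - x"]] show ?thesis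
      using True by (simp add: \<phi>_def)
  next
    case False
    then show ?thesis by (simp add: zero)
  qed
  then show ?thesis using nn le test by blast
qed

section \<open>Weak derivatives\<close>

lemma in_L2_iff: "in_L2 f \<longleftrightarrow> sq_integrable f"
  by (simp add: in_L2_def sq_integrable_def)

lemma locally_integrable_box:
  assumes "locally_integrable f"
  shows "set_integrable lborel {c<..<d} f"
proof (rule set_integrable_subset)
  show "set_integrable lborel {- max \<bar>c\<bar> \<bar>d\<bar>..max \<bar>c\<bar> \<bar>d\<bar>} f"
    using assms unfolding locally_integrable_def by blast
qed auto

lemma locally_integrable_measurable:
  assumes "locally_integrable f"
  shows "f \<in> borel_measurable borel"
proof (rule borel_measurable_LIMSEQ_real)
  show "(\<lambda>n. indicator {- real n..real n} x * f x) \<longlonglongrightarrow> f x" for x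
  proof (rule tendsto_eventually)
    obtain N :: nat where N: "\<bar>x\<bar> \<le> real N" using real_arch_simple by blast
    show "\<forall>\<^sub>F n in sequentially. indicator {- real n..real n} x * f x = f x"
      unfolding eventually_sequentially
    proof (intro exI[of _ N] allI impI)
      fix n assume "N \<le> n"
      then have "real N \<le> real n" by simp
      then show "indicator {- real n..real n} x * f x = f x" using N by (auto simp: indicator_def)
    qed
  qed
  show "(\<lambda>x. indicator {- real n..real n} x * f x) \<in> borel_measurable borel" for n
  proof -
    have "integrable lborel (\<lambda>x. indicator {- real n..real n} x *\<^sub>R f x)"
      using assms unfolding locally_integrable_def set_integrable_def by blast
    from borel_measurable_integrable[OF this] show ?thesis by simp
  qed
qed

lemma locally_integrable_test:
  assumes "locally_integrable f" "test_function \<phi>"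
  shows "integrable lborel (\<lambda>x. f x * \<phi> x)"
proof -
  obtain r where r: "0 < r" "\<And>x. r < \<bar>x\<bar> \<Longrightarrow> \<phi> x = 0" "\<And>x. r < \<bar>x\<bar> \<Longrightarrow> deriv \<phi> x = 0"
    using test_function_support[OF assms(2)] by blast
  obtain M where M: "0 < M" "\<And>x. \<bar>\<phi> x\<bar> \<le> M" using test_function_bounded[OF assms(2)] by blast
  note [measurable] = locally_integrable_measurable[OF assms(1)] test_function_measurable[OF assms(2)]
  show ?thesis
  proof (rule Bochner_Integration.integrable_bound)
    show "integrable lborel (\<lambda>x. M * (indicator {- r..r} x *\<^sub>R f x))"
      using assms(1) unfolding locally_integrable_def set_integrable_def by (intro integrable_mult_right) auto
    show "AE x in lborel. norm (f x * \<phi> x) \<le> norm (M * (indicator {- r..r} x *\<^sub>R f x))"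
    proof (rule AE_I2)
      fix x
      show "norm (f x * \<phi> x) \<le> norm (M * (indicator {- r..r} x *\<^sub>R f x))"
      proof (cases "r < \<bar>x\<bar>")
        case False
        then show ?thesis
        proof -
          have "indicator {- r..r} x = (1::real)" using False by (auto simp: indicator_def)
          then show ?thesis
            using mult_right_mono[OF M(2), of "\<bar>f x\<bar>" x] M(1) by (simp add: abs_mult mult.commute)
        qed
      qed (simp add: r)
    qed
  qed measurable
qed

lemma locally_integrable_diff:
  assumes "locally_integrable f" "locally_integrable h"
  shows "locally_integrable (\<lambda>x. f x - h x)"
  using assms unfolding locally_integrable_def by (auto intro: set_integral_diff)

lemma locally_integrable_sq: "sq_integrable f \<Longrightarrow> locally_integrable f"
  unfolding locally_integrable_def
proof
  fix r :: real assume f: "sq_integrable f"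
  have "integrable lborel (\<lambda>x. f x * indicator {- r..r} x)"
  proof (rule sq_integrable_mult[OF f])
    have "(\<lambda>x. (indicator {- r..r} x :: real)\<^sup>2) = indicator {- r..r}" by (auto simp: indicator_def)
    moreover have "integrable lborel (indicator {- r..r} :: real \<Rightarrow> real)"
      by (intro integrable_real_indicator) (auto simp: emeasure_lborel_Icc_eq)
    ultimately show "sq_integrable (indicator {- r..r} :: real \<Rightarrow> real)"
      by (simp add: sq_integrable_def)
  qed
  then show "set_integrable lborel {- r..r} f" by (simp add: set_integrable_def mult.commute)
qed

lemma box_integral_limit:
  assumes f: "locally_integrable f" and lim: "\<And>\<phi>. test_function \<phi> \<Longrightarrow> (LBINT x. f x * \<phi> x) = 0"
  shows "(LBINT x:{c<..<d}. f x) = 0"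
proof -
  obtain \<phi> where \<phi>: "\<And>n::nat. test_function (\<phi> n)" "\<And>n x. 0 \<le> \<phi> n x" "\<And>n x. \<phi> n x \<le> indicator {c<..<d} x"
    "\<And>x. (\<lambda>n. \<phi> n x) \<longlonglongrightarrow> indicator {c<..<d} x" using bump_exists by blast
  note [measurable] = locally_integrable_measurable[OF f] test_function_measurable[OF \<phi>(1)]
  have "(\<lambda>n. LBINT x. f x * \<phi> n x) \<longlonglongrightarrow> (LBINT x. f x * indicator {c<..<d} x)"
  proof (rule integral_dominated_convergence[of "\<lambda>x. f x * indicator {c<..<d} x" lborel "\<lambda>n x. f x * \<phi> n x" "\<lambda>x. norm (indicator {c<..<d} x *\<^sub>R f x)"])
    show "integrable lborel (\<lambda>x. norm (indicator {c<..<d} x *\<^sub>R f x))"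
      using locally_integrable_box[OF f] unfolding set_integrable_def by (rule integrable_norm)
    show "AE x in lborel. norm (f x * \<phi> n x) \<le> norm (indicator {c<..<d} x *\<^sub>R f x)" for n
      using \<phi>(2,3) by (intro AE_I2) (auto simp: abs_mult mult.commute[of "\<bar>f _\<bar>"] intro!: mult_right_mono)
    show "AE x in lborel. (\<lambda>n. f x * \<phi> n x) \<longlonglongrightarrow> f x * indicator {c<..<d} x"
      by (intro AE_I2 tendsto_mult tendsto_const \<phi>)
  qed auto
  then have "(LBINT x. f x * indicator {c<..<d} x) = 0"
    using lim[OF \<phi>(1)] by (simp add: LIMSEQ_const_iff)
  then show ?thesis by (simp add: set_lebesgue_integral_def mult.commute)
qed

text \<open>The fundamental lemma of the calculus of variations: bumps approximate indicators of
  intervals, and vanishing integrals over intervals force a function to vanish.\<close>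

lemma AE_zero_if_test:
  assumes "locally_integrable f" "\<And>\<phi>. test_function \<phi> \<Longrightarrow> (LBINT x. f x * \<phi> x) = 0"
  shows "AE x in lborel. f x = 0"
  using AE_zero_if_box[of f] locally_integrable_box[OF assms(1)] box_integral_limit[OF assms]
  by (simp add: box_real)

lemma weak_deriv_unique:
  assumes "weak_deriv n f h" "weak_deriv n f h'"
  shows "AE x in lborel. h x = h' x"
proof -
  have l: "locally_integrable h" "locally_integrable h'" using assms by (auto simp: weak_deriv_def)
  have "(-1) ^ n * (LBINT x. h x * \<phi> x) = (-1) ^ n * (LBINT x. h' x * \<phi> x)" if "test_function \<phi>" for \<phi>
  proof -
    have "(LBINT x. f x * (deriv ^^ n) \<phi> x) = (-1) ^ n * (LBINT x. h x * \<phi> x)"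
      "(LBINT x. f x * (deriv ^^ n) \<phi> x) = (-1) ^ n * (LBINT x. h' x * \<phi> x)"
      using assms that unfolding weak_deriv_def by blast+
    then show ?thesis by simp
  qed
  then have "(LBINT x. h x * \<phi> x) = (LBINT x. h' x * \<phi> x)" if "test_function \<phi>" for \<phi>
    using that by fastforce
  then have "(LBINT x. (h x - h' x) * \<phi> x) = 0" if "test_function \<phi>" for \<phi>
    using that locally_integrable_test[OF l(1) that] locally_integrable_test[OF l(2) that]
    by (simp add: left_diff_distrib)
  from AE_zero_if_test[OF locally_integrable_diff[OF l] this] show ?thesis by simp
qed

lemma weak_deriv_0: "locally_integrable f \<Longrightarrow> weak_deriv 0 f f"
  by (simp add: weak_deriv_def)

lemma funpow_deriv_Suc: "(deriv ^^ Suc n) \<phi> = (deriv ^^ n) (deriv \<phi>)"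
  by (simp add: funpow_swap1)

text \<open>Reduces weak derivatives of higher order to successive first ones, the form in which
  \<open>dern\<close> is defined.\<close>

lemma weak_deriv_step:
  assumes "weak_deriv n f h"
  shows "weak_deriv (Suc n) f h' \<longleftrightarrow> weak_deriv 1 h h'"
proof -
  have 1: "(LBINT x. f x * (deriv ^^ Suc n) \<phi> x) = (-1) ^ n * (LBINT x. h x * deriv \<phi> x)" if "test_function \<phi>" for \<phi>
    using assms test_function_deriv[OF that] unfolding weak_deriv_def funpow_deriv_Suc by blast
  have "(-1) ^ n * a = (-1) ^ Suc n * b \<longleftrightarrow> a = - b" for a b :: real
    by (cases "even n") auto
  then show ?thesis
    using assms 1 unfolding weak_deriv_def by auto
qed

section \<open>Weak derivatives as derivatives along translations\<close>

abbreviation "TX s \<equiv> shift_l2 (s *\<^sub>R (1::real))"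

interpretation X: isometry_group "\<lambda>s. shift_l2 (s *\<^sub>R (1::real))"
  by (rule isometry_group_shift)

lemma test_function_sq_integrable:
  assumes "test_function \<phi>"
  shows "sq_integrable \<phi>"
proof -
  have "integrable lborel (\<lambda>x. \<phi> x * \<phi> x)"
  proof (rule locally_integrable_test[OF _ assms])
    show "locally_integrable \<phi>"
      unfolding locally_integrable_def
      using borel_integrable_compact[OF compact_Icc test_function_continuous[OF assms]]
      by (auto simp: set_integrable_def indicator_def if_distrib[of "\<lambda>c. c * _"] cong: if_cong)
  qed
  then show ?thesis
    using test_function_measurable[OF assms] by (simp add: sq_integrable_def power2_eq_square)
qed

lemma test_function_taylor:
  assumes "test_function \<phi>"
  shows "\<exists>M>0. \<forall>x s. \<bar>\<phi> (x + s) - \<phi> x - s * deriv \<phi> x\<bar> \<le> M * s\<^sup>2"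
proof -
  obtain M where M: "0 < M" "\<And>x. \<bar>deriv (deriv \<phi>) x\<bar> \<le> M"
    using test_function_bounded[OF test_function_deriv[OF test_function_deriv[OF assms]]] by blast
  have d: "(\<phi> has_real_derivative deriv \<phi> x) (at x)" "(deriv \<phi> has_real_derivative deriv (deriv \<phi>) x) (at x)" for x
    using assms by (auto simp: test_function_iff intro!: smooth_has_derivative smooth_deriv)
  have 1: "\<bar>deriv \<phi> (x + t) - deriv \<phi> x\<bar> \<le> M * \<bar>t\<bar>" for x t
    using field_differentiable_bound[of UNIV "deriv \<phi>" "deriv (deriv \<phi>)" M "x" "x + t"] d(2) M(2)
    by (auto simp: abs_minus_commute)
  have "\<bar>\<phi> (x + s) - \<phi> x - s * deriv \<phi> x\<bar> \<le> M * s\<^sup>2" for x s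
  proof -
    have "norm ((\<phi> (x + s) - s * deriv \<phi> x) - (\<phi> (x + 0) - 0 * deriv \<phi> x)) \<le> (M * \<bar>s\<bar>) * norm (s - 0)"
    proof (rule field_differentiable_bound[of "cball (0::real) \<bar>s\<bar>" "\<lambda>t. \<phi> (x + t) - t * deriv \<phi> x" "\<lambda>t. deriv \<phi> (x + t) - deriv \<phi> x"])
      fix t :: real assume t: "t \<in> cball 0 \<bar>s\<bar>"
      have "((\<lambda>t. \<phi> (x + t)) has_real_derivative deriv \<phi> (x + t)) (at t)"
        using d(1)[of "x + t"] DERIV_shift[of \<phi> "deriv \<phi> (x + t)" t x] by (simp only: add.commute[of t x] add.commute[of _ x])
      moreover have "((\<lambda>t. t * deriv \<phi> x) has_real_derivative deriv \<phi> x) (at t)"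
        using DERIV_cmult_right[OF DERIV_ident, of "deriv \<phi> x" t UNIV] by simp
      ultimately show "((\<lambda>t. \<phi> (x + t) - t * deriv \<phi> x) has_real_derivative deriv \<phi> (x + t) - deriv \<phi> x) (at t within cball 0 \<bar>s\<bar>)"
        by (rule has_field_derivative_at_within[OF DERIV_diff])
      have "M * \<bar>t\<bar> \<le> M * \<bar>s\<bar>" using t M(1) by simp
      then show "norm (deriv \<phi> (x + t) - deriv \<phi> x) \<le> M * \<bar>s\<bar>" using 1[of x t] by simp
    qed auto
    then show ?thesis by (simp add: power2_eq_square abs_if algebra_simps split: if_splits)
  qed
  then show ?thesis using M(1) by blast
qed

lemma tder_if_quadratic:
  assumes "\<And>s. \<bar>s\<bar> \<le> 1 \<Longrightarrow> norm (T s x - T 0 x - s *\<^sub>R y) \<le> K * s\<^sup>2"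
  shows "tder T x y"
  unfolding tder_def has_vector_derivative_def has_derivative_within
proof
  show "bounded_linear (\<lambda>u. u *\<^sub>R y)" by (rule bounded_linear_scaleR_left)
  show "((\<lambda>s. (1 / norm (s - 0)) *\<^sub>R (T s x - (T 0 x + (s - 0) *\<^sub>R y))) \<longlongrightarrow> 0) (at 0)"
  proof (rule Lim_null_comparison)
    show "((\<lambda>s. K * \<bar>s\<bar>) \<longlongrightarrow> 0) (at 0)"
      by (intro tendsto_mult_right_zero tendsto_rabs_zero tendsto_ident_at)
    show "\<forall>\<^sub>F s in at 0. norm ((1 / norm (s - 0)) *\<^sub>R (T s x - (T 0 x + (s - 0) *\<^sub>R y))) \<le> K * \<bar>s\<bar>"
      unfolding eventually_at
    proof (intro exI[of _ 1] conjI ballI impI)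
      fix s :: real assume s: "s \<noteq> 0 \<and> dist s 0 < 1"
      then have "norm (T s x - T 0 x - s *\<^sub>R y) / \<bar>s\<bar> \<le> K * s\<^sup>2 / \<bar>s\<bar>"
        by (intro divide_right_mono assms) auto
      also have "\<dots> = K * \<bar>s\<bar>" using s by (simp add: power2_eq_square abs_if)
      finally have le: "norm (T s x - T 0 x - s *\<^sub>R y) / \<bar>s\<bar> \<le> K * \<bar>s\<bar>" .
      have "(1 / norm (s - 0)) *\<^sub>R (T s x - (T 0 x + (s - 0) *\<^sub>R y)) = (1 / \<bar>s\<bar>) *\<^sub>R (T s x - T 0 x - s *\<^sub>R y)"
        by (simp add: diff_diff_add)
      then have "norm ((1 / norm (s - 0)) *\<^sub>R (T s x - (T 0 x + (s - 0) *\<^sub>R y))) = norm (T s x - T 0 x - s *\<^sub>R y) / \<bar>s\<bar>"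
        by (simp only: norm_scaleR) simp
      then show "norm ((1 / norm (s - 0)) *\<^sub>R (T s x - (T 0 x + (s - 0) *\<^sub>R y))) \<le> K * \<bar>s\<bar>"
        using le by (simp only:)
    qed simp
  qed
qed

lemma tder_test_function:
  assumes "test_function \<phi>"
  shows "tder (\<lambda>s. TX s) (abs_l2 \<phi>) (abs_l2 (deriv \<phi>))"
proof -
  obtain M where M: "0 < M" "\<And>x s. \<bar>\<phi> (x + s) - \<phi> x - s * deriv \<phi> x\<bar> \<le> M * s\<^sup>2"
    using test_function_taylor[OF assms] by blast
  obtain r where r: "0 < r" "\<And>x. r < \<bar>x\<bar> \<Longrightarrow> \<phi> x = 0" "\<And>x. r < \<bar>x\<bar> \<Longrightarrow> deriv \<phi> x = 0"
    using test_function_support[OF assms] by blast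
  note sq = test_function_sq_integrable[OF assms] test_function_sq_integrable[OF test_function_deriv[OF assms]]
  show ?thesis
  proof (rule tder_if_quadratic)
    fix s :: real assume s: "\<bar>s\<bar> \<le> 1"
    let ?d = "\<lambda>x. \<phi> (x + s) - \<phi> x - s * deriv \<phi> x"
    \<comment> \<open>The support is enlarged by 1 to cover all translates with
      \<open>\<bar>s\<bar> \<le> 1\<close>; on this fixed interval the pointwise Taylor bound
      becomes a bound in norm.\<close>
    let ?I = "indicator {- (r + 1)..r + 1} :: real \<Rightarrow> real"
    have d: "sq_integrable ?d"
      by (intro sq_integrable_diff sq_integrable_shift sq_integrable_scale sq)
    have "TX s (abs_l2 \<phi>) - TX 0 (abs_l2 \<phi>) - s *\<^sub>R abs_l2 (deriv \<phi>) = abs_l2 ?d"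
      using sq by (simp add: shift_zero shift_abs abs_scaleR abs_diff sq_integrable_shift sq_integrable_diff sq_integrable_scale)
    then have "(norm (TX s (abs_l2 \<phi>) - TX 0 (abs_l2 \<phi>) - s *\<^sub>R abs_l2 (deriv \<phi>)))\<^sup>2 = (LBINT x. (?d x)\<^sup>2)"
      using d by (simp add: norm_abs)
    also have "\<dots> \<le> (LBINT x. (M * s\<^sup>2)\<^sup>2 * ?I x)"
    proof (rule integral_mono)
      show "integrable lborel (\<lambda>x. (?d x)\<^sup>2)" using d by (simp add: sq_integrable_def)
      show "integrable lborel (\<lambda>x. (M * s\<^sup>2)\<^sup>2 * ?I x)" using r by simp
      show "(?d x)\<^sup>2 \<le> (M * s\<^sup>2)\<^sup>2 * ?I x" for x
      proof (cases "x \<in> {- (r + 1)..r + 1}")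
        case True
        then show ?thesis using power_mono[OF M(2)[of x s] abs_ge_zero, of 2] by simp
      next
        case False
        then have "r < \<bar>x\<bar>" "r < \<bar>x + s\<bar>" using s by auto
        then show ?thesis using r by simp
      qed
    qed
    also have "\<dots> = ((M * sqrt (2 * r + 2)) * s\<^sup>2)\<^sup>2"
      using r(1) by (simp add: power_mult_distrib)
    finally show "norm (TX s (abs_l2 \<phi>) - TX 0 (abs_l2 \<phi>) - s *\<^sub>R abs_l2 (deriv \<phi>)) \<le> (M * sqrt (2 * r + 2)) * s\<^sup>2"
      by (rule power2_le_imp_le) (use M(1) r(1) in simp)
  qed
qed

text \<open>The bridge between function spaces and the abstract theory. Test functions form a total
  translation-invariant set, which gives one direction by \<open>tder_weak\<close>; the other is
  skewness against a test function.\<close>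

lemma weak_deriv_1_iff_tder:
  assumes f: "sq_integrable f" and h: "sq_integrable h"
  shows "weak_deriv 1 f h \<longleftrightarrow> tder (\<lambda>s. TX s) (abs_l2 f) (abs_l2 h)"
proof
  assume w: "weak_deriv 1 f h"
  show "tder (\<lambda>s. TX s) (abs_l2 f) (abs_l2 h)"
  proof (rule X.tder_weak[where \<Phi> = "abs_l2 ` Collect test_function"])
    show "TX s \<phi> \<in> abs_l2 ` Collect test_function" if "\<phi> \<in> abs_l2 ` Collect test_function" for \<phi> s
      using that by (auto simp: shift_abs test_function_sq_integrable test_function_shift)
    show "\<exists>\<phi>'. tder (\<lambda>s. TX s) \<phi> \<phi>' \<and> inner (abs_l2 f) \<phi>' = - inner (abs_l2 h) \<phi>" if \<phi>: "\<phi> \<in> abs_l2 ` Collect test_function" for \<phi>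
    proof -
      obtain \<psi> where \<psi>: "test_function \<psi>" "\<phi> = abs_l2 \<psi>" using \<phi> by auto
      have "(LBINT x. f x * deriv \<psi> x) = - (LBINT x. h x * \<psi> x)"
        using w \<psi>(1) by (auto simp: weak_deriv_def)
      then show ?thesis
        using tder_test_function[OF \<psi>(1)] f h \<psi>
        by (auto simp: inner_abs test_function_sq_integrable test_function_deriv)
    qed
    show "z = 0" if z: "\<And>\<phi>. \<phi> \<in> abs_l2 ` Collect test_function \<Longrightarrow> inner z \<phi> = 0" for z
    proof -
      obtain k where k: "z = abs_l2 k" "sq_integrable k" by (metis l2_cases)
      have "AE x in lborel. k x = 0"
      proof (rule AE_zero_if_test[OF locally_integrable_sq[OF k(2)]])
        show "(LBINT x. k x * \<phi> x) = 0" if "test_function \<phi>" for \<phi>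
          using z[of "abs_l2 \<phi>"] that k by (simp add: inner_abs test_function_sq_integrable)
      qed
      then show ?thesis using abs_eq_iff[OF k(2) sq_integrable_zero] k by (simp add: zero_l2.abs_eq)
    qed
  qed
next
  assume t: "tder (\<lambda>s. TX s) (abs_l2 f) (abs_l2 h)"
  have "(LBINT x. f x * deriv \<phi> x) = - (LBINT x. h x * \<phi> x)" if "test_function \<phi>" for \<phi>
    using X.tder_skew[OF t tder_test_function[OF that]] f h that
    by (simp add: inner_abs test_function_sq_integrable test_function_deriv)
  then show "weak_deriv 1 f h"
    using f h by (simp add: weak_deriv_def locally_integrable_sq)
qed

section \<open>The weighted history space\<close>

lemma integral_prod_lborel:
  fixes F :: "real \<times> real \<Rightarrow> real"
  assumes "integrable lborel F"
  shows "(\<integral>p. F p \<partial>lborel) = (\<integral>x. (\<integral>y. F (x, y) \<partial>lborel) \<partial>lborel)"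
    "integrable lborel (\<lambda>x. \<integral>y. F (x, y) \<partial>lborel)"
    "AE x in lborel. integrable lborel (\<lambda>y. F (x, y))"
proof -
  have F: "integrable (lborel \<Otimes>\<^sub>M lborel) F" using assms by (simp add: lborel_prod)
  show "(\<integral>p. F p \<partial>lborel) = (\<integral>x. (\<integral>y. F (x, y) \<partial>lborel) \<partial>lborel)"
    using lborel_pair.integral_fst'[OF F] by (simp add: lborel_prod)
  show "integrable lborel (\<lambda>x. \<integral>y. F (x, y) \<partial>lborel)"
    by (rule lborel_pair.integrable_fst'[OF F])
  show "AE x in lborel. integrable lborel (\<lambda>y. F (x, y))"
    by (rule lborel_pair.AE_integrable_fst'[OF F])
qed

lemma AE_prod_lborel:
  assumes "AE x in lborel. AE y in lborel. P (x, y)" "{p. P p} \<in> sets borel"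
  shows "AE p in (lborel :: (real \<times> real) measure). P p"
proof -
  have "{p \<in> space (lborel \<Otimes>\<^sub>M lborel). P p} \<in> sets ((lborel :: real measure) \<Otimes>\<^sub>M (lborel :: real measure))"
    using assms(2) by (simp only: lborel_prod) simp
  from lborel_pair.AE_pair_measure[OF this] assms(1) show ?thesis by (simp only: lborel_prod)
qed

lemma AE_prod_lborelD:
  assumes "AE p in (lborel :: (real \<times> real) measure). P p"
  shows "AE x in lborel. AE y in lborel. P (x, y)"
  using lborel_pair.AE_pair[of P] assms by (simp only: lborel_prod)

lemma measurable_section:
  assumes "F \<in> borel_measurable (borel :: (real \<times> real) measure)"
  shows "(\<lambda>y. F (x, y)) \<in> borel_measurable borel"
  by (rule measurable_compose[OF _ assms]) (simp add: borel_prod[symmetric])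

lemma sq_integrable_section:
  assumes "sq_integrable (F :: real \<times> real \<Rightarrow> real)"
  shows "AE x in lborel. sq_integrable (\<lambda>y. F (x, y))"
  using integral_prod_lborel(3)[of "\<lambda>p. (F p)\<^sup>2"] measurable_section[OF sq_integrable_measurable[OF assms]] assms
  by (auto simp: sq_integrable_def)

lemma sq_integrable_tensor:
  fixes f h :: "real \<Rightarrow> real"
  assumes f: "sq_integrable f" and h: "sq_integrable h"
  shows "sq_integrable (\<lambda>p. f (fst p) * h (snd p))"
proof -
  note [measurable] = sq_integrable_measurable[OF f] sq_integrable_measurable[OF h]
  have "integrable (lborel \<Otimes>\<^sub>M lborel) (\<lambda>p. (f (fst p) * h (snd p))\<^sup>2)"
  proof (rule lborel_pair.Fubini_integrable)
    show "integrable lborel (\<lambda>x. \<integral>y. norm ((f (fst (x, y)) * h (snd (x, y)))\<^sup>2) \<partial>lborel)"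
      using f by (simp add: power_mult_distrib sq_integrable_def)
    show "AE x in lborel. integrable lborel (\<lambda>y. (f (fst (x, y)) * h (snd (x, y)))\<^sup>2)"
      using h by (simp add: power_mult_distrib sq_integrable_def)
  qed measurable
  moreover have "(\<lambda>p. f (fst p) * h (snd p)) \<in> borel_measurable (lborel \<Otimes>\<^sub>M lborel)" by measurable
  ultimately show ?thesis by (simp add: sq_integrable_def lborel_prod)
qed

text \<open>The first factor depends on the history variable, the second on x. With the square root
  of the kernel as first factor this becomes the map \<open>J\<close> of the abstract
  system.\<close>

lift_definition tensor :: "real l2 \<Rightarrow> real l2 \<Rightarrow> (real \<times> real) l2" is "\<lambda>f h p. f (fst p) * h (snd p)"
proof (intro conjI; (elim conjE)?)
  fix f f' h h' :: "real \<Rightarrow> real"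
  assume sq: "sq_integrable f" "sq_integrable f'" "sq_integrable h" "sq_integrable h'"
    and ae: "AE x in lborel. f x = f' x" "AE x in lborel. h x = h' x"
  show "sq_integrable (\<lambda>p. f (fst p) * h (snd p))" "sq_integrable (\<lambda>p. f' (fst p) * h' (snd p))"
    using sq by (auto intro: sq_integrable_tensor)
  note [measurable] = sq[THEN sq_integrable_measurable]
  show "AE p in lborel. f (fst p) * h (snd p) = f' (fst p) * h' (snd p)"
  proof (rule AE_prod_lborel)
    show "AE x in lborel. AE y in lborel. f (fst (x, y)) * h (snd (x, y)) = f' (fst (x, y)) * h' (snd (x, y))"
      using ae(1)
    proof eventually_elim
      case (elim x)
      show ?case using ae(2) by eventually_elim (simp add: elim)
    qed
    have "{p \<in> space (borel \<Otimes>\<^sub>M borel). f (fst p) * h (snd p) = f' (fst p) * h' (snd p)} \<in> sets (borel \<Otimes>\<^sub>M borel)"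
      by measurable
    then show "{p. f (fst p) * h (snd p) = f' (fst p) * h' (snd p)} \<in> sets borel"
      by (simp only: borel_prod) simp
  qed
qed

lemma tensor_abs:
  "sq_integrable f \<Longrightarrow> sq_integrable h \<Longrightarrow> tensor (abs_l2 f) (abs_l2 h) = abs_l2 (\<lambda>p. f (fst p) * h (snd p))"
  by (rule tensor.abs_eq) auto

lemma inner_abs_tensor:
  fixes F :: "real \<times> real \<Rightarrow> real"
  assumes F: "sq_integrable F" and f: "sq_integrable f" and h: "sq_integrable h"
  shows "inner (abs_l2 F) (tensor (abs_l2 f) (abs_l2 h)) = (\<integral>x. f x * (\<integral>y. F (x, y) * h y \<partial>lborel) \<partial>lborel)"
  unfolding tensor_abs[OF f h] inner_abs[OF F sq_integrable_tensor[OF f h]]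
  by (subst integral_prod_lborel(1)[OF sq_integrable_mult[OF F sq_integrable_tensor[OF f h]]])
    (simp add: mult.left_commute)

lemma inner_tensor: "inner (tensor x y) (tensor x' y') = inner x x' * inner y y'"
proof -
  obtain f h f' h' where r: "x = abs_l2 f" "sq_integrable f" "y = abs_l2 h" "sq_integrable h"
    "x' = abs_l2 f'" "sq_integrable f'" "y' = abs_l2 h'" "sq_integrable h'" by (metis l2_cases)
  have "inner (tensor x y) (tensor x' y') = (\<integral>s. f' s * (\<integral>t. f s * h t * h' t \<partial>lborel) \<partial>lborel)"
    using inner_abs_tensor[OF sq_integrable_tensor[OF r(2,4)] r(6,8)] r by (simp add: tensor_abs)
  also have "\<dots> = (\<integral>s. (f s * f' s) * (\<integral>t. h t * h' t \<partial>lborel) \<partial>lborel)"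
  proof (rule arg_cong[of _ _ "integral\<^sup>L lborel"], rule ext)
    fix s
    have "(\<integral>t. f s * h t * h' t \<partial>lborel) = f s * (\<integral>t. h t * h' t \<partial>lborel)"
      unfolding mult.assoc by (rule integral_mult_right_zero)
    then show "f' s * (\<integral>t. f s * h t * h' t \<partial>lborel) = (f s * f' s) * (\<integral>t. h t * h' t \<partial>lborel)"
      by (simp only: mult_ac)
  qed
  also have "\<dots> = inner x x' * inner y y'"
    using r by (simp only: integral_mult_left_zero inner_abs)
  finally show ?thesis .
qed

lemma norm_tensor: "norm (tensor x y) = norm x * norm y"
  by (simp add: norm_eq_sqrt_inner inner_tensor real_sqrt_mult)

lemma tensor_add_right: "tensor w (x + y) = tensor w x + tensor w y"
proof -
  obtain f h k where r: "x = abs_l2 f" "sq_integrable f" "y = abs_l2 h" "sq_integrable h"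
    "w = abs_l2 k" "sq_integrable k" by (metis l2_cases)
  show ?thesis
    using r by (simp add: tensor_abs abs_add sq_integrable_add sq_integrable_tensor distrib_left)
qed

lemma tensor_scaleR_right: "tensor w (c *\<^sub>R x) = c *\<^sub>R tensor w x"
proof -
  obtain f k where r: "x = abs_l2 f" "sq_integrable f" "w = abs_l2 k" "sq_integrable k" by (metis l2_cases)
  show ?thesis
    using r by (simp add: tensor_abs abs_scaleR sq_integrable_scale sq_integrable_tensor mult.left_commute)
qed

lemma bounded_linear_tensor: "bounded_linear (tensor w)"
  by (rule bounded_linear_intro[of _ "norm w"])
    (simp_all add: tensor_add_right tensor_scaleR_right norm_tensor mult.commute)

abbreviation "TY s \<equiv> shift_l2 (s *\<^sub>R (0::real, 1::real))"

interpretation Y: isometry_group "\<lambda>s. shift_l2 (s *\<^sub>R (0::real, 1::real))"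
  by (rule isometry_group_shift)

interpretation X: isometry_group "\<lambda>s. shift_l2 (s *\<^sub>R (1::real))"
  by (rule isometry_group_shift)

lemma shift_tensor: "TY s (tensor w x) = tensor w (TX s x)"
proof -
  obtain f k where r: "x = abs_l2 f" "sq_integrable f" "w = abs_l2 k" "sq_integrable k" by (metis l2_cases)
  show ?thesis
    using r by (simp add: tensor_abs shift_abs sq_integrable_shift sq_integrable_tensor)
qed

lemma tder_tensor: "tder (\<lambda>s. TX s) x y \<Longrightarrow> tder (\<lambda>s. TY s) (tensor w x) (tensor w y)"
  unfolding tder_def shift_tensor by (rule bounded_linear.has_vector_derivative[OF bounded_linear_tensor])

definition ind :: "real \<Rightarrow> real \<Rightarrow> real l2" where
  "ind c d = abs_l2 (indicator (box c d))"

lemma bump_tendsto_ind: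
  "\<exists>\<phi>. (\<forall>n::nat. test_function (\<phi> n)) \<and> (\<lambda>n. abs_l2 (\<phi> n)) \<longlonglongrightarrow> ind c d"
proof -
  obtain \<phi> where \<phi>: "\<And>n::nat. test_function (\<phi> n)" "\<And>n x. 0 \<le> \<phi> n x" "\<And>n x. \<phi> n x \<le> indicator {c<..<d} x"
    "\<And>x. (\<lambda>n. \<phi> n x) \<longlonglongrightarrow> indicator {c<..<d} x" using bump_exists by blast
  let ?i = "indicator {c<..<d} :: real \<Rightarrow> real"
  have i: "sq_integrable ?i" using sq_integrable_indicator_box[of c d] by (simp add: box_real)
  have i_int: "integrable lborel ?i" by (rule integrable_real_indicator) (use emeasure_lborel_box_finite[of c d] in \<open>simp_all add: box_real\<close>)
  note [measurable] = test_function_measurable[OF \<phi>(1)]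
  have "(\<lambda>n. \<integral>x. (\<phi> n x - ?i x)\<^sup>2 \<partial>lborel) \<longlonglongrightarrow> integral\<^sup>L (lborel :: real measure) (\<lambda>x. 0)"
  proof (rule integral_dominated_convergence[of "\<lambda>x. 0" lborel "\<lambda>n x. (\<phi> n x - ?i x)\<^sup>2" ?i])
    show "AE x in lborel. (\<lambda>n. (\<phi> n x - ?i x)\<^sup>2) \<longlonglongrightarrow> 0"
    proof (rule AE_I2)
      fix x
      have "(\<lambda>n. (\<phi> n x - ?i x)\<^sup>2) \<longlonglongrightarrow> 0\<^sup>2" by (intro tendsto_power LIM_zero \<phi>(4))
      then show "(\<lambda>n. (\<phi> n x - ?i x)\<^sup>2) \<longlonglongrightarrow> 0" by (simp only: zero_power2)
    qed
    show "AE x in lborel. norm ((\<phi> n x - ?i x)\<^sup>2) \<le> ?i x" for n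
    proof (rule AE_I2)
      fix x
      show "norm ((\<phi> n x - ?i x)\<^sup>2) \<le> ?i x"
      proof (cases "x \<in> {c<..<d}")
        case True
        then have "\<bar>\<phi> n x - 1\<bar> \<le> 1" using \<phi>(2,3)[of n x] by (auto simp: abs_le_iff)
        then show ?thesis using True abs_square_le_1[of "\<phi> n x - 1"] by simp
      next
        case False
        then have "\<phi> n x = 0" using \<phi>(2,3)[of n x] by simp
        then show ?thesis using False by simp
      qed
    qed
  qed (use i_int in auto)
  then have "(\<lambda>n. (norm (abs_l2 (\<phi> n) - abs_l2 ?i))\<^sup>2) \<longlonglongrightarrow> 0"
    by (simp add: abs_diff i test_function_sq_integrable \<phi>(1) norm_abs sq_integrable_diff)
  from tendsto_real_sqrt[OF this] have "(\<lambda>n. abs_l2 (\<phi> n) - abs_l2 ?i) \<longlonglongrightarrow> 0"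
    by (simp add: tendsto_norm_zero_iff)
  then have "(\<lambda>n. abs_l2 (\<phi> n)) \<longlonglongrightarrow> ind c d"
    unfolding ind_def by (simp add: box_real LIM_zero_cancel)
  then show ?thesis using \<phi>(1) by blast
qed

lemma l2_prod_eq_zero_if_ind:
  assumes "\<And>a b c d. inner z (tensor (ind a b) (ind c d)) = 0"
  shows "z = 0"
proof (rule l2_eq_zero_if_box)
  fix p q :: "real \<times> real"
  have "(indicator (box p q) :: real \<times> real \<Rightarrow> real)
      = (\<lambda>t. indicator (box (fst p) (fst q)) (fst t) * indicator (box (snd p) (snd q)) (snd t))"
    unfolding indicator_def fun_eq_iff mem_box Basis_prod_def by (auto simp: inner_prod_def)
  then have "abs_l2 (indicator (box p q)) = tensor (ind (fst p) (fst q)) (ind (snd p) (snd q))"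
    by (simp only: ind_def tensor_abs[OF sq_integrable_indicator_box sq_integrable_indicator_box])
  then show "inner z (abs_l2 (indicator (box p q))) = 0" using assms by simp
qed

text \<open>Smoothness is asked only in x, the variable that is differentiated; in the history
  variable indicators suffice.\<close>

lemma l2_prod_eq_zero_if_test:
  assumes "\<And>a b \<phi>. test_function \<phi> \<Longrightarrow> inner z (tensor (ind a b) (abs_l2 \<phi>)) = 0"
  shows "z = 0"
proof (rule l2_prod_eq_zero_if_ind)
  fix a b c d
  obtain \<phi> where \<phi>: "\<And>n::nat. test_function (\<phi> n)" "(\<lambda>n. abs_l2 (\<phi> n)) \<longlonglongrightarrow> ind c d"
    using bump_tendsto_ind by blast
  have "(\<lambda>n. inner z (tensor (ind a b) (abs_l2 (\<phi> n)))) \<longlonglongrightarrow> inner z (tensor (ind a b) (ind c d))"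
    by (intro tendsto_inner tendsto_const bounded_linear.tendsto[OF bounded_linear_tensor] \<phi>)
  then show "inner z (tensor (ind a b) (ind c d)) = 0"
    using assms[OF \<phi>(1)] by (simp add: LIMSEQ_const_iff)
qed

lemma decreasing_if_derivative:
  fixes f :: "real \<Rightarrow> real"
  assumes d: "\<And>t. 0 \<le> t \<Longrightarrow> (f has_real_derivative f' t) (at t within {0..})"
    and le: "\<And>t. 0 \<le> t \<Longrightarrow> f' t \<le> 0" and t: "0 \<le> s" "s \<le> t"
  shows "f t \<le> f s"
proof (rule DERIV_nonpos_imp_decreasing_open[of s t f])
  show "\<exists>y. (f has_real_derivative y) (at x) \<and> y \<le> 0" if "s < x" "x < t" for x
    using d[of x] le[of x] that t by (auto simp: at_within_interior[of x "{0..}"])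
  show "continuous_on {s..t} f"
    by (rule DERIV_continuous_on[of "{s..t}" f f'], rule DERIV_subset[OF d]) (use t in auto)
qed (rule t)

section \<open>The memory kernel\<close>

locale memory_kernel =
  fixes g g' :: "real \<Rightarrow> real" and k1 k2 :: real
  assumes g_deriv: "\<And>\<sigma>. \<sigma> \<ge> 0 \<Longrightarrow> (g has_real_derivative g' \<sigma>) (at \<sigma> within {0..})"
    and g_nonzero: "\<exists>\<sigma>\<ge>0. g \<sigma> \<noteq> 0" and g_nonneg: "\<And>\<sigma>. \<sigma> \<ge> 0 \<Longrightarrow> g \<sigma> \<ge> 0"
    and k_pos: "k1 > 0" "k2 > 0"
    and g'_bounds: "\<And>\<sigma>. \<sigma> \<ge> 0 \<Longrightarrow> - k1 * g \<sigma> \<le> g' \<sigma> \<and> g' \<sigma> \<le> - k2 * g \<sigma>"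
begin

lemma g_exp_deriv:
  assumes "0 \<le> t"
  shows "((\<lambda>t. g t * exp (c * t)) has_real_derivative (g' t + c * g t) * exp (c * t)) (at t within {0..})"
  by (rule DERIV_cong[OF DERIV_mult[OF g_deriv[OF assms]]])
    (auto intro!: derivative_eq_intros simp: algebra_simps)

lemma g_decay: "0 \<le> s \<Longrightarrow> s \<le> t \<Longrightarrow> g t * exp (k2 * t) \<le> g s * exp (k2 * s)"
  by (rule decreasing_if_derivative[OF g_exp_deriv])
    (use g'_bounds in \<open>force intro!: mult_nonpos_nonneg\<close>)+

lemma g_lower: "0 \<le> s \<Longrightarrow> s \<le> t \<Longrightarrow> g s * exp (k1 * s) \<le> g t * exp (k1 * t)"
  using decreasing_if_derivative[OF DERIV_minus[OF g_exp_deriv[of _ k1]], of s t] g'_bounds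
  by (force intro!: mult_nonneg_nonneg)

lemma g_decreasing: "0 \<le> s \<Longrightarrow> s \<le> t \<Longrightarrow> g t \<le> g s"
proof (rule decreasing_if_derivative[OF g_deriv])
  show "g' t \<le> 0" if "0 \<le> t" for t
    using g'_bounds[OF that] mult_nonneg_nonneg[of k2 "g t"] g_nonneg[OF that] k_pos by linarith
qed

text \<open>From a point where the kernel is positive, monotonicity carries positivity to the left,
  and the lower bound with \<open>k1\<close> carries it to the right.\<close>

lemma g_pos: "0 \<le> \<sigma> \<Longrightarrow> 0 < g \<sigma>"
proof -
  assume \<sigma>: "0 \<le> \<sigma>"
  obtain s where s: "0 \<le> s" "0 < g s" using g_nonzero g_nonneg by (metis order_less_le)
  show ?thesis
  proof (cases "\<sigma> \<le> s")
    case True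
    then show ?thesis using g_decreasing[OF \<sigma> True] s by simp
  next
    case False
    then have "g s * exp (k1 * s) \<le> g \<sigma> * exp (k1 * \<sigma>)" using s by (intro g_lower) auto
    moreover have "0 < g s * exp (k1 * s)" using s by simp
    ultimately have "0 < g \<sigma> * exp (k1 * \<sigma>)" by linarith
    then show ?thesis by (simp add: zero_less_mult_iff)
  qed
qed

definition wt :: "real \<Rightarrow> real" where
  "wt \<sigma> = sqrt (indicator {0..} \<sigma> * g \<sigma>)"

lemma wt_nonneg: "0 \<le> \<sigma> \<Longrightarrow> wt \<sigma> = sqrt (g \<sigma>)" and wt_neg: "\<sigma> < 0 \<Longrightarrow> wt \<sigma> = 0"
  by (simp_all add: wt_def)

lemma wt_pos: "0 < wt \<sigma> \<longleftrightarrow> 0 \<le> \<sigma>"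
  using g_pos[of \<sigma>] by (cases "0 \<le> \<sigma>") (simp_all add: wt_def)

lemma wt_ge_0: "0 \<le> wt \<sigma>"
  using wt_pos[of \<sigma>] wt_neg[of \<sigma>] by (cases "0 \<le> \<sigma>") auto

lemma wt_sq: "(wt \<sigma>)\<^sup>2 = indicator {0..} \<sigma> * g \<sigma>"
  using g_nonneg[of \<sigma>] by (cases "0 \<le> \<sigma>") (simp_all add: wt_def)

lemma g_continuous: "continuous_on {0..} g"
  by (rule DERIV_continuous_on[of "{0..}" g g'], rule g_deriv) auto

lemma g_measurable: "(\<lambda>\<sigma>. indicator {0..} \<sigma> * g \<sigma>) \<in> borel_measurable borel"
  using borel_measurable_continuous_on_indicator[OF _ g_continuous] by simp

lemma wt_measurable[measurable]: "wt \<in> borel_measurable borel"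
  unfolding wt_def[abs_def] by (rule measurable_compose[OF g_measurable borel_measurable_sqrt])

lemma g_integrable: "integrable lborel (\<lambda>\<sigma>. indicator {0..} \<sigma> * g \<sigma>)"
proof (rule Bochner_Integration.integrable_bound)
  have "(\<integral>\<^sup>+x. ennreal (exp (- (k2 * x))) * indicator {0..} x \<partial>lborel) = ennreal (0 - (- (exp (- (k2 * 0)) / k2)))"
  proof (rule nn_integral_FTC_atLeast)
    show "((\<lambda>x. - (exp (- (k2 * x)) / k2)) has_real_derivative exp (- (k2 * x))) (at x)" for x
      using k_pos by (auto intro!: derivative_eq_intros)
    have "((\<lambda>x. exp (- (k2 * x))) \<longlongrightarrow> 0) at_top"
      using filterlim_compose[OF exp_at_bot filterlim_tendsto_neg_mult_at_bot[OF tendsto_const[of "- k2"] _ filterlim_ident]] k_pos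
      by simp
    then show "((\<lambda>x. - (exp (- (k2 * x)) / k2)) \<longlongrightarrow> 0) at_top"
      using tendsto_minus[OF tendsto_divide[OF _ tendsto_const[of k2]]] k_pos by fastforce
  qed auto
  then have "integrable lborel (\<lambda>x. indicator {0..} x *\<^sub>R exp (- (k2 * x)))"
    by (intro integrableI_nonneg) (auto simp: indicator_mult_ennreal mult.commute ennreal_mult''[symmetric] ennreal_indicator[symmetric])
  then show "integrable lborel (\<lambda>x. g 0 * (indicator {0..} x *\<^sub>R exp (- (k2 * x))))"
    by (rule integrable_mult_right)
  show "AE x in lborel. norm (indicator {0..} x * g x) \<le> norm (g 0 * (indicator {0..} x *\<^sub>R exp (- (k2 * x))))"
  proof (rule AE_I2)
    fix x :: real
    show "norm (indicator {0..} x * g x) \<le> norm (g 0 * (indicator {0..} x *\<^sub>R exp (- (k2 * x))))"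
    proof (cases "0 \<le> x")
      case True
      have "g x * exp (k2 * x) \<le> g 0" using g_decay[of 0 x] True by simp
      then have "g x \<le> g 0 * exp (- (k2 * x))" by (simp add: exp_minus field_simps)
      then show ?thesis using True g_nonneg[of x] g_nonneg[of 0] by simp
    qed simp
  qed
qed (use g_measurable in simp)

lemma sq_integrable_wt: "sq_integrable wt"
  using g_integrable by (simp add: sq_integrable_def wt_sq)

end

section \<open>Derivatives in the plane and on lines\<close>

text \<open>By closedness, convergence along a single sequence of steps suffices. This is exactly
  what survives the passage to a subsequence.\<close>

lemma (in isometry_group) tder_if_diffq:
  assumes s: "filterlim s (at_right 0) sequentially" and d: "(\<lambda>n. diffq T (s n) x) \<longlonglongrightarrow> y"
  shows "tder T x y"
proof -
  have "\<forall>\<^sub>F n in sequentially. 0 < s n"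
    using s unfolding filterlim_at by (auto elim: eventually_mono)
  then obtain N where N: "\<And>n. N \<le> n \<Longrightarrow> 0 < s n" unfolding eventually_sequentially by blast
  show ?thesis
  proof (rule tder_closed[OF tder_avg])
    show "0 < s (n + N)" for n using N by simp
    show "(\<lambda>n. avg T (s (n + N)) x) \<longlonglongrightarrow> x"
      using LIMSEQ_ignore_initial_segment[OF filterlim_compose[OF avg_tendsto s]] .
    show "(\<lambda>n. diffq T (s (n + N)) x) \<longlonglongrightarrow> y" by (rule LIMSEQ_ignore_initial_segment[OF d])
  qed
qed

lemma sq_integral_sections:
  fixes F :: "real \<times> real \<Rightarrow> real"
  assumes "sq_integrable F"
  shows "integrable lborel (\<lambda>x. \<integral>y. (F (x, y))\<^sup>2 \<partial>lborel)"
    "(\<integral>x. (\<integral>y. (F (x, y))\<^sup>2 \<partial>lborel) \<partial>lborel) = (norm (abs_l2 F))\<^sup>2"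
  using integral_prod_lborel[of "\<lambda>p. (F p)\<^sup>2"] assms by (auto simp: sq_integrable_def norm_abs[OF assms])

text \<open>Convergence of the difference quotients in the plane is convergence in L1 of their
  squared errors on the lines; along a subsequence these errors tend to 0 on almost every line, and
  there \<open>tder_if_diffq\<close> applies.\<close>

lemma tder_section:
  fixes F h :: "real \<times> real \<Rightarrow> real"
  assumes F: "sq_integrable F" and h: "sq_integrable h" and d: "tder (\<lambda>s. TY s) (abs_l2 F) (abs_l2 h)"
  shows "AE s in lborel. tder (\<lambda>s. TX s) (abs_l2 (\<lambda>x. F (s, x))) (abs_l2 (\<lambda>x. h (s, x)))"
proof -
  define e where "e n = 1 / real (Suc n)" for n
  define D where "D n p = (1 / e n) * (F (p + e n *\<^sub>R (0, 1)) - F p)" for n p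
  have D: "sq_integrable (D n)" "abs_l2 (D n) = diffq (\<lambda>s. TY s) (e n) (abs_l2 F)" for n
  proof -
    have s: "sq_integrable (\<lambda>p. F (p + e n *\<^sub>R (0, 1)) - F p)"
      by (rule sq_integrable_diff[OF sq_integrable_shift[OF F] F])
    show "sq_integrable (D n)" unfolding D_def[abs_def] by (rule sq_integrable_scale[OF s])
    show "abs_l2 (D n) = diffq (\<lambda>s. TY s) (e n) (abs_l2 F)"
      unfolding D_def[abs_def] diffq_def shift_abs[OF F] abs_diff[OF sq_integrable_shift[OF F] F]
      by (rule abs_scaleR[OF s, symmetric])
  qed
  have "(\<lambda>n. diffq (\<lambda>s. TY s) (e n) (abs_l2 F)) \<longlonglongrightarrow> abs_l2 h"
    using filterlim_compose[OF Y.diffq_funpow_tendsto[of 1] Y.inverse_at_right] d by (simp add: e_def)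
  from tendsto_power[OF tendsto_norm_zero[OF LIM_zero[OF this]], of 2]
  have "(\<lambda>n. (norm (abs_l2 (\<lambda>p. D n p - h p)))\<^sup>2) \<longlonglongrightarrow> 0"
    unfolding D(2)[symmetric] abs_diff[OF D(1) h] zero_power2 .
  then have lim: "(\<lambda>n. \<integral>s. norm (\<integral>x. (D n (s, x) - h (s, x))\<^sup>2 \<partial>lborel) \<partial>lborel) \<longlonglongrightarrow> 0"
    by (simp add: sq_integral_sections(2)[OF sq_integrable_diff[OF D(1) h], symmetric])
  obtain r where r: "strict_mono r"
      "AE s in lborel. (\<lambda>n. \<integral>x. (D (r n) (s, x) - h (s, x))\<^sup>2 \<partial>lborel) \<longlonglongrightarrow> 0"
    using tendsto_L1_AE_subseq[OF sq_integral_sections(1)[OF sq_integrable_diff[OF D(1) h]] lim] by blast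
  show ?thesis
    using r(2) sq_integrable_section[OF F] sq_integrable_section[OF h]
  proof eventually_elim
    case (elim s)
    have D': "D n (s, x) = (1 / e n) * (F (s, x + e n *\<^sub>R 1) - F (s, x))" for n x by (simp add: D_def)
    have sq: "sq_integrable (\<lambda>x. D n (s, x))"
      "abs_l2 (\<lambda>x. D n (s, x)) = diffq (\<lambda>s. TX s) (e n) (abs_l2 (\<lambda>x. F (s, x)))" for n
    proof -
      note sh = sq_integrable_shift[OF elim(2), of "e n *\<^sub>R 1"]
      show "sq_integrable (\<lambda>x. D n (s, x))"
        unfolding D' by (rule sq_integrable_scale[OF sq_integrable_diff[OF sh elim(2)]])
      show "abs_l2 (\<lambda>x. D n (s, x)) = diffq (\<lambda>s. TX s) (e n) (abs_l2 (\<lambda>x. F (s, x)))"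
        unfolding D' diffq_def shift_abs[OF elim(2)] abs_diff[OF sh elim(2)]
        by (rule abs_scaleR[OF sq_integrable_diff[OF sh elim(2)], symmetric])
    qed
    have "(\<lambda>n. (norm (abs_l2 (\<lambda>x. D (r n) (s, x)) - abs_l2 (\<lambda>x. h (s, x))))\<^sup>2) \<longlonglongrightarrow> 0"
      using elim(1) by (simp add: abs_diff sq(1) elim(3) norm_abs sq_integrable_diff)
    from tendsto_real_sqrt[OF this]
    have "(\<lambda>n. abs_l2 (\<lambda>x. D (r n) (s, x)) - abs_l2 (\<lambda>x. h (s, x))) \<longlonglongrightarrow> 0"
      by (simp add: tendsto_norm_zero_iff)
    then have "(\<lambda>n. diffq (\<lambda>s. TX s) (e (r n)) (abs_l2 (\<lambda>x. F (s, x)))) \<longlonglongrightarrow> abs_l2 (\<lambda>x. h (s, x))"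
      unfolding sq(2) by (rule LIM_zero_cancel)
    then show ?case
      by (rule X.tder_if_diffq[rotated])
        (use filterlim_compose[OF X.inverse_at_right filterlim_subseq[OF r(1)]] in \<open>simp add: e_def\<close>)
  qed
qed

lemma integrable_inner_sections:
  fixes F :: "real \<times> real \<Rightarrow> real"
  assumes "sq_integrable F" "sq_integrable f" "sq_integrable h"
  shows "integrable lborel (\<lambda>x. f x * (\<integral>y. F (x, y) * h y \<partial>lborel))"
proof -
  have "integrable lborel (\<lambda>p. F p * (f (fst p) * h (snd p)))"
    by (rule sq_integrable_mult[OF assms(1) sq_integrable_tensor[OF assms(2,3)]])
  from integral_prod_lborel(2)[OF this] show ?thesis by (simp add: mult.left_commute)
qed

text \<open>Tested against products of an indicator in the history variable and a test function in
  x, the claim reduces to integration by parts on each line, followed by integration over the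
  lines.\<close>

lemma tder_if_section:
  fixes F h :: "real \<times> real \<Rightarrow> real"
  assumes F: "sq_integrable F" and h: "sq_integrable h"
    and d: "AE s in lborel. tder (\<lambda>s. TX s) (abs_l2 (\<lambda>x. F (s, x))) (abs_l2 (\<lambda>x. h (s, x)))"
  shows "tder (\<lambda>s. TY s) (abs_l2 F) (abs_l2 h)"
proof (rule Y.tder_weak[where \<Phi> = "{tensor (ind a b) (abs_l2 \<phi>) | a b \<phi>. test_function \<phi>}"])
  fix \<psi> s assume "\<psi> \<in> {tensor (ind a b) (abs_l2 \<phi>) | a b \<phi>. test_function \<phi>}"
  then obtain a b \<phi> where \<psi>: "\<psi> = tensor (ind a b) (abs_l2 \<phi>)" "test_function \<phi>" by blast
  show "TY s \<psi> \<in> {tensor (ind a b) (abs_l2 \<phi>) | a b \<phi>. test_function \<phi>}"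
  proof -
    have "TY s \<psi> = tensor (ind a b) (abs_l2 (\<lambda>x. \<phi> (x + s)))"
      unfolding \<psi>(1) shift_tensor shift_abs[OF test_function_sq_integrable[OF \<psi>(2)]] by simp
    then show ?thesis using test_function_shift[OF \<psi>(2), of s] by blast
  qed
  let ?i = "indicator (box a b) :: real \<Rightarrow> real"
  note sq = sq_integrable_indicator_box[of a b] test_function_sq_integrable[OF \<psi>(2)]
    test_function_sq_integrable[OF test_function_deriv[OF \<psi>(2)]]
  have "inner (abs_l2 F) (tensor (ind a b) (abs_l2 (deriv \<phi>)))
      = (\<integral>x. ?i x * (\<integral>y. F (x, y) * deriv \<phi> y \<partial>lborel) \<partial>lborel)"
    unfolding ind_def by (rule inner_abs_tensor[OF F sq(1,3)])
  also have "\<dots> = (\<integral>x. - (?i x * (\<integral>y. h (x, y) * \<phi> y \<partial>lborel)) \<partial>lborel)"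
  proof (rule integral_cong_AE)
    show "AE x in lborel. ?i x * (\<integral>y. F (x, y) * deriv \<phi> y \<partial>lborel) = - (?i x * (\<integral>y. h (x, y) * \<phi> y \<partial>lborel))"
      using d sq_integrable_section[OF F] sq_integrable_section[OF h]
    proof eventually_elim
      case (elim x)
      have "(\<integral>y. F (x, y) * deriv \<phi> y \<partial>lborel) = - (\<integral>y. h (x, y) * \<phi> y \<partial>lborel)"
        using X.tder_skew[OF elim(1) tder_test_function[OF \<psi>(2)]] sq elim by (simp add: inner_abs)
      then show ?case by simp
    qed
  qed (use integrable_inner_sections[OF F sq(1,3)] integrable_inner_sections[OF h sq(1,2)]
        in \<open>auto intro: borel_measurable_integrable\<close>)
  also have "\<dots> = - inner (abs_l2 h) \<psi>"
    unfolding \<psi>(1) ind_def inner_abs_tensor[OF h sq(1,2)] by simp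
  finally show "\<exists>\<psi>'. tder (\<lambda>s. TY s) \<psi> \<psi>' \<and> inner (abs_l2 F) \<psi>' = - inner (abs_l2 h) \<psi>"
    using tder_tensor[OF tder_test_function[OF \<psi>(2)], of "ind a b"] unfolding \<psi>(1) by blast
next
  fix z :: "(real \<times> real) l2"
  assume "\<And>\<phi>. \<phi> \<in> {tensor (ind a b) (abs_l2 \<phi>) | a b \<phi>. test_function \<phi>} \<Longrightarrow> inner z \<phi> = 0"
  then show "z = 0" by (intro l2_prod_eq_zero_if_test) blast
qed

lemma weak_deriv_scale: "weak_deriv n f h \<Longrightarrow> weak_deriv n (\<lambda>x. c * f x) (\<lambda>x. c * h x)"
  unfolding weak_deriv_def locally_integrable_def by (auto simp: mult.assoc intro: set_integrable_mult_right)

lemma weak_deriv_scale_iff: "c \<noteq> 0 \<Longrightarrow> weak_deriv n (\<lambda>x. c * f x) (\<lambda>x. c * h x) \<longleftrightarrow> weak_deriv n f h"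
  using weak_deriv_scale[of n f h c] weak_deriv_scale[of n "\<lambda>x. c * f x" "\<lambda>x. c * h x" "1 / c"] by auto

text \<open>\<open>dx\<close> is fixed by a choice operator and could be any weak derivative; almost
  everywhere uniqueness ties it to the square integrable one, so its class is determined.\<close>

lemma in_Hs_dern:
  assumes "in_Hs n f"
  shows "sq_integrable (dx n f)" "dern (\<lambda>s. TX s) n (abs_l2 f) (abs_l2 (dx n f))" "weak_deriv n f (dx n f)"
proof -
  obtain h where h: "sq_integrable h" "weak_deriv n f h" using assms by (auto simp: in_Hs_def in_L2_iff)
  have w: "weak_deriv n f (dx n f)" unfolding dx_def by (rule someI[of "weak_deriv n f", OF h(2)])
  then show "weak_deriv n f (dx n f)" .
  have ae: "AE x in lborel. h x = dx n f x" by (rule weak_deriv_unique[OF h(2) w])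
  show sq: "sq_integrable (dx n f)"
    using sq_integrable_cong_AE[OF h(1) _ ae] w locally_integrable_measurable by (auto simp: weak_deriv_def)
  have "dern (\<lambda>s. TX s) n (abs_l2 f) (abs_l2 h)" using h assms
  proof (induction n arbitrary: h)
    case 0
    have l: "locally_integrable f" using 0 by (auto simp: weak_deriv_def)
    have "sq_integrable f" using 0 by (auto simp: in_Hs_def in_L2_iff)
    then show ?case using weak_deriv_unique[OF weak_deriv_0[OF l] 0(2)] 0(1) by (simp add: abs_eq_iff)
  next
    case (Suc n)
    obtain h' where h': "sq_integrable h'" "weak_deriv n f h'"
      using Suc.prems(3) by (auto simp: in_Hs_def in_L2_iff intro: le_SucI)
    have "in_Hs n f" using Suc.prems(3) by (auto simp: in_Hs_def)
    from Suc.IH[OF h' this] weak_deriv_step[OF h'(2), of h] Suc.prems(1,2) weak_deriv_1_iff_tder[OF h'(1) Suc.prems(1)]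
    show ?case by auto
  qed
  then show "dern (\<lambda>s. TX s) n (abs_l2 f) (abs_l2 (dx n f))"
    using ae abs_eq_iff[OF h(1) sq] by simp
qed

lemma weak_deriv_if_dern:
  assumes f: "sq_integrable f" and "dern (\<lambda>s. TX s) n (abs_l2 f) y"
  shows "\<exists>h. sq_integrable h \<and> weak_deriv n f h \<and> abs_l2 h = y"
  using assms(2)
proof (induction n arbitrary: y)
  case 0
  then show ?case using f weak_deriv_0[OF locally_integrable_sq[OF f]] by auto
next
  case (Suc n)
  then obtain z where z: "dern (\<lambda>s. TX s) n (abs_l2 f) z" "tder (\<lambda>s. TX s) z y" by auto
  obtain h where h: "sq_integrable h" "weak_deriv n f h" "abs_l2 h = z" using Suc.IH[OF z(1)] by blast
  obtain k where k: "y = abs_l2 k" "sq_integrable k" by (rule l2_cases)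
  have "weak_deriv (Suc n) f k"
    using weak_deriv_step[OF h(2), of k] weak_deriv_1_iff_tder[OF h(1) k(2)] z(2) h(3) k(1) by simp
  then show ?case using k by blast
qed

lemma in_Hs_if_dern:
  assumes "sq_integrable f" and "dern (\<lambda>s. TX s) n (abs_l2 f) y"
  shows "in_Hs n f"
  unfolding in_Hs_def in_L2_iff
proof (intro conjI allI impI)
  fix i assume "i \<le> n"
  then obtain d where "n = i + d" using le_Suc_ex by blast
  then obtain z where "dern (\<lambda>s. TX s) i (abs_l2 f) z" using assms(2) X.dern_append[of i d] by blast
  from weak_deriv_if_dern[OF assms(1) this] show "\<exists>h. sq_integrable h \<and> weak_deriv i f h" by blast
qed (rule assms(1))

section \<open>Weighted histories as functions on the plane\<close>

context memory_kernel begin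

lemma history_measure_eq: "history_measure g = density lborel (\<lambda>\<sigma>. ennreal ((wt \<sigma>)\<^sup>2))"
  unfolding history_measure_def wt_sq ..

lemma history_prod_eq:
  "history_measure g \<Otimes>\<^sub>M lborel = density (lborel :: (real \<times> real) measure) (\<lambda>p. ennreal ((wt (fst p))\<^sup>2))"
proof -
  have "history_measure g \<Otimes>\<^sub>M lborel = density lborel (\<lambda>\<sigma>. ennreal ((wt \<sigma>)\<^sup>2)) \<Otimes>\<^sub>M density (lborel :: real measure) (\<lambda>_. 1)"
    by (simp add: history_measure_eq density_1)
  also have "\<dots> = density (lborel \<Otimes>\<^sub>M lborel) (\<lambda>(x, y). ennreal ((wt x)\<^sup>2) * 1)"
    by (rule pair_measure_density) (auto simp: density_1 lborel.sigma_finite_measure_axioms)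
  finally show ?thesis by (simp add: lborel_prod case_prod_beta')
qed

lemma wt_fst_measurable[measurable]: "(\<lambda>p. wt (fst p)) \<in> borel_measurable (borel :: (real \<times> real) measure)"
  by (rule measurable_compose[OF _ wt_measurable]) (rule borel_measurable_continuous_onI, intro continuous_intros)

lemma wt_sq_pos: "0 < ennreal ((wt \<sigma>)\<^sup>2) \<longleftrightarrow> 0 \<le> \<sigma>"
  using wt_pos[of \<sigma>] wt_neg[of \<sigma>] by (cases "0 \<le> \<sigma>") auto

lemma AE_history: "(AE \<sigma> in history_measure g. P \<sigma>) \<longleftrightarrow> (AE \<sigma> in lborel. 0 \<le> \<sigma> \<longrightarrow> P \<sigma>)"
  unfolding history_measure_eq
  by (subst AE_density) (simp, simp only: wt_sq_pos)

lemma AE_history_prod: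
  "(AE p in history_measure g \<Otimes>\<^sub>M (lborel :: real measure). P p) \<longleftrightarrow> (AE p in lborel. 0 \<le> fst p \<longrightarrow> P p)"
  unfolding history_prod_eq
  by (subst AE_density) (simp, simp only: wt_sq_pos)

lemma history_measurable_iff: "history_measurable g e \<longleftrightarrow> (\<lambda>p. e (fst p) (snd p)) \<in> borel_measurable borel"
  unfolding history_measurable_def history_prod_eq by (simp add: case_prod_beta')

text \<open>Multiplying by \<open>\<surd>g\<close>, which vanishes for \<open>\<sigma> < 0\<close>, embeds the weighted history space into \<open>L\<^sup>2(\<real> \<times> \<real>)\<close>.\<close>

definition whist :: "(real \<Rightarrow> real \<Rightarrow> real) \<Rightarrow> real \<times> real \<Rightarrow> real" where
  "whist e p = wt (fst p) * e (fst p) (snd p)"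

abbreviation "YY e \<equiv> abs_l2 (whist e)"

lemma whist_sections: "whist e (s, x) = wt s * e s x"
  by (simp add: whist_def)

lemma history_in_L2_iff: "history_in_L2 g e \<longleftrightarrow> history_measurable g e \<and> sq_integrable (whist e)"
proof (cases "history_measurable g e")
  case True
  then have [measurable]: "(\<lambda>p. e (fst p) (snd p)) \<in> borel_measurable borel" by (simp add: history_measurable_iff)
  have "integrable (history_measure g \<Otimes>\<^sub>M lborel) (\<lambda>(\<sigma>, x). (e \<sigma> x)\<^sup>2) \<longleftrightarrow>
      integrable lborel (\<lambda>p. (whist e p)\<^sup>2)"
    unfolding history_prod_eq by (subst integrable_density) (auto simp: case_prod_beta' whist_def power_mult_distrib)
  moreover have "whist e \<in> borel_measurable lborel" unfolding whist_def[abs_def] by measurable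
  ultimately show ?thesis using True by (simp add: history_in_L2_def sq_integrable_def)
qed (simp add: history_in_L2_def)

lemma whist_sq_integrable: "history_in_L2 g e \<Longrightarrow> sq_integrable (whist e)"
  by (simp add: history_in_L2_iff)

lemma history_L2_norm_eq: "history_in_L2 g e \<Longrightarrow> history_L2_norm g e = norm (YY e)"
proof -
  assume e: "history_in_L2 g e"
  then have [measurable]: "(\<lambda>p. e (fst p) (snd p)) \<in> borel_measurable borel"
    by (simp add: history_in_L2_iff history_measurable_iff)
  have "(LINT p|(history_measure g \<Otimes>\<^sub>M lborel). (e (fst p) (snd p))\<^sup>2) = (norm (YY e))\<^sup>2"
    unfolding history_prod_eq norm_abs[OF whist_sq_integrable[OF e]]
    by (subst integral_density) (auto simp: whist_def power_mult_distrib)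
  then show ?thesis by (simp add: history_L2_norm_def)
qed

lemma YY_eq_iff:
  assumes "history_in_L2 g e" "history_in_L2 g e'"
  shows "YY e = YY e' \<longleftrightarrow> (AE p in history_measure g \<Otimes>\<^sub>M lborel. e (fst p) (snd p) = e' (fst p) (snd p))"
proof -
  have "whist e p = whist e' p \<longleftrightarrow> (0 \<le> fst p \<longrightarrow> e (fst p) (snd p) = e' (fst p) (snd p))" for p
    using wt_pos[of "fst p"] wt_neg[of "fst p"] by (cases "0 \<le> fst p") (auto simp: whist_def)
  then show ?thesis
    by (simp add: abs_eq_iff whist_sq_integrable assms AE_history_prod)
qed

lemma history_in_L2_cong:
  assumes "history_in_L2 g e" "history_measurable g e'"
    "AE p in history_measure g \<Otimes>\<^sub>M lborel. e (fst p) (snd p) = e' (fst p) (snd p)"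
  shows "history_in_L2 g e'"
  unfolding history_in_L2_iff
proof
  have [measurable]: "(\<lambda>p. e' (fst p) (snd p)) \<in> borel_measurable borel"
    using assms by (simp add: history_measurable_iff)
  show "sq_integrable (whist e')"
  proof (rule sq_integrable_cong_AE[OF whist_sq_integrable[OF assms(1)]])
    show "whist e' \<in> borel_measurable lborel" unfolding whist_def[abs_def] by measurable
    show "AE x in lborel. whist e x = whist e' x"
      using assms(3) unfolding AE_history_prod
    proof eventually_elim
      case (elim p)
      then show ?case using wt_neg[of "fst p"] by (cases "0 \<le> fst p") (auto simp: whist_def)
    qed
  qed
qed (rule assms(2))

text \<open>Line by line the weight is a constant factor: nonzero for \<sigma> \<ge> 0, hence
  cancellable, and zero for \<sigma> < 0, where both sides hold trivially.\<close>

lemma history_weak_deriv_1_iff_tder: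
  assumes e: "history_in_L2 g e" and e': "history_in_L2 g e'"
  shows "history_weak_deriv g 1 e e' \<longleftrightarrow> tder (\<lambda>s. TY s) (YY e) (YY e')"
proof -
  note F = whist_sq_integrable[OF e] and h = whist_sq_integrable[OF e']
  have *: "tder (\<lambda>s. TX s) (abs_l2 (\<lambda>x. whist e (s, x))) (abs_l2 (\<lambda>x. whist e' (s, x)))
      \<longleftrightarrow> (0 \<le> s \<longrightarrow> weak_deriv 1 (e s) (e' s))"
    if sq: "sq_integrable (\<lambda>x. whist e (s, x))" "sq_integrable (\<lambda>x. whist e' (s, x))" for s
  proof (cases "0 \<le> s")
    case True
    then have "wt s \<noteq> 0" using wt_pos[of s] by simp
    then show ?thesis
      using weak_deriv_1_iff_tder[OF sq] weak_deriv_scale_iff[of "wt s" 1 "e s" "e' s"] True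
      by (simp add: whist_sections)
  next
    case False
    then show ?thesis
      using weak_deriv_1_iff_tder[OF sq_integrable_zero sq_integrable_zero]
      by (simp add: whist_sections wt_neg weak_deriv_def locally_integrable_def set_integrable_def)
  qed
  have "tder (\<lambda>s. TY s) (YY e) (YY e') \<longleftrightarrow>
      (AE s in lborel. tder (\<lambda>s. TX s) (abs_l2 (\<lambda>x. whist e (s, x))) (abs_l2 (\<lambda>x. whist e' (s, x))))"
    using tder_section[OF F h] tder_if_section[OF F h] by blast
  also have "\<dots> \<longleftrightarrow> (AE s in lborel. 0 \<le> s \<longrightarrow> weak_deriv 1 (e s) (e' s))"
  proof -
    have "AE s in lborel. tder (\<lambda>s. TX s) (abs_l2 (\<lambda>x. whist e (s, x))) (abs_l2 (\<lambda>x. whist e' (s, x)))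
      \<longleftrightarrow> (0 \<le> s \<longrightarrow> weak_deriv 1 (e s) (e' s))"
      using sq_integrable_section[OF F] sq_integrable_section[OF h] by eventually_elim (rule *)
    then show ?thesis by (rule eventually_subst)
  qed
  also have "\<dots> \<longleftrightarrow> history_weak_deriv g 1 e e'"
    using e' by (simp add: history_weak_deriv_def AE_history history_in_L2_iff)
  finally show ?thesis ..
qed

text \<open>On almost every line with \<sigma> < 0 the derivative of the zero function is zero, so
  the derivative in the plane stays in the range of the embedding, and division by the weight
  recovers a history.\<close>

lemma history_cases:
  assumes e: "history_in_L2 g e" and d: "tder (\<lambda>s. TY s) (YY e) y"
  obtains e' where "history_in_L2 g e'" "YY e' = y"
proof -
  obtain y0 where y0: "y = abs_l2 y0" "sq_integrable y0" by (rule l2_cases)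
  note [measurable] = sq_integrable_measurable[OF y0(2)]
  define e' where "e' s x = y0 (s, x) / wt s" for s x
  have m: "(\<lambda>p. e' (fst p) (snd p)) \<in> borel_measurable borel" unfolding e'_def by simp measurable
  have "AE p in lborel. y0 p = whist e' p"
  proof (rule AE_prod_lborel)
    show "AE s in lborel. AE x in lborel. y0 (s, x) = whist e' (s, x)"
      using tder_section[OF whist_sq_integrable[OF e] y0(2) d[unfolded y0(1)]] sq_integrable_section[OF y0(2)]
    proof eventually_elim
      case (elim s)
      show ?case
      proof (cases "0 \<le> s")
        case True
        then show ?thesis using wt_pos[of s] by (simp add: whist_sections e'_def)
      next
        case False
        then have "tder (\<lambda>s. TX s) 0 (abs_l2 (\<lambda>x. y0 (s, x)))"
          using elim(1) by (simp add: whist_sections wt_neg zero_l2.abs_eq)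
        moreover have "tder (\<lambda>s. TX s) (0 :: real l2) 0"
          using X.tder_diff[OF calculation calculation] by simp
        ultimately have "abs_l2 (\<lambda>x. y0 (s, x)) = abs_l2 (\<lambda>x. 0)"
          using X.tder_unique by (simp add: zero_l2.abs_eq)
        then show ?thesis
          using False by (simp add: abs_eq_iff elim(2) sq_integrable_zero whist_sections wt_neg)
      qed
    qed
    have [measurable]: "whist e' \<in> borel_measurable borel" unfolding whist_def[abs_def] using m by measurable
    have "{p \<in> space borel. y0 p = whist e' p} \<in> sets borel" by measurable
    then show "{p. y0 p = whist e' p} \<in> sets borel" by simp
  qed
  moreover have "whist e' \<in> borel_measurable lborel" unfolding whist_def[abs_def] using m by measurable
  ultimately have sq: "sq_integrable (whist e')" and "AE p in lborel. y0 p = whist e' p"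
    using sq_integrable_cong_AE[OF y0(2)] by auto
  then have "YY e' = y" using abs_eq_iff[OF y0(2) sq] by (simp add: y0(1))
  moreover have "history_in_L2 g e'" using sq m by (simp add: history_in_L2_iff history_measurable_iff)
  ultimately show ?thesis using that by blast
qed

lemma history_weak_deriv_0: "history_in_L2 g e \<Longrightarrow> history_weak_deriv g 0 e e"
proof -
  assume e: "history_in_L2 g e"
  have "AE s in lborel. 0 \<le> s \<longrightarrow> weak_deriv 0 (e s) (e s)"
    using sq_integrable_section[OF whist_sq_integrable[OF e]]
  proof eventually_elim
    case (elim s)
    show ?case
    proof
      assume "0 \<le> s"
      then have "wt s \<noteq> 0" using wt_pos[of s] by simp
      then show "weak_deriv 0 (e s) (e s)"
        using weak_deriv_0[OF locally_integrable_sq[OF elim]] weak_deriv_scale_iff[of "wt s" 0 "e s" "e s"]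
        by (simp add: whist_sections)
    qed
  qed
  then show ?thesis using e by (simp add: history_weak_deriv_def AE_history history_in_L2_iff)
qed

lemma history_weak_deriv_step:
  assumes "history_weak_deriv g n e e'"
  shows "history_weak_deriv g (Suc n) e e'' \<longleftrightarrow> history_weak_deriv g 1 e' e''"
proof -
  have ae: "AE s in history_measure g. weak_deriv n (e s) (e' s)" using assms by (simp add: history_weak_deriv_def)
  have "(AE s in history_measure g. weak_deriv (Suc n) (e s) (e'' s)) \<longleftrightarrow>
    (AE s in history_measure g. weak_deriv 1 (e' s) (e'' s))"
  proof (intro iffI)
    assume "AE s in history_measure g. weak_deriv (Suc n) (e s) (e'' s)"
    with ae show "AE s in history_measure g. weak_deriv 1 (e' s) (e'' s)"
      by eventually_elim (simp add: weak_deriv_step)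
  next
    assume "AE s in history_measure g. weak_deriv 1 (e' s) (e'' s)"
    with ae show "AE s in history_measure g. weak_deriv (Suc n) (e s) (e'' s)"
      by eventually_elim (simp add: weak_deriv_step)
  qed
  then show ?thesis by (simp add: history_weak_deriv_def)
qed

lemma history_weak_deriv_unique:
  assumes "history_weak_deriv g n e e1" "history_weak_deriv g n e e2"
  shows "AE p in history_measure g \<Otimes>\<^sub>M lborel. e1 (fst p) (snd p) = e2 (fst p) (snd p)"
  unfolding AE_history_prod
proof (rule AE_prod_lborel)
  have [measurable]: "(\<lambda>p. e1 (fst p) (snd p)) \<in> borel_measurable borel" "(\<lambda>p. e2 (fst p) (snd p)) \<in> borel_measurable borel"
    using assms by (auto simp: history_weak_deriv_def history_measurable_iff)
  have f[measurable]: "(fst :: real \<times> real \<Rightarrow> real) \<in> borel_measurable borel"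
    by (rule borel_measurable_continuous_onI) (intro continuous_intros)
  have "{p \<in> space borel. 0 \<le> fst p \<longrightarrow> e1 (fst p) (snd p) = e2 (fst p) (snd p)} \<in> sets borel" by measurable
  then show "{p. 0 \<le> fst p \<longrightarrow> e1 (fst p) (snd p) = e2 (fst p) (snd p)} \<in> sets borel" by simp
  have "AE s in lborel. 0 \<le> s \<longrightarrow> weak_deriv n (e s) (e1 s)" "AE s in lborel. 0 \<le> s \<longrightarrow> weak_deriv n (e s) (e2 s)"
    using assms by (auto simp: history_weak_deriv_def AE_history)
  then show "AE x in lborel. AE y in lborel. 0 \<le> fst (x, y) \<longrightarrow> e1 (fst (x, y)) (snd (x, y)) = e2 (fst (x, y)) (snd (x, y))"
  proof eventually_elim
    case (elim s)
    then show ?case using weak_deriv_unique[of n "e s" "e1 s" "e2 s"] by (cases "0 \<le> s") auto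
  qed
qed

lemma history_weak_deriv_if_dern:
  assumes e: "history_in_L2 g e" and "dern (\<lambda>s. TY s) n (YY e) y"
  shows "\<exists>e'. history_in_L2 g e' \<and> history_weak_deriv g n e e' \<and> YY e' = y"
  using assms(2)
proof (induction n arbitrary: y)
  case 0
  then show ?case using e history_weak_deriv_0[OF e] by auto
next
  case (Suc n)
  then obtain z where z: "dern (\<lambda>s. TY s) n (YY e) z" "tder (\<lambda>s. TY s) z y" by auto
  obtain e1 where h: "history_in_L2 g e1" "history_weak_deriv g n e e1" "YY e1 = z" using Suc.IH[OF z(1)] by blast
  obtain e2 where k: "history_in_L2 g e2" "YY e2 = y" using history_cases[OF h(1)] z(2) h(3) by metis
  have "history_weak_deriv g (Suc n) e e2"
    using history_weak_deriv_step[OF h(2), of e2] history_weak_deriv_1_iff_tder[OF h(1) k(1)] z(2) h(3) k(2) by simp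
  then show ?case using k by blast
qed

lemma history_in_Hs_if_dern:
  assumes "history_in_L2 g e" and "dern (\<lambda>s. TY s) n (YY e) y"
  shows "history_in_Hs g n e"
  unfolding history_in_Hs_def
proof (intro conjI allI impI)
  fix i assume "i \<le> n"
  then obtain d where "n = i + d" using le_Suc_ex by blast
  then obtain z where "dern (\<lambda>s. TY s) i (YY e) z" using assms(2) Y.dern_append[of i d] by blast
  from history_weak_deriv_if_dern[OF assms(1) this]
  show "\<exists>h. history_in_L2 g h \<and> history_weak_deriv g i e h" by blast
qed (rule assms(1))

lemma history_in_Hs_dern:
  assumes "history_in_Hs g n e"
  shows "history_in_L2 g (history_dx g n e)" "dern (\<lambda>s. TY s) n (YY e) (YY (history_dx g n e))"
    "history_weak_deriv g n e (history_dx g n e)"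
proof -
  obtain h where h: "history_in_L2 g h" "history_weak_deriv g n e h" using assms by (auto simp: history_in_Hs_def)
  show w: "history_weak_deriv g n e (history_dx g n e)"
    unfolding history_dx_def by (rule someI[of "history_weak_deriv g n e", OF h(2)])
  note ae = history_weak_deriv_unique[OF h(2) w]
  show sq: "history_in_L2 g (history_dx g n e)"
    using history_in_L2_cong[OF h(1) _ ae] w by (auto simp: history_weak_deriv_def)
  have "dern (\<lambda>s. TY s) n (YY e) (YY h)" using h assms
  proof (induction n arbitrary: h)
    case 0
    have e: "history_in_L2 g e" using 0 by (auto simp: history_in_Hs_def)
    then show ?case
      using history_weak_deriv_unique[OF history_weak_deriv_0[OF e] 0(2)] YY_eq_iff[OF e 0(1)] by simp
  next
    case (Suc n)
    obtain h' where h': "history_in_L2 g h'" "history_weak_deriv g n e h'"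
      using Suc.prems(3) by (auto simp: history_in_Hs_def intro: le_SucI)
    have "history_in_Hs g n e" using Suc.prems(3) by (auto simp: history_in_Hs_def)
    from Suc.IH[OF h' this] history_weak_deriv_step[OF h'(2), of h] Suc.prems(1,2)
      history_weak_deriv_1_iff_tder[OF h'(1) Suc.prems(1)]
    show ?case by auto
  qed
  then show "dern (\<lambda>s. TY s) n (YY e) (YY (history_dx g n e))"
    using ae YY_eq_iff[OF h(1) sq] by simp
qed

end

section \<open>The shift semigroup of the history variable\<close>

lemma norm_abs_mono:
  assumes "sq_integrable f" "sq_integrable h" "\<And>x. \<bar>f x\<bar> \<le> \<bar>h x\<bar>"
  shows "norm (abs_l2 f) \<le> norm (abs_l2 h)"
proof (rule power2_le_imp_le)
  have "(f x)\<^sup>2 \<le> (h x)\<^sup>2" for x using assms(3)[of x] by (simp add: abs_le_square_iff)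
  then show "(norm (abs_l2 f))\<^sup>2 \<le> (norm (abs_l2 h))\<^sup>2"
    using assms unfolding norm_abs[OF assms(1)] norm_abs[OF assms(2)] sq_integrable_def
    by (intro integral_mono) auto
qed simp

context memory_kernel begin

text \<open>Agrees with \<open>wt\<close> on the half line that matters but is positive everywhere,
  so that it may be divided by.\<close>

definition wr :: "real \<Rightarrow> real" where
  "wr \<sigma> = (if \<sigma> < 0 then 1 else sqrt (g \<sigma>))"

lemma wr_pos: "0 < wr \<sigma>"
  using g_pos[of \<sigma>] by (simp add: wr_def)

lemma wr_eq_wt: "0 \<le> \<sigma> \<Longrightarrow> wr \<sigma> = wt \<sigma>"
  by (simp add: wr_def wt_nonneg)

lemma wr_measurable[measurable]: "wr \<in> borel_measurable borel"
proof -
  have "wr = (\<lambda>\<sigma>. wt \<sigma> + indicator {..<0} \<sigma>)" by (auto simp: wr_def wt_nonneg wt_neg)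
  then show ?thesis by simp
qed

text \<open>For \<sigma> \<ge> 0 and s \<ge> 0 the quotient by which a shift in the history variable
  alters the square root of the kernel. The value on the negative half line is chosen to obey the
  same upper and lower exponential bounds.\<close>

definition mlt :: "real \<Rightarrow> real \<Rightarrow> real" where
  "mlt s \<sigma> = (if \<sigma> < 0 then exp (- (k2 * s / 2)) else wr (\<sigma> + s) / wr \<sigma>)"

lemma mlt_measurable[measurable]: "mlt s \<in> borel_measurable borel"
  unfolding mlt_def[abs_def] by measurable

lemma sqrt_exp: "sqrt (exp x) = exp (x / 2)" for x :: real
  by (rule real_sqrt_unique) (simp_all add: power2_eq_square exp_add[symmetric])

text \<open>Makes the factor chosen on the negative half line respect the lower bound
  \<open>mlt_lower\<close>.\<close>

lemma k2_le_k1: "k2 \<le> k1"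
proof -
  have "- k1 * g 0 \<le> - k2 * g 0" using g'_bounds[of 0] by linarith
  then show ?thesis using g_pos[of 0] by simp
qed

lemma mlt_upper: "0 \<le> s \<Longrightarrow> mlt s \<sigma> \<le> exp (- (k2 * s / 2))"
proof (cases "\<sigma> < 0")
  case False
  assume s: "0 \<le> s"
  have "g (\<sigma> + s) * (exp (k2 * \<sigma>) * exp (k2 * s)) \<le> g \<sigma> * exp (k2 * \<sigma>)"
    using g_decay[of \<sigma> "\<sigma> + s"] s False by (simp add: distrib_left exp_add)
  then have "g (\<sigma> + s) * exp (k2 * s) \<le> g \<sigma>" by (simp add: mult.assoc[symmetric] mult.commute[of _ "exp (k2 * \<sigma>)"] mult.left_commute)
  then have "g (\<sigma> + s) \<le> g \<sigma> * exp (- (k2 * s))" by (simp add: exp_minus field_simps)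
  then have "sqrt (g (\<sigma> + s)) \<le> sqrt (g \<sigma>) * exp (- (k2 * s / 2))"
    using real_sqrt_le_mono by (fastforce simp: real_sqrt_mult sqrt_exp)
  then show ?thesis using False s g_pos[of \<sigma>] by (simp add: mlt_def wr_def pos_divide_le_eq mult.commute)
qed (simp add: mlt_def)

lemma mlt_lower: "0 \<le> s \<Longrightarrow> exp (- (k1 * s / 2)) \<le> mlt s \<sigma>"
proof (cases "\<sigma> < 0")
  case True
  assume "0 \<le> s"
  then show ?thesis using True k2_le_k1 by (simp add: mlt_def mult_right_mono)
next
  case False
  assume s: "0 \<le> s"
  have "g \<sigma> * exp (k1 * \<sigma>) \<le> g (\<sigma> + s) * (exp (k1 * \<sigma>) * exp (k1 * s))"
    using g_lower[of \<sigma> "\<sigma> + s"] s False by (simp add: distrib_left exp_add)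
  then have "g \<sigma> \<le> g (\<sigma> + s) * exp (k1 * s)" by (simp add: mult.assoc[symmetric] mult.commute[of _ "exp (k1 * \<sigma>)"] mult.left_commute)
  then have "g \<sigma> * exp (- (k1 * s)) \<le> g (\<sigma> + s)" by (simp add: exp_minus field_simps)
  then have "sqrt (g \<sigma>) * exp (- (k1 * s / 2)) \<le> sqrt (g (\<sigma> + s))"
    using real_sqrt_le_mono by (fastforce simp: real_sqrt_mult sqrt_exp)
  then show ?thesis using False s g_pos[of \<sigma>] by (simp add: mlt_def wr_def pos_le_divide_eq mult.commute)
qed

lemma mlt_pos: "0 \<le> s \<Longrightarrow> 0 < mlt s \<sigma>"
  using mlt_lower[of s \<sigma>] exp_gt_zero[of "- (k1 * s / 2)"] by linarith

lemma mlt_le_1: "0 \<le> s \<Longrightarrow> mlt s \<sigma> \<le> 1"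
  using mlt_upper[of s \<sigma>] k_pos by (smt (verit) exp_le_one_iff mult_nonneg_nonneg divide_nonneg_nonneg)

text \<open>
  The adjoint of the right shift of \<open>\<eta>\<close> in \<open>\<sigma>\<close>, read in the variable \<open>\<surd>g \<eta>\<^sub>x\<close>. On the unused half
  line \<open>\<sigma> < 0\<close> it is a scalar contraction, so that the whole semigroup decays at rate \<open>k2 / 2\<close>.
\<close>

definition Rf :: "real \<Rightarrow> (real \<times> real \<Rightarrow> real) \<Rightarrow> real \<times> real \<Rightarrow> real" where
  "Rf s F p = mlt s (fst p) * (if fst p < 0 then F p else F (p + s *\<^sub>R (1, 0)))"

lemma fst_measurable[measurable]: "(fst :: real \<times> real \<Rightarrow> real) \<in> borel_measurable borel"
  by (rule borel_measurable_continuous_onI) (intro continuous_intros)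

lemma Rf_measurable: "F \<in> borel_measurable borel \<Longrightarrow> Rf s F \<in> borel_measurable borel"
proof -
  assume F[measurable]: "F \<in> borel_measurable borel"
  have [measurable]: "(\<lambda>p. F (p + s *\<^sub>R (1, 0))) \<in> borel_measurable borel"
    by (rule measurable_compose[OF _ F]) measurable
  show ?thesis unfolding Rf_def[abs_def] by measurable
qed

lemma Rf_sq:
  assumes F: "sq_integrable F" and s: "0 \<le> s"
  shows "sq_integrable (Rf s F)" "norm (abs_l2 (Rf s F)) \<le> exp (- (k2 * s / 2)) * norm (abs_l2 F)"
proof -
  define H1 where "H1 p = (if fst p < 0 then (F p)\<^sup>2 else 0)" for p
  define H2 where "H2 p = (if fst p < s then 0 else (F p)\<^sup>2)" for p
  let ?c = "exp (- (k2 * s / 2))"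
  note [measurable] = sq_integrable_measurable[OF F] Rf_measurable[OF sq_integrable_measurable[OF F]]
  have F2: "integrable lborel (\<lambda>p. (F p)\<^sup>2)" using F by (simp add: sq_integrable_def)
  have H1: "integrable lborel H1" and H2: "integrable lborel H2"
    by (rule Bochner_Integration.integrable_bound[OF F2]; simp add: H1_def[abs_def] H2_def[abs_def])+
  have H2s: "integrable lborel (\<lambda>p. H2 (p + s *\<^sub>R (1, 0)))" by (rule integrable_shift_lborel[OF H2])
  have le: "(Rf s F p)\<^sup>2 \<le> ?c\<^sup>2 * (H1 p + H2 (p + s *\<^sub>R (1, 0)))" for p
  proof -
    have "(mlt s (fst p))\<^sup>2 \<le> ?c\<^sup>2" using mlt_upper[OF s] mlt_pos[OF s] by (intro power_mono) (auto intro: less_imp_le)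
    then show ?thesis
      by (auto simp: Rf_def H1_def H2_def power_mult_distrib intro!: mult_mono)
  qed
  have int: "integrable lborel (\<lambda>p. ?c\<^sup>2 * (H1 p + H2 (p + s *\<^sub>R (1, 0))))"
    using H1 H2s by (intro integrable_mult_right Bochner_Integration.integrable_add)
  have "integrable lborel (\<lambda>p. (Rf s F p)\<^sup>2)"
    by (rule Bochner_Integration.integrable_bound[OF int]) (use le in \<open>auto intro!: AE_I2 intro: order_trans[OF _ abs_ge_self]\<close>)
  then show sq: "sq_integrable (Rf s F)" by (simp add: sq_integrable_def)
  have "(norm (abs_l2 (Rf s F)))\<^sup>2 \<le> (\<integral>p. ?c\<^sup>2 * (H1 p + H2 (p + s *\<^sub>R (1, 0))) \<partial>lborel)"
    unfolding norm_abs[OF sq] using sq int le by (intro integral_mono) (auto simp: sq_integrable_def)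
  also have "\<dots> = ?c\<^sup>2 * ((\<integral>p. H1 p \<partial>lborel) + (\<integral>p. H2 p \<partial>lborel))"
    using H1 H2s integral_shift_lborel[OF borel_measurable_integrable[OF H2, simplified], of "s *\<^sub>R (1, 0)"] by simp
  also have "(\<integral>p. H1 p \<partial>lborel) + (\<integral>p. H2 p \<partial>lborel) = (\<integral>p. H1 p + H2 p \<partial>lborel)"
    using H1 H2 by simp
  also have "?c\<^sup>2 * \<dots> \<le> ?c\<^sup>2 * (norm (abs_l2 F))\<^sup>2"
    unfolding norm_abs[OF F]
  proof (intro mult_left_mono integral_mono F2 Bochner_Integration.integrable_add H1 H2)
    show "H1 p + H2 p \<le> (F p)\<^sup>2" for p using s by (auto simp: H1_def H2_def)
  qed simp
  finally have "(norm (abs_l2 (Rf s F)))\<^sup>2 \<le> (?c * norm (abs_l2 F))\<^sup>2" by (simp only: power_mult_distrib)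
  then show "norm (abs_l2 (Rf s F)) \<le> ?c * norm (abs_l2 F)" by (rule power2_le_imp_le) simp
qed

definition R :: "real \<Rightarrow> (real \<times> real) l2 \<Rightarrow> (real \<times> real) l2" where
  "R s x = abs_l2 (Rf s (rep_l2 x))"

lemma R_abs:
  assumes F: "sq_integrable F" and s: "0 \<le> s"
  shows "R s (abs_l2 F) = abs_l2 (Rf s F)"
proof -
  have "AE p in lborel. rep_l2 (abs_l2 F) p = F p" by (rule rep_abs_AE[OF F])
  then have "AE p in lborel. Rf s (rep_l2 (abs_l2 F)) p = Rf s F p"
    using AE_shift_lborel[OF rep_abs_AE[OF F], of "s *\<^sub>R (1, 0)"]
    by eventually_elim (auto simp: Rf_def)
  then show ?thesis
    unfolding R_def by (simp add: abs_eq_iff Rf_sq F s sq_integrable_rep)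
qed

lemma norm_R: "0 \<le> s \<Longrightarrow> norm (R s x) \<le> exp (- (k2 * s / 2)) * norm x"
  using Rf_sq(2)[OF sq_integrable_rep[of x]] by (simp add: R_def abs_rep)

lemma norm_R_le: "0 \<le> s \<Longrightarrow> norm (R s x) \<le> norm x"
  using order_trans[OF norm_R[of s x] mult_right_mono[of _ 1]] k_pos by simp

lemma R_linear: "0 \<le> s \<Longrightarrow> R s (x + y) = R s x + R s y" "0 \<le> s \<Longrightarrow> R s (c *\<^sub>R x) = c *\<^sub>R R s x"
proof -
  obtain F h where r: "x = abs_l2 F" "sq_integrable F" "y = abs_l2 h" "sq_integrable h" by (metis l2_cases)
  assume s: "0 \<le> s"
  have "Rf s (\<lambda>p. F p + h p) = (\<lambda>p. Rf s F p + Rf s h p)" "Rf s (\<lambda>p. c * F p) = (\<lambda>p. c * Rf s F p)"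
    by (auto simp: Rf_def fun_eq_iff algebra_simps)
  then show "R s (x + y) = R s x + R s y" "R s (c *\<^sub>R x) = c *\<^sub>R R s x"
    using r s by (simp_all add: abs_add abs_scaleR R_abs Rf_sq sq_integrable_add sq_integrable_scale)
qed

lemma bounded_linear_R: "0 \<le> s \<Longrightarrow> bounded_linear (R s)"
  by (rule bounded_linear_intro[of _ 1]) (simp_all add: R_linear norm_R_le)

lemma R_shift: "0 \<le> s \<Longrightarrow> R s (TY t x) = TY t (R s x)"
proof -
  obtain F where r: "x = abs_l2 F" "sq_integrable F" by (rule l2_cases)
  assume s: "0 \<le> s"
  have "Rf s (\<lambda>p. F (p + t *\<^sub>R (0, 1))) = (\<lambda>p. Rf s F (p + t *\<^sub>R (0, 1)))"
    by (auto simp: Rf_def fun_eq_iff add.assoc)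
  then show ?thesis
    unfolding r(1) shift_abs[OF r(2)] R_abs[OF r(2) s] shift_abs[OF Rf_sq(1)[OF r(2) s]]
      R_abs[OF sq_integrable_shift[OF r(2)] s] by simp
qed

lemma R_add: "0 \<le> s \<Longrightarrow> 0 \<le> t \<Longrightarrow> R (s + t) x = R s (R t x)"
proof -
  obtain F where r: "x = abs_l2 F" "sq_integrable F" by (rule l2_cases)
  assume s: "0 \<le> s" and t: "0 \<le> t"
  have "Rf (s + t) F p = Rf s (Rf t F) p" for p :: "real \<times> real"
  proof (cases "fst p < 0")
    case True
    then show ?thesis by (simp add: Rf_def mlt_def exp_add[symmetric] algebra_simps add_divide_distrib diff_divide_distrib)
  next
    case False
    moreover have "wr (fst p + s) \<noteq> 0" using wr_pos[of "fst p + s"] by simp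
    ultimately show ?thesis using s t by (simp add: Rf_def mlt_def prod_eq_iff add.assoc)
  qed
  then have "Rf (s + t) F = Rf s (Rf t F)" by (rule ext)
  then show ?thesis
    using s t unfolding r(1) by (simp add: R_abs r(2) Rf_sq)
qed

text \<open>Separates the two actions of \<open>R\<close>: the translation in the history variable,
  continuous by \<open>shift_tendsto\<close>, and the multiplier, which differs from 1 by at most
  \<open>1 - exp (- (k1 * s / 2))\<close>.\<close>

lemma R_near:
  assumes s: "0 \<le> s"
  shows "norm (R s x - x) \<le> norm (shift_l2 (s *\<^sub>R (1, 0)) x - x) + (1 - exp (- (k1 * s / 2))) * norm x"
proof -
  obtain F where r: "x = abs_l2 F" "sq_integrable F" by (rule l2_cases)
  let ?d = "1 - exp (- (k1 * s / 2))"
  have d: "0 \<le> ?d" using s k_pos by simp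
  define G where "G p = \<bar>F (p + s *\<^sub>R (1, 0)) - F p\<bar>" for p
  define H where "H p = ?d * \<bar>F p\<bar>" for p
  have G: "sq_integrable G" and H: "sq_integrable H"
    unfolding G_def H_def by (intro sq_integrable_abs sq_integrable_diff sq_integrable_shift sq_integrable_scale r(2))+
  have "R s x - x = abs_l2 (\<lambda>p. Rf s F p - F p)"
    using s unfolding r(1) by (simp add: R_abs r(2) abs_diff Rf_sq)
  also have "norm \<dots> \<le> norm (abs_l2 (\<lambda>p. G p + H p))"
  proof (rule norm_abs_mono)
    fix p :: "real \<times> real"
    have m: "\<bar>mlt s (fst p) - 1\<bar> \<le> ?d" using mlt_lower[OF s, of "fst p"] mlt_le_1[OF s, of "fst p"] by linarith
    show "\<bar>Rf s F p - F p\<bar> \<le> \<bar>G p + H p\<bar>"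
    proof (cases "fst p < 0")
      case True
      have "Rf s F p - F p = (mlt s (fst p) - 1) * F p" using True by (simp add: Rf_def algebra_simps)
      then have "\<bar>Rf s F p - F p\<bar> \<le> H p" using m by (simp add: H_def abs_mult mult_right_mono)
      then show ?thesis using G_def[of p] by linarith
    next
      case False
      have "Rf s F p - F p = mlt s (fst p) * (F (p + s *\<^sub>R (1, 0)) - F p) + (mlt s (fst p) - 1) * F p"
        using False by (simp add: Rf_def algebra_simps)
      also have "\<bar>\<dots>\<bar> \<le> mlt s (fst p) * G p + \<bar>mlt s (fst p) - 1\<bar> * \<bar>F p\<bar>"
        using mlt_pos[OF s, of "fst p"] by (intro order_trans[OF abs_triangle_ineq]) (simp add: abs_mult G_def)
      also have "\<dots> \<le> 1 * G p + H p"
        unfolding H_def using mlt_le_1[OF s] m by (intro add_mono mult_right_mono) (auto simp: G_def)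
      finally show ?thesis by linarith
    qed
  qed (intro sq_integrable_add sq_integrable_diff G H Rf_sq(1) r(2) s)+
  also have "\<dots> \<le> norm (abs_l2 G) + norm (abs_l2 H)"
    unfolding abs_add[OF G H, symmetric] by (rule norm_triangle_ineq)
  also have "norm (abs_l2 G) = norm (shift_l2 (s *\<^sub>R (1, 0)) x - x)"
    unfolding G_def[abs_def] r(1) shift_abs[OF r(2)] abs_diff[OF sq_integrable_shift[OF r(2)] r(2)]
    by (rule norm_abs_abs[OF sq_integrable_diff[OF sq_integrable_shift[OF r(2)] r(2)]])
  also have "norm (abs_l2 H) = ?d * norm x"
    unfolding H_def[abs_def] r(1) abs_scaleR[OF sq_integrable_abs[OF r(2)], symmetric]
    using d by (simp add: norm_abs_abs r(2))
  finally show ?thesis .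
qed

lemma R_tendsto: "((\<lambda>s. norm (R s x - x)) \<longlongrightarrow> 0) (at 0 within {0..})"
proof (rule tendsto_sandwich[of "\<lambda>_. 0" _ _ "\<lambda>s. norm (shift_l2 (s *\<^sub>R (1, 0)) x - x) + (1 - exp (- (k1 * s / 2))) * norm x"])
  interpret Z: isometry_group "\<lambda>s. shift_l2 (s *\<^sub>R (1::real, 0::real))" by (rule isometry_group_shift)
  have "((\<lambda>s. shift_l2 (s *\<^sub>R (1, 0)) x) \<longlongrightarrow> shift_l2 (0 *\<^sub>R (1, 0)) x) (at 0 within {0..})"
    using Z.continuous_T_on[of "{0..}" x] by (simp only: continuous_on_def) auto
  then have "((\<lambda>s. norm (shift_l2 (s *\<^sub>R (1, 0)) x - x)) \<longlongrightarrow> 0) (at 0 within {0..})"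
    unfolding Z.T_zero by (intro tendsto_norm_zero LIM_zero)
  moreover have "((\<lambda>s. (1 - exp (- (k1 * s / 2))) * norm x) \<longlongrightarrow> (1 - exp (- (k1 * 0 / 2))) * norm x) (at 0 within {0..})"
    by (intro tendsto_intros) auto
  ultimately show "((\<lambda>s. norm (shift_l2 (s *\<^sub>R (1, 0)) x - x) + (1 - exp (- (k1 * s / 2))) * norm x) \<longlongrightarrow> 0) (at 0 within {0..})"
    using tendsto_add by fastforce
  show "\<forall>\<^sub>F s in at 0 within {0..}. norm (R s x - x) \<le> norm (shift_l2 (s *\<^sub>R (1, 0)) x - x) + (1 - exp (- (k1 * s / 2))) * norm x"
    using R_near by (auto simp: eventually_at_filter)
qed auto

lemma R_zero: "R 0 x = x"
  using R_near[of 0 x] by (simp add: shift_zero flip: zero_prod_def)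

lemma R_dist: "0 \<le> s \<Longrightarrow> 0 \<le> t \<Longrightarrow> norm (R s x - R t x) \<le> norm (R \<bar>s - t\<bar> x - x)"
proof (induction s t rule: linorder_wlog)
  case (le s t)
  have "R t x = R s (R (t - s) x)" using R_add[of s "t - s" x] le by simp
  then have "R s x - R t x = R s (x - R (t - s) x)"
    using le linear_diff[OF bounded_linear.linear[OF bounded_linear_R]] by simp
  then show ?case using norm_R_le[of s "x - R (t - s) x"] le by (simp add: norm_minus_commute)
qed (simp add: norm_minus_commute abs_minus_commute)

lemma continuous_R: "continuous_on {0..} (\<lambda>s. R s x)"
  unfolding continuous_on_iff
proof (intro ballI allI impI)
  fix s e :: real assume s: "s \<in> {0..}" and e: "0 < e"
  obtain d where d: "0 < d" "\<And>h. 0 \<le> h \<Longrightarrow> h < d \<Longrightarrow> h \<noteq> 0 \<Longrightarrow> norm (R h x - x) < e"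
    using tendstoD[OF R_tendsto[of x] e] by (auto simp: eventually_at)
  show "\<exists>d>0. \<forall>t\<in>{0..}. dist t s < d \<longrightarrow> dist (R t x) (R s x) < e"
  proof (intro exI[of _ d] conjI ballI impI)
    fix t :: real assume t: "t \<in> {0..}" "dist t s < d"
    show "dist (R t x) (R s x) < e"
      using R_dist[of t s x] d(2)[of "\<bar>t - s\<bar>"] s t e by (cases "t = s") (auto simp: dist_norm)
  qed (rule d)
qed

lemma integrable_R: "(\<lambda>s. R s x) integrable_on {0..r}"
  by (intro integrable_continuous_interval continuous_on_subset[OF continuous_R]) auto

lemma R_mean_tendsto: "((\<lambda>r. (1 / r) *\<^sub>R integral {0..r} (\<lambda>s. R s x)) \<longlongrightarrow> x) (at_right 0)"
proof (rule tendstoI)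
  fix e :: real assume e: "0 < e"
  obtain d where d: "0 < d" "\<And>h. 0 \<le> h \<Longrightarrow> h < d \<Longrightarrow> h \<noteq> 0 \<Longrightarrow> norm (R h x - x) < e / 2"
    using tendstoD[OF R_tendsto[of x], of "e / 2"] e by (auto simp: eventually_at)
  have "dist ((1 / r) *\<^sub>R integral {0..r} (\<lambda>s. R s x)) x < e" if r: "0 < r" "r < d" for r
  proof -
    have "integral {0..r} (\<lambda>s. R s x) - r *\<^sub>R x = integral {0..r} (\<lambda>s. R s x - x)"
      using r by (subst integral_diff[OF integrable_R]) auto
    also have "norm \<dots> \<le> e / 2 * (r - 0)"
    proof (rule integral_bound)
      show "continuous_on {0..r} (\<lambda>s. R s x - x)"
        by (intro continuous_intros continuous_on_subset[OF continuous_R]) auto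
      show "norm (R t x - x) \<le> e / 2" if "t \<in> {0..r}" for t
        using d(2)[of t] that r e by (cases "t = 0") (auto simp: R_zero)
    qed (use r in simp)
    finally have "norm (integral {0..r} (\<lambda>s. R s x) - r *\<^sub>R x) \<le> e / 2 * r" by simp
    moreover have "(1 / r) *\<^sub>R integral {0..r} (\<lambda>s. R s x) - x = (1 / r) *\<^sub>R (integral {0..r} (\<lambda>s. R s x) - r *\<^sub>R x)"
      using r by (simp add: scaleR_diff_right)
    ultimately have "dist ((1 / r) *\<^sub>R integral {0..r} (\<lambda>s. R s x)) x \<le> 1 / r * (e / 2 * r)"
    proof -
      assume n: "norm (integral {0..r} (\<lambda>s. R s x) - r *\<^sub>R x) \<le> e / 2 * r"
        and eq: "(1 / r) *\<^sub>R integral {0..r} (\<lambda>s. R s x) - x = (1 / r) *\<^sub>R (integral {0..r} (\<lambda>s. R s x) - r *\<^sub>R x)"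
      have "dist ((1 / r) *\<^sub>R integral {0..r} (\<lambda>s. R s x)) x = 1 / r * norm (integral {0..r} (\<lambda>s. R s x) - r *\<^sub>R x)"
        unfolding dist_norm eq norm_scaleR using r by simp
      also have "\<dots> \<le> 1 / r * (e / 2 * r)" using r by (intro mult_left_mono n) simp
      finally show ?thesis .
    qed
    then show ?thesis using r e by simp
  qed
  then show "\<forall>\<^sub>F r in at_right 0. dist ((1 / r) *\<^sub>R integral {0..r} (\<lambda>s. R s x)) x < e"
    using d(1) by (auto simp: eventually_at_right_field)
qed

text \<open>
  Testing against \<open>\<Psi>\<close> states \<open>\<zeta> - S(r)\<zeta> = \<integral>\<^sub>0\<^sup>r S(s)\<zeta>' ds\<close> for the right shift \<open>S\<close>, the adjoint of \<open>R\<close>.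
  The growth bounds of \<open>R\<close> then replace every use of \<open>g'\<close>.
\<close>

definition \<Psi> :: "((real \<times> real) l2 \<times> (real \<times> real) l2) set" where
  "\<Psi> = {(\<psi> - R r \<psi>, integral {0..r} (\<lambda>s. R s \<psi>)) | r \<psi>. 0 \<le> r}"

abbreviation "JJ \<equiv> tensor (abs_l2 wt)"

lemma norm_wt_pos: "0 < norm (abs_l2 wt)"
proof -
  have "abs_l2 wt \<noteq> 0"
  proof
    assume "abs_l2 wt = 0"
    then have "AE \<sigma> in lborel. wt \<sigma> = 0"
      using abs_eq_iff[OF sq_integrable_wt sq_integrable_zero] by (simp add: zero_l2.abs_eq)
    then have "AE \<sigma> in lborel. \<sigma> \<notin> {0..1::real}"
      by eventually_elim (metis wt_pos less_irrefl atLeastAtMost_iff)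
    then have "{0..1::real} \<in> null_sets lborel" by (subst AE_iff_null_sets) auto
    then show False by (auto simp: null_sets_def)
  qed
  then show ?thesis by simp
qed

text \<open>The profile of \<open>JJ x\<close> in the history variable is the weight itself. The
  shift multiplies it by \<open>mlt\<close>, and \<open>R\<close> multiplies by \<open>mlt\<close>
  once more, so the defect is \<open>1 - mlt^2\<close>, at most \<open>k1 * r\<close>. Being linear
  in \<open>r\<close>, it provides the constant \<kappa> of the abstract system.\<close>

lemma R_JJ: "0 \<le> r \<Longrightarrow> norm (JJ x - R r (JJ x)) \<le> k1 * r * norm (JJ x)"
proof -
  assume r: "0 \<le> r"
  obtain f where f: "x = abs_l2 f" "sq_integrable f" by (rule l2_cases)
  define F where "F = (\<lambda>p. wt (fst p) * f (snd p))"
  have F: "sq_integrable F" "JJ x = abs_l2 F"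
    unfolding F_def f(1) by (simp_all add: tensor_abs sq_integrable_wt f(2) sq_integrable_tensor)
  have "JJ x - R r (JJ x) = abs_l2 (\<lambda>p. F p - Rf r F p)"
    using r unfolding F(2) by (simp add: R_abs F(1) abs_diff Rf_sq)
  also have "norm \<dots> \<le> norm (abs_l2 (\<lambda>p. (k1 * r) * F p))"
  proof (rule norm_abs_mono)
    fix p :: "real \<times> real"
    show "\<bar>F p - Rf r F p\<bar> \<le> \<bar>k1 * r * F p\<bar>"
    proof (cases "fst p < 0")
      case True
      then show ?thesis by (simp add: F_def Rf_def wt_neg)
    next
      case False
      let ?m = "mlt r (fst p)"
      have "wt (fst p + r) = ?m * wt (fst p)"
        using False r wr_pos[of "fst p"] by (simp add: mlt_def wr_eq_wt[symmetric])
      then have eq: "F p - Rf r F p = (1 - ?m\<^sup>2) * F p"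
        using False by (simp add: F_def Rf_def algebra_simps power2_eq_square)
      have "1 - k1 * r \<le> exp (- (k1 * r))" using exp_ge_add_one_self[of "- (k1 * r)"] by simp
      also have "\<dots> = (exp (- (k1 * r / 2)))\<^sup>2" by (simp add: power2_eq_square exp_add[symmetric])
      also have "\<dots> \<le> ?m\<^sup>2" using mlt_lower[OF r] by (intro power_mono) auto
      finally have "1 - ?m\<^sup>2 \<le> k1 * r" by simp
      moreover have "0 \<le> 1 - ?m\<^sup>2"
        using mlt_le_1[OF r, of "fst p"] mlt_pos[OF r, of "fst p"] by (simp add: power_le_one)
      ultimately show ?thesis
        unfolding eq abs_mult using k_pos r by (intro mult_right_mono) (auto simp: abs_mult)
    qed
  qed (intro sq_integrable_diff sq_integrable_scale Rf_sq(1) F(1) r)+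
  also have "\<dots> = k1 * r * norm (JJ x)"
    using k_pos r by (simp add: abs_scaleR[OF F(1), symmetric] F(2))
  finally show ?thesis .
qed

lemma \<Psi>_mean:
  assumes "\<forall>p\<in>\<Psi>. inner \<zeta> (fst p) = inner \<zeta>' (snd p)" and r: "0 < r"
  shows "inner \<zeta> (\<psi> - R r \<psi>) = r * inner \<zeta>' ((1 / r) *\<^sub>R integral {0..r} (\<lambda>s. R s \<psi>))"
proof -
  have "(\<psi> - R r \<psi>, integral {0..r} (\<lambda>s. R s \<psi>)) \<in> \<Psi>" unfolding \<Psi>_def using r less_imp_le by blast
  from bspec[OF assms(1) this] show ?thesis using r by simp
qed

lemma R_mean_inner: "((\<lambda>r. inner z ((1 / r) *\<^sub>R integral {0..r} (\<lambda>s. R s x))) \<longlongrightarrow> inner z x) (at_right 0)"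
  by (intro tendsto_inner tendsto_const R_mean_tendsto)

text \<open>The integral means of \<open>R\<close> tend to the identity, so pairings with \<zeta>'
  are limits of difference quotients of the semigroup \<open>R\<close> paired with \<zeta>.
  Coercivity and boundedness become statements about \<open>R\<close> for small
  \<open>r\<close>.\<close>

lemma history_system_kernel:
  assumes "0 < \<rho>1" "0 < \<rho>2" "0 < \<rho>3" "0 < k" "0 < a" "0 < m" "0 < \<beta>"
  shows "history_system (\<lambda>s. TX s) (\<lambda>s. TY s) JJ \<Psi> \<rho>1 \<rho>2 \<rho>3 k a m \<beta> ((norm (abs_l2 wt))\<^sup>2) k2 (k1 * norm (abs_l2 wt))"
proof (intro history_system.intro X.isometry_group_axioms Y.isometry_group_axioms history_system_axioms.intro assms)
  show "0 < (norm (abs_l2 wt))\<^sup>2" using norm_wt_pos by simp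
  show "0 < k2" "0 \<le> k1 * norm (abs_l2 wt)" using k_pos by auto
  show "bounded_linear JJ" by (rule bounded_linear_tensor)
  show "inner (JJ x) (JJ y) = (norm (abs_l2 wt))\<^sup>2 * inner x y" for x y
    by (simp add: inner_tensor power2_norm_eq_inner)
  show "JJ (TX s x) = TY s (JJ x)" for s x by (simp only: shift_tensor)
  show "(TY s \<psi>1, TY s \<psi>2) \<in> \<Psi>" if \<psi>: "(\<psi>1, \<psi>2) \<in> \<Psi>" for s \<psi>1 \<psi>2
  proof -
    obtain r \<psi> where r: "\<psi>1 = \<psi> - R r \<psi>" "\<psi>2 = integral {0..r} (\<lambda>s. R s \<psi>)" "0 \<le> r"
      using \<psi> unfolding \<Psi>_def by blast
    have "TY s \<psi>1 = TY s \<psi> - R r (TY s \<psi>)" unfolding r(1) R_shift[OF r(3)] by (rule Y.T_diff)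
    moreover have "TY s \<psi>2 = integral {0..r} (\<lambda>q. R q (TY s \<psi>))"
    proof -
      have "TY s \<psi>2 = integral {0..r} (\<lambda>q. TY s (R q \<psi>))"
        unfolding r(2) using integral_linear[OF integrable_R Y.linear_T] by (simp add: o_def)
      also have "\<dots> = integral {0..r} (\<lambda>q. R q (TY s \<psi>))"
        by (rule integral_cong) (simp only: R_shift atLeastAtMost_iff)
      finally show ?thesis .
    qed
    ultimately show ?thesis unfolding \<Psi>_def using r(3) by blast
  qed
  fix \<zeta> \<zeta>' :: "(real \<times> real) l2"
  {
    assume "\<And>\<psi>1 \<psi>2. (\<psi>1, \<psi>2) \<in> \<Psi> \<Longrightarrow> inner \<zeta> \<psi>1 = inner \<zeta>' \<psi>2"
    then have tr: "\<forall>p\<in>\<Psi>. inner \<zeta> (fst p) = inner \<zeta>' (snd p)" by auto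
    show "k2 / 2 * (norm \<zeta>)\<^sup>2 \<le> inner \<zeta> \<zeta>'"
    proof (rule tendsto_le[OF _ R_mean_inner[of \<zeta>' \<zeta>, unfolded inner_commute[of \<zeta>' \<zeta>]]])
      have "((\<lambda>r. k2 / 2 * (norm \<zeta>)\<^sup>2 / (1 + k2 * r / 2)) \<longlongrightarrow> k2 / 2 * (norm \<zeta>)\<^sup>2 / (1 + k2 * 0 / 2)) (at_right 0)"
        by (intro tendsto_intros) auto
      then show "((\<lambda>r. k2 / 2 * (norm \<zeta>)\<^sup>2 / (1 + k2 * r / 2)) \<longlongrightarrow> k2 / 2 * (norm \<zeta>)\<^sup>2) (at_right 0)" by simp
      have "k2 / 2 * (norm \<zeta>)\<^sup>2 / (1 + k2 * r / 2) \<le> inner \<zeta>' ((1 / r) *\<^sub>R integral {0..r} (\<lambda>s. R s \<zeta>))" if r: "0 < r" for r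
      proof -
        \<comment> \<open>The exponential decay of \<open>R r\<close> is weakened to 1/(1 + x) with
          x = k2 r / 2; the difference quotient is then explicit and tends to
          \<open>k2 / 2\<close>.\<close>
        let ?q = "1 + k2 * r / 2"
        have q: "0 < ?q" using k_pos r by (simp add: add_pos_pos)
        have "exp (- (k2 * r / 2)) \<le> 1 / ?q"
          using exp_ge_add_one_self[of "k2 * r / 2"] q by (simp add: exp_minus field_simps)
        then have "norm (R r \<zeta>) \<le> 1 / ?q * norm \<zeta>"
          using norm_R[of r \<zeta>] r by (meson less_imp_le mult_right_mono norm_ge_zero order_trans)
        then have "inner \<zeta> (R r \<zeta>) \<le> norm \<zeta> * (1 / ?q * norm \<zeta>)"
          using norm_cauchy_schwarz[of \<zeta> "R r \<zeta>"] mult_left_mono[OF _ norm_ge_zero] by (meson order_trans)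
        then have "(norm \<zeta>)\<^sup>2 - (norm \<zeta>)\<^sup>2 / ?q \<le> inner \<zeta> (\<zeta> - R r \<zeta>)"
          by (simp add: inner_diff_right power2_norm_eq_inner[symmetric] power2_eq_square)
        moreover have "(norm \<zeta>)\<^sup>2 - (norm \<zeta>)\<^sup>2 / ?q = r * (k2 / 2 * (norm \<zeta>)\<^sup>2 / ?q)"
          using q by (simp add: field_simps)
        ultimately have "r * (k2 / 2 * (norm \<zeta>)\<^sup>2 / ?q) \<le> r * inner \<zeta>' ((1 / r) *\<^sub>R integral {0..r} (\<lambda>s. R s \<zeta>))"
          using \<Psi>_mean[OF tr r, of \<zeta>] by argo
        then show ?thesis by (rule mult_left_le_imp_le[OF _ r])
      qed
      then show "\<forall>\<^sub>F r in at_right 0. k2 / 2 * (norm \<zeta>)\<^sup>2 / (1 + k2 * r / 2)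
          \<le> inner \<zeta>' ((1 / r) *\<^sub>R integral {0..r} (\<lambda>s. R s \<zeta>))"
        by (auto simp: eventually_at_right_field intro!: exI[of _ 1])
    qed simp
    fix x
    show "\<bar>inner (JJ x) \<zeta>'\<bar> \<le> k1 * norm (abs_l2 wt) * norm x * norm \<zeta>"
    proof (rule tendsto_upperbound[OF tendsto_rabs[OF R_mean_inner[of \<zeta>' "JJ x", unfolded inner_commute[of \<zeta>' "JJ x"]]]])
      have "\<bar>inner \<zeta>' ((1 / r) *\<^sub>R integral {0..r} (\<lambda>s. R s (JJ x)))\<bar> \<le> k1 * norm (abs_l2 wt) * norm x * norm \<zeta>"
        if r: "0 < r" for r
      proof -
        \<comment> \<open>The semigroup falls on \<open>JJ x\<close>, where its increment is of
          order \<open>r\<close>, instead of on \<zeta>, about which nothing is known.\<close>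
        have "r * \<bar>inner \<zeta>' ((1 / r) *\<^sub>R integral {0..r} (\<lambda>s. R s (JJ x)))\<bar> = \<bar>inner \<zeta> (JJ x - R r (JJ x))\<bar>"
          unfolding \<Psi>_mean[OF tr r] using r by (simp add: abs_mult)
        also have "\<dots> \<le> norm \<zeta> * (k1 * r * norm (JJ x))"
          using r by (intro order_trans[OF Cauchy_Schwarz_ineq2] mult_left_mono R_JJ) auto
        also have "\<dots> = r * (k1 * norm (abs_l2 wt) * norm x * norm \<zeta>)" by (simp add: norm_tensor)
        finally show ?thesis by (rule mult_left_le_imp_le[OF _ r])
      qed
      then show "\<forall>\<^sub>F r in at_right 0. \<bar>inner \<zeta>' ((1 / r) *\<^sub>R integral {0..r} (\<lambda>s. R s (JJ x)))\<bar>
          \<le> k1 * norm (abs_l2 wt) * norm x * norm \<zeta>"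
        by (auto simp: eventually_at_right_field intro!: exI[of _ 1])
    qed simp
  }
  assume z: "\<And>\<psi>1 \<psi>2. (\<psi>1, \<psi>2) \<in> \<Psi> \<Longrightarrow> inner \<zeta>' \<psi>2 = 0"
  have "inner \<zeta>' ((1 / r) *\<^sub>R integral {0..r} (\<lambda>s. R s \<zeta>')) = 0" if "0 < r" for r
    using \<Psi>_mean[of 0 \<zeta>' r \<zeta>'] z that by fastforce
  then have "((\<lambda>r. inner \<zeta>' ((1 / r) *\<^sub>R integral {0..r} (\<lambda>s. R s \<zeta>'))) \<longlongrightarrow> 0) (at_right 0)"
    by (intro tendsto_eventually) (auto simp: eventually_at_right_field intro!: exI[of _ 1])
  then have "inner \<zeta>' \<zeta>' = 0" using tendsto_unique[OF _ _ R_mean_inner] by force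
  then show "\<zeta>' = 0" by simp
qed

end

section \<open>From the integral formula in the history variable to the transport equation\<close>

lemma bounded_linear_zero_if_total:
  fixes L :: "'h::{real_inner,banach} \<Rightarrow> real"
  assumes L: "bounded_linear L" and 0: "\<And>\<psi>. \<psi> \<in> \<Phi> \<Longrightarrow> L \<psi> = 0"
    and total: "\<And>z. (\<And>\<psi>. \<psi> \<in> \<Phi> \<Longrightarrow> inner z \<psi> = 0) \<Longrightarrow> z = 0"
  shows "L x = 0"
proof -
  have "x \<in> {x. L x = 0}"
  proof (rule closed_subspace_eq_UNIV)
    show "subspace {x. L x = 0}"
      using bounded_linear.linear[OF L] by (auto simp: subspace_def linear_add linear_scale linear_0)
    show "closed {x. L x = 0}"
      by (intro closed_Collect_eq continuous_on_const linear_continuous_on[OF L])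
    show "z = 0" if "\<And>x. x \<in> {x. L x = 0} \<Longrightarrow> inner z x = 0" for z
      using that 0 by (intro total) blast
  qed
  then show ?thesis by simp
qed

lemma integral_reflect_shift:
  fixes f :: "real \<Rightarrow> real"
  shows "integral {0..r} (\<lambda>s. f (c - s)) = integral {c - r..c} f"
  using Henstock_Kurzweil_Integration.integral_reflect_real[of 0 "- r" "\<lambda>s. f (c + s)"] integral_shift_real_ivl[of "c - r" c c f]
  by (simp add: add.commute)

context memory_kernel begin

text \<open>Dividing the indicator of an interval by the weight undoes the weight in the embedding:
  pairing with these vectors gives plain integrals over rectangles, in which a primitive in \<sigma>
  can be recognised.\<close>

abbreviation "wind a b \<equiv> (\<lambda>\<sigma>. indicator (box a b) \<sigma> / wr \<sigma> :: real)"

lemma wr_lower: "\<exists>M>0. \<forall>\<sigma>\<le>b. 1 / wr \<sigma> \<le> M"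
proof (intro exI[of _ "1 + 1 / wr (max b 0)"] conjI allI impI)
  show "0 < 1 + 1 / wr (max b 0)" using wr_pos[of "max b 0"] by (simp add: add_pos_pos)
  fix \<sigma> assume \<sigma>: "\<sigma> \<le> b"
  show "1 / wr \<sigma> \<le> 1 + 1 / wr (max b 0)"
  proof (cases "\<sigma> < 0")
    case True
    then show ?thesis using wr_pos[of "max b 0"] by (simp add: wr_def)
  next
    case False
    then have "wr (max b 0) \<le> wr \<sigma>" using g_decreasing[of \<sigma> "max b 0"] \<sigma> by (simp add: wr_def)
    then have "1 / wr \<sigma> \<le> 1 / wr (max b 0)" using wr_pos[of "max b 0"] by (simp add: frac_le)
    then show ?thesis by simp
  qed
qed

lemma sq_integrable_wind_gen:
  assumes "A \<in> sets borel" "A \<subseteq> {a..b}"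
  shows "sq_integrable (\<lambda>\<sigma>. indicator A \<sigma> / wr \<sigma>)"
proof -
  obtain M where M: "0 < M" "\<And>\<sigma>. \<sigma> \<le> b \<Longrightarrow> 1 / wr \<sigma> \<le> M" using wr_lower by blast
  have m[measurable]: "(\<lambda>\<sigma>. indicator A \<sigma> / wr \<sigma> :: real) \<in> borel_measurable borel" using assms(1) by measurable
  have "integrable lborel (\<lambda>\<sigma>. (indicator A \<sigma> / wr \<sigma>)\<^sup>2)"
  proof (rule Bochner_Integration.integrable_bound)
    show "integrable lborel (\<lambda>\<sigma>. M\<^sup>2 * indicator {a..b} \<sigma> :: real)"
      by (intro integrable_mult_right integrable_real_indicator) (auto simp: emeasure_lborel_Icc_eq)
    show "AE x in lborel. norm ((indicator A x / wr x)\<^sup>2) \<le> norm (M\<^sup>2 * indicator {a..b} x :: real)"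
    proof (rule AE_I2)
      fix x
      show "norm ((indicator A x / wr x)\<^sup>2) \<le> norm (M\<^sup>2 * indicator {a..b} x :: real)"
      proof (cases "x \<in> A")
        case True
        then have "x \<in> {a..b}" using assms(2) by blast
        moreover have "(1 / wr x)\<^sup>2 \<le> M\<^sup>2" using M(2)[of x] calculation wr_pos[of x] by (intro power_mono) auto
        ultimately show ?thesis using True by simp
      qed simp
    qed
  qed simp
  then show ?thesis using m by (simp add: sq_integrable_def)
qed

lemma sq_integrable_wind: "sq_integrable (wind a b)"
  by (rule sq_integrable_wind_gen[of _ a b]) (auto simp: box_real)

lemma wind_total:
  assumes "\<And>a b c d. a \<le> b \<Longrightarrow> inner z (tensor (abs_l2 (wind a b)) (ind c d)) = 0"
  shows "z = 0"
proof -
  obtain F where F: "z = abs_l2 F" "sq_integrable F" by (rule l2_cases)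
  have "AE p in lborel. F p / wr (fst p) = 0"
  proof (rule AE_zero_if_box)
    fix p q :: "real \<times> real"
    let ?w = "\<lambda>t. wind (fst p) (fst q) (fst t) * indicator (box (snd p) (snd q)) (snd t)"
    have eq: "indicator (box p q) t *\<^sub>R (F t / wr (fst t)) = F t * ?w t" for t
      unfolding indicator_def mem_box Basis_prod_def by (auto simp: inner_prod_def)
    note sq = sq_integrable_wind[of "fst p" "fst q"] sq_integrable_indicator_box[of "snd p" "snd q"]
    show "set_integrable lborel (box p q) (\<lambda>p. F p / wr (fst p))"
      unfolding set_integrable_def eq by (rule sq_integrable_mult[OF F(2) sq_integrable_tensor[OF sq]])
    have "(LINT x:box p q|lborel. F x / wr (fst x)) = inner z (tensor (abs_l2 (wind (fst p) (fst q))) (ind (snd p) (snd q)))"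
      unfolding set_lebesgue_integral_def eq F(1) ind_def tensor_abs[OF sq] inner_abs[OF F(2) sq_integrable_tensor[OF sq]] ..
    also have "\<dots> = 0"
    proof (cases "fst p \<le> fst q")
      case False
      then have "wind (fst p) (fst q) = (\<lambda>x. 0)" by (auto simp: fun_eq_iff box_real)
      then have 0: "abs_l2 (wind (fst p) (fst q)) = 0 *\<^sub>R abs_l2 (wind (fst p) (fst q))"
        by (simp add: zero_l2.abs_eq)
      have "tensor (0 :: real l2) x = 0" for x using norm_tensor[of 0 x] by simp
      then show ?thesis using 0 by simp
    qed (rule assms)
    finally show "(LINT x:box p q|lborel. F x / wr (fst x)) = 0" .
  qed
  then have "AE p in lborel. F p = 0"
    by eventually_elim (use wr_pos in \<open>metis divide_eq_0_iff less_irrefl\<close>)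
  then show ?thesis using abs_eq_iff[OF F(2) sq_integrable_zero] by (simp add: F(1) zero_l2.abs_eq)
qed

text \<open>The multiplier of \<open>R s\<close> turns the divisor at \<open>\<sigma> + s\<close>
  into the divisor at \<sigma>, so \<open>R s\<close> just moves the window to the left by
  \<open>s\<close>. The part reaching below 0 is lost, since embedded histories vanish
  there.\<close>

lemma inner_R_wind:
  assumes c: "history_in_L2 g c" and s: "0 \<le> s"
  shows "inner (YY c) (R s (tensor (abs_l2 (wind a b)) (ind p q)))
    = (\<integral>\<sigma>. indicator ({0..} \<inter> {a - s<..<b - s}) \<sigma> * (\<integral>x. c \<sigma> x * indicator (box p q) x \<partial>lborel) \<partial>lborel)"
proof -
  let ?D = "indicator (box p q) :: real \<Rightarrow> real"
  let ?A = "{0..} \<inter> {a - s<..<b - s}"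
  note F = whist_sq_integrable[OF c]
  note sq = sq_integrable_wind[of a b] sq_integrable_indicator_box[of p q]
  have A: "sq_integrable (\<lambda>\<sigma>. indicator ?A \<sigma> / wr \<sigma>)"
    by (rule sq_integrable_wind_gen[of _ "a - s" "b - s"]) auto
  have "inner (YY c) (R s (tensor (abs_l2 (wind a b)) (ind p q)))
      = (\<integral>t. whist c t * Rf s (\<lambda>t. wind a b (fst t) * ?D (snd t)) t \<partial>lborel)"
    unfolding ind_def tensor_abs[OF sq] R_abs[OF sq_integrable_tensor[OF sq] s]
    by (rule inner_abs[OF F Rf_sq(1)[OF sq_integrable_tensor[OF sq] s]])
  also have "\<dots> = (\<integral>t. whist c t * ((indicator ?A (fst t) / wr (fst t)) * ?D (snd t)) \<partial>lborel)"
  proof (rule arg_cong[of _ _ "integral\<^sup>L lborel"], rule ext)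
    fix t :: "real \<times> real"
    have "wr (fst t + s) \<noteq> 0" using wr_pos[of "fst t + s"] by simp
    then show "whist c t * Rf s (\<lambda>t. wind a b (fst t) * ?D (snd t)) t
        = whist c t * ((indicator ?A (fst t) / wr (fst t)) * ?D (snd t))"
      by (cases "fst t < 0") (auto simp: whist_def wt_neg Rf_def mlt_def box_real indicator_def)
  qed
  also have "\<dots> = inner (YY c) (tensor (abs_l2 (\<lambda>\<sigma>. indicator ?A \<sigma> / wr \<sigma>)) (abs_l2 ?D))"
    unfolding tensor_abs[OF A sq(2)] by (rule inner_abs[OF F sq_integrable_tensor[OF A sq(2)], symmetric])
  also have "\<dots> = (\<integral>\<sigma>. (indicator ?A \<sigma> / wr \<sigma>) * (\<integral>x. whist c (\<sigma>, x) * ?D x \<partial>lborel) \<partial>lborel)"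
    by (rule inner_abs_tensor[OF F A sq(2)])
  also have "\<dots> = (\<integral>\<sigma>. indicator ?A \<sigma> * (\<integral>x. c \<sigma> x * ?D x \<partial>lborel) \<partial>lborel)"
  proof (rule arg_cong[of _ _ "integral\<^sup>L lborel"], rule ext)
    fix \<sigma> :: real
    have "(\<integral>x. whist c (\<sigma>, x) * ?D x \<partial>lborel) = wt \<sigma> * (\<integral>x. c \<sigma> x * ?D x \<partial>lborel)"
      unfolding whist_sections mult.assoc by (rule integral_mult_right_zero)
    then show "(indicator ?A \<sigma> / wr \<sigma>) * (\<integral>x. whist c (\<sigma>, x) * ?D x \<partial>lborel)
        = indicator ?A \<sigma> * (\<integral>x. c \<sigma> x * ?D x \<partial>lborel)"
      using wr_eq_wt[of \<sigma>] wr_pos[of \<sigma>] by (cases "\<sigma> \<in> ?A") auto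
  qed
  finally show ?thesis .
qed

text \<open>Integrated in x over the test interval, \<open>c\<close> has the primitive
  \<open>E\<close>, and \<open>e\<close> equals \<open>E\<close>. Both sides are then integrals of
  \<open>E\<close> over intervals: the left side compares the window with its translate, and the
  right side compares the strips swept by its two ends.\<close>

lemma history_ds_transport_wind:
  assumes e: "history_in_L2 g e" and c: "history_in_L2 g c" and ds: "history_ds g e c"
    and ab: "a \<le> b" and r: "0 \<le> r" and \<psi>_def: "\<psi> = tensor (abs_l2 (wind a b)) (ind p q)"
  shows "inner (YY e) (\<psi> - R r \<psi>) = inner (YY c) (integral {0..r} (\<lambda>s. R s \<psi>))"
proof -
  let ?D = "indicator (box p q) :: real \<Rightarrow> real"
  \<comment> \<open>Large enough for \<open>{- M..M}\<close> to contain all windows met below, from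
    \<open>a - r\<close> to \<open>b\<close>.\<close>
  define M where "M = \<bar>a\<bar> + \<bar>b\<bar> + r + 1"
  define C where "C \<tau> = indicator {0..M} \<tau> * (\<integral>x. c \<tau> x * ?D x \<partial>lborel)" for \<tau>
  define E where "E t = integral {-M..t} C" for t
  have [measurable]: "(\<lambda>p. c (fst p) (snd p)) \<in> borel_measurable borel" "(\<lambda>p. e (fst p) (snd p)) \<in> borel_measurable borel"
    using e c by (auto simp: history_in_L2_iff history_measurable_iff)
  have cD: "integrable lborel (\<lambda>t. indicator {0..s} (fst t) * (c (fst t) (snd t) * ?D (snd t)))" for s
  proof -
    have A: "sq_integrable (\<lambda>\<sigma>. indicator {0..s} \<sigma> / wr \<sigma>)"
      by (rule sq_integrable_wind_gen[of _ 0 s]) auto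
    have "integrable lborel (\<lambda>t. whist c t * ((indicator {0..s} (fst t) / wr (fst t)) * ?D (snd t)))"
      by (rule sq_integrable_mult[OF whist_sq_integrable[OF c] sq_integrable_tensor[OF A sq_integrable_indicator_box]])
    moreover have "whist c t * ((indicator {0..s} (fst t) / wr (fst t)) * ?D (snd t))
        = indicator {0..s} (fst t) * (c (fst t) (snd t) * ?D (snd t))" for t
      using wr_eq_wt[of "fst t"] wr_pos[of "fst t"] by (cases "fst t \<in> {0..s}") (auto simp: whist_def)
    ultimately show ?thesis by simp
  qed
  have C: "integrable lborel C"
    using integral_prod_lborel(2)[OF cD[of M]] by (simp add: C_def[abs_def])
  have si: "set_integrable lborel S C" if "S \<in> sets borel" for S
    using integrable_mult_indicator[OF _ C, of S] that by (simp add: set_integrable_def)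
  have C_int: "C integrable_on S" "integral S C = (\<integral>\<tau>. indicator S \<tau> * C \<tau> \<partial>lborel)" if "S \<in> sets borel" for S
    using set_borel_integral_eq_integral[OF si[OF that]] by (auto simp: set_lebesgue_integral_def)
  have E_cont: "continuous_on {-M..M} E"
    unfolding E_def by (rule indefinite_integral_continuous_1) (rule C_int, simp)
  have E_diff: "(\<integral>\<sigma>. indicator ({0..} \<inter> {t<..<t'}) \<sigma> * (\<integral>x. c \<sigma> x * ?D x \<partial>lborel) \<partial>lborel) = E t' - E t"
    if t: "- M \<le> t" "t \<le> t'" "t' \<le> M" for t t'
  proof -
    have "indicator ({0..} \<inter> {t<..<t'}) \<sigma> * (\<integral>x. c \<sigma> x * ?D x \<partial>lborel) = indicator {t<..<t'} \<sigma> * C \<sigma>" for \<sigma>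
      using t by (auto simp: C_def indicator_def)
    then have "(\<integral>\<sigma>. indicator ({0..} \<inter> {t<..<t'}) \<sigma> * (\<integral>x. c \<sigma> x * ?D x \<partial>lborel) \<partial>lborel) = integral {t<..<t'} C"
      by (simp add: C_int(2))
    also have "\<dots> = integral {t..t'} C" using integral_open_interval[of t t' C] by (simp add: box_real)
    also have "\<dots> = E t' - E t"
      using Henstock_Kurzweil_Integration.integral_combine[OF t(1,2) C_int(1)] by (simp add: E_def)
    finally show ?thesis .
  qed
  have E_eq: "E t = (\<integral>\<tau>. indicator {0..t} \<tau> * (\<integral>x. c \<tau> x * ?D x \<partial>lborel) \<partial>lborel)" if "t \<le> M" for t
  proof -
    have "0 \<le> M" using r by (simp add: M_def)
    then have "indicator {-M..t} \<tau> * C \<tau> = indicator {0..t} \<tau> * (\<integral>x. c \<tau> x * ?D x \<partial>lborel)" for \<tau>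
      using that by (auto simp: C_def indicator_def)
    then show ?thesis by (simp add: E_def C_int(2))
  qed
  have sec: "(\<lambda>x. e \<sigma> x) \<in> borel_measurable borel" for \<sigma>
    using measurable_section[of "\<lambda>p. e (fst p) (snd p)" \<sigma>] by simp
  have E_e: "AE \<sigma> in lborel. 0 \<le> \<sigma> \<and> \<sigma> \<le> M \<longrightarrow> (\<integral>x. e \<sigma> x * ?D x \<partial>lborel) = E \<sigma>"
  proof -
    have "AE p in lborel. 0 \<le> fst p \<longrightarrow> e (fst p) (snd p) = (LBINT \<tau>:{0..fst p}. c \<tau> (snd p))"
      using ds unfolding history_ds_def AE_history_prod by (simp add: case_prod_beta')
    from AE_prod_lborelD[OF this] show ?thesis
    proof eventually_elim
      case (elim \<sigma>)
      show ?case
      proof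
        assume \<sigma>: "0 \<le> \<sigma> \<and> \<sigma> \<le> M"
        have int: "integrable (lborel \<Otimes>\<^sub>M lborel) (\<lambda>(\<tau>, x). indicator {0..\<sigma>} \<tau> * (c \<tau> x * ?D x))"
          using cD[of \<sigma>] by (simp add: lborel_prod case_prod_beta')
        have eq: "(LBINT \<tau>:{0..\<sigma>}. c \<tau> x) * ?D x = (\<integral>\<tau>. indicator {0..\<sigma>} \<tau> * (c \<tau> x * ?D x) \<partial>lborel)" for x
          unfolding set_lebesgue_integral_def by (subst integral_mult_left_zero[symmetric]) (simp add: mult.assoc)
        have "(\<integral>x. e \<sigma> x * ?D x \<partial>lborel) = (\<integral>x. (LBINT \<tau>:{0..\<sigma>}. c \<tau> x) * ?D x \<partial>lborel)"
        proof (rule integral_cong_AE)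
          show "(\<lambda>x. e \<sigma> x * ?D x) \<in> borel_measurable lborel" using sec[of \<sigma>] by measurable
          show "(\<lambda>x. (LBINT \<tau>:{0..\<sigma>}. c \<tau> x) * ?D x) \<in> borel_measurable lborel"
            unfolding eq using lborel_pair.integrable_snd[OF int] by (auto intro: borel_measurable_integrable)
          show "AE x in lborel. e \<sigma> x * ?D x = (LBINT \<tau>:{0..\<sigma>}. c \<tau> x) * ?D x"
            using elim by eventually_elim (use \<sigma> in simp)
        qed
        also have "\<dots> = (\<integral>x. (\<integral>\<tau>. indicator {0..\<sigma>} \<tau> * (c \<tau> x * ?D x) \<partial>lborel) \<partial>lborel)"
          unfolding eq ..
        also have "\<dots> = (\<integral>\<tau>. (\<integral>x. indicator {0..\<sigma>} \<tau> * (c \<tau> x * ?D x) \<partial>lborel) \<partial>lborel)"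
          by (rule lborel_pair.Fubini_integral[OF int])
        also have "\<dots> = E \<sigma>" using \<sigma> by (simp add: E_eq)
        finally show "(\<integral>x. e \<sigma> x * ?D x \<partial>lborel) = E \<sigma>" .
      qed
    qed
  qed
  have eD: "(\<lambda>\<sigma>. \<integral>x. e \<sigma> x * ?D x \<partial>lborel) \<in> borel_measurable lborel"
  proof (rule lborel.borel_measurable_lebesgue_integral)
    have snd: "(snd :: real \<times> real \<Rightarrow> real) \<in> borel_measurable borel"
      by (rule borel_measurable_continuous_onI) (intro continuous_intros)
    have D: "?D \<in> borel_measurable borel" by measurable
    have "(\<lambda>p. e (fst p) (snd p) * ?D (snd p)) \<in> borel_measurable (borel \<Otimes>\<^sub>M borel)"
      unfolding borel_prod by (rule borel_measurable_times[OF _ measurable_compose[OF snd D]]) measurable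
    then have "(\<lambda>(\<sigma>, x). e \<sigma> x * ?D x) \<in> borel_measurable (borel \<Otimes>\<^sub>M borel)"
      by (simp add: case_prod_beta')
    then show "(\<lambda>(\<sigma>, x). e \<sigma> x * ?D x) \<in> borel_measurable (lborel \<Otimes>\<^sub>M lborel)"
      by (simp add: lborel_prod borel_prod)
  qed
  have E_int: "(\<integral>\<sigma>. indicator ({0..} \<inter> {t<..<t'}) \<sigma> * (\<integral>x. e \<sigma> x * ?D x \<partial>lborel) \<partial>lborel) = integral {t..t'} E"
    if t: "- M \<le> t" "t \<le> t'" "t' \<le> M" for t t'
  proof -
    have cont: "continuous_on {t..t'} E" by (rule continuous_on_subset[OF E_cont]) (use t in auto)
    have si: "set_integrable lborel {t<..<t'} E"
      by (rule set_integrable_subset[OF borel_integrable_atLeastAtMost'[OF cont]]) auto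
    have "(\<integral>\<sigma>. indicator ({0..} \<inter> {t<..<t'}) \<sigma> * (\<integral>x. e \<sigma> x * ?D x \<partial>lborel) \<partial>lborel) = (\<integral>\<sigma>. indicator {t<..<t'} \<sigma> *\<^sub>R E \<sigma> \<partial>lborel)"
    proof (rule integral_cong_AE)
      show "AE \<sigma> in lborel. indicator ({0..} \<inter> {t<..<t'}) \<sigma> * (\<integral>x. e \<sigma> x * ?D x \<partial>lborel) = indicator {t<..<t'} \<sigma> *\<^sub>R E \<sigma>"
        using E_e
      proof eventually_elim
        case (elim \<sigma>)
        have "E \<sigma> = 0" if "\<sigma> < 0" using E_eq[of \<sigma>] that r by (simp add: M_def)
        then show ?case using elim t by (cases "\<sigma> < 0") (auto simp: indicator_def)
      qed
      show "(\<lambda>\<sigma>. indicator ({0..} \<inter> {t<..<t'}) \<sigma> * (\<integral>x. e \<sigma> x * ?D x \<partial>lborel)) \<in> borel_measurable lborel"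
        using eD by measurable
    qed (use si in \<open>auto simp: set_integrable_def intro: borel_measurable_integrable\<close>)
    also have "\<dots> = integral {t<..<t'} E"
      using set_borel_integral_eq_integral(2)[OF si] by (simp add: set_lebesgue_integral_def)
    also have "\<dots> = integral {t..t'} E" using integral_open_interval[of t t' E] by (simp add: box_real)
    finally show ?thesis .
  qed
  have int: "E integrable_on {t..t'}" if "- M \<le> t" "t' \<le> M" for t t'
    using that by (intro integrable_continuous_interval continuous_on_subset[OF E_cont]) auto
  have "inner (YY e) (\<psi> - R r \<psi>) = inner (YY e) (R 0 \<psi>) - inner (YY e) (R r \<psi>)"
    by (simp add: inner_diff_right R_zero)
  also have "\<dots> = integral {a..b} E - integral {a - r..b - r} E"
    unfolding \<psi>_def inner_R_wind[OF e order_refl] inner_R_wind[OF e r] using ab r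
    by (subst (1 2) E_int) (auto simp: M_def)
  \<comment> \<open>The interval from \<open>a - r\<close> to \<open>b\<close> is cut once at
    \<open>a\<close> and once at \<open>b - r\<close>; this is valid whether or not the window and
    its translate overlap.\<close>
  also have "\<dots> = integral {b - r..b} E - integral {a - r..a} E"
    using Henstock_Kurzweil_Integration.integral_combine[of "a - r" a b E]
      Henstock_Kurzweil_Integration.integral_combine[of "a - r" "b - r" b E] int[of "a - r" b] ab r
    by (simp add: M_def)
  also have "\<dots> = integral {0..r} (\<lambda>s. E (b - s)) - integral {0..r} (\<lambda>s. E (a - s))"
    by (simp add: integral_reflect_shift)
  also have "\<dots> = integral {0..r} (\<lambda>s. E (b - s) - E (a - s))"
    using ab r by (intro integral_diff[symmetric] integrable_continuous_interval continuous_on_compose2[OF E_cont] continuous_intros)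
      (auto simp: M_def)
  also have "\<dots> = integral {0..r} (\<lambda>s. inner (YY c) (R s \<psi>))"
  proof (rule integral_cong)
    fix s assume s: "s \<in> {0..r}"
    then have "0 \<le> s" by simp
    have "inner (YY c) (R s \<psi>) = E (b - s) - E (a - s)"
      unfolding \<psi>_def inner_R_wind[OF c \<open>0 \<le> s\<close>] by (rule E_diff) (use ab s in \<open>auto simp: M_def\<close>)
    then show "E (b - s) - E (a - s) = inner (YY c) (R s \<psi>)" ..
  qed
  also have "\<dots> = inner (YY c) (integral {0..r} (\<lambda>s. R s \<psi>))"
    using integral_linear[OF integrable_R bounded_linear_inner_right] by (simp add: o_def)
  finally show ?thesis .
qed

text \<open>The relation \<open>transport\<close> of the abstract system, stated here where no
  coefficients of the system are at hand.\<close>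

definition transp :: "(real \<times> real) l2 \<Rightarrow> (real \<times> real) l2 \<Rightarrow> bool" where
  "transp \<zeta> \<zeta>' \<longleftrightarrow> (\<forall>p\<in>\<Psi>. inner \<zeta> (fst p) = inner \<zeta>' (snd p))"

text \<open>For fixed \<open>r\<close> the difference of the two sides is a bounded linear
  functional of the test vector; it vanishes on the weighted rectangles, which are total.\<close>

lemma transp_if_history_ds:
  assumes e: "history_in_L2 g e" and c: "history_in_L2 g c" and ds: "history_ds g e c"
  shows "transp (YY e) (YY c)"
  unfolding transp_def
proof
  fix p assume "p \<in> \<Psi>"
  then obtain r \<psi> where p: "p = (\<psi> - R r \<psi>, integral {0..r} (\<lambda>s. R s \<psi>))" "0 \<le> r"
    unfolding \<Psi>_def by blast
  let ?L = "\<lambda>\<psi>. inner (YY e) (\<psi> - R r \<psi>) - inner (YY c) (integral {0..r} (\<lambda>s. R s \<psi>))"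
  have "?L \<psi> = 0"
  proof (rule bounded_linear_zero_if_total[where L = ?L and \<Phi> = "{tensor (abs_l2 (wind a b)) (ind c d) | a b c d. a \<le> b}"])
    have "bounded_linear (\<lambda>\<psi>. integral {0..r} (\<lambda>s. R s \<psi>))"
    proof (rule bounded_linear_intro[of _ r])
      fix x y :: "(real \<times> real) l2" and k :: real
      show "integral {0..r} (\<lambda>s. R s (x + y)) = integral {0..r} (\<lambda>s. R s x) + integral {0..r} (\<lambda>s. R s y)"
        by (subst integral_add[OF integrable_R integrable_R, symmetric]) (rule integral_cong, simp add: R_linear)
      show "integral {0..r} (\<lambda>s. R s (k *\<^sub>R x)) = k *\<^sub>R integral {0..r} (\<lambda>s. R s x)"
        by (subst integral_cmul[symmetric]) (rule integral_cong, simp add: R_linear)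
      have "norm (integral {0..r} (\<lambda>s. R s x)) \<le> norm x * (r - 0)"
        by (rule integral_bound) (use p(2) in \<open>auto intro: continuous_on_subset[OF continuous_R] norm_R_le\<close>)
      then show "norm (integral {0..r} (\<lambda>s. R s x)) \<le> norm x * r" by simp
    qed
    from bounded_linear_compose[OF bounded_linear_inner_right this]
    show "bounded_linear ?L"
      by (rule bounded_linear_sub[OF bounded_linear_compose[OF bounded_linear_inner_right
          bounded_linear_sub[OF bounded_linear_ident bounded_linear_R[OF p(2)]]]])
    show "?L \<psi> = 0" if \<psi>: "\<psi> \<in> {tensor (abs_l2 (wind a b)) (ind c d) | a b c d. a \<le> b}" for \<psi>
    proof -
      obtain a b c' d where "a \<le> b" "\<psi> = tensor (abs_l2 (wind a b)) (ind c' d)" using \<psi> by blast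
      from history_ds_transport_wind[OF e c ds this(1) p(2) this(2)] show ?thesis by simp
    qed
    show "z = 0" if "\<And>\<psi>. \<psi> \<in> {tensor (abs_l2 (wind a b)) (ind c d) | a b c d. a \<le> b} \<Longrightarrow> inner z \<psi> = 0" for z
      by (rule wind_total) (use that in blast)
  qed
  then show "inner (YY e) (fst p) = inner (YY c) (snd p)" by (simp add: p(1))
qed

text \<open>The boundary value and the transport are formulated for the history, while the state
  vector contains its x-derivative. Since \<Psi> is invariant under translation in x, the relation
  passes to difference quotients and to their limits.\<close>

lemma transp_tder:
  assumes t: "transp \<zeta> \<zeta>'" and d: "tder (\<lambda>s. TY s) \<zeta> \<zeta>x" "tder (\<lambda>s. TY s) \<zeta>' \<zeta>x'"
  shows "transp \<zeta>x \<zeta>x'"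
  unfolding transp_def
proof
  fix p assume p: "p \<in> \<Psi>"
  \<comment> \<open>The coefficients are placeholders: only the invariance of \<Psi> is taken from
    the instance, and it involves the kernel alone.\<close>
  interpret S: history_system "\<lambda>s. TX s" "\<lambda>s. TY s" JJ \<Psi> 1 1 1 1 1 1 0 1 "(norm (abs_l2 wt))\<^sup>2" k2 "k1 * norm (abs_l2 wt)"
    by (rule history_system_kernel) auto
  have sh: "inner (TY s \<zeta>) (fst p) = inner (TY s \<zeta>') (snd p)" for s
    using t S.\<Psi>_T[of "fst p" "snd p" "- s"] p unfolding transp_def Y.inner_T_left by fastforce
  have eq: "inner (diffq (\<lambda>s. TY s) s \<zeta>) (fst p) = inner (diffq (\<lambda>s. TY s) s \<zeta>') (snd p)" for s
    using sh[of s] sh[of 0] by (simp only: diffq_def inner_diff_left inner_scaleR_left Y.T_zero)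
  have "((\<lambda>s. inner (diffq (\<lambda>s. TY s) s \<zeta>) (fst p)) \<longlongrightarrow> inner \<zeta>x (fst p)) (at_right 0)"
    using Y.diffq_funpow_tendsto[of 1 \<zeta> \<zeta>x] d by (intro tendsto_inner tendsto_const) simp
  moreover have "((\<lambda>s. inner (diffq (\<lambda>s. TY s) s \<zeta>) (fst p)) \<longlongrightarrow> inner \<zeta>x' (snd p)) (at_right 0)"
    unfolding eq using Y.diffq_funpow_tendsto[of 1 \<zeta>' \<zeta>x'] d by (intro tendsto_inner tendsto_const) simp
  ultimately show "inner \<zeta>x (fst p) = inner \<zeta>x' (snd p)" by (rule tendsto_unique[rotated]) simp
qed

text \<open>Fubini's theorem identifies integration against the kernel with the adjoint of
  \<open>JJ\<close>: one factor \<open>wt\<close> comes from the embedding of the history, the other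
  from \<open>JJ\<close>.\<close>

lemma inner_memory:
  assumes e: "history_in_L2 g e" and f: "sq_integrable f"
    and q: "sq_integrable (\<lambda>x. LINT \<sigma>|history_measure g. e \<sigma> x)"
  shows "inner (abs_l2 (\<lambda>x. LINT \<sigma>|history_measure g. e \<sigma> x)) (abs_l2 f) = inner (YY e) (JJ (abs_l2 f))"
proof -
  have [measurable]: "(\<lambda>p. e (fst p) (snd p)) \<in> borel_measurable borel"
    using e by (auto simp: history_in_L2_iff history_measurable_iff)
  have [measurable]: "(\<lambda>\<sigma>. e \<sigma> x) \<in> borel_measurable borel" for x
  proof -
    have "(\<lambda>\<sigma>. (\<sigma>, x)) \<in> (borel :: real measure) \<rightarrow>\<^sub>M (borel :: (real \<times> real) measure)"
      by (simp add: borel_prod[symmetric])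
    then show ?thesis
      using measurable_compose[of "\<lambda>\<sigma>. (\<sigma>, x)" borel borel "\<lambda>p. e (fst p) (snd p)" borel] by simp
  qed
  have mem: "(LINT \<sigma>|history_measure g. e \<sigma> x) = (\<integral>\<sigma>. (wt \<sigma>)\<^sup>2 * e \<sigma> x \<partial>lborel)" for x
    unfolding history_measure_eq by (subst integral_density) auto
  have "integrable lborel (\<lambda>p. whist e p * (wt (fst p) * f (snd p)))"
    by (rule sq_integrable_mult[OF whist_sq_integrable[OF e] sq_integrable_tensor[OF sq_integrable_wt f]])
  then have int: "integrable (lborel \<Otimes>\<^sub>M lborel) (\<lambda>(\<sigma>, x). whist e (\<sigma>, x) * (wt \<sigma> * f x))"
    by (simp add: lborel_prod case_prod_beta')
  have "inner (YY e) (JJ (abs_l2 f)) = (\<integral>p. whist e p * (wt (fst p) * f (snd p)) \<partial>lborel)"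
    unfolding tensor_abs[OF sq_integrable_wt f]
    by (rule inner_abs[OF whist_sq_integrable[OF e] sq_integrable_tensor[OF sq_integrable_wt f]])
  also have "\<dots> = (\<integral>x. (\<integral>\<sigma>. whist e (\<sigma>, x) * (wt \<sigma> * f x) \<partial>lborel) \<partial>lborel)"
    unfolding lborel_pair.integral_snd[OF int] by (simp add: lborel_prod case_prod_beta')
  also have "\<dots> = (\<integral>x. (LINT \<sigma>|history_measure g. e \<sigma> x) * f x \<partial>lborel)"
  proof (rule arg_cong[of _ _ "integral\<^sup>L lborel"], rule ext)
    fix x
    have "(\<integral>\<sigma>. whist e (\<sigma>, x) * (wt \<sigma> * f x) \<partial>lborel) = (\<integral>\<sigma>. (wt \<sigma>)\<^sup>2 * e \<sigma> x * f x \<partial>lborel)"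
      by (simp add: whist_sections power2_eq_square mult_ac)
    then show "(\<integral>\<sigma>. whist e (\<sigma>, x) * (wt \<sigma> * f x) \<partial>lborel) = (LINT \<sigma>|history_measure g. e \<sigma> x) * f x"
      unfolding mem by simp
  qed
  also have "\<dots> = inner (abs_l2 (\<lambda>x. LINT \<sigma>|history_measure g. e \<sigma> x)) (abs_l2 f)"
    by (rule inner_abs[OF q f, symmetric])
  finally show ?thesis ..
qed

end

section \<open>Averages of integrable functions\<close>

text \<open>The square of the unnormalised average is a double integral of the autocorrelation at
  the difference of the two times. The inner integral is at most \<open>K\<close>, the outer one
  contributes \<open>r\<close>, and normalisation divides by \<open>r^2\<close>.\<close>

lemma (in isometry_group) norm_avg_correlation:
  assumes K: "\<And>a b. a \<le> b \<Longrightarrow> integral {a..b} (\<lambda>u. \<bar>inner (T u x) x\<bar>) \<le> K" and r: "0 < r"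
  shows "(norm (avg T r x))\<^sup>2 \<le> K / r"
proof -
  let ?I = "integral {0..r} (\<lambda>s. T s x)"
  have int: "(\<lambda>s. T s x) integrable_on {a..b}" for a b by (intro integrable_continuous_interval continuous_T_on)
  have corr: "continuous_on S (\<lambda>u. \<bar>inner (T u x) x\<bar>)" for S by (intro continuous_intros continuous_T_on)
  have inner_I: "inner z ?I = integral {0..r} (\<lambda>t. inner z (T t x))" for z
    using integral_linear[OF int bounded_linear_inner_right] by (simp add: o_def)
  have le: "inner (T s x) ?I \<le> K" for s
  proof -
    have eq: "inner (T s x) (T t x) = inner (T (s - t) x) x" for t
      using inner_T_left[of t "T (s - t) x" "T t x"] by (simp add: T_add[symmetric] T_zero)
    have "inner (T s x) ?I = integral {0..r} (\<lambda>t. inner (T (s - t) x) x)" unfolding inner_I eq ..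
    also have "\<dots> \<le> integral {0..r} (\<lambda>t. \<bar>inner (T (s - t) x) x\<bar>)"
      by (intro integral_le integrable_continuous_interval continuous_intros continuous_on_compose2[OF continuous_T[of x]]) auto
    also have "\<dots> = integral {s - r..s} (\<lambda>u. \<bar>inner (T u x) x\<bar>)" by (rule integral_reflect_shift)
    also have "\<dots> \<le> K" using r by (intro K) simp
    finally show ?thesis .
  qed
  have "(norm ?I)\<^sup>2 = integral {0..r} (\<lambda>s. inner (T s x) ?I)"
    unfolding power2_norm_eq_inner inner_I[of ?I] by (simp add: inner_commute)
  also have "\<dots> \<le> integral {0..r} (\<lambda>s. K)"
    by (intro integral_le integrable_continuous_interval continuous_intros continuous_T_on le)
  also have "\<dots> = r * K" using r by simp
  finally have "(norm ?I)\<^sup>2 \<le> r * K" .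
  then have "(1 / r)\<^sup>2 * (norm ?I)\<^sup>2 \<le> (1 / r)\<^sup>2 * (r * K)" by (intro mult_left_mono) auto
  moreover have "avg T r x = (1 / r) *\<^sub>R ?I" by (simp add: avg_def damped_mean_def)
  ultimately show ?thesis using r by (simp add: power_mult_distrib power2_eq_square power_divide)
qed

text \<open>Tonelli's theorem moves the integral over the shifts inside, so the correlation constant
  is the integral of \<open>\<bar>F p\<bar>\<close> times the integral of
  \<open>\<bar>F\<bar>\<close> along the line through \<open>p\<close>.\<close>

lemma avg_shift_bound:
  fixes F :: "'a::euclidean_space \<Rightarrow> real"
  assumes F: "sq_integrable F" and K: "0 \<le> K"
    and le: "(\<integral>\<^sup>+p. ennreal \<bar>F p\<bar> * (\<integral>\<^sup>+u. ennreal \<bar>F (p + u *\<^sub>R c)\<bar> \<partial>lborel) \<partial>lborel) \<le> ennreal K"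
    and r: "0 < r"
  shows "(norm (avg (\<lambda>s. shift_l2 (s *\<^sub>R c)) r (abs_l2 F)))\<^sup>2 \<le> K / r"
proof -
  interpret S: isometry_group "\<lambda>s. shift_l2 (s *\<^sub>R c)" by (rule isometry_group_shift)
  note m[measurable] = sq_integrable_measurable[OF F]
  show ?thesis
  proof (rule S.norm_avg_correlation[OF _ r])
    fix a b :: real assume ab: "a \<le> b"
    let ?k = "\<lambda>u. \<bar>inner (shift_l2 (u *\<^sub>R c) (abs_l2 F)) (abs_l2 F)\<bar>"
    have cont: "continuous_on S ?k" for S by (intro continuous_intros S.continuous_T_on)
    have si: "set_integrable lborel {a..b} ?k" by (rule borel_integrable_atLeastAtMost'[OF cont])
    have "integral {a..b} ?k = (\<integral>u. indicator {a..b} u *\<^sub>R ?k u \<partial>lborel)"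
      using set_borel_integral_eq_integral(2)[OF si] by (simp add: set_lebesgue_integral_def)
    also have "ennreal \<dots> = (\<integral>\<^sup>+u. ennreal (indicator {a..b} u *\<^sub>R ?k u) \<partial>lborel)"
      using si unfolding set_integrable_def by (intro nn_integral_eq_integral[symmetric]) auto
    also have "\<dots> = (\<integral>\<^sup>+u. indicator {a..b} u * ennreal (?k u) \<partial>lborel)"
      by (intro nn_integral_cong) (auto simp: indicator_def)
    also have "\<dots> \<le> (\<integral>\<^sup>+u. (\<integral>\<^sup>+p. ennreal \<bar>F (p + u *\<^sub>R c)\<bar> * ennreal \<bar>F p\<bar> \<partial>lborel) \<partial>lborel)"
    proof (rule nn_integral_mono)
      fix u :: real
      have "?k u = norm (\<integral>p. F (p + u *\<^sub>R c) * F p \<partial>lborel)"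
        by (simp add: shift_abs[OF F] inner_abs[OF sq_integrable_shift[OF F] F])
      also have "ennreal \<dots> \<le> (\<integral>\<^sup>+p. ennreal (norm (F (p + u *\<^sub>R c) * F p)) \<partial>lborel)"
        by (rule integral_norm_bound_ennreal[OF sq_integrable_mult[OF sq_integrable_shift[OF F] F]])
      finally show "indicator {a..b} u * ennreal (?k u) \<le> (\<integral>\<^sup>+p. ennreal \<bar>F (p + u *\<^sub>R c)\<bar> * ennreal \<bar>F p\<bar> \<partial>lborel)"
        by (cases "u \<in> {a..b}") (simp_all add: abs_mult ennreal_mult)
    qed
    also have "\<dots> = (\<integral>\<^sup>+p. (\<integral>\<^sup>+u. ennreal \<bar>F (p + u *\<^sub>R c)\<bar> * ennreal \<bar>F p\<bar> \<partial>lborel) \<partial>lborel)"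
    proof (rule lborel_pair.Fubini')
      have "(\<lambda>x. F (fst x + snd x *\<^sub>R c)) \<in> borel_measurable (borel \<Otimes>\<^sub>M borel)"
        by (rule measurable_compose[OF _ m]) measurable
      moreover have "(\<lambda>x :: 'a \<times> real. F (fst x)) \<in> borel_measurable (borel \<Otimes>\<^sub>M borel)" by measurable
      ultimately have "(\<lambda>x. ennreal \<bar>F (fst x + snd x *\<^sub>R c)\<bar> * ennreal \<bar>F (fst x)\<bar>) \<in> borel_measurable (borel \<Otimes>\<^sub>M borel)"
        by measurable
      then show "(\<lambda>(p, u). ennreal \<bar>F (p + u *\<^sub>R c)\<bar> * ennreal \<bar>F p\<bar>) \<in> borel_measurable (lborel \<Otimes>\<^sub>M lborel)"
        by (simp add: case_prod_beta' lborel_prod borel_prod)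
    qed
    also have "\<dots> = (\<integral>\<^sup>+p. ennreal \<bar>F p\<bar> * (\<integral>\<^sup>+u. ennreal \<bar>F (p + u *\<^sub>R c)\<bar> \<partial>lborel) \<partial>lborel)"
    proof (rule nn_integral_cong)
      fix p
      have "(\<lambda>u. F (p + u *\<^sub>R c)) \<in> borel_measurable borel" by (rule measurable_compose[OF _ m]) measurable
      then show "(\<integral>\<^sup>+u. ennreal \<bar>F (p + u *\<^sub>R c)\<bar> * ennreal \<bar>F p\<bar> \<partial>lborel) = ennreal \<bar>F p\<bar> * (\<integral>\<^sup>+u. ennreal \<bar>F (p + u *\<^sub>R c)\<bar> \<partial>lborel)"
        by (subst nn_integral_cmult[symmetric]) (auto simp: mult.commute)
    qed
    also note le
    finally show "integral {a..b} ?k \<le> K" using K by simp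
  qed
qed

lemma nn_integral_shift_lborel:
  fixes f :: "real \<Rightarrow> ennreal"
  assumes "f \<in> borel_measurable borel"
  shows "(\<integral>\<^sup>+u. f (x + u) \<partial>lborel) = (\<integral>\<^sup>+u. f u \<partial>lborel)"
  using nn_integral_real_affine[OF assms, of 1 x] by simp

lemma avg_L1_bound:
  assumes f: "sq_integrable f" and int: "integrable lborel f" and r: "0 < r"
  shows "norm (avg (\<lambda>s. TX s) r (abs_l2 f)) \<le> L1_norm f / sqrt r"
proof -
  note [measurable] = sq_integrable_measurable[OF f]
  have L: "0 \<le> L1_norm f" unfolding L1_norm_def by (rule integral_nonneg_AE) simp
  have L1: "(\<integral>\<^sup>+x. ennreal \<bar>f x\<bar> \<partial>lborel) = ennreal (L1_norm f)"
    unfolding L1_norm_def using int by (intro nn_integral_eq_integral) auto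
  have "(norm (avg (\<lambda>s. TX s) r (abs_l2 f)))\<^sup>2 \<le> (L1_norm f)\<^sup>2 / r"
  proof (rule avg_shift_bound[OF f _ _ r])
    have "(\<integral>\<^sup>+p. ennreal \<bar>f p\<bar> * (\<integral>\<^sup>+u. ennreal \<bar>f (p + u *\<^sub>R 1)\<bar> \<partial>lborel) \<partial>lborel) = ennreal ((L1_norm f)\<^sup>2)"
    proof -
      have "(\<integral>\<^sup>+p. ennreal \<bar>f p\<bar> * (\<integral>\<^sup>+u. ennreal \<bar>f (p + u *\<^sub>R 1)\<bar> \<partial>lborel) \<partial>lborel)
          = (\<integral>\<^sup>+p. ennreal \<bar>f p\<bar> * ennreal (L1_norm f) \<partial>lborel)"
        using nn_integral_shift_lborel[of "\<lambda>u. ennreal \<bar>f u\<bar>"] by (simp only: L1 real_scaleR_def mult_1_right) simp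
      also have "\<dots> = ennreal (L1_norm f) * ennreal (L1_norm f)"
        by (subst nn_integral_multc) (simp_all add: L1)
      finally show ?thesis using L by (simp add: ennreal_mult[symmetric] power2_eq_square)
    qed
    then show "(\<integral>\<^sup>+p. ennreal \<bar>f p\<bar> * (\<integral>\<^sup>+u. ennreal \<bar>f (p + u *\<^sub>R 1)\<bar> \<partial>lborel) \<partial>lborel) \<le> ennreal ((L1_norm f)\<^sup>2)" by simp
  qed simp
  also have "\<dots> = (L1_norm f / sqrt r)\<^sup>2" using r by (simp add: power_divide)
  finally show ?thesis by (rule power2_le_imp_le) (use L r in simp)
qed

context memory_kernel begin

lemma measurable_history_section: "history_measurable g e \<Longrightarrow> (\<lambda>x. e \<sigma> x) \<in> borel_measurable borel"
  using measurable_section[of "\<lambda>p. e (fst p) (snd p)" \<sigma>] by (simp add: history_measurable_iff)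

text \<open>Translation acts on x only, so the line integrals depend on \<sigma> alone. The
  correlation constant is the integral over \<sigma> of the squared L1 norms of the slices, and the
  squared weight turns it into an integral for the history measure.\<close>

lemma avg_history_bound:
  assumes e: "history_in_L2 g e"
    and int: "AE \<sigma> in history_measure g. integrable lborel (e \<sigma>)"
    and N: "integrable (history_measure g) N" "0 \<le> K" "(LINT \<sigma>|history_measure g. N \<sigma>) \<le> K\<^sup>2"
      "AE \<sigma> in history_measure g. (L1_norm (e \<sigma>))\<^sup>2 \<le> N \<sigma>" and r: "0 < r"
  shows "norm (avg (\<lambda>s. TY s) r (YY e)) \<le> K / sqrt r"
proof -
  note F = whist_sq_integrable[OF e]
  note m[measurable] = sq_integrable_measurable[OF F]
  have wm: "(\<lambda>\<sigma>. ennreal ((wt \<sigma>)\<^sup>2)) \<in> borel_measurable lborel" by simp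
  let ?n = "\<lambda>\<sigma>. \<integral>\<^sup>+x. ennreal \<bar>whist e (\<sigma>, x)\<bar> \<partial>lborel"
  have sec[measurable]: "(\<lambda>x. whist e (\<sigma>, x)) \<in> borel_measurable borel" for \<sigma> by (rule measurable_section[OF m])
  have nm: "?n \<in> borel_measurable lborel"
  proof (rule lborel.borel_measurable_nn_integral)
    show "(\<lambda>(\<sigma>, x). ennreal \<bar>whist e (\<sigma>, x)\<bar>) \<in> borel_measurable (lborel \<Otimes>\<^sub>M lborel)"
      by (simp add: case_prod_beta' lborel_prod)
  qed
  have N0: "AE \<sigma> in history_measure g. 0 \<le> N \<sigma>"
    using N(4) by eventually_elim (meson order_trans zero_le_power2)
  have "(norm (avg (\<lambda>s. TY s) r (YY e)))\<^sup>2 \<le> K\<^sup>2 / r"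
  proof (rule avg_shift_bound[OF F _ _ r])
    have "(\<integral>\<^sup>+p. ennreal \<bar>whist e p\<bar> * (\<integral>\<^sup>+u. ennreal \<bar>whist e (p + u *\<^sub>R (0, 1))\<bar> \<partial>lborel) \<partial>lborel)
        = (\<integral>\<^sup>+p. ennreal \<bar>whist e p\<bar> * ?n (fst p) \<partial>lborel)"
    proof (rule nn_integral_cong)
      fix p :: "real \<times> real"
      show "ennreal \<bar>whist e p\<bar> * (\<integral>\<^sup>+u. ennreal \<bar>whist e (p + u *\<^sub>R (0, 1))\<bar> \<partial>lborel) = ennreal \<bar>whist e p\<bar> * ?n (fst p)"
        using nn_integral_shift_lborel[of "\<lambda>u. ennreal \<bar>whist e (fst p, u)\<bar>" "snd p"] sec[of "fst p"]
        by (cases p) simp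
    qed
    also have "\<dots> = (\<integral>\<^sup>+p. ennreal \<bar>whist e p\<bar> * ?n (fst p) \<partial>(lborel \<Otimes>\<^sub>M lborel))" by (simp add: lborel_prod)
    also have "\<dots> = (\<integral>\<^sup>+\<sigma>. (\<integral>\<^sup>+x. ennreal \<bar>whist e (\<sigma>, x)\<bar> * ?n (fst (\<sigma>, x)) \<partial>lborel) \<partial>lborel)"
    proof (rule lborel.nn_integral_fst[symmetric])
      have "(\<lambda>p. ?n (fst p)) \<in> borel_measurable (lborel \<Otimes>\<^sub>M lborel)"
        by (rule measurable_compose[OF measurable_fst nm])
      moreover have "(\<lambda>p. ennreal \<bar>whist e p\<bar>) \<in> borel_measurable (lborel \<Otimes>\<^sub>M lborel)" by (simp add: lborel_prod)
      ultimately show "(\<lambda>p. ennreal \<bar>whist e p\<bar> * ?n (fst p)) \<in> borel_measurable (lborel \<Otimes>\<^sub>M lborel)" by measurable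
    qed
    also have "\<dots> = (\<integral>\<^sup>+\<sigma>. ?n \<sigma> * ?n \<sigma> \<partial>lborel)" by (simp add: nn_integral_multc)
    also have "\<dots> \<le> (\<integral>\<^sup>+\<sigma>. ennreal ((wt \<sigma>)\<^sup>2) * ennreal (N \<sigma>) \<partial>lborel)"
    proof (rule nn_integral_mono_AE)
      have "AE \<sigma> in lborel. 0 \<le> \<sigma> \<longrightarrow> integrable lborel (e \<sigma>)" "AE \<sigma> in lborel. 0 \<le> \<sigma> \<longrightarrow> (L1_norm (e \<sigma>))\<^sup>2 \<le> N \<sigma>"
        using int N(4) by (auto simp: AE_history)
      then show "AE \<sigma> in lborel. ?n \<sigma> * ?n \<sigma> \<le> ennreal ((wt \<sigma>)\<^sup>2) * ennreal (N \<sigma>)"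
      proof eventually_elim
        case (elim \<sigma>)
        show ?case
        proof (cases "0 \<le> \<sigma>")
          case True
          have L: "0 \<le> L1_norm (e \<sigma>)" unfolding L1_norm_def by (rule integral_nonneg_AE) simp
          have "?n \<sigma> = (\<integral>\<^sup>+x. ennreal (wt \<sigma>) * ennreal \<bar>e \<sigma> x\<bar> \<partial>lborel)"
            by (simp add: whist_sections abs_mult ennreal_mult wt_ge_0)
          also have "\<dots> = ennreal (wt \<sigma>) * ennreal (L1_norm (e \<sigma>))"
            unfolding L1_norm_def using elim(1) True
            by (subst nn_integral_cmult) (auto intro!: arg_cong2[where f = "(*)"] nn_integral_eq_integral)
          finally have "?n \<sigma> = ennreal (wt \<sigma> * L1_norm (e \<sigma>))" using L by (simp add: ennreal_mult wt_ge_0)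
          then have "?n \<sigma> * ?n \<sigma> = ennreal ((wt \<sigma>)\<^sup>2 * (L1_norm (e \<sigma>))\<^sup>2)"
            using L by (simp add: ennreal_mult[symmetric] wt_ge_0 power2_eq_square mult_ac)
          also have "\<dots> \<le> ennreal ((wt \<sigma>)\<^sup>2 * N \<sigma>)"
            using elim(2) True by (intro ennreal_leI mult_left_mono) auto
          also have "\<dots> = ennreal ((wt \<sigma>)\<^sup>2) * ennreal (N \<sigma>)" by (rule ennreal_mult') simp
          finally show ?thesis .
        next
          case False
          then show ?thesis by (simp add: whist_sections wt_neg)
        qed
      qed
    qed
    also have "\<dots> = (\<integral>\<^sup>+\<sigma>. ennreal (N \<sigma>) \<partial>history_measure g)"
    proof -
      have "(\<lambda>\<sigma>. ennreal (N \<sigma>)) \<in> borel_measurable lborel"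
        using borel_measurable_integrable[OF N(1)] by (simp add: history_measure_eq)
      then show ?thesis unfolding history_measure_eq by (rule nn_integral_density[OF wm, symmetric])
    qed
    also have "\<dots> = ennreal (LINT \<sigma>|history_measure g. N \<sigma>)" by (rule nn_integral_eq_integral[OF N(1) N0])
    also have "\<dots> \<le> ennreal (K\<^sup>2)" by (rule ennreal_leI[OF N(3)])
    finally show "(\<integral>\<^sup>+p. ennreal \<bar>whist e p\<bar> * (\<integral>\<^sup>+u. ennreal \<bar>whist e (p + u *\<^sub>R (0, 1))\<bar> \<partial>lborel) \<partial>lborel) \<le> ennreal (K\<^sup>2)" .
  qed simp
  also have "\<dots> = (K / sqrt r)\<^sup>2" using r by (simp add: power_divide)
  finally show ?thesis by (rule power2_le_imp_le) (use N(2) r in simp)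
qed

text \<open>The state contains only the derivative of the history, whose L1 norm is one of the two
  summands in the norm of W11. The derivative granted by the hypothesis and the one chosen by
  \<open>history_dx\<close> agree almost everywhere.\<close>

lemma avg_W11_bound:
  assumes W: "history_in_W11 g \<eta>" and H: "history_in_Hs g 1 \<eta>" and r: "0 < r"
  shows "norm (avg (\<lambda>s. TY s) r (YY (history_dx g 1 \<eta>))) \<le> history_W11_norm g \<eta> / sqrt r"
proof -
  let ?e = "history_dx g 1 \<eta>"
  obtain \<zeta> where z: "history_weak_deriv g 1 \<eta> \<zeta>"
    "AE \<sigma> in history_measure g. integrable lborel (\<eta> \<sigma>) \<and> integrable lborel (\<zeta> \<sigma>)"
    "integrable (history_measure g) (\<lambda>\<sigma>. (L1_norm (\<eta> \<sigma>) + L1_norm (\<zeta> \<sigma>))\<^sup>2)"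
    using W by (auto simp: history_in_W11_def)
  note e = history_in_Hs_dern[OF H]
  have ae: "AE \<sigma> in history_measure g. AE x in lborel. \<zeta> \<sigma> x = ?e \<sigma> x"
  proof -
    have "AE \<sigma> in history_measure g. weak_deriv 1 (\<eta> \<sigma>) (\<zeta> \<sigma>)" "AE \<sigma> in history_measure g. weak_deriv 1 (\<eta> \<sigma>) (?e \<sigma>)"
      using z(1) e(3) by (simp_all only: history_weak_deriv_def)
    then show ?thesis by eventually_elim (rule weak_deriv_unique)
  qed
  have mm: "history_measurable g ?e" "history_measurable g \<eta>"
    using e(1) W by (simp_all only: history_in_L2_def history_in_W11_def)
  have em: "(\<lambda>x. ?e \<sigma> x) \<in> borel_measurable borel" "(\<lambda>x. \<zeta> \<sigma> x) \<in> borel_measurable borel"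
    "(\<lambda>x. \<eta> \<sigma> x) \<in> borel_measurable borel" for \<sigma>
    using mm z(1) by (simp_all add: measurable_history_section history_weak_deriv_def)
  have L1m: "(\<lambda>\<sigma>. L1_norm (h \<sigma>)) \<in> borel_measurable (history_measure g)" if "history_measurable g h" for h
  proof -
    have [measurable]: "(\<lambda>p. h (fst p) (snd p)) \<in> borel_measurable borel" using that by (simp add: history_measurable_iff)
    have "(\<lambda>\<sigma>. L1_norm (h \<sigma>)) \<in> borel_measurable lborel"
      unfolding L1_norm_def
    proof (rule lborel.borel_measurable_lebesgue_integral)
      show "(\<lambda>(\<sigma>, x). \<bar>h \<sigma> x\<bar>) \<in> borel_measurable (lborel \<Otimes>\<^sub>M lborel)"
        by (simp add: case_prod_beta' lborel_prod)
    qed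
    then show ?thesis by (simp add: history_measure_eq)
  qed
  have L1_eq: "AE \<sigma> in history_measure g. L1_norm (\<zeta> \<sigma>) = L1_norm (?e \<sigma>)"
    using ae
  proof eventually_elim
    case (elim \<sigma>)
    show ?case unfolding L1_norm_def
      by (rule integral_cong_AE) (use elim em[of \<sigma>] in \<open>auto\<close>)
  qed
  let ?N = "\<lambda>\<sigma>. (L1_norm (\<eta> \<sigma>) + L1_norm (?e \<sigma>))\<^sup>2"
  have Nm: "?N \<in> borel_measurable (history_measure g)" using L1m[OF mm(1)] L1m[OF mm(2)] by measurable
  have N_eq: "AE \<sigma> in history_measure g. (L1_norm (\<eta> \<sigma>) + L1_norm (\<zeta> \<sigma>))\<^sup>2 = ?N \<sigma>"
    using L1_eq by eventually_elim simp
  have N: "integrable (history_measure g) ?N"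
    using integrable_cong_AE[OF borel_measurable_integrable[OF z(3)] Nm N_eq] z(3) by simp
  have L0: "0 \<le> L1_norm f" for f unfolding L1_norm_def by (rule integral_nonneg_AE) simp
  have I0: "0 \<le> (LINT \<sigma>|history_measure g. ?N \<sigma>)" by (rule integral_nonneg_AE) simp
  show ?thesis
  proof (rule avg_history_bound[OF e(1) _ N _ _ _ r])
    show "AE \<sigma> in history_measure g. integrable lborel (?e \<sigma>)"
      using z(2) ae
    proof eventually_elim
      case (elim \<sigma>)
      have "integrable lborel (\<zeta> \<sigma>) \<longleftrightarrow> integrable lborel (?e \<sigma>)"
        by (rule integrable_cong_AE) (use em[of \<sigma>] elim(2) in simp_all)
      then show ?case using elim(1) by blast
    qed
    show "0 \<le> history_W11_norm g \<eta>" unfolding history_W11_norm_def using I0 by simp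
    show "(LINT \<sigma>|history_measure g. ?N \<sigma>) \<le> (history_W11_norm g \<eta>)\<^sup>2"
      unfolding history_W11_norm_def using I0 by simp
    show "AE \<sigma> in history_measure g. (L1_norm (?e \<sigma>))\<^sup>2 \<le> ?N \<sigma>"
      using L0 by (intro AE_I2 power_mono) auto
  qed
qed

end

section \<open>Decay of solutions\<close>

lemma avg_prod:
  assumes "isometry_group T" "isometry_group T'"
  shows "avg (prod_group T T') r p = (avg T r (fst p), avg T' r (snd p))"
  by (simp add: avg_def damped_mean_prod[OF assms])

lemma norm_Pair_bound: "norm x \<le> A \<Longrightarrow> norm y \<le> B \<Longrightarrow> norm (x, y) \<le> A + B"
  using norm_Pair_le[of x y] by linarith

lemma in_Hs_mono: "in_Hs s f \<Longrightarrow> n \<le> s \<Longrightarrow> in_Hs n f"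
  by (auto simp: in_Hs_def)

lemma history_in_Hs_mono: "history_in_Hs g s e \<Longrightarrow> n \<le> s \<Longrightarrow> history_in_Hs g n e"
  by (auto simp: history_in_Hs_def)

lemma in_HHs_mono: "in_HHs g s V \<Longrightarrow> n \<le> s \<Longrightarrow> in_HHs g n V"
  by (auto simp: in_HHs_def intro: in_Hs_mono history_in_Hs_mono)

lemma in_Hs_sq: "in_Hs n f \<Longrightarrow> sq_integrable f"
  by (simp add: in_Hs_def in_L2_iff)

lemma in_Hs_0_iff: "in_Hs 0 f \<longleftrightarrow> sq_integrable f"
  using in_Hs_if_dern[of f 0 "abs_l2 f"] in_Hs_sq by auto

lemma in_Hs_1_tder: "in_Hs 1 f \<Longrightarrow> tder (\<lambda>s. TX s) (abs_l2 f) (abs_l2 (dx 1 f))"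
  using in_Hs_dern(2)[of 1 f] by simp

lemma L2_norm_eq: "sq_integrable f \<Longrightarrow> L2_norm f = norm (abs_l2 f)"
  by (simp add: L2_norm_def norm_abs[symmetric])

lemma abs_eqI: "sq_integrable f \<Longrightarrow> sq_integrable h \<Longrightarrow> AE x in lborel. f x = h x \<Longrightarrow> abs_l2 f = abs_l2 h"
  by (simp add: abs_eq_iff)

context memory_kernel begin

lemma history_in_Hs_L2: "history_in_Hs g n e \<Longrightarrow> history_in_L2 g e"
  by (simp add: history_in_Hs_def)

lemma history_in_Hs_1_tder: "history_in_Hs g 1 e \<Longrightarrow> tder (\<lambda>s. TY s) (YY e) (YY (history_dx g 1 e))"
  using history_in_Hs_dern(2)[of 1 e] by simp

lemma history_in_Hs_lin:
  assumes e: "history_in_Hs g 1 e" and e': "history_in_Hs g 1 e'"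
  shows "history_in_Hs g 1 (\<lambda>\<sigma> x. c * e \<sigma> x + d * e' \<sigma> x)"
    "YY (history_dx g 1 (\<lambda>\<sigma> x. c * e \<sigma> x + d * e' \<sigma> x)) = c *\<^sub>R YY (history_dx g 1 e) + d *\<^sub>R YY (history_dx g 1 e')"
proof -
  let ?h = "\<lambda>\<sigma> x. c * e \<sigma> x + d * e' \<sigma> x"
  note L = history_in_Hs_L2[OF e] history_in_Hs_L2[OF e']
  note sq = whist_sq_integrable[OF L(1)] whist_sq_integrable[OF L(2)]
  have eq: "whist ?h = (\<lambda>p. c * whist e p + d * whist e' p)" by (auto simp: whist_def fun_eq_iff algebra_simps)
  have [measurable]: "(\<lambda>p. e (fst p) (snd p)) \<in> borel_measurable borel" "(\<lambda>p. e' (fst p) (snd p)) \<in> borel_measurable borel"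
    using L by (auto simp: history_in_L2_iff history_measurable_iff)
  have h: "history_in_L2 g ?h"
    unfolding history_in_L2_iff eq history_measurable_iff by (intro conjI sq_integrable_add sq_integrable_scale sq) measurable
  have YYh: "YY ?h = c *\<^sub>R YY e + d *\<^sub>R YY e'"
    unfolding eq by (simp add: abs_add abs_scaleR sq sq_integrable_scale)
  have d: "tder (\<lambda>s. TY s) (YY ?h) (c *\<^sub>R YY (history_dx g 1 e) + d *\<^sub>R YY (history_dx g 1 e'))"
    unfolding YYh by (intro Y.tder_plus Y.tder_scaleR history_in_Hs_1_tder e e')
  then show H: "history_in_Hs g 1 ?h" by (intro history_in_Hs_if_dern[OF h]) simp
  show "YY (history_dx g 1 ?h) = c *\<^sub>R YY (history_dx g 1 e) + d *\<^sub>R YY (history_dx g 1 e')"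
    by (rule Y.tder_unique[OF history_in_Hs_1_tder[OF H] d])
qed

lemma history_dx_dern:
  assumes "history_in_Hs g (1 + n) e"
  shows "dern (\<lambda>s. TY s) n (YY (history_dx g 1 e)) (YY (history_dx g (n + 1) e))"
proof -
  obtain z where z: "dern (\<lambda>s. TY s) 1 (YY e) z" "dern (\<lambda>s. TY s) n z (YY (history_dx g (1 + n) e))"
    using history_in_Hs_dern(2)[OF assms] Y.dern_append[of 1 n] by blast
  have "history_in_Hs g 1 e" by (rule history_in_Hs_mono[OF assms]) simp
  then have "z = YY (history_dx g 1 e)" using z(1) Y.dern_unique history_in_Hs_dern(2) by blast
  then show ?thesis using z(2) by (simp add: add.commute)
qed

text \<open>The last component is the weighted x-derivative of the history, since that is what the
  phase space norm measures; \<open>norm (emb V)\<close> is thereby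
  \<open>dx_norm g 0 V\<close>.\<close>

definition emb :: "state \<Rightarrow> real l2 \<times> real l2 \<times> real l2 \<times> real l2 \<times> real l2 \<times> (real \<times> real) l2" where
  "emb V = (abs_l2 (cv V), abs_l2 (cu V), abs_l2 (cz V), abs_l2 (cy V), abs_l2 (c\<theta> V), YY (history_dx g 1 (c\<eta> V)))"

lemma emb_lin:
  assumes V: "in_HHs g 0 V" and W: "in_HHs g 0 W"
    and Z: "Z = State (\<lambda>x. c * cv V x + d * cv W x) (\<lambda>x. c * cu V x + d * cu W x) (\<lambda>x. c * cz V x + d * cz W x)
     (\<lambda>x. c * cy V x + d * cy W x) (\<lambda>x. c * c\<theta> V x + d * c\<theta> W x) (\<lambda>\<sigma> x. c * c\<eta> V \<sigma> x + d * c\<eta> W \<sigma> x)"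
  shows "in_HHs g 0 Z" "emb Z = c *\<^sub>R emb V + d *\<^sub>R emb W"
proof -
  have H: "history_in_Hs g 1 (c\<eta> V)" "history_in_Hs g 1 (c\<eta> W)" using V W by (simp_all add: in_HHs_def)
  have sq: "sq_integrable (cv V)" "sq_integrable (cu V)" "sq_integrable (cz V)" "sq_integrable (cy V)" "sq_integrable (c\<theta> V)"
    "sq_integrable (cv W)" "sq_integrable (cu W)" "sq_integrable (cz W)" "sq_integrable (cy W)" "sq_integrable (c\<theta> W)"
    using V W by (simp_all add: in_HHs_def in_Hs_0_iff)
  show "in_HHs g 0 Z"
    using history_in_Hs_lin(1)[OF H, of c d] sq
    by (simp add: Z in_HHs_def in_Hs_0_iff sq_integrable_add sq_integrable_scale)
  show "emb Z = c *\<^sub>R emb V + d *\<^sub>R emb W"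
    unfolding emb_def Z
    by (simp only: state.sel history_in_Hs_lin(2)[OF H] scaleR_Pair add_Pair)
      (simp add: abs_add abs_scaleR sq sq_integrable_scale)
qed

lemma emb_diff:
  assumes "in_HHs g 0 V" "in_HHs g 0 W"
  shows "in_HHs g 0 (state_diff V W)" "emb (state_diff V W) = emb V - emb W"
  using emb_lin[OF assms, of "state_diff V W" 1 "- 1"] by (simp_all add: state_diff_def)

lemma emb_scale:
  assumes "in_HHs g 0 V"
  shows "in_HHs g 0 (state_scale r V)" "emb (state_scale r V) = r *\<^sub>R emb V"
  using emb_lin[OF assms assms, of "state_scale r V" r 0] by (simp_all add: state_scale_def)

end

section \<open>The concrete system\<close>

locale viscoelastic_system = memory_kernel +
  fixes \<rho>1 \<rho>2 \<rho>3 k a m \<delta> \<beta> :: real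
  assumes coeff_pos: "0 < \<rho>1" "0 < \<rho>2" "0 < \<rho>3" "0 < k" "0 < a" "0 < m" "0 < \<beta>"

sublocale viscoelastic_system \<subseteq> S: history_system "\<lambda>s. TX s" "\<lambda>s. TY s" JJ \<Psi> \<rho>1 \<rho>2 \<rho>3 k a m \<delta> \<beta>
    "(norm (abs_l2 wt))\<^sup>2" k2 "k1 * norm (abs_l2 wt)"
  by (rule history_system_kernel) (rule coeff_pos)+

context viscoelastic_system begin

lemma dern_TH:
  "dern S.TH n (x1, x2, x3, x4, x5, x6) (y1, y2, y3, y4, y5, y6) \<longleftrightarrow>
    dern (\<lambda>s. TX s) n x1 y1 \<and> dern (\<lambda>s. TX s) n x2 y2 \<and> dern (\<lambda>s. TX s) n x3 y3 \<and> dern (\<lambda>s. TX s) n x4 y4 \<and>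
    dern (\<lambda>s. TX s) n x5 y5 \<and> dern (\<lambda>s. TY s) n x6 y6"
  unfolding S.TH_def dern_prod fst_conv snd_conv ..

lemma emb_dern:
  assumes V: "in_HHs g n V"
  shows "\<exists>M. dern S.TH n (emb V) M \<and> norm M = dx_norm g n V"
proof -
  have in_Hs: "in_Hs n (cv V)" "in_Hs n (cu V)" "in_Hs n (cz V)" "in_Hs n (cy V)" "in_Hs n (c\<theta> V)"
    and H: "history_in_Hs g (1 + n) (c\<eta> V)" using V by (simp_all add: in_HHs_def)
  have e: "history_in_L2 g (history_dx g (n + 1) (c\<eta> V))"
    using history_in_Hs_dern(1)[OF H] by (simp add: add.commute)
  let ?M = "(abs_l2 (dx n (cv V)), abs_l2 (dx n (cu V)), abs_l2 (dx n (cz V)), abs_l2 (dx n (cy V)), abs_l2 (dx n (c\<theta> V)),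
    YY (history_dx g (n + 1) (c\<eta> V)))"
  have "dern S.TH n (emb V) ?M"
    unfolding emb_def dern_TH by (intro conjI in_Hs_dern(2) in_Hs history_dx_dern[OF H])
  moreover have "(norm ?M)\<^sup>2 = (dx_norm g n V)\<^sup>2"
    unfolding S.norm_state fst_conv snd_conv dx_norm_def
    by (simp add: L2_norm_eq in_Hs_dern(1) in_Hs history_L2_norm_eq[OF e, simplified] power2_norm_eq_inner)
  then have "norm ?M = dx_norm g n V" by (rule power2_eq_imp_eq) (simp_all add: dx_norm_def)
  ultimately show ?thesis by blast
qed

lemma norm_emb: "in_HHs g 0 V \<Longrightarrow> norm (emb V) = dx_norm g 0 V"
  using emb_dern[of 0 V] by auto

text \<open>The history lies in L2 and has a first derivative by assumption; derivatives of the
  embedded state add \<open>n\<close> more to it, which gives the order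
  \<open>1 + n\<close>.\<close>

lemma in_HHs_if_dern:
  assumes V: "in_HHs g 0 V" and d: "dern S.TH n (emb V) y"
  shows "in_HHs g n V" "norm y = dx_norm g n V"
proof -
  obtain y1 y2 y3 y4 y5 y6 where y: "y = (y1, y2, y3, y4, y5, y6)" by (cases y)
  note d' = d[unfolded emb_def y dern_TH]
  have sq: "sq_integrable (cv V)" "sq_integrable (cu V)" "sq_integrable (cz V)" "sq_integrable (cy V)" "sq_integrable (c\<theta> V)"
    and H: "history_in_Hs g 1 (c\<eta> V)" using V by (simp_all add: in_HHs_def in_Hs_0_iff)
  have "dern (\<lambda>s. TY s) (1 + n) (YY (c\<eta> V)) y6"
    using Y.dern_append[of 1 n] history_in_Hs_dern(2)[OF H] d' by blast
  from history_in_Hs_if_dern[OF history_in_Hs_L2[OF H] this] show HH: "in_HHs g n V"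
    using d' sq unfolding in_HHs_def by (auto intro: in_Hs_if_dern)
  show "norm y = dx_norm g n V" using emb_dern[OF HH] d S.H.dern_unique by blast
qed

lemma gen_if_generator:
  assumes "generator \<rho>1 \<rho>2 \<rho>3 k a m \<delta> \<beta> g W F"
  shows "S.gen (emb W) (emb F)"
proof -
  define q where "q x = (LINT \<sigma>|history_measure g. history_dx g 1 (c\<eta> W) \<sigma> x)" for x
  define p where "p x = a * cz W x + m * q x" for x
  note gen = assms[unfolded generator_def Let_def, folded q_def, folded p_def[abs_def]]
  have W: "in_HHs g 0 W" and F: "in_HHs g 0 F" and Hs: "in_Hs 1 (cv W)" "in_Hs 1 (cu W)" "in_Hs 1 (cy W)" "in_Hs 1 p" "in_Hs 2 (c\<theta> W)"
    and ae: "AE x in lborel. cv F x = dx 1 (cu W) x - cy W x" "AE x in lborel. \<rho>1 * cu F x = k * dx 1 (cv W) x"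
      "AE x in lborel. cz F x = dx 1 (cy W) x" "AE x in lborel. \<rho>2 * cy F x = dx 1 p x + k * cv W x - \<delta> * dx 1 (c\<theta> W) x"
      "AE x in lborel. \<rho>3 * c\<theta> F x = \<beta> * dx 2 (c\<theta> W) x - \<delta> * dx 1 (cy W) x"
    using gen by simp_all
  obtain \<zeta> where \<zeta>: "history_in_Hs g 1 \<zeta>" "history_ds g (c\<eta> W) \<zeta>"
      "AE (\<sigma>, x) in history_measure g \<Otimes>\<^sub>M lborel. c\<eta> F \<sigma> x = - \<zeta> \<sigma> x + cy W x"
    using gen by blast
  have Hs\<theta>: "in_Hs 1 (c\<theta> W)" by (rule in_Hs_mono[OF Hs(5)]) simp
  have sq: "sq_integrable (cv W)" "sq_integrable (cz W)" "sq_integrable (cy W)" "sq_integrable p" "sq_integrable (c\<theta> W)"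
    "sq_integrable (cv F)" "sq_integrable (cu F)" "sq_integrable (cz F)" "sq_integrable (cy F)" "sq_integrable (c\<theta> F)"
    using W F Hs by (simp_all add: in_HHs_def in_Hs_0_iff in_Hs_sq)
  note dsq = Hs(1-4)[THEN in_Hs_dern(1)] in_Hs_dern(1)[OF Hs(5)] in_Hs_dern(1)[OF Hs\<theta>]
  have H: "history_in_Hs g 1 (c\<eta> W)" "history_in_Hs g 1 (c\<eta> F)" using W F by (simp_all add: in_HHs_def)
  \<comment> \<open>Regularity is granted only to the sum \<open>p\<close>. As \<open>z\<close> is
    square integrable, the memory term is so as a difference.\<close>
  have "q = (\<lambda>x. 1 / m * (p x - a * cz W x))" using coeff_pos by (auto simp: p_def fun_eq_iff)
  then have q: "sq_integrable q" using sq by (simp only: sq_integrable_scale sq_integrable_diff)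
  note td = Hs(1-4)[THEN in_Hs_1_tder] in_Hs_1_tder[OF Hs\<theta>]
  have u: "abs_l2 (dx 1 (cu W)) = abs_l2 (cv F) + abs_l2 (cy W)"
    unfolding abs_add[OF sq(6,3)] by (rule abs_eqI) (use dsq sq ae(1) in \<open>auto intro: sq_integrable_add elim: eventually_mono\<close>)
  have v: "k *\<^sub>R abs_l2 (dx 1 (cv W)) = \<rho>1 *\<^sub>R abs_l2 (cu F)"
    unfolding abs_scaleR[OF dsq(1)] abs_scaleR[OF sq(7)]
    by (rule abs_eqI) (use dsq sq ae(2) in \<open>auto intro: sq_integrable_scale elim: eventually_mono\<close>)
  have z: "abs_l2 (dx 1 (cy W)) = abs_l2 (cz F)"
    by (rule abs_eqI) (use dsq sq ae(3) in \<open>auto elim: eventually_mono\<close>)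
  have P: "abs_l2 p = a *\<^sub>R abs_l2 (cz W) + m *\<^sub>R abs_l2 q"
    unfolding p_def[abs_def] by (simp add: abs_add abs_scaleR sq q sq_integrable_scale)
  have y: "abs_l2 (dx 1 p) = \<rho>2 *\<^sub>R abs_l2 (cy F) - k *\<^sub>R abs_l2 (cv W) + \<delta> *\<^sub>R abs_l2 (dx 1 (c\<theta> W))"
  proof -
    have "\<rho>2 *\<^sub>R abs_l2 (cy F) - k *\<^sub>R abs_l2 (cv W) + \<delta> *\<^sub>R abs_l2 (dx 1 (c\<theta> W))
        = abs_l2 (\<lambda>x. \<rho>2 * cy F x - k * cv W x + \<delta> * dx 1 (c\<theta> W) x)"
      by (simp only: abs_add abs_diff abs_scaleR sq dsq sq_integrable_scale sq_integrable_diff)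
    moreover have "abs_l2 (dx 1 p) = abs_l2 (\<lambda>x. \<rho>2 * cy F x - k * cv W x + \<delta> * dx 1 (c\<theta> W) x)"
      by (rule abs_eqI)
        (use dsq sq ae(4) in \<open>auto intro!: sq_integrable_add sq_integrable_diff sq_integrable_scale elim: eventually_mono\<close>)
    ultimately show ?thesis by simp
  qed
  have th: "tder (\<lambda>s. TX s) (abs_l2 (dx 1 (c\<theta> W))) (abs_l2 (dx 2 (c\<theta> W)))"
  proof -
    have "dern (\<lambda>s. TX s) (Suc 1) (abs_l2 (c\<theta> W)) (abs_l2 (dx 2 (c\<theta> W)))"
      using in_Hs_dern(2)[OF Hs(5)] by (simp only: Suc_1)
    then obtain z where z: "dern (\<lambda>s. TX s) 1 (abs_l2 (c\<theta> W)) z" "tder (\<lambda>s. TX s) z (abs_l2 (dx 2 (c\<theta> W)))"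
      unfolding dern.simps(2) by blast
    then show ?thesis using X.dern_unique[OF z(1) in_Hs_dern(2)[OF Hs\<theta>]] by simp
  qed
  have t: "\<beta> *\<^sub>R abs_l2 (dx 2 (c\<theta> W)) = \<rho>3 *\<^sub>R abs_l2 (c\<theta> F) + \<delta> *\<^sub>R abs_l2 (cz F)"
  proof -
    have "\<rho>3 *\<^sub>R abs_l2 (c\<theta> F) + \<delta> *\<^sub>R abs_l2 (cz F) = abs_l2 (\<lambda>x. \<rho>3 * c\<theta> F x + \<delta> * cz F x)"
      by (simp only: abs_add abs_scaleR sq sq_integrable_scale)
    also have "\<dots> = abs_l2 (\<lambda>x. \<beta> * dx 2 (c\<theta> W) x)"
    proof (rule abs_eqI)
      show "AE x in lborel. \<rho>3 * c\<theta> F x + \<delta> * cz F x = \<beta> * dx 2 (c\<theta> W) x"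
        using ae(3,5) by eventually_elim simp
    qed (use dsq sq in \<open>auto intro: sq_integrable_add sq_integrable_scale\<close>)
    finally show ?thesis by (simp add: abs_scaleR dsq)
  qed
  \<comment> \<open>The domain condition speaks of the history, the abstract generator of its
    x-derivative; hence one differentiation in x.\<close>
  have tr: "transp (YY (history_dx g 1 (c\<eta> W))) (YY (history_dx g 1 \<zeta>))"
    by (rule transp_tder[OF transp_if_history_ds[OF history_in_Hs_L2[OF H(1)] history_in_Hs_L2[OF \<zeta>(1)] \<zeta>(2)]
        history_in_Hs_1_tder[OF H(1)] history_in_Hs_1_tder[OF \<zeta>(1)]])
  have F\<eta>: "YY (c\<eta> F) = JJ (abs_l2 (cy W)) - YY \<zeta>"
  proof -
    note sq' = whist_sq_integrable[OF history_in_Hs_L2[OF H(2)]] whist_sq_integrable[OF history_in_Hs_L2[OF \<zeta>(1)]]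
    note ten = sq_integrable_tensor[OF sq_integrable_wt sq(3)]
    have "AE r in lborel. 0 \<le> fst r \<longrightarrow> c\<eta> F (fst r) (snd r) = - \<zeta> (fst r) (snd r) + cy W (snd r)"
      using \<zeta>(3) unfolding AE_history_prod by (simp add: case_prod_beta')
    then have "AE r in lborel. whist (c\<eta> F) r = wt (fst r) * cy W (snd r) - whist \<zeta> r"
    proof eventually_elim
      case (elim r)
      show ?case
      proof (cases "0 \<le> fst r")
        case True
        then show ?thesis unfolding whist_def elim[rule_format, OF True] by (simp add: algebra_simps)
      qed (simp add: whist_def wt_neg)
    qed
    then have "YY (c\<eta> F) = abs_l2 (\<lambda>r. wt (fst r) * cy W (snd r) - whist \<zeta> r)"
      by (rule abs_eqI[OF sq'(1) sq_integrable_diff[OF ten sq'(2)]])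
    also have "\<dots> = JJ (abs_l2 (cy W)) - YY \<zeta>"
      unfolding tensor_abs[OF sq_integrable_wt sq(3)] by (rule abs_diff[OF ten sq'(2), symmetric])
    finally show ?thesis .
  qed
  have F\<eta>x: "YY (history_dx g 1 (c\<eta> F)) = JJ (abs_l2 (cz F)) - YY (history_dx g 1 \<zeta>)"
  proof (rule Y.tder_unique[OF history_in_Hs_1_tder[OF H(2)]])
    show "tder (\<lambda>s. TY s) (YY (c\<eta> F)) (JJ (abs_l2 (cz F)) - YY (history_dx g 1 \<zeta>))"
      unfolding F\<eta> z[symmetric] by (rule Y.tder_diff[OF tder_tensor[OF td(3)] history_in_Hs_1_tder[OF \<zeta>(1)]])
  qed
  show ?thesis
    unfolding S.gen_def emb_def fst_conv snd_conv
  proof (rule exI[of _ "abs_l2 q"], rule exI[of _ "abs_l2 (dx 1 (c\<theta> W))"], intro conjI allI)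
    show "inner (abs_l2 q) x = inner (YY (history_dx g 1 (c\<eta> W))) (JJ x)" for x
    proof -
      obtain f where f: "x = abs_l2 f" "sq_integrable f" by (rule l2_cases)
      show ?thesis
        using inner_memory[OF history_in_Hs_dern(1)[OF H(1)] f(2)] q unfolding f(1) q_def[abs_def] by blast
    qed
    show "tder (\<lambda>s. TX s) (abs_l2 (cu W)) (abs_l2 (cv F) + abs_l2 (cy W))" using td(2) unfolding u .
    show "tder (\<lambda>s. TX s) (k *\<^sub>R abs_l2 (cv W)) (\<rho>1 *\<^sub>R abs_l2 (cu F))" using X.tder_scaleR[OF td(1), of k] unfolding v .
    show "tder (\<lambda>s. TX s) (abs_l2 (cy W)) (abs_l2 (cz F))" using td(3) unfolding z .
    show "tder (\<lambda>s. TX s) (abs_l2 (c\<theta> W)) (abs_l2 (dx 1 (c\<theta> W)))" by (rule td(5))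
    show "tder (\<lambda>s. TX s) (a *\<^sub>R abs_l2 (cz W) + m *\<^sub>R abs_l2 q)
        (\<rho>2 *\<^sub>R abs_l2 (cy F) - k *\<^sub>R abs_l2 (cv W) + \<delta> *\<^sub>R abs_l2 (dx 1 (c\<theta> W)))"
      using td(4) unfolding P y .
    show "tder (\<lambda>s. TX s) (\<beta> *\<^sub>R abs_l2 (dx 1 (c\<theta> W))) (\<rho>3 *\<^sub>R abs_l2 (c\<theta> F) + \<delta> *\<^sub>R abs_l2 (cz F))"
      using X.tder_scaleR[OF th, of \<beta>] unfolding t .
    show "S.transport (YY (history_dx g 1 (c\<eta> W))) (JJ (abs_l2 (cz F)) - YY (history_dx g 1 (c\<eta> F)))"
      using tr unfolding F\<eta>x S.transport_def transp_def by fastforce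
  qed
qed

lemma mild_if_mild_solution:
  assumes sol: "mild_solution \<rho>1 \<rho>2 \<rho>3 k a m \<delta> \<beta> g V0 V" and V0: "in_HHs g 0 V0"
  shows "\<exists>W. S.mild (emb V0) W (\<lambda>t. emb (V t))"
proof -
  obtain W where W: "dx_norm g 0 (W 0) = 0"
      "\<And>t. 0 \<le> t \<Longrightarrow> generator \<rho>1 \<rho>2 \<rho>3 k a m \<delta> \<beta> g (W t) (state_diff (V t) V0)"
      "\<And>t. 0 \<le> t \<Longrightarrow> ((\<lambda>r. dx_norm g 0
        (state_diff (state_scale (1 / (r - t)) (state_diff (W r) (W t))) (V t))) \<longlongrightarrow> 0) (at t within {0..})"
    using sol unfolding mild_solution_def by blast
  have V: "in_HHs g 0 (V t)" if "0 \<le> t" for t using sol that unfolding mild_solution_def by blast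
  have HW: "in_HHs g 0 (W t)" if "0 \<le> t" for t
    using W(2)[OF that] unfolding generator_def Let_def by blast
  have "S.mild (emb V0) (\<lambda>t. emb (W t)) (\<lambda>t. emb (V t))"
    unfolding S.mild_def
  proof (intro conjI allI impI)
    show "emb (W 0) = 0" using norm_emb[OF HW[of 0]] W(1) by simp
    fix t :: real assume t: "0 \<le> t"
    show "S.gen (emb (W t)) (emb (V t) - emb V0)"
      using gen_if_generator[OF W(2)[OF t]] emb_diff(2)[OF V[OF t] V0] by simp
    \<comment> \<open>The difference quotient in the phase space norm is the quotient of norms that
      defines differentiability of the embedded curve.\<close>
    have eq: "dx_norm g 0 (state_diff (state_scale (1 / (r - t)) (state_diff (W r) (W t))) (V t))
        = norm (emb (W r) - emb (W t) - (r - t) *\<^sub>R emb (V t)) / norm (r - t)" if r: "0 \<le> r" "r \<noteq> t" for r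
    proof -
      note D = emb_diff[OF HW[OF r(1)] HW[OF t]]
      note D2 = emb_diff[OF emb_scale(1)[OF D(1)] V[OF t]]
      have "dx_norm g 0 (state_diff (state_scale (1 / (r - t)) (state_diff (W r) (W t))) (V t))
          = norm ((1 / (r - t)) *\<^sub>R (emb (W r) - emb (W t)) - emb (V t))"
        unfolding norm_emb[OF D2(1), symmetric] D2(2) emb_scale(2)[OF D(1)] D(2) ..
      also have "(1 / (r - t)) *\<^sub>R (emb (W r) - emb (W t)) - emb (V t)
          = (1 / (r - t)) *\<^sub>R (emb (W r) - emb (W t) - (r - t) *\<^sub>R emb (V t))"
        using r(2) by (simp add: scaleR_diff_right)
      finally show ?thesis by (simp add: divide_inverse mult.commute)
    qed
    have "((\<lambda>r. norm (emb (W r) - emb (W t) - (r - t) *\<^sub>R emb (V t)) / norm (r - t)) \<longlongrightarrow> 0) (at t within {0..})"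
      by (rule Lim_transform_eventually[OF W(3)[OF t]]) (use eq in \<open>simp add: eventually_at_filter\<close>)
    then show "((\<lambda>t. emb (W t)) has_vector_derivative emb (V t)) (at t within {0..})"
      unfolding has_vector_derivative_def has_derivative_iff_norm by (simp add: bounded_linear_scaleR_left)
  qed
  then show ?thesis by blast
qed

lemma avg_emb_bound:
  assumes V: "in_HHs g 0 V" and L: "in_LL1 g V" and r: "0 < r"
  shows "norm (avg S.TH r (emb V)) \<le> LL1_norm g V / sqrt r"
proof -
  have sq: "sq_integrable (cv V)" "sq_integrable (cu V)" "sq_integrable (cz V)" "sq_integrable (cy V)" "sq_integrable (c\<theta> V)"
    and H: "history_in_Hs g 1 (c\<eta> V)" using V by (simp_all add: in_HHs_def in_Hs_0_iff)
  have int: "integrable lborel (cv V)" "integrable lborel (cu V)" "integrable lborel (cz V)"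
    "integrable lborel (cy V)" "integrable lborel (c\<theta> V)" and W: "history_in_W11 g (c\<eta> V)"
    using L by (simp_all add: in_LL1_def)
  note X = X.isometry_group_axioms
  note i5 = isometry_group_prod[OF X Y.isometry_group_axioms]
  note i4 = isometry_group_prod[OF X i5]
  note i3 = isometry_group_prod[OF X i4]
  note i2 = isometry_group_prod[OF X i3]
  have "norm (avg S.TH r (emb V)) \<le> L1_norm (cv V) / sqrt r + (L1_norm (cu V) / sqrt r + (L1_norm (cz V) / sqrt r
      + (L1_norm (cy V) / sqrt r + (L1_norm (c\<theta> V) / sqrt r + history_W11_norm g (c\<eta> V) / sqrt r))))"
    unfolding S.TH_def avg_prod[OF X i2] avg_prod[OF X i3] avg_prod[OF X i4] avg_prod[OF X i5]
      avg_prod[OF X Y.isometry_group_axioms] emb_def fst_conv snd_conv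
    by (intro norm_Pair_bound avg_L1_bound avg_W11_bound sq int W H r)
  also have "\<dots> = LL1_norm g V / sqrt r" by (simp add: LL1_norm_def add_divide_distrib)
  finally show ?thesis .
qed

lemma decay:
  "\<exists>C>0. \<forall>V0 V t. in_HHs g (j + l) V0 \<and> in_LL1 g V0 \<and> mild_solution \<rho>1 \<rho>2 \<rho>3 k a m \<delta> \<beta> g V0 V \<and> 0 \<le> t \<longrightarrow>
    in_HHs g j (V t) \<and>
    dx_norm g j (V t) \<le> C * (1 + t) powr (- 1 / 8 - real j / 4) * LL1_norm g V0
      + C * (1 + t) powr (- real l / 2) * dx_norm g (j + l) V0"
proof -
  obtain C where C: "0 < C" "\<And>V0 W V N M0 t y. S.mild V0 W V \<Longrightarrow> dern S.TH (j + l) V0 M0 \<Longrightarrow> 0 \<le> N \<Longrightarrow>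
      (\<And>r. 0 < r \<Longrightarrow> norm (avg S.TH r V0) \<le> N / sqrt r) \<Longrightarrow> 0 \<le> t \<Longrightarrow> dern S.TH j (V t) y \<Longrightarrow>
      norm y \<le> C * (1 + t) powr (- 1 / 8 - real j / 4) * N + C * (1 + t) powr (- real l / 2) * norm M0"
    using S.mild_decay[of j l] by (elim exE conjE) blast
  show ?thesis
  proof (intro exI[of _ C] conjI C(1) allI impI; elim conjE)
    fix V0 V and t :: real
    assume V0: "in_HHs g (j + l) V0" and L: "in_LL1 g V0" and sol: "mild_solution \<rho>1 \<rho>2 \<rho>3 k a m \<delta> \<beta> g V0 V" and t: "0 \<le> t"
    have V00: "in_HHs g 0 V0" by (rule in_HHs_mono[OF V0]) simp
    have Vt: "in_HHs g 0 (V t)" using sol t unfolding mild_solution_def by blast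
    obtain W where W: "S.mild (emb V0) W (\<lambda>t. emb (V t))" using mild_if_mild_solution[OF sol V00] by blast
    obtain M0 where M0: "dern S.TH (j + l) (emb V0) M0" "norm M0 = dx_norm g (j + l) V0" using emb_dern[OF V0] by blast
    obtain M1 where M1: "dern S.TH j (emb V0) M1" using M0(1) S.H.dern_append by blast
    obtain y where y: "dern S.TH j (emb (V t)) y" using S.mild_dern[OF W M1 t] by blast
    have "0 \<le> LL1_norm g V0"
      unfolding LL1_norm_def L1_norm_def history_W11_norm_def
      by (intro add_nonneg_nonneg real_sqrt_ge_zero integral_nonneg_AE) auto
    from C(2)[OF W M0(1) this avg_emb_bound[OF V00 L] t y]
    show "dx_norm g j (V t) \<le> C * (1 + t) powr (- 1 / 8 - real j / 4) * LL1_norm g V0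
        + C * (1 + t) powr (- real l / 2) * dx_norm g (j + l) V0"
      unfolding in_HHs_if_dern(2)[OF Vt y] M0(2) .
    show "in_HHs g j (V t)" by (rule in_HHs_if_dern(1)[OF Vt y])
  qed
qed

end

theorem theorem4p2:
  fixes \<rho>1 \<rho>2 \<rho>3 k b m \<delta> \<beta> b0 a \<chi>0 k1 k2 :: real
    and g g' :: "real \<Rightarrow> real"
    and s j l :: nat
  assumes "\<rho>1 > 0" "\<rho>2 > 0" "\<rho>3 > 0" "k > 0" "b > 0" "m > 0" "\<delta> > 0" "\<beta> > 0"
    and "\<And>\<sigma>. \<sigma> \<ge> 0 \<Longrightarrow> (g has_real_derivative g' \<sigma>) (at \<sigma> within {0..})"
    and "\<exists>\<sigma>\<ge>0. g \<sigma> \<noteq> 0"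
    and "\<And>\<sigma>. \<sigma> \<ge> 0 \<Longrightarrow> g \<sigma> \<ge> 0"
    and "k1 > 0" "k2 > 0"
    and "\<And>\<sigma>. \<sigma> \<ge> 0 \<Longrightarrow> - k1 * g \<sigma> \<le> g' \<sigma> \<and> g' \<sigma> \<le> - k2 * g \<sigma>"
    and "b0 = (LBINT \<sigma>:{0..}. g \<sigma>)"
    and "a = b - b0" "a > 0"
    and "\<chi>0 = \<rho>2 - b * \<rho>1 / k"
    and "j + l \<le> s"
  shows "\<exists>C1>0. \<exists>C2>0. \<forall>V0 V.
    in_HHs g s V0 \<and> in_LL1 g V0 \<and> mild_solution \<rho>1 \<rho>2 \<rho>3 k a m \<delta> \<beta> g V0 V \<longrightarrow>
    (\<chi>0 = 0 \<longrightarrow>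
      (\<forall>t\<ge>0. in_HHs g j (V t) \<and>
         dx_norm g j (V t) \<le> C1 * (1 + t) powr (- 1 / 8 - real j / 4) * LL1_norm g V0
                           + C2 * (1 + t) powr (- real l / 2) * dx_norm g (j + l) V0)) \<and>
    (\<chi>0 \<noteq> 0 \<longrightarrow>
      (\<forall>t\<ge>0. in_HHs g j (V t) \<and>
         dx_norm g j (V t) \<le> C1 * (1 + t) powr (- 1 / 8 - real j / 4) * LL1_norm g V0
                           + C2 * (1 + t) powr (- real l / 4) * dx_norm g (j + l) V0))"
proof -
  interpret memory_kernel g g' k1 k2
    by (rule memory_kernel.intro) (use assms in \<open>simp_all\<close>)
  interpret viscoelastic_system g g' k1 k2 \<rho>1 \<rho>2 \<rho>3 k a m \<delta> \<beta>
    by unfold_locales (use assms in simp_all)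
  obtain C where C: "0 < C" "\<And>V0 V t. in_HHs g (j + l) V0 \<Longrightarrow> in_LL1 g V0 \<Longrightarrow>
      mild_solution \<rho>1 \<rho>2 \<rho>3 k a m \<delta> \<beta> g V0 V \<Longrightarrow> 0 \<le> t \<Longrightarrow> in_HHs g j (V t) \<and>
      dx_norm g j (V t) \<le> C * (1 + t) powr (- 1 / 8 - real j / 4) * LL1_norm g V0
        + C * (1 + t) powr (- real l / 2) * dx_norm g (j + l) V0"
    using decay[of j l] by (elim exE conjE) blast
  \<comment> \<open>The value \<open>c = 4\<close> serves case (ii): since \<open>1 + t\<close> is
    at least 1, the exponent \<open>- real l / 4\<close> gives a larger bound than
    \<open>- real l / 2\<close>.\<close>
  have main: "in_HHs g j (V t) \<and> dx_norm g j (V t) \<le> C * (1 + t) powr (- 1 / 8 - real j / 4) * LL1_norm g V0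
        + C * (1 + t) powr (- real l / c) * dx_norm g (j + l) V0"
    if V0: "in_HHs g s V0" and L: "in_LL1 g V0" and sol: "mild_solution \<rho>1 \<rho>2 \<rho>3 k a m \<delta> \<beta> g V0 V"
      and t: "0 \<le> t" and c: "c = 2 \<or> c = 4" for V0 V and t c :: real
  proof -
    have "C * (1 + t) powr (- real l / 2) * dx_norm g (j + l) V0 \<le> C * (1 + t) powr (- real l / c) * dx_norm g (j + l) V0"
      using C(1) t c by (intro mult_right_mono mult_left_mono powr_mono) (auto simp: dx_norm_def)
    then show ?thesis
      using C(2)[OF in_HHs_mono[OF V0 assms(19)] L sol t] by linarith
  qed
  show ?thesis
    using C(1) main[where c = 2, OF _ _ _ _ disjI1[OF refl]] main[where c = 4, OF _ _ _ _ disjI2[OF refl]]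
    by (intro exI[of _ C] conjI) blast+
qed

end
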